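(* Let $M$ be a nonzero finitely generated graded $\Lambda$-module such that $\check E(M)$ is a weakly Koszul $\Gamma$-module. Then $\check E(M)$ has a nonzero direct summand (as a graded $\Gamma$-module) which is a Koszul $\Gamma$-module.
   Context: Let $k$ be a field and $\Lambda=\bigoplus_{i\ge 0}\Lambda_i$ a graded $k$-algebra with $\dim_k\Lambda_i<\infty$ for all $i$ and $\Lambda_0\simeq k\times\cdots\times k$ as rings. Modules are left modules. For a graded algebra $A$ of this kind, $\mathrm{Gr}\,A$ is the category of $\mathbb{Z}$-graded $A$-modules with degree $0$ morphisms. The graded shift $M\langle i\rangle$ is given by $(M\langle i\rangle)_n=M_{n-i}$. A graded $A$-module $M$ is a Koszul module if it is finitely generated and $\mathrm{Ext}^j_{\mathrm{Gr}\,A}(M,A_0\langle i\rangle)\ne 0$ implies $i=j$ (in particular it is generated in degree $0$). $A$ is a Koszul algebra if $A_0$ is a Koszul $A$-module. Assume $\Lambda$ is a Koszul algebra, and let $\Gamma=\bigoplus_{i\ge0}\mathrm{Ext}^i_\Lambda(\Lambda_0,\Lambda_0)$ (Yoneda product, graded by $i$) be its Koszul dual, which is again a Koszul algebra. For a graded $\Lambda$-module $M$ put $\check E(M)=\bigoplus_{i\ge 0}\mathrm{Ext}^i_\Lambda(M,\Lambda_0)$, a graded $\Gamma$-module graded by $i$ (ungraded Ext is used, so the internal grading of $M$ is forgotten). A finitely generated graded module $L$ over a Koszul algebra $A$ (that is, a graded $k$-algebra $A=\bigoplus_{i\ge 0}A_i$ with $\dim_k A_i<\infty$ for all $i$, with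 $A_0\simeq k\times\cdots\times k$ as rings, and such that $A_0$ is a Koszul $A$-module) is weakly Koszul if $\bigoplus_{i\ge0}\mathrm{Ext}^i_A(L,A_0)$, graded by $i$, is a Koszul module over $\bigoplus_{i\ge0}\mathrm{Ext}^i_A(A_0,A_0)$. This is applied here with $A=\Gamma$ and $L=\check E(M)$. *)

theory Defs
  imports "HOL-Algebra.Module" "HOL-Algebra.Chinese_Remainder"
begin

section \<open>Graded algebras and graded left modules\<close>

text \<open>
  HOL-Algebra's locale \<open>module\<close> requires a commutative base ring; it is used here only
  over the ground field. The record \<open>graded\<close> serves both for a graded \<open>k\<close>-algebra
  (\<open>smult\<close> is then the action of \<open>k\<close>) and for a graded left module over a graded
  algebra \<open>A\<close> (\<open>smult\<close> is then the action of \<open>A\<close>, and the fields \<open>mult\<close> and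
  \<open>one\<close> are irrelevant). All gradings are indexed by the integers.
\<close>

record ('r, 'm) graded = "('r, 'm) module" +
  hcomp :: "int \<Rightarrow> 'm set"

locale left_module = R?: ring R + M?: abelian_group M
  for R :: "('r, 'x) ring_scheme" (structure) and M :: "('r, 'm, 'y) module_scheme" (structure) +
  assumes smult_closed: "\<lbrakk>a \<in> carrier R; x \<in> carrier M\<rbrakk> \<Longrightarrow> a \<odot>\<^bsub>M\<^esub> x \<in> carrier M"
    and smult_l_distr: "\<lbrakk>a \<in> carrier R; b \<in> carrier R; x \<in> carrier M\<rbrakk> \<Longrightarrow>
      (a \<oplus>\<^bsub>R\<^esub> b) \<odot>\<^bsub>M\<^esub> x = a \<odot>\<^bsub>M\<^esub> x \<oplus>\<^bsub>M\<^esub> b \<odot>\<^bsub>M\<^esub> x"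
    and smult_r_distr: "\<lbrakk>a \<in> carrier R; x \<in> carrier M; y \<in> carrier M\<rbrakk> \<Longrightarrow>
      a \<odot>\<^bsub>M\<^esub> (x \<oplus>\<^bsub>M\<^esub> y) = a \<odot>\<^bsub>M\<^esub> x \<oplus>\<^bsub>M\<^esub> a \<odot>\<^bsub>M\<^esub> y"
    and smult_assoc: "\<lbrakk>a \<in> carrier R; b \<in> carrier R; x \<in> carrier M\<rbrakk> \<Longrightarrow>
      (a \<otimes>\<^bsub>R\<^esub> b) \<odot>\<^bsub>M\<^esub> x = a \<odot>\<^bsub>M\<^esub> (b \<odot>\<^bsub>M\<^esub> x)"
    and smult_one: "x \<in> carrier M \<Longrightarrow> \<one>\<^bsub>R\<^esub> \<odot>\<^bsub>M\<^esub> x = x"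

definition is_decomposition ::
    "('m, 'y) ring_scheme \<Rightarrow> ('i \<Rightarrow> 'm set) \<Rightarrow> 'm \<Rightarrow> ('i \<Rightarrow> 'm) \<Rightarrow> bool" where
  "is_decomposition M C x c \<longleftrightarrow>
     (\<forall>i. c i \<in> C i) \<and> finite {i. c i \<noteq> \<zero>\<^bsub>M\<^esub>} \<and> x = (\<Oplus>\<^bsub>M\<^esub>i\<in>{i. c i \<noteq> \<zero>\<^bsub>M\<^esub>}. c i)"

definition internal_direct_sum :: "('m, 'y) ring_scheme \<Rightarrow> ('i \<Rightarrow> 'm set) \<Rightarrow> bool" where
  "internal_direct_sum M C \<longleftrightarrow>
     (\<forall>i. additive_subgroup (C i) M) \<and> (\<forall>x\<in>carrier M. \<exists>!c. is_decomposition M C x c)"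

definition homog_part :: "('r, 'm, 'y) graded_scheme \<Rightarrow> int \<Rightarrow> 'm \<Rightarrow> 'm" where
  "homog_part M i x = (THE c. is_decomposition M (hcomp M) x c) i"

definition graded_module ::
    "('k, 'a, 'x) graded_scheme \<Rightarrow> ('a, 'm, 'y) graded_scheme \<Rightarrow> bool" where
  "graded_module A M \<longleftrightarrow> left_module A M \<and> internal_direct_sum M (hcomp M) \<and>
     (\<forall>i j. \<forall>a\<in>hcomp A i. \<forall>x\<in>hcomp M j. a \<odot>\<^bsub>M\<^esub> x \<in> hcomp M (i + j))"

definition fin_gen :: "('r, 'x) ring_scheme \<Rightarrow> ('r, 'm, 'y) module_scheme \<Rightarrow> bool" where
  "fin_gen R M \<longleftrightarrow> (\<exists>S. finite S \<and> S \<subseteq> carrier M \<and>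
     (\<forall>x\<in>carrier M. \<exists>c\<in>S \<rightarrow> carrier R. x = (\<Oplus>\<^bsub>M\<^esub>s\<in>S. c s \<odot>\<^bsub>M\<^esub> s)))"

definition graded_algebra :: "('k, 'w) ring_scheme \<Rightarrow> ('k, 'a, 'x) graded_scheme \<Rightarrow> bool" where
  "graded_algebra k A \<longleftrightarrow> field k \<and> ring A \<and> module k A \<and>
     (\<forall>c\<in>carrier k. \<forall>a\<in>carrier A. \<forall>b\<in>carrier A.
        c \<odot>\<^bsub>A\<^esub> (a \<otimes>\<^bsub>A\<^esub> b) = (c \<odot>\<^bsub>A\<^esub> a) \<otimes>\<^bsub>A\<^esub> b \<and>
        c \<odot>\<^bsub>A\<^esub> (a \<otimes>\<^bsub>A\<^esub> b) = a \<otimes>\<^bsub>A\<^esub> (c \<odot>\<^bsub>A\<^esub> b)) \<and>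
     internal_direct_sum A (hcomp A) \<and>
     (\<forall>i. submodule (hcomp A i) k A) \<and>
     (\<forall>i<0. hcomp A i = {\<zero>\<^bsub>A\<^esub>}) \<and>
     (\<forall>i j. \<forall>a\<in>hcomp A i. \<forall>b\<in>hcomp A j. a \<otimes>\<^bsub>A\<^esub> b \<in> hcomp A (i + j))"

text \<open>
  \<open>degree_zero A\<close> is \<open>A\<^sub>0\<close>, at the same time as a ring and as a graded left
  \<open>A\<close>-module concentrated in degree \<open>0\<close>: the action is that of the quotient of \<open>A\<close>
  by the ideal of elements of positive degree, so \<open>a\<close> acts through its degree \<open>0\<close> part.
\<close>

definition degree_zero :: "('k, 'a, 'x) graded_scheme \<Rightarrow> ('a, 'a) graded" where
  "degree_zero A = \<lparr>carrier = hcomp A 0, mult = mult A, one = one A, zero = zero A, add = add A,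
     smult = (\<lambda>a x. homog_part A 0 a \<otimes>\<^bsub>A\<^esub> x),
     hcomp = (\<lambda>i. if i = 0 then hcomp A 0 else {\<zero>\<^bsub>A\<^esub>})\<rparr>"

definition standard_graded_algebra ::
    "('k, 'w) ring_scheme \<Rightarrow> ('k, 'a, 'x) graded_scheme \<Rightarrow> bool" where
  "standard_graded_algebra k A \<longleftrightarrow> graded_algebra k A \<and>
     (\<forall>i. fin_gen k (A\<lparr>carrier := hcomp A i\<rparr>)) \<and>
     (\<exists>n>0. degree_zero A \<simeq> RDirProd_list (replicate n k))"

definition grade_shift :: "('r, 'm, 'y) graded_scheme \<Rightarrow> int \<Rightarrow> ('r, 'm, 'y) graded_scheme" where
  "grade_shift M i = M\<lparr>hcomp := (\<lambda>n. hcomp M (n - i))\<rparr>"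

definition graded_submodule ::
    "('k, 'a, 'x) graded_scheme \<Rightarrow> ('a, 'm, 'y) graded_scheme \<Rightarrow> 'm set \<Rightarrow> bool" where
  "graded_submodule A M U \<longleftrightarrow> submodule U A M \<and> (\<forall>x\<in>U. \<forall>i. homog_part M i x \<in> U)"

definition graded_restrict ::
    "('a, 'm, 'y) graded_scheme \<Rightarrow> 'm set \<Rightarrow> ('a, 'm, 'y) graded_scheme" where
  "graded_restrict M U = M\<lparr>carrier := U, hcomp := (\<lambda>i. hcomp M i \<inter> U)\<rparr>"

definition graded_direct_summand ::
    "('k, 'a, 'x) graded_scheme \<Rightarrow> ('a, 'm, 'y) graded_scheme \<Rightarrow> 'm set \<Rightarrow> bool" where
  "graded_direct_summand A M U \<longleftrightarrow> graded_submodule A M U \<and>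
     (\<exists>V. graded_submodule A M V \<and> U \<inter> V = {\<zero>\<^bsub>M\<^esub>} \<and> U <+>\<^bsub>M\<^esub> V = carrier M)"

section \<open>Cohomology of a cochain complex\<close>

definition cocycles :: "(nat \<Rightarrow> ('k, 'c) module) \<Rightarrow> (nat \<Rightarrow> 'c \<Rightarrow> 'c) \<Rightarrow> nat \<Rightarrow> 'c set" where
  "cocycles C d n = {z \<in> carrier (C n). d n z = \<zero>\<^bsub>C (Suc n)\<^esub>}"

definition coboundaries :: "(nat \<Rightarrow> ('k, 'c) module) \<Rightarrow> (nat \<Rightarrow> 'c \<Rightarrow> 'c) \<Rightarrow> nat \<Rightarrow> 'c set" where
  "coboundaries C d n = (case n of 0 \<Rightarrow> {\<zero>\<^bsub>C 0\<^esub>} | Suc m \<Rightarrow> d m ` carrier (C m))"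

definition cohomology_class ::
    "(nat \<Rightarrow> ('k, 'c) module) \<Rightarrow> (nat \<Rightarrow> 'c \<Rightarrow> 'c) \<Rightarrow> nat \<Rightarrow> 'c \<Rightarrow> 'c set" where
  "cohomology_class C d n z = coboundaries C d n +>\<^bsub>C n\<^esub> z"

definition cohomology ::
    "(nat \<Rightarrow> ('k, 'c) module) \<Rightarrow> (nat \<Rightarrow> 'c \<Rightarrow> 'c) \<Rightarrow> nat \<Rightarrow> ('k, 'c set) module" where
  "cohomology C d n = \<lparr>carrier = cohomology_class C d n ` cocycles C d n,
     mult = undefined, one = undefined,
     zero = coboundaries C d n, add = (\<lambda>X Y. X <+>\<^bsub>C n\<^esub> Y),
     smult = (\<lambda>c X. \<Union>z\<in>X. cohomology_class C d n (c \<odot>\<^bsub>C n\<^esub> z))\<rparr>"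

section \<open>Ext via the bar resolution\<close>

text \<open>
  Ext is computed with the bar resolution of a left \<open>A\<close>-module \<open>M\<close> over the field \<open>k\<close>,
  the projective resolution (free, because \<open>k\<close> is a field)
  \<open>\<dots> \<rightarrow> A \<otimes> A \<otimes> A \<otimes> M \<rightarrow> A \<otimes> A \<otimes> M \<rightarrow> A \<otimes> M \<rightarrow> M\<close>, tensor products over \<open>k\<close>. Its
  \<open>n\<close>-th term is the left \<open>A\<close>-module induced from the \<open>k\<close>-space with \<open>n\<close> tensor factors
  \<open>A\<close> and one factor \<open>M\<close>, so \<open>A\<close>-linear maps from it to \<open>N\<close> are the same as
  \<open>k\<close>-multilinear maps of \<open>n\<close> arguments in \<open>A\<close> and one argument in \<open>M\<close>. A cochain is
  thus a function of a pair \<open>(as, x)\<close> with \<open>length as = n\<close>, extended by \<open>undefined\<close>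
  outside its domain. Here \<open>k\<close> acts on an \<open>A\<close>-module through \<open>c \<mapsto> c \<odot> \<one>\<close>.

  In \<open>Gr A\<close> the same resolution, with the total grading, is a projective resolution, and a
  cochain is a degree \<open>0\<close> morphism if and only if it preserves total degrees.
\<close>

definition bar_args ::
    "('k, 'a, 'x) graded_scheme \<Rightarrow> ('a, 'm, 'y) graded_scheme \<Rightarrow> nat \<Rightarrow> ('a list \<times> 'm) set" where
  "bar_args A M n = {as. set as \<subseteq> carrier A \<and> length as = n} \<times> carrier M"

definition base_smult ::
    "('k, 'a, 'x) graded_scheme \<Rightarrow> ('a, 'm, 'y) graded_scheme \<Rightarrow> 'k \<Rightarrow> 'm \<Rightarrow> 'm" where
  "base_smult A M c x = (c \<odot>\<^bsub>A\<^esub> \<one>\<^bsub>A\<^esub>) \<odot>\<^bsub>M\<^esub> x"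

definition multilinear ::
    "('k, 'w) ring_scheme \<Rightarrow> ('k, 'a, 'x) graded_scheme \<Rightarrow> ('a, 'm, 'y) graded_scheme \<Rightarrow>
     ('a, 'n, 'z) graded_scheme \<Rightarrow> nat \<Rightarrow> ('a list \<times> 'm \<Rightarrow> 'n) \<Rightarrow> bool" where
  "multilinear k A M N n f \<longleftrightarrow>
     (\<forall>(as, x)\<in>bar_args A M n.
        (\<forall>i<n. \<forall>a\<in>carrier A. \<forall>b\<in>carrier A.
           f (as[i := a \<oplus>\<^bsub>A\<^esub> b], x) = f (as[i := a], x) \<oplus>\<^bsub>N\<^esub> f (as[i := b], x)) \<and>
        (\<forall>i<n. \<forall>c\<in>carrier k. \<forall>a\<in>carrier A.
           f (as[i := c \<odot>\<^bsub>A\<^esub> a], x) = base_smult A N c (f (as[i := a], x))) \<and>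
        (\<forall>y\<in>carrier M. f (as, x \<oplus>\<^bsub>M\<^esub> y) = f (as, x) \<oplus>\<^bsub>N\<^esub> f (as, y)) \<and>
        (\<forall>c\<in>carrier k. f (as, base_smult A M c x) = base_smult A N c (f (as, x))))"

definition bar_cochains ::
    "('k, 'w) ring_scheme \<Rightarrow> ('k, 'a, 'x) graded_scheme \<Rightarrow> ('a, 'm, 'y) graded_scheme \<Rightarrow>
     ('a, 'n, 'z) graded_scheme \<Rightarrow> nat \<Rightarrow> ('k, 'a list \<times> 'm \<Rightarrow> 'n) module" where
  "bar_cochains k A M N n =
     \<lparr>carrier = {f \<in> bar_args A M n \<rightarrow>\<^sub>E carrier N. multilinear k A M N n f},
      mult = undefined, one = undefined,
      zero = (\<lambda>p\<in>bar_args A M n. \<zero>\<^bsub>N\<^esub>),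
      add = (\<lambda>f g. \<lambda>p\<in>bar_args A M n. f p \<oplus>\<^bsub>N\<^esub> g p),
      smult = (\<lambda>c f. \<lambda>p\<in>bar_args A M n. base_smult A N c (f p))\<rparr>"

definition gr_bar_cochains ::
    "('k, 'w) ring_scheme \<Rightarrow> ('k, 'a, 'x) graded_scheme \<Rightarrow> ('a, 'm, 'y) graded_scheme \<Rightarrow>
     ('a, 'n, 'z) graded_scheme \<Rightarrow> nat \<Rightarrow> ('k, 'a list \<times> 'm \<Rightarrow> 'n) module" where
  "gr_bar_cochains k A M N n = (bar_cochains k A M N n)
     \<lparr>carrier := {f \<in> carrier (bar_cochains k A M N n).
        \<forall>as ds x e. length as = n \<and> list_all2 (\<lambda>a d. a \<in> hcomp A d) as ds \<and> x \<in> hcomp M e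
          \<longrightarrow> f (as, x) \<in> hcomp N (sum_list ds + e)}\<rparr>"

text \<open>
  With \<open>as = [a\<^sub>1, \<dots>, a\<^sub>n\<^sub>+\<^sub>1]\<close>, the differential is
  \<open>a\<^sub>1 f(a\<^sub>2, \<dots>, a\<^sub>n\<^sub>+\<^sub>1; x) + (\<Sum>j=1..n. (-1)^j f(\<dots>, a\<^sub>j a\<^sub>j\<^sub>+\<^sub>1, \<dots>; x))
    + (-1)^(n+1) f(a\<^sub>1, \<dots>, a\<^sub>n; a\<^sub>n\<^sub>+\<^sub>1 x)\<close>;
  below, the list index \<open>i\<close> is \<open>j - 1\<close>. In particular the cocycles of degree \<open>0\<close> are the
  \<open>A\<close>-linear maps.
\<close>

definition bar_diff ::
    "('k, 'a, 'x) graded_scheme \<Rightarrow> ('a, 'm, 'y) graded_scheme \<Rightarrow> ('a, 'n, 'z) graded_scheme \<Rightarrow>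
     nat \<Rightarrow> ('a list \<times> 'm \<Rightarrow> 'n) \<Rightarrow> 'a list \<times> 'm \<Rightarrow> 'n" where
  "bar_diff A M N n f = (\<lambda>(as, x)\<in>bar_args A M (Suc n).
     hd as \<odot>\<^bsub>N\<^esub> f (tl as, x)
     \<oplus>\<^bsub>N\<^esub> (\<Oplus>\<^bsub>N\<^esub>i\<in>{..<n}. add_pow N ((-1 :: int) ^ Suc i)
             (f (take i as @ (as ! i \<otimes>\<^bsub>A\<^esub> as ! Suc i) # drop (i + 2) as, x)))
     \<oplus>\<^bsub>N\<^esub> add_pow N ((-1 :: int) ^ Suc n) (f (butlast as, last as \<odot>\<^bsub>M\<^esub> x)))"

definition Ext ::
    "('k, 'w) ring_scheme \<Rightarrow> ('k, 'a, 'x) graded_scheme \<Rightarrow> ('a, 'm, 'y) graded_scheme \<Rightarrow>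
     ('a, 'n, 'z) graded_scheme \<Rightarrow> nat \<Rightarrow> ('k, ('a list \<times> 'm \<Rightarrow> 'n) set) module" where
  "Ext k A M N n = cohomology (bar_cochains k A M N) (bar_diff A M N) n"

definition Ext_Gr ::
    "('k, 'w) ring_scheme \<Rightarrow> ('k, 'a, 'x) graded_scheme \<Rightarrow> ('a, 'm, 'y) graded_scheme \<Rightarrow>
     ('a, 'n, 'z) graded_scheme \<Rightarrow> nat \<Rightarrow> ('k, ('a list \<times> 'm \<Rightarrow> 'n) set) module" where
  "Ext_Gr k A M N n = cohomology (gr_bar_cochains k A M N) (bar_diff A M N) n"

section \<open>The Yoneda product\<close>

text \<open>
  On bar cochains the Yoneda composite of \<open>g\<close> (from \<open>N\<close> to \<open>P\<close>, degree \<open>m\<close>) with \<open>f\<close>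
  (from \<open>M\<close> to \<open>N\<close>, degree \<open>n\<close>) is \<open>g(a\<^sub>1, \<dots>, a\<^sub>m; f(a\<^sub>m\<^sub>+\<^sub>1, \<dots>, a\<^sub>m\<^sub>+\<^sub>n; x))\<close>; it
  satisfies \<open>d(g f) = (d g) f + (-1)^m g (d f)\<close>. The other usual convention inserts the
  sign \<open>(-1)^(m n)\<close>; rescaling degree \<open>n\<close> by \<open>(-1)^(n (n - 1) / 2)\<close> identifies the
  two, compatibly for algebras and modules.
\<close>

definition cochain_comp ::
    "('k, 'a, 'x) graded_scheme \<Rightarrow> ('a, 'm, 'y) graded_scheme \<Rightarrow> nat \<Rightarrow> nat \<Rightarrow>
     ('a list \<times> 'n \<Rightarrow> 'p) \<Rightarrow> ('a list \<times> 'm \<Rightarrow> 'n) \<Rightarrow> 'a list \<times> 'm \<Rightarrow> 'p" where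
  "cochain_comp A M m n g f =
     (\<lambda>(as, x)\<in>bar_args A M (m + n). g (take m as, f (drop m as, x)))"

definition ext_comp ::
    "('k, 'w) ring_scheme \<Rightarrow> ('k, 'a, 'x) graded_scheme \<Rightarrow> ('a, 'm, 'y) graded_scheme \<Rightarrow>
     ('a, 'p, 'z) graded_scheme \<Rightarrow> nat \<Rightarrow> nat \<Rightarrow>
     ('a list \<times> 'n \<Rightarrow> 'p) set \<Rightarrow> ('a list \<times> 'm \<Rightarrow> 'n) set \<Rightarrow> ('a list \<times> 'm \<Rightarrow> 'p) set" where
  "ext_comp k A M P m n X Y = (\<Union>g\<in>X. \<Union>f\<in>Y.
     cohomology_class (bar_cochains k A M P) (bar_diff A M P) (m + n) (cochain_comp A M m n g f))"

definition yoneda ::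
    "('k, 'w) ring_scheme \<Rightarrow> ('k, 'a, 'x) graded_scheme \<Rightarrow> ('a, 'm, 'y) graded_scheme \<Rightarrow>
     ('a, 'p, 'z) graded_scheme \<Rightarrow> (nat \<Rightarrow> ('a list \<times> 'n \<Rightarrow> 'p) set) \<Rightarrow>
     (nat \<Rightarrow> ('a list \<times> 'm \<Rightarrow> 'n) set) \<Rightarrow> nat \<Rightarrow> ('a list \<times> 'm \<Rightarrow> 'p) set" where
  "yoneda k A M P \<phi> \<psi> =
     (\<lambda>n. \<Oplus>\<^bsub>Ext k A M P n\<^esub>i\<in>{..n}. ext_comp k A M P i (n - i) (\<phi> i) (\<psi> (n - i)))"

text \<open>
  \<open>total_ext\<close> is the graded \<open>k\<close>-space \<open>\<Oplus>n\<ge>0. Ext\<^sup>n\<close>, an element being a family of classes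
  with finite support.
\<close>

definition total_ext ::
    "('k, 'w) ring_scheme \<Rightarrow> ('k, 'a, 'x) graded_scheme \<Rightarrow> ('a, 'm, 'y) graded_scheme \<Rightarrow>
     ('a, 'n, 'z) graded_scheme \<Rightarrow> ('k, nat \<Rightarrow> ('a list \<times> 'm \<Rightarrow> 'n) set) graded" where
  "total_ext k A M N = (let E = {\<phi>. (\<forall>n. \<phi> n \<in> carrier (Ext k A M N n)) \<and>
                                    finite {n. \<phi> n \<noteq> \<zero>\<^bsub>Ext k A M N n\<^esub>}} in
     \<lparr>carrier = E, mult = undefined, one = undefined,
      zero = (\<lambda>n. \<zero>\<^bsub>Ext k A M N n\<^esub>),
      add = (\<lambda>\<phi> \<psi> n. \<phi> n \<oplus>\<^bsub>Ext k A M N n\<^esub> \<psi> n),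
      smult = (\<lambda>c \<phi> n. c \<odot>\<^bsub>Ext k A M N n\<^esub> \<phi> n),
      hcomp = (\<lambda>i. {\<phi>\<in>E. \<forall>n. int n \<noteq> i \<longrightarrow> \<phi> n = \<zero>\<^bsub>Ext k A M N n\<^esub>})\<rparr>)"

definition koszul_dual ::
    "('k, 'w) ring_scheme \<Rightarrow> ('k, 'a, 'x) graded_scheme \<Rightarrow>
     ('k, nat \<Rightarrow> ('a list \<times> 'a \<Rightarrow> 'a) set) graded" where
  "koszul_dual k A = (let S = degree_zero A in (total_ext k A S S)
     \<lparr>mult := yoneda k A S S,
      one := (\<lambda>n. if n = 0
        then cohomology_class (bar_cochains k A S S) (bar_diff A S S) 0 (\<lambda>(as, x)\<in>bar_args A S 0. x)
        else \<zero>\<^bsub>Ext k A S S n\<^esub>)\<rparr>)"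

definition ext_module ::
    "('k, 'w) ring_scheme \<Rightarrow> ('k, 'a, 'x) graded_scheme \<Rightarrow> ('a, 'm, 'y) graded_scheme \<Rightarrow>
     (nat \<Rightarrow> ('a list \<times> 'a \<Rightarrow> 'a) set, nat \<Rightarrow> ('a list \<times> 'm \<Rightarrow> 'a) set) graded" where
  "ext_module k A M = (let S = degree_zero A; T = total_ext k A M S in
     \<lparr>carrier = carrier T, mult = undefined, one = undefined, zero = zero T, add = add T,
      smult = yoneda k A M S, hcomp = hcomp T\<rparr>)"

section \<open>Koszul and weakly Koszul modules\<close>

definition koszul_module ::
    "('k, 'w) ring_scheme \<Rightarrow> ('k, 'a, 'x) graded_scheme \<Rightarrow> ('a, 'm, 'y) graded_scheme \<Rightarrow> bool" where
  "koszul_module k A M \<longleftrightarrow> graded_module A M \<and> fin_gen A M \<and>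
     (\<forall>j i. let E = Ext_Gr k A M (grade_shift (degree_zero A) i) j in
        carrier E \<noteq> {\<zero>\<^bsub>E\<^esub>} \<longrightarrow> i = int j)"

definition koszul_algebra :: "('k, 'w) ring_scheme \<Rightarrow> ('k, 'a, 'x) graded_scheme \<Rightarrow> bool" where
  "koszul_algebra k A \<longleftrightarrow> standard_graded_algebra k A \<and> koszul_module k A (degree_zero A)"

definition weakly_koszul_module ::
    "('k, 'w) ring_scheme \<Rightarrow> ('k, 'a, 'x) graded_scheme \<Rightarrow> ('a, 'm, 'y) graded_scheme \<Rightarrow> bool" where
  "weakly_koszul_module k A L \<longleftrightarrow> koszul_algebra k A \<and> graded_module A L \<and> fin_gen A L \<and>
     koszul_module k (koszul_dual k A) (ext_module k A L)"

end

theory Submission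
  imports Defs
begin

text \<open>
  Forgetting the internal grading, \<open>Ext\<^sup>n(M, \<Lambda>\<^sub>0)\<close> still splits by internal degree. Since \<open>\<Gamma>\<close> is
  concentrated on the diagonal, the part of internal degree \<open>n + s\<close>, for \<open>n = 0, 1, \<dots>\<close>, is a
  \<open>\<Gamma>\<close>-submodule, the strand \<open>s\<close>; the classes without component there form a complement. Let \<open>s\<close> be
  the lowest degree with \<open>M\<^sub>s \<noteq> 0\<close>. Koszulity of \<open>\<Lambda>\<^sub>0\<close> lets one change a cocycle of the strand \<open>s\<close> until
  it vanishes on \<open>M\<^sub>e\<close> for \<open>e > s\<close>; it then factors through the projection of \<open>M\<close> onto \<open>M\<^sub>s\<close>, a
  \<open>\<Lambda>\<close>-linear map to a semisimple module, so the strand is generated over \<open>\<Gamma>\<close> by the nonzero space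
  \<open>Hom(M\<^sub>s, \<Lambda>\<^sub>0)\<close> in degree \<open>0\<close>.

  Let \<open>X\<close> be a graded summand of a weakly Koszul \<open>\<Gamma>\<close>-module \<open>L\<close>, generated in degree \<open>0\<close>. By Nakayama
  \<open>Ext(L, \<Gamma>\<^sub>0)\<close> is generated by \<open>Hom(L, \<Gamma>\<^sub>0)\<close>. Hence a class in \<open>Ext\<^sup>n(X, \<Gamma>\<^sub>0)\<close>, pulled back to \<open>L\<close>
  and restricted again, is a combination of products of classes of \<open>\<Gamma>\<close>'s dual with maps \<open>X \<rightarrow> \<Gamma>\<^sub>0\<close>.
  Those maps have degree \<open>0\<close> because \<open>X\<close> is generated in degree \<open>0\<close>, and the dual of \<open>\<Gamma>\<close> is
  diagonal, so the class has internal degree \<open>n\<close>.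
\<close>

section \<open>Multilinear cochains and the bar differential\<close>

text \<open>All of Ext is handled through explicit bar cochains, so a statement about a class
  becomes one about a cocycle that may be changed by a coboundary. The obstacle is that an ungraded
  cochain need not be a finite sum of homogeneous ones: the complement of a strand is therefore cut
  out by a condition on representatives, and not built as a sum of the other strands. Nonnegativity
  of the grading makes the lowest degree tractable: a cocycle of internal degree n + s vanishes on
  M_e for e > n + s from the start, which leaves the n degrees from s + 1 to n + s to be cleared,
  from the top down. At each of them the cocycle restricts, along the points of M_e, to cocycles on
  \<Lambda>_0 of internal degree n + s - e, which differs from n and so lies off the diagonal. Going
  back from \<Lambda>_0 to M_e uses dual bases, which exist because \<Lambda>_0 is semisimple.
  Nakayama uses the same device over the dual of \<Gamma>, whose degree 0 part is a homomorphic
  image of \<Gamma>_0.\<close>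

definition zlin :: "'a set \<Rightarrow> ('x, 'p) ring_scheme \<Rightarrow> ('a \<Rightarrow> 'x \<Rightarrow> 'x) \<Rightarrow>
    ('y, 'q) ring_scheme \<Rightarrow> ('a \<Rightarrow> 'y \<Rightarrow> 'y) \<Rightarrow> ('x \<Rightarrow> 'y) \<Rightarrow> bool" where
  "zlin Z X s Y t h \<longleftrightarrow> (\<forall>x\<in>carrier X. h x \<in> carrier Y) \<and>
     (\<forall>x\<in>carrier X. \<forall>y\<in>carrier X. h (x \<oplus>\<^bsub>X\<^esub> y) = h x \<oplus>\<^bsub>Y\<^esub> h y) \<and>
     (\<forall>z\<in>Z. \<forall>x\<in>carrier X. h (s z x) = t z (h x))"

lemma zlinD:
  assumes "zlin Z X s Y t h"
  shows "x \<in> carrier X \<Longrightarrow> h x \<in> carrier Y"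
    and "x \<in> carrier X \<Longrightarrow> y \<in> carrier X \<Longrightarrow> h (x \<oplus>\<^bsub>X\<^esub> y) = h x \<oplus>\<^bsub>Y\<^esub> h y"
    and "z \<in> Z \<Longrightarrow> x \<in> carrier X \<Longrightarrow> h (s z x) = t z (h x)"
  using assms by (auto simp: zlin_def)

section \<open>Additive maps between abelian groups, and scalar multiplication\<close>

lemma additive_zero:
  assumes "abelian_group X" "abelian_group Y" "\<And>x. x \<in> carrier X \<Longrightarrow> h x \<in> carrier Y"
    and "\<And>x y. x \<in> carrier X \<Longrightarrow> y \<in> carrier X \<Longrightarrow> h (x \<oplus>\<^bsub>X\<^esub> y) = h x \<oplus>\<^bsub>Y\<^esub> h y"
  shows "h \<zero>\<^bsub>X\<^esub> = \<zero>\<^bsub>Y\<^esub>"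
proof -
  interpret X: abelian_group X by fact
  interpret Y: abelian_group Y by fact
  show ?thesis using assms(3)[OF X.zero_closed] assms(4)[OF X.zero_closed X.zero_closed]
    by (metis X.l_zero X.zero_closed Y.add.l_cancel_one')
qed

lemma zlin_zero:
  assumes "abelian_group X" "abelian_group Y" "zlin Z X s Y t h"
  shows "h \<zero>\<^bsub>X\<^esub> = \<zero>\<^bsub>Y\<^esub>"
proof -
  interpret X: abelian_group X by fact
  show ?thesis
    by (rule additive_zero[OF assms(1,2)]) (use assms(3) in \<open>auto simp: zlin_def\<close>)
qed

lemma additive_finsum:
  assumes "abelian_group X" "abelian_group Y" "finite I" "\<And>i. i \<in> I \<Longrightarrow> f i \<in> carrier X"
    and "\<And>x. x \<in> carrier X \<Longrightarrow> h x \<in> carrier Y"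
    and "\<And>x y. x \<in> carrier X \<Longrightarrow> y \<in> carrier X \<Longrightarrow> h (x \<oplus>\<^bsub>X\<^esub> y) = h x \<oplus>\<^bsub>Y\<^esub> h y"
  shows "h (\<Oplus>\<^bsub>X\<^esub>i\<in>I. f i) = (\<Oplus>\<^bsub>Y\<^esub>i\<in>I. h (f i))"
proof -
  interpret X: abelian_group X by fact
  interpret Y: abelian_group Y by fact
  have z: "h \<zero>\<^bsub>X\<^esub> = \<zero>\<^bsub>Y\<^esub>"
    by (rule additive_zero[OF assms(1,2)]) (use assms(5,6) in auto)
  show ?thesis
    using assms(3,4)
  proof (induction I rule: finite_induct)
    case empty
    then show ?case by (simp add: z)
  next
    case (insert i I)
    then show ?case
      by (simp add: X.finsum_insert Y.finsum_insert assms(5,6) Pi_def)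
  qed
qed

lemma additive_minus:
  assumes "abelian_group X" "abelian_group Y" "x \<in> carrier X"
    and "\<And>x. x \<in> carrier X \<Longrightarrow> h x \<in> carrier Y"
    and "\<And>x y. x \<in> carrier X \<Longrightarrow> y \<in> carrier X \<Longrightarrow> h (x \<oplus>\<^bsub>X\<^esub> y) = h x \<oplus>\<^bsub>Y\<^esub> h y"
  shows "h (\<ominus>\<^bsub>X\<^esub> x) = \<ominus>\<^bsub>Y\<^esub> h x"
proof -
  interpret X: abelian_group X by fact
  interpret Y: abelian_group Y by fact
  have z: "h \<zero>\<^bsub>X\<^esub> = \<zero>\<^bsub>Y\<^esub>"
    by (rule additive_zero[OF assms(1,2)]) (use assms(4,5) in auto)
  have "h (\<ominus>\<^bsub>X\<^esub> x) \<oplus>\<^bsub>Y\<^esub> h x = \<zero>\<^bsub>Y\<^esub>"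
    using assms(3,4) assms(5)[symmetric, of "\<ominus>\<^bsub>X\<^esub> x" x] by (simp add: X.l_neg z)
  then show ?thesis using assms(3,4) by (metis X.a_inv_closed Y.minus_equality)
qed

lemma (in left_module) smult_l_null: "x \<in> carrier M \<Longrightarrow> \<zero>\<^bsub>R\<^esub> \<odot>\<^bsub>M\<^esub> x = \<zero>\<^bsub>M\<^esub>"
  by (rule additive_zero[where X = R and Y = M and h = "\<lambda>a. a \<odot>\<^bsub>M\<^esub> x"])
    (auto simp: smult_closed smult_l_distr R.is_abelian_group M.abelian_group_axioms)

lemma (in left_module) smult_r_null: "a \<in> carrier R \<Longrightarrow> a \<odot>\<^bsub>M\<^esub> \<zero>\<^bsub>M\<^esub> = \<zero>\<^bsub>M\<^esub>"
  by (rule additive_zero[where X = M and Y = M and h = "\<lambda>x. a \<odot>\<^bsub>M\<^esub> x"])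
    (auto simp: smult_closed smult_r_distr M.abelian_group_axioms)

lemma (in left_module) smult_r_minus:
  "a \<in> carrier R \<Longrightarrow> x \<in> carrier M \<Longrightarrow> a \<odot>\<^bsub>M\<^esub> (\<ominus>\<^bsub>M\<^esub> x) = \<ominus>\<^bsub>M\<^esub> (a \<odot>\<^bsub>M\<^esub> x)"
  by (rule additive_minus[where X = M and Y = M and h = "\<lambda>x. a \<odot>\<^bsub>M\<^esub> x"])
    (auto simp: smult_closed smult_r_distr M.abelian_group_axioms)

lemma (in left_module) smult_l_minus:
  "a \<in> carrier R \<Longrightarrow> x \<in> carrier M \<Longrightarrow> (\<ominus>\<^bsub>R\<^esub> a) \<odot>\<^bsub>M\<^esub> x = \<ominus>\<^bsub>M\<^esub> (a \<odot>\<^bsub>M\<^esub> x)"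
  by (rule additive_minus[where X = R and Y = M and h = "\<lambda>a. a \<odot>\<^bsub>M\<^esub> x"])
    (auto simp: smult_closed smult_l_distr M.abelian_group_axioms R.is_abelian_group)

lemma (in left_module) smult_l_finsum:
  assumes "finite I" "\<And>i. i \<in> I \<Longrightarrow> c i \<in> carrier R" "x \<in> carrier M"
  shows "(\<Oplus>\<^bsub>R\<^esub>i\<in>I. c i) \<odot>\<^bsub>M\<^esub> x = (\<Oplus>\<^bsub>M\<^esub>i\<in>I. c i \<odot>\<^bsub>M\<^esub> x)"
  by (rule additive_finsum[where X = R and Y = M and h = "\<lambda>a. a \<odot>\<^bsub>M\<^esub> x"])
    (use assms in \<open>auto simp: smult_closed smult_l_distr M.abelian_group_axioms R.is_abelian_group\<close>)

lemma (in left_module) smult_r_finsum: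
  assumes "finite I" "\<And>i. i \<in> I \<Longrightarrow> f i \<in> carrier M" "a \<in> carrier R"
  shows "a \<odot>\<^bsub>M\<^esub> (\<Oplus>\<^bsub>M\<^esub>i\<in>I. f i) = (\<Oplus>\<^bsub>M\<^esub>i\<in>I. a \<odot>\<^bsub>M\<^esub> f i)"
  by (rule additive_finsum[where X = M and Y = M and h = "\<lambda>x. a \<odot>\<^bsub>M\<^esub> x"])
    (use assms in \<open>auto simp: smult_closed smult_r_distr M.abelian_group_axioms\<close>)

section \<open>Cochains by recursion on the first argument\<close>

definition tuples :: "('a, 'x) ring_scheme \<Rightarrow> nat \<Rightarrow> 'a list set" where
  "tuples A n = {as. set as \<subseteq> carrier A \<and> length as = n}"

lemma tuples_0 [simp]: "as \<in> tuples A 0 \<longleftrightarrow> as = []"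
  by (auto simp: tuples_def)

lemma tuples_Suc [simp]: "a # as \<in> tuples A (Suc n) \<longleftrightarrow> a \<in> carrier A \<and> as \<in> tuples A n"
  by (auto simp: tuples_def)

lemma tuples_SucE:
  assumes "as \<in> tuples A (Suc n)"
  obtains b bs where "as = b # bs" "b \<in> carrier A" "bs \<in> tuples A n"
  using assms by (cases as) (auto simp: tuples_def)

lemma tuples_append:
  assumes "as \<in> tuples A (m + n)"
  obtains us vs where "as = us @ vs" "us \<in> tuples A m" "vs \<in> tuples A n"
proof
  show "as = take m as @ drop m as" by simp
  show "take m as \<in> tuples A m" "drop m as \<in> tuples A n"
    using assms set_take_subset[of m as] set_drop_subset[of m as] by (auto simp: tuples_def)
qed

lemma length_tuples: "as \<in> tuples A n \<Longrightarrow> length as = n"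
  by (simp add: tuples_def)

text \<open>\<open>multilinear\<close> speaks of positions in a list. Here the first argument is
  peeled off instead, to match the recursion of \<open>inner\<close>; \<open>multilinear_iff\<close>
  compares the two.\<close>

primrec multilin :: "'a set \<Rightarrow> ('k, 'a, 'x) graded_scheme \<Rightarrow> ('a, 'm, 'y) graded_scheme \<Rightarrow>
    ('a, 'n, 'z) graded_scheme \<Rightarrow> nat \<Rightarrow> ('a list \<Rightarrow> 'm \<Rightarrow> 'n) \<Rightarrow> bool" where
  "multilin Z A M N 0 F \<longleftrightarrow> zlin Z M (smult M) N (smult N) (F [])"
| "multilin Z A M N (Suc n) F \<longleftrightarrow> (\<forall>a\<in>carrier A. multilin Z A M N n (\<lambda>as. F (a # as))) \<and>
     (\<forall>as\<in>tuples A n. \<forall>x\<in>carrier M. zlin Z A (mult A) N (smult N) (\<lambda>a. F (a # as) x))"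

text \<open>
  \<open>inner\<close> collects, up to sign, the terms of the bar differential other than the first one;
  the recursion peels off the first argument.
\<close>

fun inner :: "('k, 'a, 'x) graded_scheme \<Rightarrow> ('a, 'm, 'y) graded_scheme \<Rightarrow>
    ('a, 'n, 'z) graded_scheme \<Rightarrow> ('a list \<Rightarrow> 'm \<Rightarrow> 'n) \<Rightarrow> 'a list \<Rightarrow> 'm \<Rightarrow> 'n" where
  "inner A M N F [] x = \<zero>\<^bsub>N\<^esub>"
| "inner A M N F [a] x = F [] (a \<odot>\<^bsub>M\<^esub> x)"
| "inner A M N F (a # b # cs) x =
     F ((a \<otimes>\<^bsub>A\<^esub> b) # cs) x \<ominus>\<^bsub>N\<^esub> inner A M N (\<lambda>as. F (a # as)) (b # cs) x"

text \<open>The leading term of \<open>inner\<close> carries a plus sign, hence the subtraction;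
  \<open>bar_diff_mk\<close> identifies \<open>delta\<close> with \<open>bar_diff\<close>.\<close>

definition delta :: "('k, 'a, 'x) graded_scheme \<Rightarrow> ('a, 'm, 'y) graded_scheme \<Rightarrow>
    ('a, 'n, 'z) graded_scheme \<Rightarrow> ('a list \<Rightarrow> 'm \<Rightarrow> 'n) \<Rightarrow> 'a list \<Rightarrow> 'm \<Rightarrow> 'n" where
  "delta A M N F as x = hd as \<odot>\<^bsub>N\<^esub> F (tl as) x \<ominus>\<^bsub>N\<^esub> inner A M N F as x"

text \<open>The central set \<open>Z\<close> stands for the base field: \<open>k\<close>-linearity
  is compatibility with \<open>Z\<close>, so that no separate action of \<open>k\<close> has to be
  carried along. It is instantiated with \<open>scal k A\<close>.\<close>

locale bar =
  fixes A :: "('k, 'a, 'x) graded_scheme" and M :: "('a, 'm, 'y) graded_scheme"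
    and N :: "('a, 'n, 'z) graded_scheme" and Z :: "'a set"
  assumes ring_A: "ring A" and mod_M: "left_module A M" and mod_N: "left_module A N"
    and Z_sub: "Z \<subseteq> carrier A"
    and Z_central: "\<And>z a. z \<in> Z \<Longrightarrow> a \<in> carrier A \<Longrightarrow> z \<otimes>\<^bsub>A\<^esub> a = a \<otimes>\<^bsub>A\<^esub> z"
begin

sublocale A: ring A by (rule ring_A)
sublocale M: left_module A M by (rule mod_M)
sublocale N: left_module A N by (rule mod_N)

abbreviation "ml \<equiv> multilin Z A M N"
abbreviation "inn \<equiv> inner A M N"
abbreviation "dl \<equiv> delta A M N"

declare M.smult_closed [simp] N.smult_closed [simp]

lemmas N_simps = N.minus_eq N.minus_add N.minus_minus N.a_ac N.r_neg N.r_neg1 N.r_neg2 N.l_neg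

lemma Z_closed [simp]: "z \<in> Z \<Longrightarrow> z \<in> carrier A"
  using Z_sub by auto

lemma Z_smult: "z \<in> Z \<Longrightarrow> a \<in> carrier A \<Longrightarrow> y \<in> carrier N \<Longrightarrow>
    z \<odot>\<^bsub>N\<^esub> (a \<odot>\<^bsub>N\<^esub> y) = a \<odot>\<^bsub>N\<^esub> (z \<odot>\<^bsub>N\<^esub> y)"
  by (simp add: N.smult_assoc[symmetric] Z_central)

lemma Z_smult_M: "z \<in> Z \<Longrightarrow> a \<in> carrier A \<Longrightarrow> y \<in> carrier M \<Longrightarrow>
    z \<odot>\<^bsub>M\<^esub> (a \<odot>\<^bsub>M\<^esub> y) = a \<odot>\<^bsub>M\<^esub> (z \<odot>\<^bsub>M\<^esub> y)"
  by (simp add: M.smult_assoc[symmetric] Z_central)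

lemma ml_closed: "ml n F \<Longrightarrow> as \<in> tuples A n \<Longrightarrow> x \<in> carrier M \<Longrightarrow> F as x \<in> carrier N"
proof (induction n arbitrary: F as)
  case 0
  then show ?case by (simp add: zlinD(1))
next
  case (Suc n)
  from Suc.prems(2) obtain b bs where "as = b # bs" "b \<in> carrier A" "bs \<in> tuples A n"
    by (rule tuples_SucE)
  with Suc show ?case by auto
qed

text \<open>Curried cochains are total functions with arbitrary values off the legal arguments.
  Equality of cochains is thus replaced by agreement on legal arguments, and each notion needs a
  congruence rule of this kind.\<close>

lemma ml_cong:
  assumes "ml n F" "\<And>as x. as \<in> tuples A n \<Longrightarrow> x \<in> carrier M \<Longrightarrow> G as x = F as x"
  shows "ml n G"
  using assms
proof (induction n arbitrary: F G)
  case 0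
  then show ?case by (auto simp: zlin_def)
next
  case (Suc n)
  have "ml n (\<lambda>as. G (a # as))" if "a \<in> carrier A" for a
    by (rule Suc.IH[of "\<lambda>as. F (a # as)"]) (use Suc.prems that in auto)
  moreover have "zlin Z A (mult A) N (smult N) (\<lambda>a. G (a # as) x)"
    if "as \<in> tuples A n" "x \<in> carrier M" for as x
    using Suc.prems that by (auto simp: zlin_def)
  ultimately show ?case by simp
qed

lemma zlin_add:
  assumes "zlin Z X s N (smult N) g" "zlin Z X s N (smult N) h"
    and "abelian_group X" "\<And>z x. z \<in> Z \<Longrightarrow> x \<in> carrier X \<Longrightarrow> s z x \<in> carrier X"
  shows "zlin Z X s N (smult N) (\<lambda>x. g x \<oplus>\<^bsub>N\<^esub> h x)"
proof -
  interpret X: abelian_group X by fact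
  show ?thesis using assms(1,2,4) by (auto simp: zlin_def N.a_ac N.smult_r_distr)
qed

lemma zlin_smult:
  assumes "zlin Z X s N (smult N) g" "a \<in> carrier A"
  shows "zlin Z X s N (smult N) (\<lambda>x. a \<odot>\<^bsub>N\<^esub> g x)"
proof -
  have "a \<odot>\<^bsub>N\<^esub> (z \<odot>\<^bsub>N\<^esub> g x) = z \<odot>\<^bsub>N\<^esub> (a \<odot>\<^bsub>N\<^esub> g x)" if "z \<in> Z" "x \<in> carrier X" for z x
    using Z_smult[of z a "g x"] assms that by (simp add: zlin_def)
  then show ?thesis using assms by (auto simp: zlin_def N.smult_r_distr)
qed

lemma zlin_uminus:
  assumes "zlin Z X s N (smult N) g"
  shows "zlin Z X s N (smult N) (\<lambda>x. \<ominus>\<^bsub>N\<^esub> g x)"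
  using assms by (auto simp: zlin_def N.smult_r_minus N.minus_add)

lemma zlin_const_zero: "zlin Z X s N (smult N) (\<lambda>x. \<zero>\<^bsub>N\<^esub>)"
  by (auto simp: zlin_def N.smult_r_null)

lemma ml_add: "ml n F \<Longrightarrow> ml n G \<Longrightarrow> ml n (\<lambda>as x. F as x \<oplus>\<^bsub>N\<^esub> G as x)"
  by (induction n arbitrary: F G)
    (auto intro!: zlin_add simp: M.abelian_group_axioms A.is_abelian_group)

lemma ml_smult: "ml n F \<Longrightarrow> a \<in> carrier A \<Longrightarrow> ml n (\<lambda>as x. a \<odot>\<^bsub>N\<^esub> F as x)"
  by (induction n arbitrary: F) (auto intro!: zlin_smult)

lemma ml_uminus: "ml n F \<Longrightarrow> ml n (\<lambda>as x. \<ominus>\<^bsub>N\<^esub> F as x)"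
  by (induction n arbitrary: F) (auto intro!: zlin_uminus)

lemma ml_zero: "ml n (\<lambda>as x. \<zero>\<^bsub>N\<^esub>)"
  by (induction n) (auto intro!: zlin_const_zero)

lemma ml_minus: "ml n F \<Longrightarrow> ml n G \<Longrightarrow> ml n (\<lambda>as x. F as x \<ominus>\<^bsub>N\<^esub> G as x)"
  unfolding N.minus_eq by (intro ml_add ml_uminus)

lemma ml_finsum:
  assumes "finite I" "\<And>i. i \<in> I \<Longrightarrow> ml n (F i)"
  shows "ml n (\<lambda>as x. \<Oplus>\<^bsub>N\<^esub>i\<in>I. F i as x)"
  using assms
proof (induction I rule: finite_induct)
  case empty
  then show ?case by (simp add: ml_zero)
next
  case (insert i I)
  show ?case
    by (rule ml_cong[OF ml_add[of n "F i" "\<lambda>as x. \<Oplus>\<^bsub>N\<^esub>i\<in>I. F i as x"]])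
      (use insert in \<open>auto intro!: N.finsum_insert dest!: ml_closed\<close>)
qed

lemma inn_closed: "ml n F \<Longrightarrow> as \<in> tuples A (Suc n) \<Longrightarrow> x \<in> carrier M \<Longrightarrow> inn F as x \<in> carrier N"
proof (induction n arbitrary: F as)
  case 0
  then show ?case by (auto elim!: tuples_SucE simp: zlinD(1))
next
  case (Suc n)
  from Suc.prems(2) obtain a b cs where as: "as = a # b # cs" "a \<in> carrier A" "b \<in> carrier A" "cs \<in> tuples A n"
    by (auto elim!: tuples_SucE)
  have "inn (\<lambda>as. F (a # as)) (b # cs) x \<in> carrier N"
    by (rule Suc.IH) (use Suc.prems as in auto)
  moreover have "F ((a \<otimes>\<^bsub>A\<^esub> b) # cs) x \<in> carrier N"
    by (rule ml_closed[OF Suc.prems(1)]) (use as Suc.prems in auto)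
  ultimately show ?case by (simp add: as)
qed

lemma inn_cong:
  assumes "as \<in> tuples A (Suc n)" "x \<in> carrier M"
    and "\<And>as x. as \<in> tuples A n \<Longrightarrow> x \<in> carrier M \<Longrightarrow> G as x = F as x"
  shows "inn G as x = inn F as x"
  using assms
proof (induction n arbitrary: F G as)
  case 0
  then show ?case by (auto elim!: tuples_SucE)
next
  case (Suc n)
  from Suc.prems(1) obtain a b cs where as: "as = a # b # cs" "a \<in> carrier A" "b \<in> carrier A" "cs \<in> tuples A n"
    by (auto elim!: tuples_SucE)
  have "inn (\<lambda>as. G (a # as)) (b # cs) x = inn (\<lambda>as. F (a # as)) (b # cs) x"
    by (rule Suc.IH) (use Suc.prems as in auto)
  then show ?case using as Suc.prems by simp
qed

lemma inn_add: "ml n F \<Longrightarrow> ml n G \<Longrightarrow> as \<in> tuples A (Suc n) \<Longrightarrow> x \<in> carrier M \<Longrightarrow>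
    inn (\<lambda>as x. F as x \<oplus>\<^bsub>N\<^esub> G as x) as x = inn F as x \<oplus>\<^bsub>N\<^esub> inn G as x"
proof (induction n arbitrary: F G as)
  case 0
  then show ?case by (auto elim!: tuples_SucE)
next
  case (Suc n)
  from Suc.prems(3) obtain a b cs where as: "as = a # b # cs" "a \<in> carrier A" "b \<in> carrier A" "cs \<in> tuples A n"
    by (auto elim!: tuples_SucE)
  have "ml n (\<lambda>as. F (a # as))" "ml n (\<lambda>as. G (a # as))" using Suc.prems as by auto
  note this[THEN inn_closed, of "b # cs" x] and Suc.IH[OF this, of "b # cs"]
  moreover have "F ((a \<otimes>\<^bsub>A\<^esub> b) # cs) x \<in> carrier N" "G ((a \<otimes>\<^bsub>A\<^esub> b) # cs) x \<in> carrier N"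
    by (auto intro!: ml_closed[OF Suc.prems(1)] ml_closed[OF Suc.prems(2)] simp: as Suc.prems)
  ultimately show ?case using as Suc.prems(4) by (simp add: N_simps)
qed

lemma inn_smult: "ml n F \<Longrightarrow> s \<in> carrier A \<Longrightarrow> as \<in> tuples A (Suc n) \<Longrightarrow> x \<in> carrier M \<Longrightarrow>
    inn (\<lambda>as x. s \<odot>\<^bsub>N\<^esub> F as x) as x = s \<odot>\<^bsub>N\<^esub> inn F as x"
proof (induction n arbitrary: F as)
  case 0
  then show ?case by (auto elim!: tuples_SucE)
next
  case (Suc n)
  from Suc.prems(3) obtain a b cs where as: "as = a # b # cs" "a \<in> carrier A" "b \<in> carrier A" "cs \<in> tuples A n"
    by (auto elim!: tuples_SucE)
  have "ml n (\<lambda>as. F (a # as))" using Suc.prems as by auto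
  note this[THEN inn_closed, of "b # cs" x] and Suc.IH[OF this, of "b # cs"]
  moreover have "F ((a \<otimes>\<^bsub>A\<^esub> b) # cs) x \<in> carrier N"
    by (auto intro!: ml_closed[OF Suc.prems(1)] simp: as Suc.prems)
  ultimately show ?case using as Suc.prems by (simp add: N.minus_eq N.smult_r_distr N.smult_r_minus)
qed

lemma inn_uminus: "ml n F \<Longrightarrow> as \<in> tuples A (Suc n) \<Longrightarrow> x \<in> carrier M \<Longrightarrow>
    inn (\<lambda>as x. \<ominus>\<^bsub>N\<^esub> F as x) as x = \<ominus>\<^bsub>N\<^esub> inn F as x"
proof (induction n arbitrary: F as)
  case 0
  then show ?case by (auto elim!: tuples_SucE)
next
  case (Suc n)
  from Suc.prems(2) obtain a b cs where as: "as = a # b # cs" "a \<in> carrier A" "b \<in> carrier A" "cs \<in> tuples A n"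
    by (auto elim!: tuples_SucE)
  have "ml n (\<lambda>as. F (a # as))" using Suc.prems as by auto
  note this[THEN inn_closed, of "b # cs" x] and Suc.IH[OF this, of "b # cs"]
  moreover have "F ((a \<otimes>\<^bsub>A\<^esub> b) # cs) x \<in> carrier N"
    by (auto intro!: ml_closed[OF Suc.prems(1)] simp: as Suc.prems)
  ultimately show ?case using as Suc.prems by (simp add: N.minus_eq N.minus_add)
qed

lemma inn_minus: "ml n F \<Longrightarrow> ml n G \<Longrightarrow> as \<in> tuples A (Suc n) \<Longrightarrow> x \<in> carrier M \<Longrightarrow>
    inn (\<lambda>as x. F as x \<ominus>\<^bsub>N\<^esub> G as x) as x = inn F as x \<ominus>\<^bsub>N\<^esub> inn G as x"
  unfolding N.minus_eq by (simp add: inn_add inn_uminus ml_uminus)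

text \<open>A scalar in the second argument or in the module argument has to be moved past
  \<open>a\<close>; this is where the centrality of \<open>Z\<close> enters. Linearity in the first
  argument reduces to \<open>inn_add\<close> and \<open>inn_smult\<close> for the cochain with its
  first argument fixed.\<close>

lemma inn_ml: "ml n F \<Longrightarrow> ml (Suc n) (inn F)"
proof (induction n arbitrary: F)
  case 0
  then have F: "zlin Z M (smult M) N (smult N) (F [])" by simp
  show ?case
  proof -
    have "F [] (a \<odot>\<^bsub>M\<^esub> (z \<odot>\<^bsub>M\<^esub> x)) = z \<odot>\<^bsub>N\<^esub> F [] (a \<odot>\<^bsub>M\<^esub> x)"
      if "a \<in> carrier A" "z \<in> Z" "x \<in> carrier M" for a z x
      using F that by (simp add: zlin_def Z_smult_M[OF that(2,1,3), symmetric])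
    then show ?thesis
      using F by (auto simp: zlin_def M.smult_r_distr M.smult_l_distr M.smult_assoc)
  qed
next
  case (Suc n)
  have shift: "ml n (\<lambda>as. F (a # as))" if "a \<in> carrier A" for a using Suc.prems that by auto
  have IH: "ml (Suc n) (inn (\<lambda>as. F (a # as)))" if "a \<in> carrier A" for a
    by (rule Suc.IH) (rule shift[OF that])
  have lin: "zlin Z A (mult A) N (smult N) (\<lambda>a. F (a # cs) x)" if "cs \<in> tuples A n" "x \<in> carrier M" for cs x
    using Suc.prems that by auto
  have 1: "ml (Suc n) (\<lambda>bs. inn F (a # bs))" if a: "a \<in> carrier A" for a
  proof -
    have "ml n (\<lambda>cs x. F ((a \<otimes>\<^bsub>A\<^esub> b) # cs) x \<ominus>\<^bsub>N\<^esub> inn (\<lambda>as. F (a # as)) (b # cs) x)" if "b \<in> carrier A" for b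
      using shift[of "a \<otimes>\<^bsub>A\<^esub> b"] IH[OF a] that a by (intro ml_minus) auto
    moreover have "zlin Z A (mult A) N (smult N) (\<lambda>b. F ((a \<otimes>\<^bsub>A\<^esub> b) # cs) x \<ominus>\<^bsub>N\<^esub> inn (\<lambda>as. F (a # as)) (b # cs) x)"
      if "cs \<in> tuples A n" "x \<in> carrier M" for cs x
    proof -
      have "zlin Z A (mult A) N (smult N) (\<lambda>b. F ((a \<otimes>\<^bsub>A\<^esub> b) # cs) x)"
        using lin[OF that] a Z_central[symmetric, of _ a]
        by (auto simp: zlin_def A.r_distr A.m_assoc[symmetric])
          (simp add: A.m_assoc)
      moreover have "zlin Z A (mult A) N (smult N) (\<lambda>b. inn (\<lambda>as. F (a # as)) (b # cs) x)"
        using IH[OF a] that by auto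
      ultimately show ?thesis
        unfolding N.minus_eq by (intro zlin_add zlin_uminus) (auto simp: A.is_abelian_group)
    qed
    moreover have "(\<lambda>cs. inn F (a # b # cs)) =
        (\<lambda>cs x. F ((a \<otimes>\<^bsub>A\<^esub> b) # cs) x \<ominus>\<^bsub>N\<^esub> inn (\<lambda>as. F (a # as)) (b # cs) x)" for b
      by (intro ext) simp
    ultimately show ?thesis by simp
  qed
  have 2: "zlin Z A (mult A) N (smult N) (\<lambda>a. inn F (a # bs) x)"
    if bs: "bs \<in> tuples A (Suc n)" and x: "x \<in> carrier M" for bs x
  proof -
    obtain b cs where bs': "bs = b # cs" "b \<in> carrier A" "cs \<in> tuples A n"
      using bs by (rule tuples_SucE)
    have "zlin Z A (mult A) N (smult N) (\<lambda>a. F ((a \<otimes>\<^bsub>A\<^esub> b) # cs) x)"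
      using lin[of cs x] bs' x by (auto simp: zlin_def A.l_distr A.m_assoc)
    moreover have "zlin Z A (mult A) N (smult N) (\<lambda>a. inn (\<lambda>as. F (a # as)) bs x)"
      unfolding zlin_def
    proof (intro conjI ballI)
      fix a assume "a \<in> carrier A" then show "inn (\<lambda>as. F (a # as)) bs x \<in> carrier N"
        by (intro inn_closed[OF shift] bs x)
    next
      fix a a' assume a: "a \<in> carrier A" "a' \<in> carrier A"
      have "inn (\<lambda>as. F ((a \<oplus>\<^bsub>A\<^esub> a') # as)) bs x = inn (\<lambda>as x. F (a # as) x \<oplus>\<^bsub>N\<^esub> F (a' # as) x) bs x"
        by (rule inn_cong[OF bs x]) (use lin a in \<open>auto simp: zlin_def\<close>)
      then show "inn (\<lambda>as. F ((a \<oplus>\<^bsub>A\<^esub> a') # as)) bs x =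
          inn (\<lambda>as. F (a # as)) bs x \<oplus>\<^bsub>N\<^esub> inn (\<lambda>as. F (a' # as)) bs x"
        by (simp add: inn_add[OF shift shift bs x] a)
    next
      fix z a assume a: "z \<in> Z" "a \<in> carrier A"
      have "inn (\<lambda>as. F ((z \<otimes>\<^bsub>A\<^esub> a) # as)) bs x = inn (\<lambda>as x. z \<odot>\<^bsub>N\<^esub> F (a # as) x) bs x"
        by (rule inn_cong[OF bs x]) (use lin a in \<open>auto simp: zlin_def\<close>)
      then show "inn (\<lambda>as. F ((z \<otimes>\<^bsub>A\<^esub> a) # as)) bs x = z \<odot>\<^bsub>N\<^esub> inn (\<lambda>as. F (a # as)) bs x"
        by (simp add: inn_smult[OF shift _ bs x] a)
    qed
    ultimately show ?thesis
      unfolding N.minus_eq bs'(1) inner.simps by (intro zlin_add zlin_uminus) (auto simp: A.is_abelian_group)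
  qed
  show ?case using 1 2 by (simp only: multilin.simps(2)[where n = "Suc n"]) blast
qed

lemma dl_Cons: "dl F (a # as) x = a \<odot>\<^bsub>N\<^esub> F as x \<ominus>\<^bsub>N\<^esub> inn F (a # as) x"
  by (simp add: delta_def)

lemma dl_ml: "ml n F \<Longrightarrow> ml (Suc n) (dl F)"
proof -
  assume F: "ml n F"
  have "ml (Suc n) (\<lambda>as x. hd as \<odot>\<^bsub>N\<^esub> F (tl as) x)"
    using F by (auto intro!: ml_smult simp: zlin_def ml_closed N.smult_l_distr N.smult_assoc)
  from ml_minus[OF this inn_ml[OF F]] show ?thesis
    by (rule ml_cong) (auto elim!: tuples_SucE simp: dl_Cons)
qed

lemma dl_cong:
  assumes "as \<in> tuples A (Suc n)" "x \<in> carrier M"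
    and "\<And>as x. as \<in> tuples A n \<Longrightarrow> x \<in> carrier M \<Longrightarrow> G as x = F as x"
  shows "dl G as x = dl F as x"
proof -
  obtain b bs where "as = b # bs" "bs \<in> tuples A n" using assms(1) by (rule tuples_SucE)
  then show ?thesis using inn_cong[OF assms] assms by (simp add: delta_def)
qed

lemma dl_add: "ml n F \<Longrightarrow> ml n G \<Longrightarrow> as \<in> tuples A (Suc n) \<Longrightarrow> x \<in> carrier M \<Longrightarrow>
    dl (\<lambda>as x. F as x \<oplus>\<^bsub>N\<^esub> G as x) as x = dl F as x \<oplus>\<^bsub>N\<^esub> dl G as x"
  using inn_add[of n F G as x] inn_closed[of n F as x] inn_closed[of n G as x]
    ml_closed[of n F "tl as" x] ml_closed[of n G "tl as" x]
  by (auto elim!: tuples_SucE simp: delta_def N.smult_r_distr N_simps)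

lemma dl_uminus: "ml n F \<Longrightarrow> as \<in> tuples A (Suc n) \<Longrightarrow> x \<in> carrier M \<Longrightarrow>
    dl (\<lambda>as x. \<ominus>\<^bsub>N\<^esub> F as x) as x = \<ominus>\<^bsub>N\<^esub> dl F as x"
  using inn_uminus[of n F as x] inn_closed[of n F as x] ml_closed[of n F "tl as" x]
  by (auto elim!: tuples_SucE simp: delta_def N.smult_r_minus N_simps)

lemma dl_closed: "ml n F \<Longrightarrow> as \<in> tuples A (Suc n) \<Longrightarrow> x \<in> carrier M \<Longrightarrow> dl F as x \<in> carrier N"
  by (rule ml_closed[OF dl_ml])

lemma dl_minus: "ml n F \<Longrightarrow> ml n G \<Longrightarrow> as \<in> tuples A (Suc n) \<Longrightarrow> x \<in> carrier M \<Longrightarrow>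
    dl (\<lambda>as x. F as x \<ominus>\<^bsub>N\<^esub> G as x) as x = dl F as x \<ominus>\<^bsub>N\<^esub> dl G as x"
  unfolding N.minus_eq by (simp add: dl_add dl_uminus ml_uminus)

lemma dl_zero: "as \<in> tuples A (Suc n) \<Longrightarrow> x \<in> carrier M \<Longrightarrow> dl (\<lambda>as x. \<zero>\<^bsub>N\<^esub>) as x = \<zero>\<^bsub>N\<^esub>"
  using dl_minus[OF ml_zero ml_zero, of as n x] dl_closed[OF ml_zero, of as n x]
  by (simp add: N.minus_eq N.r_neg)

lemma dl_finsum:
  assumes "finite I" "\<And>i. i \<in> I \<Longrightarrow> ml n (F i)" "as \<in> tuples A (Suc n)" "x \<in> carrier M"
  shows "dl (\<lambda>as x. \<Oplus>\<^bsub>N\<^esub>i\<in>I. F i as x) as x = (\<Oplus>\<^bsub>N\<^esub>i\<in>I. dl (F i) as x)"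
  using assms(1,2)
proof (induction I rule: finite_induct)
  case empty
  then show ?case using dl_zero[OF assms(3,4)] by simp
next
  case (insert i I)
  have "dl (\<lambda>as x. \<Oplus>\<^bsub>N\<^esub>i\<in>insert i I. F i as x) as x =
      dl (\<lambda>as x. F i as x \<oplus>\<^bsub>N\<^esub> (\<Oplus>\<^bsub>N\<^esub>i\<in>I. F i as x)) as x"
    by (rule dl_cong[OF assms(3,4)])
      (use insert in \<open>auto intro!: N.finsum_insert dest!: ml_closed\<close>)
  also have "\<dots> = dl (F i) as x \<oplus>\<^bsub>N\<^esub> dl (\<lambda>as x. \<Oplus>\<^bsub>N\<^esub>i\<in>I. F i as x) as x"
    by (rule dl_add) (use insert assms in \<open>auto intro!: ml_finsum\<close>)
  finally show ?case
    using insert dl_closed[OF _ assms(3,4)] by (simp add: N.finsum_insert Pi_def)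
qed

text \<open>The terms that keep \<open>a\<close> as a separate argument cancel in pairs, and
  associativity of \<open>A\<close> identifies the rest. This is the core of the fact that the
  differential squares to zero.\<close>

lemma inn_inn:
  assumes "ml n F" "a \<in> carrier A" "b \<in> carrier A" "cs \<in> tuples A n" "x \<in> carrier M"
  shows "inn (\<lambda>as. inn F (a # as)) (b # cs) x = inn F ((a \<otimes>\<^bsub>A\<^esub> b) # cs) x"
  using assms
proof (induction n arbitrary: F a b cs)
  case 0
  then show ?case by (simp add: M.smult_assoc)
next
  case (Suc n)
  obtain c ds where cs: "cs = c # ds" "c \<in> carrier A" "ds \<in> tuples A n"
    using Suc.prems(4) by (rule tuples_SucE)
  note ab = Suc.prems(2,3)
  have shift: "ml n (\<lambda>as. F (a # as))" if "a \<in> carrier A" for a using Suc.prems that by auto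
  have Fcl: "F (u # us) y \<in> carrier N" if "u \<in> carrier A" "us \<in> tuples A n" "y \<in> carrier M" for u us y
    by (rule ml_closed[OF Suc.prems(1)]) (use that in auto)
  have "inn (\<lambda>as. inn F (a # b # as)) (c # ds) x =
      inn (\<lambda>as x. F ((a \<otimes>\<^bsub>A\<^esub> b) # as) x \<ominus>\<^bsub>N\<^esub> inn (\<lambda>as. F (a # as)) (b # as) x) (c # ds) x"
    by (rule arg_cong[where f = "\<lambda>G. inn G (c # ds) x"]) (intro ext, simp)
  also have "\<dots> = inn (\<lambda>as. F ((a \<otimes>\<^bsub>A\<^esub> b) # as)) (c # ds) x \<ominus>\<^bsub>N\<^esub>
      inn (\<lambda>as. inn (\<lambda>as. F (a # as)) (b # as)) (c # ds) x"
    using inn_ml[OF shift[OF ab(1)]] ab cs Suc.prems by (intro inn_minus[of n] shift) auto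
  also have "inn (\<lambda>as. inn (\<lambda>as. F (a # as)) (b # as)) (c # ds) x = inn (\<lambda>as. F (a # as)) ((b \<otimes>\<^bsub>A\<^esub> c) # ds) x"
    by (rule Suc.IH) (use shift ab cs Suc.prems in auto)
  finally have "inn (\<lambda>as. inn F (a # b # as)) (c # ds) x =
    inn (\<lambda>as. F ((a \<otimes>\<^bsub>A\<^esub> b) # as)) (c # ds) x \<ominus>\<^bsub>N\<^esub> inn (\<lambda>as. F (a # as)) ((b \<otimes>\<^bsub>A\<^esub> c) # ds) x" .
  moreover have "inn (\<lambda>as. F ((a \<otimes>\<^bsub>A\<^esub> b) # as)) (c # ds) x \<in> carrier N"
    "inn (\<lambda>as. F (a # as)) ((b \<otimes>\<^bsub>A\<^esub> c) # ds) x \<in> carrier N"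
    using ab cs Suc.prems by (auto intro!: inn_closed[OF shift])
  ultimately show ?case
    unfolding cs(1) inner.simps
    using Fcl[of "(a \<otimes>\<^bsub>A\<^esub> b) \<otimes>\<^bsub>A\<^esub> c" ds x] ab cs Suc.prems(5) by (simp add: A.m_assoc N_simps)
qed

text \<open>The terms in which \<open>a\<close> acts on \<open>inn F\<close> cancel directly, those
  with \<open>a\<close> and \<open>b\<close> acting on \<open>F\<close> by associativity of the
  action, and the last pair is the one that \<open>inn_inn\<close> identifies.\<close>

lemma dl_dl:
  assumes "ml n F" "as \<in> tuples A (Suc (Suc n))" "x \<in> carrier M"
  shows "dl (dl F) as x = \<zero>\<^bsub>N\<^esub>"
proof -
  obtain a b cs where as: "as = a # b # cs" "a \<in> carrier A" "b \<in> carrier A" "cs \<in> tuples A n"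
    using assms(2) by (auto elim!: tuples_SucE)
  have ab: "a \<otimes>\<^bsub>A\<^esub> b \<in> carrier A" using as by simp
  have cl: "F cs x \<in> carrier N" "inn F (b # cs) x \<in> carrier N" "inn F ((a \<otimes>\<^bsub>A\<^esub> b) # cs) x \<in> carrier N"
    using assms as by (auto intro: ml_closed inn_closed)
  have "inn (\<lambda>as. dl F (a # as)) (b # cs) x = inn (\<lambda>as x. a \<odot>\<^bsub>N\<^esub> F as x \<ominus>\<^bsub>N\<^esub> inn F (a # as) x) (b # cs) x"
    by (rule arg_cong[where f = "\<lambda>G. inn G (b # cs) x"]) (intro ext, simp add: dl_Cons)
  also have "\<dots> = inn (\<lambda>as x. a \<odot>\<^bsub>N\<^esub> F as x) (b # cs) x \<ominus>\<^bsub>N\<^esub> inn (\<lambda>as. inn F (a # as)) (b # cs) x"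
    using inn_ml[OF assms(1)] as assms by (intro inn_minus[of n] ml_smult) auto
  also have "\<dots> = a \<odot>\<^bsub>N\<^esub> inn F (b # cs) x \<ominus>\<^bsub>N\<^esub> inn F ((a \<otimes>\<^bsub>A\<^esub> b) # cs) x"
    using inn_inn[OF assms(1)] inn_smult[OF assms(1)] as assms by simp
  finally show ?thesis
    unfolding as(1) dl_Cons inner.simps using as ab cl
    by (simp add: N_simps N.smult_r_distr N.smult_assoc N.smult_r_minus)
qed

end

section \<open>Composition of cochains\<close>

definition ycomp :: "nat \<Rightarrow> ('a list \<Rightarrow> 'n \<Rightarrow> 'p) \<Rightarrow> ('a list \<Rightarrow> 'm \<Rightarrow> 'n) \<Rightarrow> 'a list \<Rightarrow> 'm \<Rightarrow> 'p" where
  "ycomp m G F as x = G (take m as) (F (drop m as) x)"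

lemma comp_0: "ycomp 0 G F = (\<lambda>as x. G [] (F as x))"
  by (intro ext) (simp add: ycomp_def)

lemma comp_Suc: "ycomp (Suc m) G F (a # as) = ycomp m (\<lambda>as. G (a # as)) F as"
  by (intro ext) (simp add: ycomp_def)

lemma comp_append: "us \<in> tuples A m \<Longrightarrow> ycomp m G F (us @ vs) x = G us (F vs x)"
  by (simp add: ycomp_def length_tuples)

locale bar_pair = F: bar A M N Z + G: bar A N P Z
  for A :: "('k, 'a, 'x) graded_scheme" and M :: "('a, 'm, 'y) graded_scheme"
    and N :: "('a, 'n, 'z) graded_scheme" and P :: "('a, 'p, 'w) graded_scheme" and Z :: "'a set"
begin

sublocale H: bar A M P Z
  by unfold_locales (use F.mod_M G.mod_N F.Z_central in auto)

lemma post_ml: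
  assumes g: "zlin Z N (smult N) P (smult P) g" and "F.ml n F"
  shows "H.ml n (\<lambda>as x. g (F as x))"
  using assms(2)
proof (induction n arbitrary: F)
  case 0
  then show ?case using g by (auto simp: zlin_def)
next
  case (Suc n)
  then show ?case using g by (auto simp: zlin_def)
qed

lemma comp_ml:
  assumes "G.ml m G" "F.ml n F"
  shows "H.ml (m + n) (ycomp m G F)"
  using assms(1)
proof (induction m arbitrary: G)
  case 0
  then show ?case using assms(2) by (simp add: comp_0 post_ml)
next
  case (Suc m)
  have "H.ml (m + n) (\<lambda>as. ycomp (Suc m) G F (a # as))" if "a \<in> carrier A" for a
    using Suc that by (simp add: comp_Suc)
  moreover have "zlin Z A (mult A) P (smult P) (\<lambda>a. ycomp (Suc m) G F (a # as) x)"
    if as: "as \<in> tuples A (m + n)" "x \<in> carrier M" for as x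
  proof -
    obtain us vs where "as = us @ vs" "us \<in> tuples A m" "vs \<in> tuples A n"
      using as(1) by (rule tuples_append)
    then show ?thesis
      using Suc.prems F.ml_closed[OF assms(2), of vs x] that by (simp add: comp_Suc comp_append)
  qed
  ultimately show ?case by simp
qed

text \<open>The term in which \<open>last us\<close> acts on \<open>F vs x\<close> is absent from
  the left side. On the right it occurs twice with opposite signs, as the last term of
  \<open>inner\<close> for \<open>G\<close> and as the first term of the differential of
  \<open>F\<close>.\<close>

lemma inn_comp:
  assumes "G.ml m G" "F.ml n F" "us \<in> tuples A (Suc m)" "vs \<in> tuples A n" "x \<in> carrier M"
  shows "H.inn (ycomp m G F) (us @ vs) x = G.inn G us (F vs x) \<ominus>\<^bsub>P\<^esub>
    (if even m then G (butlast us) (F.dl F (last us # vs) x)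
     else \<ominus>\<^bsub>P\<^esub> G (butlast us) (F.dl F (last us # vs) x))"
  using assms(1,3)
proof (induction m arbitrary: G us)
  case 0
  then have g: "zlin Z N (smult N) P (smult P) (G [])" by simp
  from 0 obtain u where u: "us = [u]" "u \<in> carrier A" by (auto elim!: tuples_SucE)
  have inn: "H.inn (\<lambda>as x. G [] (F as x)) (u # vs) x = G [] (F.inn F (u # vs) x)"
    if "F.ml n F" "u \<in> carrier A" "vs \<in> tuples A n" for F u vs n
    using that
  proof (induction n arbitrary: F u vs)
    case 0
    then show ?case by simp
  next
    case (Suc n)
    obtain c cs where cs: "vs = c # cs" "c \<in> carrier A" "cs \<in> tuples A n"
      using Suc.prems(3) by (rule tuples_SucE)
    have IH: "H.inn (\<lambda>as x. G [] (F (u # as) x)) (c # cs) x = G [] (F.inn (\<lambda>as. F (u # as)) (c # cs) x)"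
      by (rule Suc.IH) (use Suc.prems cs in auto)
    have "F ((u \<otimes>\<^bsub>A\<^esub> c) # cs) x \<in> carrier N" "F.inn (\<lambda>as. F (u # as)) (c # cs) x \<in> carrier N"
      using Suc.prems cs assms(5)
      by (auto intro!: F.ml_closed[OF Suc.prems(1)] F.inn_closed[of n "\<lambda>as. F (u # as)"])
    then show ?case
      using g additive_minus[OF F.N.abelian_group_axioms G.N.abelian_group_axioms, of _ "G []"]
      by (simp add: cs IH F.N.minus_eq G.N.minus_eq zlin_def)
  qed
  have cl: "F vs x \<in> carrier N" "F.inn F (u # vs) x \<in> carrier N"
    using assms u by (auto intro: F.ml_closed F.inn_closed)
  then have cl': "G [] (u \<odot>\<^bsub>N\<^esub> F vs x) \<in> carrier P" "G [] (F.inn F (u # vs) x) \<in> carrier P"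
    using g u by (auto simp: zlin_def)
  show ?case
    using cl cl' g u assms inn[OF assms(2) u(2) assms(4)]
      additive_minus[OF F.N.abelian_group_axioms G.N.abelian_group_axioms, of _ "G []"]
    by (simp add: comp_0 F.dl_Cons F.N.minus_eq G.N_simps zlin_def)
next
  case (Suc m)
  from Suc.prems(2) obtain a b cs where us: "us = a # b # cs" "a \<in> carrier A" "b \<in> carrier A" "cs \<in> tuples A m"
    by (auto elim!: tuples_SucE)
  have ml: "G.ml m (\<lambda>as. G (a # as))" using Suc.prems us by auto
  have y: "F vs x \<in> carrier N" using assms by (auto intro: F.ml_closed)
  have l: "last (b # cs) \<in> carrier A" "butlast (b # cs) \<in> tuples A m"
    using us last_in_set[of "b # cs"]
    by (auto simp: tuples_def simp del: last.simps butlast.simps dest!: in_set_butlastD)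
  have w: "F.dl F (last (b # cs) # vs) x \<in> carrier N"
    using assms l by (auto intro!: F.dl_closed)
  have cl: "G ((a \<otimes>\<^bsub>A\<^esub> b) # cs) (F vs x) \<in> carrier P" "G.inn (\<lambda>as. G (a # as)) (b # cs) (F vs x) \<in> carrier P"
    "G (a # butlast (b # cs)) (F.dl F (last (b # cs) # vs) x) \<in> carrier P"
    using us y w l by (auto intro!: G.ml_closed[OF Suc.prems(1)] G.inn_closed[OF ml] simp del: last.simps butlast.simps)
  have c1: "ycomp (Suc m) G F ((a \<otimes>\<^bsub>A\<^esub> b) # cs @ vs) x = G ((a \<otimes>\<^bsub>A\<^esub> b) # cs) (F vs x)"
    using us by (simp add: ycomp_def length_tuples)
  have c2: "H.inn (\<lambda>as. ycomp (Suc m) G F (a # as)) (b # cs @ vs) x =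
     H.inn (ycomp m (\<lambda>as. G (a # as)) F) ((b # cs) @ vs) x"
    by (simp add: comp_Suc)
  have "b # cs \<in> tuples A (Suc m)" using us by simp
  note IH = trans[OF c2 Suc.IH[OF ml this]]
  have b: "butlast us = a # butlast (b # cs)" "last us = last (b # cs)" by (simp_all add: us)
  show ?case
    unfolding b unfolding us(1) append.simps inner.simps c1 IH
    using cl by (simp add: G.N_simps del: last.simps butlast.simps)
qed

text \<open>Adding the outer term to \<open>inn_comp\<close> completes \<open>inner\<close> to the
  differential of \<open>G\<close>. The result is the Leibniz rule d(g f) = (d g) f + (-1)^m g (d
  f).\<close>

lemma dl_comp:
  assumes "G.ml m G" "F.ml n F" "us \<in> tuples A (Suc m)" "vs \<in> tuples A n" "x \<in> carrier M"
  shows "H.dl (ycomp m G F) (us @ vs) x = G.dl G us (F vs x) \<oplus>\<^bsub>P\<^esub>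
    (if even m then G (butlast us) (F.dl F (last us # vs) x)
     else \<ominus>\<^bsub>P\<^esub> G (butlast us) (F.dl F (last us # vs) x))"
proof -
  obtain b bs where us: "us = b # bs" "b \<in> carrier A" "bs \<in> tuples A m"
    using assms(3) by (rule tuples_SucE)
  have y: "F vs x \<in> carrier N" using assms by (auto intro: F.ml_closed)
  have l: "last us \<in> carrier A" "butlast us \<in> tuples A m"
    using us last_in_set[of us]
    by (auto simp: tuples_def simp del: last.simps butlast.simps dest!: in_set_butlastD)
  have w: "F.dl F (last us # vs) x \<in> carrier N"
    using assms l by (auto intro!: F.dl_closed)
  have cl: "G bs (F vs x) \<in> carrier P" "G.inn G us (F vs x) \<in> carrier P"
    "G (butlast us) (F.dl F (last us # vs) x) \<in> carrier P"
    using us y w l assms by (auto intro!: G.ml_closed[OF assms(1)] G.inn_closed[OF assms(1)])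
  have c: "ycomp m G F (bs @ vs) x = G bs (F vs x)"
    using us by (simp add: ycomp_def length_tuples)
  show ?thesis
    unfolding delta_def[of A M P] inn_comp[OF assms]
    using cl us(2) by (simp add: us(1) c delta_def[of A N P] G.N_simps)
qed

lemma dl_comp_left:
  assumes "G.ml m G" "F.ml n F" "as \<in> tuples A (Suc (m + n))" "x \<in> carrier M"
    and "\<And>as. as \<in> tuples A (Suc n) \<Longrightarrow> F.dl F as x = \<zero>\<^bsub>N\<^esub>"
  shows "H.dl (ycomp m G F) as x = ycomp (Suc m) (G.dl G) F as x"
proof -
  obtain us vs where as: "as = us @ vs" "us \<in> tuples A (Suc m)" "vs \<in> tuples A n"
    using assms(3) tuples_append[of as A "Suc m" n] by auto
  obtain b bs where us: "us = b # bs" using as(2) by (rule tuples_SucE)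
  have l: "last us \<in> carrier A" "butlast us \<in> tuples A m"
    using as us last_in_set[of us]
    by (auto simp: tuples_def simp del: last.simps butlast.simps dest!: in_set_butlastD)
  have "F.dl F (last us # vs) x = \<zero>\<^bsub>N\<^esub>" by (rule assms(5)) (use l as in auto)
  moreover have "G (butlast us) \<zero>\<^bsub>N\<^esub> = \<zero>\<^bsub>P\<^esub>"
    using l(2) assms(1)
  proof (induction m arbitrary: us G)
    case 0
    then show ?case
      using zlin_zero[OF F.N.abelian_group_axioms G.N.abelian_group_axioms, of _ _ _ "G []"] by auto
  next
    case (Suc m)
    then obtain c cs where c: "butlast us = c # cs" "c \<in> carrier A" "cs \<in> tuples A m"
      by (auto elim!: tuples_SucE)
    \<comment> \<open>The induction runs over a list \<open>us\<close> that is seen only through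
      \<open>butlast us\<close>; \<open>cs @ [c]\<close> is chosen as a list whose
      \<open>butlast\<close> is \<open>cs\<close>.\<close>
    have "butlast (cs @ [c]) \<in> tuples A m" using c by simp
    from Suc.IH[OF this, of "\<lambda>as. G (c # as)"] show ?case using Suc.prems c by auto
  qed
  moreover have "G.dl G us (F vs x) \<in> carrier P"
    by (rule G.dl_closed[OF assms(1) as(2)]) (rule F.ml_closed[OF assms(2) as(3) assms(4)])
  ultimately show ?thesis
    using dl_comp[OF assms(1,2) as(2,3) assms(4)] as by (simp add: comp_append)
qed

lemma dl_comp_right:
  assumes "G.ml m G" "F.ml n F" "as \<in> tuples A (m + Suc n)" "x \<in> carrier M"
    and "\<And>as y. as \<in> tuples A (Suc m) \<Longrightarrow> y \<in> carrier N \<Longrightarrow> G.dl G as y = \<zero>\<^bsub>P\<^esub>"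
  shows "H.dl (ycomp m G F) as x = (if even m then ycomp m G (F.dl F) as x
    else \<ominus>\<^bsub>P\<^esub> ycomp m G (F.dl F) as x)"
proof -
  obtain us vs where as: "as = us @ vs" "us \<in> tuples A (Suc m)" "vs \<in> tuples A n"
    using assms(3) tuples_append[of as A "Suc m" n] by auto
  have ne: "us \<noteq> []" using as(2) by (auto simp: tuples_def)
  then have eq: "as = butlast us @ (last us # vs)" using as(1) by simp
  have l: "last us \<in> carrier A" "butlast us \<in> tuples A m"
    using as ne last_in_set[of us]
    by (auto simp: tuples_def simp del: last.simps butlast.simps dest!: in_set_butlastD)
  have w: "G (butlast us) (F.dl F (last us # vs) x) \<in> carrier P"
    by (rule G.ml_closed[OF assms(1) l(2)], rule F.dl_closed[OF assms(2) _ assms(4)]) (use l as in auto)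
  have "ycomp m G (F.dl F) as x = G (butlast us) (F.dl F (last us # vs) x)"
    unfolding eq by (rule comp_append[OF l(2)])
  moreover have "G.dl G us (F vs x) = \<zero>\<^bsub>P\<^esub>"
    by (rule assms(5)[OF as(2)]) (rule F.ml_closed[OF assms(2) as(3) assms(4)])
  ultimately show ?thesis
    using dl_comp[OF assms(1,2) as(2,3) assms(4)] as(1) w by simp
qed

end

text \<open>
  Precomposition with a map \<open>p\<close> that need only be linear at the given point \<open>x\<close>, and there only
  up to elements that the cochain does not see.
\<close>

lemma inner_pre:
  assumes "as \<in> tuples A (Suc n)"
    "\<And>bs a. bs \<in> tuples A n \<Longrightarrow> a \<in> carrier A \<Longrightarrow> F bs (p (a \<odot>\<^bsub>M\<^esub> x)) = F bs (a \<odot>\<^bsub>M'\<^esub> p x)"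
  shows "inner A M N (\<lambda>as x. F as (p x)) as x = inner A M' N F as (p x)"
  using assms
proof (induction n arbitrary: F as)
  case 0
  then show ?case by (auto elim!: tuples_SucE)
next
  case (Suc n)
  from Suc.prems(1) obtain a b cs where as: "as = a # b # cs" "a \<in> carrier A" "b \<in> carrier A" "cs \<in> tuples A n"
    by (auto elim!: tuples_SucE)
  have "inner A M N (\<lambda>as x. F (a # as) (p x)) (b # cs) x = inner A M' N (\<lambda>as. F (a # as)) (b # cs) (p x)"
    by (rule Suc.IH) (use as Suc.prems(2) in auto)
  then show ?case by (simp add: as)
qed

lemma delta_pre:
  assumes "as \<in> tuples A (Suc n)"
    "\<And>bs a. bs \<in> tuples A n \<Longrightarrow> a \<in> carrier A \<Longrightarrow> F bs (p (a \<odot>\<^bsub>M\<^esub> x)) = F bs (a \<odot>\<^bsub>M'\<^esub> p x)"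
  shows "delta A M N (\<lambda>as x. F as (p x)) as x = delta A M' N F as (p x)"
  using inner_pre[where F = F and N = N and p = p, OF assms] by (simp add: delta_def)

lemma multilin_pre:
  assumes "multilin Z A M' N n F" "zlin Z M (smult M) M' (smult M') p"
  shows "multilin Z A M N n (\<lambda>as x. F as (p x))"
  using assms(1)
proof (induction n arbitrary: F)
  case 0
  then show ?case using assms(2) by (auto simp: zlin_def)
next
  case (Suc n)
  then show ?case using assms(2) by (auto simp: zlin_def)
qed

section \<open>Homogeneous components\<close>

definition supp :: "('r, 'm, 'y) graded_scheme \<Rightarrow> 'm \<Rightarrow> int set" where
  "supp M x = {i. homog_part M i x \<noteq> \<zero>\<^bsub>M\<^esub>}"

locale graded_group = abelian_group M for M :: "('r, 'm, 'y) graded_scheme" (structure) +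
  assumes internal: "internal_direct_sum M (hcomp M)"
begin

abbreviation "hp \<equiv> homog_part M"

lemma hcomp_subgroup: "additive_subgroup (hcomp M i) M"
  using internal by (simp add: internal_direct_sum_def)

lemma hcomp_closed: "x \<in> hcomp M i \<Longrightarrow> x \<in> carrier M"
  using additive_subgroup.a_subset[OF hcomp_subgroup] by auto

lemma hcomp_zero [simp]: "\<zero> \<in> hcomp M i"
  using additive_subgroup.zero_closed[OF hcomp_subgroup] .

lemma hcomp_add: "x \<in> hcomp M i \<Longrightarrow> y \<in> hcomp M i \<Longrightarrow> x \<oplus> y \<in> hcomp M i"
  using additive_subgroup.a_closed[OF hcomp_subgroup] .

lemma hcomp_uminus: "x \<in> hcomp M i \<Longrightarrow> \<ominus> x \<in> hcomp M i"
  using subgroup.m_inv_closed[OF additive_subgroup.a_subgroup[OF hcomp_subgroup]]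
  by (simp add: a_inv_def)

lemma decomposition:
  assumes "x \<in> carrier M"
  shows "is_decomposition M (hcomp M) x (\<lambda>i. hp i x)"
proof -
  have "\<exists>!c. is_decomposition M (hcomp M) x c"
    using internal assms by (simp add: internal_direct_sum_def)
  from theI'[OF this] show ?thesis by (simp add: homog_part_def[abs_def])
qed

lemma hp_in [simp]: "x \<in> carrier M \<Longrightarrow> hp i x \<in> hcomp M i"
  using decomposition by (auto simp: is_decomposition_def)

lemma hp_closed [simp]: "x \<in> carrier M \<Longrightarrow> hp i x \<in> carrier M"
  by (intro hcomp_closed[OF hp_in])

lemma supp_finite [simp]: "x \<in> carrier M \<Longrightarrow> finite (supp M x)"
  using decomposition by (auto simp: is_decomposition_def supp_def)

lemma finsum_superset:
  assumes "finite J" "I \<subseteq> J" "\<And>i. i \<in> J \<Longrightarrow> f i \<in> carrier M" "\<And>i. i \<in> J - I \<Longrightarrow> f i = \<zero>"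
  shows "(\<Oplus>i\<in>J. f i) = (\<Oplus>i\<in>I. f i)"
proof -
  have "(\<Oplus>i\<in>J. f i) = (\<Oplus>i\<in>I \<union> (J - I). f i)" using assms(2) by (simp add: Un_absorb1)
  also have "\<dots> = (\<Oplus>i\<in>I. f i) \<oplus> (\<Oplus>i\<in>J - I. f i)"
    by (rule finsum_Un_disjoint) (use assms in \<open>auto intro: finite_subset\<close>)
  also have "(\<Oplus>i\<in>J - I. f i) = (\<Oplus>i\<in>J - I. \<zero>)"
    by (rule finsum_cong') (use assms in auto)
  finally show ?thesis using assms by (auto simp: finsum_closed Pi_def subset_iff)
qed

lemma decomp:
  assumes "x \<in> carrier M" "finite I" "supp M x \<subseteq> I"
  shows "x = (\<Oplus>i\<in>I. hp i x)"
proof -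
  have "x = (\<Oplus>i\<in>supp M x. hp i x)"
    using decomposition[OF assms(1)] by (simp add: is_decomposition_def supp_def)
  also have "\<dots> = (\<Oplus>i\<in>I. hp i x)"
    by (rule finsum_superset[symmetric]) (use assms in \<open>auto simp: supp_def\<close>)
  finally show ?thesis .
qed

lemma hp_unique:
  assumes "finite I" "\<And>i. c i \<in> hcomp M i" "\<And>i. i \<notin> I \<Longrightarrow> c i = \<zero>" "x = (\<Oplus>i\<in>I. c i)"
  shows "hp i x = c i"
proof -
  have x: "x \<in> carrier M" using assms by (auto intro!: finsum_closed intro: hcomp_closed[of _ "_::int"])
  have "(\<Oplus>i\<in>I. c i) = (\<Oplus>i\<in>{i. c i \<noteq> \<zero>}. c i)"
    by (rule finsum_superset) (use assms in \<open>auto intro: hcomp_closed\<close>)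
  moreover have "finite {i. c i \<noteq> \<zero>}" by (rule finite_subset[OF _ assms(1)]) (use assms in auto)
  ultimately have "is_decomposition M (hcomp M) x c"
    using assms by (simp add: is_decomposition_def)
  moreover have "\<exists>!c. is_decomposition M (hcomp M) x c"
    using internal x by (simp add: internal_direct_sum_def)
  ultimately have "(THE c. is_decomposition M (hcomp M) x c) = c" by (rule the1_equality[rotated])
  then show ?thesis by (simp add: homog_part_def)
qed

lemma hp_homog: "x \<in> hcomp M j \<Longrightarrow> hp i x = (if i = j then x else \<zero>)"
  by (rule hp_unique[where I = "{j}"]) (auto simp: hcomp_closed)

lemma hp_zero [simp]: "hp i \<zero> = \<zero>"
  using hp_homog[OF hcomp_zero, of i i] by simp

lemma hp_add:
  assumes "x \<in> carrier M" "y \<in> carrier M"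
  shows "hp i (x \<oplus> y) = hp i x \<oplus> hp i y"
proof -
  let ?I = "supp M x \<union> supp M y"
  have "x \<oplus> y = (\<Oplus>i\<in>?I. hp i x) \<oplus> (\<Oplus>i\<in>?I. hp i y)"
    using decomp[of x ?I] decomp[of y ?I] assms by simp
  also have "\<dots> = (\<Oplus>i\<in>?I. hp i x \<oplus> hp i y)"
    by (rule finsum_addf[symmetric]) (use assms in auto)
  finally show ?thesis
    by (rule hp_unique[where I = ?I, rotated 3])
      (use assms in \<open>auto intro: hcomp_add simp del: supp_def\<close>, auto simp: supp_def)
qed

lemma hp_finsum:
  assumes "finite I" "\<And>j. j \<in> I \<Longrightarrow> f j \<in> carrier M"
  shows "hp i (\<Oplus>j\<in>I. f j) = (\<Oplus>j\<in>I. hp i (f j))"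
  by (rule additive_finsum[where h = "hp i"]) (use assms in \<open>auto simp: hp_add abelian_group_axioms\<close>)

lemma hp_ext:
  assumes "x \<in> carrier M" "y \<in> carrier M" "\<And>i. hp i x = hp i y"
  shows "x = y"
proof -
  have "supp M x = supp M y" using assms(3) by (simp add: supp_def)
  then show ?thesis
    using decomp[of x "supp M x"] decomp[of y "supp M y"] assms by simp
qed

end

text \<open>This is applied to multiplication by a homogeneous element, from either side, in an
  algebra or on a module.\<close>

lemma hp_graded_map:
  assumes "graded_group X" "graded_group Y"
    and h: "\<And>x y. x \<in> carrier X \<Longrightarrow> y \<in> carrier X \<Longrightarrow> h (x \<oplus>\<^bsub>X\<^esub> y) = h x \<oplus>\<^bsub>Y\<^esub> h y"
      "\<And>x. x \<in> carrier X \<Longrightarrow> h x \<in> carrier Y" "\<And>i x. x \<in> hcomp X i \<Longrightarrow> h x \<in> hcomp Y (i + d)"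
    and x: "x \<in> carrier X"
  shows "homog_part Y i (h x) = h (homog_part X (i - d) x)"
proof -
  interpret X: graded_group X by fact
  interpret Y: graded_group Y by fact
  have "h \<zero>\<^bsub>X\<^esub> = \<zero>\<^bsub>Y\<^esub>"
    by (rule additive_zero[OF X.abelian_group_axioms Y.abelian_group_axioms]) (use h in auto)
  have "h x = h (\<Oplus>\<^bsub>X\<^esub>i\<in>supp X x. X.hp i x)"
    using X.decomp[of x "supp X x"] x by simp
  also have "\<dots> = (\<Oplus>\<^bsub>Y\<^esub>i\<in>supp X x. h (X.hp i x))"
    by (rule additive_finsum[OF X.abelian_group_axioms Y.abelian_group_axioms]) (use h x in auto)
  also have "\<dots> = (\<Oplus>\<^bsub>Y\<^esub>i\<in>(\<lambda>i. i + d) ` supp X x. h (X.hp (i - d) x))"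
    by (subst Y.finsum_reindex) (use h x in \<open>auto simp: inj_on_def\<close>)
  finally show ?thesis
  proof (rule Y.hp_unique[rotated 3])
    fix i show "h (X.hp (i - d) x) \<in> hcomp Y i" using h(3)[of "X.hp (i - d) x" "i - d"] x by simp
  next
    fix i assume "i \<notin> (\<lambda>i. i + d) ` supp X x"
    then have "i - d \<notin> supp X x" by (metis diff_add_cancel image_eqI)
    then show "h (X.hp (i - d) x) = \<zero>\<^bsub>Y\<^esub>" by (simp add: supp_def \<open>h \<zero>\<^bsub>X\<^esub> = \<zero>\<^bsub>Y\<^esub>\<close>)
  qed (use x in simp)
qed

locale graded_ring = ring A + graded_group A for A :: "('k, 'a, 'x) graded_scheme" (structure) +
  assumes hcomp_mult: "\<And>i j a b. a \<in> hcomp A i \<Longrightarrow> b \<in> hcomp A j \<Longrightarrow> a \<otimes> b \<in> hcomp A (i + j)"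
    and hcomp_neg: "\<And>i. i < 0 \<Longrightarrow> hcomp A i = {\<zero>}"
begin

lemma hp_mult_left:
  assumes "a \<in> hcomp A d" "b \<in> carrier A" shows "hp i (a \<otimes> b) = a \<otimes> hp (i - d) b"
  by (rule hp_graded_map[where h = "\<lambda>b. a \<otimes> b", OF graded_group_axioms graded_group_axioms])
    (use assms hcomp_closed[OF assms(1)] hcomp_mult[of a d] in \<open>auto simp: r_distr add.commute\<close>)

lemma hp_mult_right:
  assumes "b \<in> hcomp A d" "a \<in> carrier A" shows "hp i (a \<otimes> b) = hp (i - d) a \<otimes> b"
  by (rule hp_graded_map[where h = "\<lambda>a. a \<otimes> b", OF graded_group_axioms graded_group_axioms])
    (use assms hcomp_closed[OF assms(1)] hcomp_mult[of _ _ b d] in \<open>auto simp: l_distr\<close>)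

text \<open>Let e be the degree 0 component of the unit. Comparing components, \<open>hp i a\<close>
  times e is the degree \<open>i\<close> component of \<open>hp i a\<close> times the unit, which is
  \<open>hp i a\<close>. So e is a right unit, and multiplying the unit by e shows that it equals
  e.\<close>

lemma one_hcomp: "\<one> \<in> hcomp A 0"
proof -
  have "a \<otimes> hp 0 \<one> = a" if a: "a \<in> carrier A" for a
  proof (rule hp_ext)
    fix i
    have "hp i (a \<otimes> hp 0 \<one>) = hp i a \<otimes> hp 0 \<one>"
      using hp_mult_right[of "hp 0 \<one>" 0 a i] a by simp
    also have "\<dots> = hp i (hp i a \<otimes> \<one>)"
      using hp_mult_left[of "hp i a" i \<one> i] a by simp
    also have "\<dots> = hp i a" using a hp_homog[of "hp i a" i i] by simp
    finally show "hp i (a \<otimes> hp 0 \<one>) = hp i a" .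
  qed (use a in auto)
  from this[of \<one>] have "hp 0 \<one> = \<one>" by simp
  then show ?thesis using hp_in[of \<one> 0] by simp
qed

lemma hp_neg [simp]: "a \<in> carrier A \<Longrightarrow> i < 0 \<Longrightarrow> hp i a = \<zero>"
  using hp_in[of a i] hcomp_neg[of i] by auto

end

locale graded_mod = A: graded_ring A + M: graded_group M + left_module A M
  for A :: "('k, 'a, 'x) graded_scheme" and M :: "('a, 'm, 'y) graded_scheme" +
  assumes hcomp_smult: "\<And>i j a x. a \<in> hcomp A i \<Longrightarrow> x \<in> hcomp M j \<Longrightarrow> a \<odot>\<^bsub>M\<^esub> x \<in> hcomp M (i + j)"
begin

lemma hp_smult_left:
  assumes "a \<in> hcomp A d" "x \<in> carrier M"
  shows "M.hp i (a \<odot>\<^bsub>M\<^esub> x) = a \<odot>\<^bsub>M\<^esub> M.hp (i - d) x"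
  by (rule hp_graded_map[where h = "\<lambda>x. a \<odot>\<^bsub>M\<^esub> x", OF M.graded_group_axioms M.graded_group_axioms])
    (use assms A.hcomp_closed[OF assms(1)] hcomp_smult[of a d] in \<open>auto simp: smult_closed smult_r_distr add.commute\<close>)

lemma hp_smult_right:
  assumes "x \<in> hcomp M e" "a \<in> carrier A"
  shows "M.hp i (a \<odot>\<^bsub>M\<^esub> x) = A.hp (i - e) a \<odot>\<^bsub>M\<^esub> x"
  by (rule hp_graded_map[where h = "\<lambda>a. a \<odot>\<^bsub>M\<^esub> x", OF A.graded_group_axioms M.graded_group_axioms])
    (use assms M.hcomp_closed[OF assms(1)] hcomp_smult[of _ _ x e] in \<open>auto simp: smult_closed smult_l_distr\<close>)

end

lemma graded_module_iff:
  assumes "graded_ring A"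
  shows "graded_module A M \<longleftrightarrow> graded_mod A M"
proof
  assume g: "graded_module A M"
  then interpret left_module A M by (simp add: graded_module_def)
  interpret A: graded_ring A by fact
  show "graded_mod A M"
    by unfold_locales (use g in \<open>auto simp: graded_module_def\<close>)
next
  assume "graded_mod A M"
  then interpret graded_mod A M .
  show "graded_module A M"
    unfolding graded_module_def using left_module_axioms M.internal hcomp_smult by auto
qed

section \<open>Homogeneous cochains\<close>

text \<open>\<open>hag A M n F G t\<close>: \<open>F\<close> and \<open>G\<close> agree on homogeneous arguments of total degree \<open>t\<close>.\<close>

primrec hag :: "('k, 'a, 'x) graded_scheme \<Rightarrow> ('a, 'm, 'y) graded_scheme \<Rightarrow> nat \<Rightarrow>
    ('a list \<Rightarrow> 'm \<Rightarrow> 'n) \<Rightarrow> ('a list \<Rightarrow> 'm \<Rightarrow> 'n) \<Rightarrow> int \<Rightarrow> bool" where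
  "hag A M 0 F G t \<longleftrightarrow> (\<forall>x\<in>hcomp M t. F [] x = G [] x)"
| "hag A M (Suc n) F G t \<longleftrightarrow>
     (\<forall>d. \<forall>a\<in>hcomp A d. hag A M n (\<lambda>as. F (a # as)) (\<lambda>as. G (a # as)) (t - d))"

text \<open>The target modules are concentrated in one degree, so a degree 0 morphism into the shift
  by \<open>j\<close> is just a cochain that vanishes on homogeneous arguments of total degree other
  than \<open>j\<close>; see \<open>gr_carrier\<close>.\<close>

definition homog :: "('k, 'a, 'x) graded_scheme \<Rightarrow> ('a, 'm, 'y) graded_scheme \<Rightarrow>
    ('a, 'n, 'z) graded_scheme \<Rightarrow> nat \<Rightarrow> ('a list \<Rightarrow> 'm \<Rightarrow> 'n) \<Rightarrow> int \<Rightarrow> bool" where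
  "homog A M N n F j \<longleftrightarrow> (\<forall>t. t \<noteq> j \<longrightarrow> hag A M n F (\<lambda>as x. \<zero>\<^bsub>N\<^esub>) t)"

text \<open>
  \<open>asm A M N F\<close> is the cochain which on homogeneous arguments of total degree \<open>t\<close> is \<open>F t\<close>.
\<close>

fun asm :: "('k, 'a, 'x) graded_scheme \<Rightarrow> ('a, 'm, 'y) graded_scheme \<Rightarrow> ('a, 'n, 'z) graded_scheme \<Rightarrow>
    (int \<Rightarrow> 'a list \<Rightarrow> 'm \<Rightarrow> 'n) \<Rightarrow> 'a list \<Rightarrow> 'm \<Rightarrow> 'n" where
  "asm A M N F [] x = (\<Oplus>\<^bsub>N\<^esub>e\<in>supp M x. F e [] (homog_part M e x))"
| "asm A M N F (a # as) x =
     (\<Oplus>\<^bsub>N\<^esub>d\<in>supp A a. asm A M N (\<lambda>t bs. F (t + d) (homog_part A d a # bs)) as x)"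

lemma hag_refl [simp]: "hag A M n F F t"
  by (induction n arbitrary: F t) auto

lemma hag_sym: "hag A M n F G t \<Longrightarrow> hag A M n G F t"
  by (induction n arbitrary: F G t) auto

lemma hag_trans: "hag A M n F G t \<Longrightarrow> hag A M n G H t \<Longrightarrow> hag A M n F H t"
  by (induction n arbitrary: F G H t) (auto, blast)

lemma hag_map2: "hag A M n F F' t \<Longrightarrow> hag A M n G G' t \<Longrightarrow>
    hag A M n (\<lambda>as x. f (F as x) (G as x)) (\<lambda>as x. f (F' as x) (G' as x)) t"
  by (induction n arbitrary: F G F' G' t) auto

lemma hag_map: "hag A M n F F' t \<Longrightarrow> hag A M n (\<lambda>as x. f (F as x)) (\<lambda>as x. f (F' as x)) t"
  by (induction n arbitrary: F F' t) auto

lemma hag_pre: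
  assumes "hag A M' n F G (t + c)" "\<And>e x. x \<in> hcomp M e \<Longrightarrow> p x \<in> hcomp M' (e + c)"
  shows "hag A M n (\<lambda>as x. F as (p x)) (\<lambda>as x. G as (p x)) t"
  using assms(1)
proof (induction n arbitrary: F G t)
  case 0
  then show ?case using assms(2) by simp
next
  case (Suc n)
  have "hag A M n (\<lambda>as x. F (a # as) (p x)) (\<lambda>as x. G (a # as) (p x)) (t - d)" if "a \<in> hcomp A d" for a d
    by (rule Suc.IH) (use Suc.prems that in \<open>auto simp: algebra_simps\<close>)
  then show ?case by simp
qed

lemma homog_pre:
  assumes "homog A M' N n F j" "\<And>e x. x \<in> hcomp M e \<Longrightarrow> p x \<in> hcomp M' (e + c)"
  shows "homog A M N n (\<lambda>as x. F as (p x)) (j - c)"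
  unfolding homog_def
proof (intro allI impI)
  fix t assume "t \<noteq> j - c"
  then have "hag A M' n F (\<lambda>as x. \<zero>\<^bsub>N\<^esub>) (t + c)" using assms(1) by (simp add: homog_def)
  from hag_pre[OF this assms(2)] show "hag A M n (\<lambda>as x. F as (p x)) (\<lambda>as x. \<zero>\<^bsub>N\<^esub>) t" .
qed

text \<open>Elements of nonzero degree act as zero on \<open>N\<close>, as they do on the degree 0
  part of \<open>A\<close>. This makes the outer term of the differential compatible with total
  degrees.\<close>

locale gbar = bar A M N Z + A: graded_ring A + M: graded_mod A M
  for A :: "('k, 'a, 'x) graded_scheme" and M :: "('a, 'm, 'y) graded_scheme"
    and N :: "('a, 'n, 'z) graded_scheme" and Z :: "'a set" +
  assumes Z_0: "Z \<subseteq> hcomp A 0"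
    and N_trivial: "\<And>d a y. d \<noteq> 0 \<Longrightarrow> a \<in> hcomp A d \<Longrightarrow> y \<in> carrier N \<Longrightarrow> a \<odot>\<^bsub>N\<^esub> y = \<zero>\<^bsub>N\<^esub>"
begin

abbreviation "hg \<equiv> hag A M"
abbreviation "hmg \<equiv> homog A M N"
abbreviation "asmb \<equiv> asm A M N"

lemma hag_cong:
  assumes "hg n F G t" "\<And>as x. as \<in> tuples A n \<Longrightarrow> x \<in> carrier M \<Longrightarrow> F' as x = F as x"
    "\<And>as x. as \<in> tuples A n \<Longrightarrow> x \<in> carrier M \<Longrightarrow> G' as x = G as x"
  shows "hg n F' G' t"
  using assms
proof (induction n arbitrary: F G F' G' t)
  case 0
  then show ?case by (auto simp: M.M.hcomp_closed)
next
  case (Suc n)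
  have "hg n (\<lambda>as. F' (a # as)) (\<lambda>as. G' (a # as)) (t - d)" if "a \<in> hcomp A d" for a d
    by (rule Suc.IH[of "\<lambda>as. F (a # as)" "\<lambda>as. G (a # as)"])
      (use Suc.prems that A.hcomp_closed[OF that] in auto)
  then show ?case by simp
qed

lemma zlin_decomp_A:
  assumes "zlin Z A (mult A) N (smult N) h" "a \<in> carrier A"
  shows "h a = (\<Oplus>\<^bsub>N\<^esub>d\<in>supp A a. h (A.hp d a))"
proof -
  have "h a = h (\<Oplus>\<^bsub>A\<^esub>d\<in>supp A a. A.hp d a)" using A.decomp[of a "supp A a"] assms by simp
  also have "\<dots> = (\<Oplus>\<^bsub>N\<^esub>d\<in>supp A a. h (A.hp d a))"
    by (rule additive_finsum[OF A.is_abelian_group N.abelian_group_axioms])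
      (use assms in \<open>auto simp: zlin_def\<close>)
  finally show ?thesis .
qed

lemma zlin_decomp_M:
  assumes "zlin Z M (smult M) N (smult N) h" "a \<in> carrier M"
  shows "h a = (\<Oplus>\<^bsub>N\<^esub>d\<in>supp M a. h (M.M.hp d a))"
proof -
  have "h a = h (\<Oplus>\<^bsub>M\<^esub>d\<in>supp M a. M.M.hp d a)" using M.M.decomp[of a "supp M a"] assms by simp
  also have "\<dots> = (\<Oplus>\<^bsub>N\<^esub>d\<in>supp M a. h (M.M.hp d a))"
    by (rule additive_finsum[OF M.M.abelian_group_axioms N.abelian_group_axioms])
      (use assms in \<open>auto simp: zlin_def\<close>)
  finally show ?thesis .
qed

lemma hag_ext:
  assumes "ml n F" "ml n G" "\<And>t. hg n F G t" "as \<in> tuples A n" "x \<in> carrier M"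
  shows "F as x = G as x"
  using assms(1-4)
proof (induction n arbitrary: F G as)
  case 0
  have "F [] (M.M.hp d x) = G [] (M.M.hp d x)" for d
    using 0(3)[of d] assms(5) by simp
  then show ?case
    using 0 zlin_decomp_M[of "F []" x] zlin_decomp_M[of "G []" x] assms(5) by simp
next
  case (Suc n)
  obtain b bs where as: "as = b # bs" "b \<in> carrier A" "bs \<in> tuples A n"
    using Suc.prems(4) by (rule tuples_SucE)
  have z: "zlin Z A (mult A) N (smult N) (\<lambda>a. F (a # bs) x)" "zlin Z A (mult A) N (smult N) (\<lambda>a. G (a # bs) x)"
    using Suc.prems as assms(5) by auto
  have "F (A.hp d b # bs) x = G (A.hp d b # bs) x" for d
  proof (rule Suc.IH[of "\<lambda>as. F (A.hp d b # as)" "\<lambda>as. G (A.hp d b # as)"])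
    fix t show "hg n (\<lambda>as. F (A.hp d b # as)) (\<lambda>as. G (A.hp d b # as)) t"
      using Suc.prems(3)[of "t + d"] as by (auto dest!: spec[of _ d] bspec[of _ _ "A.hp d b"])
  qed (use Suc.prems as in auto)
  then show ?case
    using zlin_decomp_A[OF z(1) as(2)] zlin_decomp_A[OF z(2) as(2)] as by simp
qed

lemma inn_hag:
  assumes "hg n F G t" shows "hg (Suc n) (inn F) (inn G) t"
  using assms
proof (induction n arbitrary: F G t)
  case 0
  show ?case
  proof (simp, intro allI ballI)
    fix d a x assume "a \<in> hcomp A d" "x \<in> hcomp M (t - d)"
    then have "a \<odot>\<^bsub>M\<^esub> x \<in> hcomp M t" using M.hcomp_smult[of a d x "t - d"] by simp
    then show "F [] (a \<odot>\<^bsub>M\<^esub> x) = G [] (a \<odot>\<^bsub>M\<^esub> x)" using 0 by simp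
  qed
next
  case (Suc n)
  have e: "(\<lambda>cs. inn H (a # b # cs)) =
      (\<lambda>cs x. H ((a \<otimes>\<^bsub>A\<^esub> b) # cs) x \<ominus>\<^bsub>N\<^esub> inn (\<lambda>as. H (a # as)) (b # cs) x)" for H a b
    by (intro ext) simp
  have "hg n (\<lambda>cs. inn F (a # b # cs)) (\<lambda>cs. inn G (a # b # cs)) (t - d - d')"
    if ab: "a \<in> hcomp A d" "b \<in> hcomp A d'" for a b d d'
  proof -
    have "hg n (\<lambda>as. F ((a \<otimes>\<^bsub>A\<^esub> b) # as)) (\<lambda>as. G ((a \<otimes>\<^bsub>A\<^esub> b) # as)) (t - d - d')"
      using Suc.prems A.hcomp_mult[OF ab] by (auto simp: algebra_simps)
    moreover have "hg (Suc n) (inn (\<lambda>as. F (a # as))) (inn (\<lambda>as. G (a # as))) (t - d)"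
      by (rule Suc.IH) (use Suc.prems ab in auto)
    then have "hg n (\<lambda>cs. inn (\<lambda>as. F (a # as)) (b # cs)) (\<lambda>cs. inn (\<lambda>as. G (a # as)) (b # cs)) (t - d - d')"
      using ab by auto
    ultimately show ?thesis unfolding e by (rule hag_map2[where f = "\<lambda>x y. x \<ominus>\<^bsub>N\<^esub> y"])
  qed
  then show ?case by simp
qed

text \<open>The terms of \<open>inner\<close> keep the total degree of the arguments. The outer term
  loses the degree of its first argument \<open>a\<close>, but by \<open>N_trivial\<close> it
  vanishes unless that degree is 0.\<close>

lemma dl_hag:
  assumes "ml n F" "ml n G" "hg n F G t" shows "hg (Suc n) (dl F) (dl G) t"
proof -
  have "hg n (\<lambda>as x. a \<odot>\<^bsub>N\<^esub> F as x) (\<lambda>as x. a \<odot>\<^bsub>N\<^esub> G as x) (t - d)" if a: "a \<in> hcomp A d" for a d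
  proof (cases "d = 0")
    case True
    then show ?thesis using hag_map[OF assms(3), of "\<lambda>y. a \<odot>\<^bsub>N\<^esub> y"] by simp
  next
    case False
    show ?thesis
      by (rule hag_cong[OF hag_refl[of _ _ _ "\<lambda>as x. \<zero>\<^bsub>N\<^esub>"]])
        (use N_trivial[OF False a] ml_closed assms(1,2) in auto)
  qed
  moreover have "hg n (\<lambda>as. inn F (a # as)) (\<lambda>as. inn G (a # as)) (t - d)" if a: "a \<in> hcomp A d" for a d
    using inn_hag[OF assms(3)] a by auto
  ultimately have "hg n (\<lambda>as x. a \<odot>\<^bsub>N\<^esub> F as x \<ominus>\<^bsub>N\<^esub> inn F (a # as) x)
      (\<lambda>as x. a \<odot>\<^bsub>N\<^esub> G as x \<ominus>\<^bsub>N\<^esub> inn G (a # as) x) (t - d)" if a: "a \<in> hcomp A d" for a d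
    using a by (intro hag_map2[where f = "\<lambda>x y. x \<ominus>\<^bsub>N\<^esub> y"]) auto
  moreover have "(\<lambda>as. dl H (a # as)) = (\<lambda>as x. a \<odot>\<^bsub>N\<^esub> H as x \<ominus>\<^bsub>N\<^esub> inn H (a # as) x)" for H a
    by (intro ext) (simp add: dl_Cons)
  ultimately show ?thesis by simp
qed

lemma dl_homog: "ml n F \<Longrightarrow> hmg n F j \<Longrightarrow> hmg (Suc n) (dl F) j"
  unfolding homog_def
  by (auto intro: hag_cong[OF dl_hag[OF _ ml_zero]] simp: dl_zero simp del: hag.simps)

lemma homog_minus: "hmg n F j \<Longrightarrow> hmg n G j \<Longrightarrow> hmg n (\<lambda>as x. F as x \<ominus>\<^bsub>N\<^esub> G as x) j"
  unfolding homog_def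
proof (intro allI impI)
  fix t assume "\<forall>t. t \<noteq> j \<longrightarrow> hg n F (\<lambda>as x. \<zero>\<^bsub>N\<^esub>) t" "\<forall>t. t \<noteq> j \<longrightarrow> hg n G (\<lambda>as x. \<zero>\<^bsub>N\<^esub>) t" "t \<noteq> j"
  then have "hg n F (\<lambda>as x. \<zero>\<^bsub>N\<^esub>) t" "hg n G (\<lambda>as x. \<zero>\<^bsub>N\<^esub>) t" by auto
  from hag_map2[OF this, of "\<lambda>x y. x \<ominus>\<^bsub>N\<^esub> y"]
  show "hg n (\<lambda>as x. F as x \<ominus>\<^bsub>N\<^esub> G as x) (\<lambda>as x. \<zero>\<^bsub>N\<^esub>) t" by (simp add: N.minus_eq N.r_neg)
qed

lemma hag_finsum:
  assumes "finite I" "\<And>i. i \<in> I \<Longrightarrow> ml n (F i)" "\<And>i. i \<in> I \<Longrightarrow> ml n (G i)"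
    "\<And>i. i \<in> I \<Longrightarrow> hg n (F i) (G i) t"
  shows "hg n (\<lambda>as x. \<Oplus>\<^bsub>N\<^esub>i\<in>I. F i as x) (\<lambda>as x. \<Oplus>\<^bsub>N\<^esub>i\<in>I. G i as x) t"
  using assms
proof (induction I rule: finite_induct)
  case empty
  then show ?case by simp
next
  case (insert i I)
  then have "hg n (F i) (G i) t" "hg n (\<lambda>as x. \<Oplus>\<^bsub>N\<^esub>i\<in>I. F i as x) (\<lambda>as x. \<Oplus>\<^bsub>N\<^esub>i\<in>I. G i as x) t"
    by auto
  from hag_map2[OF this, of "\<lambda>x y. x \<oplus>\<^bsub>N\<^esub> y"] show ?case
    by (rule hag_cong) (use insert in \<open>auto intro!: N.finsum_insert dest!: ml_closed\<close>)
qed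

lemma homog_finsum:
  assumes "finite I" "\<And>i. i \<in> I \<Longrightarrow> ml n (F i)" "\<And>i. i \<in> I \<Longrightarrow> hmg n (F i) j"
  shows "hmg n (\<lambda>as x. \<Oplus>\<^bsub>N\<^esub>i\<in>I. F i as x) j"
  unfolding homog_def
proof (intro allI impI)
  fix t assume "t \<noteq> j"
  then have "hg n (F i) (\<lambda>as x. \<zero>\<^bsub>N\<^esub>) t" if "i \<in> I" for i using assms(3)[OF that] by (simp add: homog_def)
  from hag_finsum[OF assms(1,2) ml_zero this]
  show "hg n (\<lambda>as x. \<Oplus>\<^bsub>N\<^esub>i\<in>I. F i as x) (\<lambda>as x. \<zero>\<^bsub>N\<^esub>) t" by simp
qed

text \<open>The range of summation depends on \<open>x\<close>. Since \<open>h d\<close> vanishes at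
  zero, it may be enlarged to a finite set common to all elements involved. The abstract
  \<open>X\<close> and \<open>s\<close> let the lemma serve both the arguments in \<open>A\<close>
  and the one in \<open>M\<close>.\<close>

lemma zlin_asm_aux:
  assumes X: "graded_group X"
    and s: "\<And>z i x. z \<in> Z \<Longrightarrow> x \<in> hcomp X i \<Longrightarrow> s z x \<in> hcomp X i"
      "\<And>z x. z \<in> Z \<Longrightarrow> x \<in> carrier X \<Longrightarrow> s z x \<in> carrier X"
      "\<And>z x y. z \<in> Z \<Longrightarrow> x \<in> carrier X \<Longrightarrow> y \<in> carrier X \<Longrightarrow> s z (x \<oplus>\<^bsub>X\<^esub> y) = s z x \<oplus>\<^bsub>X\<^esub> s z y"
    and h: "\<And>d. zlin Z X s N (smult N) (h d)"
  shows "zlin Z X s N (smult N) (\<lambda>x. \<Oplus>\<^bsub>N\<^esub>d\<in>supp X x. h d (homog_part X d x))"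
proof -
  interpret X: graded_group X by fact
  have h0: "h d \<zero>\<^bsub>X\<^esub> = \<zero>\<^bsub>N\<^esub>" for d
    using zlin_zero[OF X.abelian_group_axioms N.abelian_group_axioms h] .
  have hc: "h d x \<in> carrier N" if "x \<in> carrier X" for d x using h that by (auto simp: zlin_def)
  have sup: "(\<Oplus>\<^bsub>N\<^esub>d\<in>supp X x. h d (X.hp d x)) = (\<Oplus>\<^bsub>N\<^esub>d\<in>J. h d (X.hp d x))"
    if x: "x \<in> carrier X" "finite J" "supp X x \<subseteq> J" for x J
  proof -
    have "(\<Oplus>\<^bsub>N\<^esub>d\<in>J. h d (X.hp d x)) = (\<Oplus>\<^bsub>N\<^esub>d\<in>supp X x \<union> (J - supp X x). h d (X.hp d x))"
      using x by (simp add: Un_absorb1)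
    also have "\<dots> = (\<Oplus>\<^bsub>N\<^esub>d\<in>supp X x. h d (X.hp d x)) \<oplus>\<^bsub>N\<^esub> (\<Oplus>\<^bsub>N\<^esub>d\<in>J - supp X x. h d (X.hp d x))"
      by (rule N.finsum_Un_disjoint) (use x in \<open>auto intro!: hc\<close>)
    also have "(\<Oplus>\<^bsub>N\<^esub>d\<in>J - supp X x. h d (X.hp d x)) = (\<Oplus>\<^bsub>N\<^esub>d\<in>J - supp X x. \<zero>\<^bsub>N\<^esub>)"
      by (rule N.finsum_cong') (use h0 in \<open>auto simp: supp_def\<close>)
    finally show ?thesis using x by (simp add: hc Pi_def N.finsum_closed)
  qed
  show ?thesis
    unfolding zlin_def
  proof (intro conjI ballI)
    fix x assume "x \<in> carrier X"
    then show "(\<Oplus>\<^bsub>N\<^esub>d\<in>supp X x. h d (X.hp d x)) \<in> carrier N" by (auto intro!: N.finsum_closed hc)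
  next
    fix x y assume x: "x \<in> carrier X" "y \<in> carrier X"
    let ?J = "supp X x \<union> supp X y"
    have sub: "supp X (x \<oplus>\<^bsub>X\<^esub> y) \<subseteq> ?J" using x by (auto simp: supp_def X.hp_add)
    have "(\<Oplus>\<^bsub>N\<^esub>d\<in>supp X (x \<oplus>\<^bsub>X\<^esub> y). h d (X.hp d (x \<oplus>\<^bsub>X\<^esub> y))) = (\<Oplus>\<^bsub>N\<^esub>d\<in>?J. h d (X.hp d (x \<oplus>\<^bsub>X\<^esub> y)))"
      by (rule sup) (use x sub in auto)
    also have "\<dots> = (\<Oplus>\<^bsub>N\<^esub>d\<in>?J. h d (X.hp d x) \<oplus>\<^bsub>N\<^esub> h d (X.hp d y))"
      by (rule N.finsum_cong') (use x h in \<open>auto simp: X.hp_add zlin_def\<close>)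
    also have "\<dots> = (\<Oplus>\<^bsub>N\<^esub>d\<in>?J. h d (X.hp d x)) \<oplus>\<^bsub>N\<^esub> (\<Oplus>\<^bsub>N\<^esub>d\<in>?J. h d (X.hp d y))"
      by (rule N.finsum_addf) (use x in \<open>auto intro!: hc\<close>)
    finally show "(\<Oplus>\<^bsub>N\<^esub>d\<in>supp X (x \<oplus>\<^bsub>X\<^esub> y). h d (X.hp d (x \<oplus>\<^bsub>X\<^esub> y))) =
        (\<Oplus>\<^bsub>N\<^esub>d\<in>supp X x. h d (X.hp d x)) \<oplus>\<^bsub>N\<^esub> (\<Oplus>\<^bsub>N\<^esub>d\<in>supp X y. h d (X.hp d y))"
      using sup[of x ?J] sup[of y ?J] x by simp
  next
    fix z x assume z: "z \<in> Z" and x: "x \<in> carrier X"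
    have hps: "X.hp d (s z x) = s z (X.hp d x)" for d
      using hp_graded_map[OF X X, of "s z" 0 x d] s z x by auto
    have "s z \<zero>\<^bsub>X\<^esub> = \<zero>\<^bsub>X\<^esub>"
      by (rule additive_zero[OF X.abelian_group_axioms X.abelian_group_axioms]) (use s z in auto)
    then have sub: "supp X (s z x) \<subseteq> supp X x" by (auto simp: supp_def hps)
    have "(\<Oplus>\<^bsub>N\<^esub>d\<in>supp X (s z x). h d (X.hp d (s z x))) = (\<Oplus>\<^bsub>N\<^esub>d\<in>supp X x. h d (X.hp d (s z x)))"
      by (rule sup) (use x sub s z in auto)
    also have "\<dots> = (\<Oplus>\<^bsub>N\<^esub>d\<in>supp X x. z \<odot>\<^bsub>N\<^esub> h d (X.hp d x))"
      by (rule N.finsum_cong') (use x z h in \<open>auto simp: hps zlin_def\<close>)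
    also have "\<dots> = z \<odot>\<^bsub>N\<^esub> (\<Oplus>\<^bsub>N\<^esub>d\<in>supp X x. h d (X.hp d x))"
      by (rule N.smult_r_finsum[symmetric]) (use x z in \<open>auto intro!: hc\<close>)
    finally show "(\<Oplus>\<^bsub>N\<^esub>d\<in>supp X (s z x). h d (X.hp d (s z x))) = z \<odot>\<^bsub>N\<^esub> (\<Oplus>\<^bsub>N\<^esub>d\<in>supp X x. h d (X.hp d x))" .
  qed
qed

lemma Z_mult_hcomp: "z \<in> Z \<Longrightarrow> x \<in> hcomp A i \<Longrightarrow> z \<otimes>\<^bsub>A\<^esub> x \<in> hcomp A i"
  using Z_0 A.hcomp_mult[of z 0 x i] by auto

lemma Z_smult_hcomp: "z \<in> Z \<Longrightarrow> x \<in> hcomp M i \<Longrightarrow> z \<odot>\<^bsub>M\<^esub> x \<in> hcomp M i"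
  using Z_0 M.hcomp_smult[of z 0 x i] by auto

text \<open>The three claims share one induction, because splitting the sums over the support
  requires closedness of the inner values.\<close>

lemma asm_closed_add_smult:
  assumes "\<And>t. ml n (F t)" "\<And>t. ml n (G t)" "as \<in> tuples A n" "x \<in> carrier M" "z \<in> carrier A"
  shows "asmb F as x \<in> carrier N \<and>
    asmb (\<lambda>t as x. F t as x \<oplus>\<^bsub>N\<^esub> G t as x) as x = asmb F as x \<oplus>\<^bsub>N\<^esub> asmb G as x \<and>
    asmb (\<lambda>t as x. z \<odot>\<^bsub>N\<^esub> F t as x) as x = z \<odot>\<^bsub>N\<^esub> asmb F as x"
  using assms(1-3)
proof (induction n arbitrary: F G as)
  case 0
  have "F e [] (M.M.hp e x) \<in> carrier N" "G e [] (M.M.hp e x) \<in> carrier N" for e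
    using 0 assms(4) by (auto simp: zlin_def)
  then show ?case using 0 assms(4,5)
    by (simp add: N.finsum_closed Pi_def N.finsum_addf N.smult_r_finsum)
next
  case (Suc n)
  obtain b bs where as: "as = b # bs" "b \<in> carrier A" "bs \<in> tuples A n"
    using Suc.prems(3) by (rule tuples_SucE)
  let ?F = "\<lambda>d t bs. F (t + d) (A.hp d b # bs)" and ?G = "\<lambda>d t bs. G (t + d) (A.hp d b # bs)"
  have ml: "ml n (?F d t)" "ml n (?G d t)" for d t using Suc.prems as by auto
  note IH = Suc.IH[of "?F _" "?G _" bs, OF ml as(3)] Suc.IH[of "?G _" "?F _" bs, OF ml(2,1) as(3)]
  have cl: "asmb (?F d) bs x \<in> carrier N" "asmb (?G d) bs x \<in> carrier N" for d
    using IH by auto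
  show ?case using cl IH as(2) assms(5)
    by (simp add: as(1) N.finsum_closed Pi_def N.finsum_addf N.smult_r_finsum)
qed

lemma asm_closed: "(\<And>t. ml n (F t)) \<Longrightarrow> as \<in> tuples A n \<Longrightarrow> x \<in> carrier M \<Longrightarrow> asmb F as x \<in> carrier N"
  using asm_closed_add_smult[of n F F as x "\<zero>\<^bsub>A\<^esub>"] by simp

lemma asm_cong:
  assumes "as \<in> tuples A n" "x \<in> carrier M" "\<And>t. ml n (F t)"
    "\<And>t as x. as \<in> tuples A n \<Longrightarrow> x \<in> carrier M \<Longrightarrow> G t as x = F t as x"
  shows "asmb G as x = asmb F as x"
  using assms(1,3,4)
proof (induction n arbitrary: F G as)
  case 0
  have "F e [] (M.M.hp e x) \<in> carrier N" for e
    using 0 assms(2) by (auto simp: zlin_def)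
  then show ?case using 0 assms(2) by simp
next
  case (Suc n)
  obtain b bs where as: "as = b # bs" "b \<in> carrier A" "bs \<in> tuples A n"
    using Suc.prems(1) by (rule tuples_SucE)
  have "asmb (\<lambda>t bs. G (t + d) (A.hp d b # bs)) bs x = asmb (\<lambda>t bs. F (t + d) (A.hp d b # bs)) bs x" for d
    by (rule Suc.IH) (use Suc.prems as in auto)
  then show ?case by (simp add: as(1))
qed

lemma asm_ml: "(\<And>t. ml n (F t)) \<Longrightarrow> ml n (asmb F)"
proof (induction n arbitrary: F)
  case 0
  have "zlin Z M (smult M) N (smult N) (\<lambda>x. \<Oplus>\<^bsub>N\<^esub>e\<in>supp M x. F e [] (M.M.hp e x))"
    by (rule zlin_asm_aux[OF M.M.graded_group_axioms])
      (use 0 in \<open>auto simp: Z_smult_hcomp M.smult_r_distr\<close>)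
  moreover have "asmb F [] = (\<lambda>x. \<Oplus>\<^bsub>N\<^esub>e\<in>supp M x. F e [] (M.M.hp e x))"
    by (intro ext) simp
  ultimately show ?case by simp
next
  case (Suc n)
  have sh: "ml n (\<lambda>bs. F (t + d) (a # bs))" if "a \<in> carrier A" for t d a
    using Suc.prems that by auto
  have "ml n (\<lambda>as. asmb F (a # as))" if a: "a \<in> carrier A" for a
  proof -
    have "ml n (\<lambda>as x. \<Oplus>\<^bsub>N\<^esub>d\<in>supp A a. asmb (\<lambda>t bs. F (t + d) (A.hp d a # bs)) as x)"
      by (rule ml_finsum) (use a in \<open>auto intro!: Suc.IH sh\<close>)
    then show ?thesis by (rule ml_cong) simp
  qed
  moreover have "zlin Z A (mult A) N (smult N) (\<lambda>a. asmb F (a # as) x)"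
    if as: "as \<in> tuples A n" "x \<in> carrier M" for as x
  proof -
    have "zlin Z A (mult A) N (smult N) (\<lambda>a. asmb (\<lambda>t bs. F (t + d) (a # bs)) as x)" for d
      unfolding zlin_def
    proof (intro conjI ballI)
      fix a assume "a \<in> carrier A"
      then show "asmb (\<lambda>t bs. F (t + d) (a # bs)) as x \<in> carrier N"
        by (intro asm_closed[OF sh] as)
    next
      fix a b assume ab: "a \<in> carrier A" "b \<in> carrier A"
      have "asmb (\<lambda>t bs. F (t + d) ((a \<oplus>\<^bsub>A\<^esub> b) # bs)) as x =
          asmb (\<lambda>t bs x. F (t + d) (a # bs) x \<oplus>\<^bsub>N\<^esub> F (t + d) (b # bs) x) as x"
      proof (rule asm_cong[OF as])
        fix t as x assume "as \<in> tuples A n" "x \<in> carrier M"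
        then show "F (t + d) ((a \<oplus>\<^bsub>A\<^esub> b) # as) x = F (t + d) (a # as) x \<oplus>\<^bsub>N\<^esub> F (t + d) (b # as) x"
          using Suc.prems[of "t + d"] ab by (auto simp: zlin_def)
      qed (intro ml_add sh ab)
      also have "\<dots> = asmb (\<lambda>t bs. F (t + d) (a # bs)) as x \<oplus>\<^bsub>N\<^esub> asmb (\<lambda>t bs. F (t + d) (b # bs)) as x"
        using asm_closed_add_smult[of n "\<lambda>t bs. F (t + d) (a # bs)" "\<lambda>t bs. F (t + d) (b # bs)",
            OF sh[OF ab(1)] sh[OF ab(2)] as A.zero_closed] by blast
      finally show "asmb (\<lambda>t bs. F (t + d) ((a \<oplus>\<^bsub>A\<^esub> b) # bs)) as x =
        asmb (\<lambda>t bs. F (t + d) (a # bs)) as x \<oplus>\<^bsub>N\<^esub> asmb (\<lambda>t bs. F (t + d) (b # bs)) as x" .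
    next
      fix z a assume za: "z \<in> Z" "a \<in> carrier A"
      then have z: "z \<in> carrier A" by simp
      have "asmb (\<lambda>t bs. F (t + d) ((z \<otimes>\<^bsub>A\<^esub> a) # bs)) as x =
          asmb (\<lambda>t bs x. z \<odot>\<^bsub>N\<^esub> F (t + d) (a # bs) x) as x"
      proof (rule asm_cong[OF as])
        fix t as x assume "as \<in> tuples A n" "x \<in> carrier M"
        then show "F (t + d) ((z \<otimes>\<^bsub>A\<^esub> a) # as) x = z \<odot>\<^bsub>N\<^esub> F (t + d) (a # as) x"
          using Suc.prems[of "t + d"] za by (auto simp: zlin_def)
      qed (intro ml_smult sh za z)
      also have "\<dots> = z \<odot>\<^bsub>N\<^esub> asmb (\<lambda>t bs. F (t + d) (a # bs)) as x"
        using asm_closed_add_smult[of n "\<lambda>t bs. F (t + d) (a # bs)" "\<lambda>t bs. F (t + d) (a # bs)",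
            OF sh[OF za(2)] sh[OF za(2)] as z] by blast
      finally show "asmb (\<lambda>t bs. F (t + d) ((z \<otimes>\<^bsub>A\<^esub> a) # bs)) as x =
        z \<odot>\<^bsub>N\<^esub> asmb (\<lambda>t bs. F (t + d) (a # bs)) as x" .
    qed
    from zlin_asm_aux[where s = "mult A", OF A.graded_group_axioms _ _ _ this]
    show ?thesis by (simp add: Z_mult_hcomp A.r_distr)
  qed
  ultimately show ?case by simp
qed

lemma supp_homog_A: "a \<in> hcomp A d \<Longrightarrow> supp A a = (if a = \<zero>\<^bsub>A\<^esub> then {} else {d})"
  by (auto simp: supp_def A.hp_homog)

lemma supp_homog_M: "x \<in> hcomp M d \<Longrightarrow> supp M x = (if x = \<zero>\<^bsub>M\<^esub> then {} else {d})"
  by (auto simp: supp_def M.M.hp_homog)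

lemma asm_hag: "(\<And>t. ml n (F t)) \<Longrightarrow> hg n (asmb F) (F t) t"
proof (induction n arbitrary: F t)
  case 0
  have z: "zlin Z M (smult M) N (smult N) (F t [])" using 0 by simp
  have "(\<Oplus>\<^bsub>N\<^esub>e\<in>supp M x. F e [] (M.M.hp e x)) = F t [] x" if x: "x \<in> hcomp M t" for x
    using zlin_zero[OF M.M.abelian_group_axioms N.abelian_group_axioms z] zlinD(1)[OF z] M.M.hcomp_closed[OF x]
    by (auto simp: supp_homog_M[OF x] M.M.hp_homog[OF x] N.finsum_insert)
  then show ?case by simp
next
  case (Suc n)
  have "hg n (\<lambda>as. asmb F (a # as)) (\<lambda>as. F t (a # as)) (t - d)" if a: "a \<in> hcomp A d" for a d
  \<comment> \<open>Zero belongs to every homogeneous component but has empty support, so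
    \<open>asm\<close> is an empty sum there.\<close>
  proof (cases "a = \<zero>\<^bsub>A\<^esub>")
    case True
    have "F t (a # as) x = \<zero>\<^bsub>N\<^esub>" if "as \<in> tuples A n" "x \<in> carrier M" for as x
      unfolding True
      by (rule zlin_zero[OF A.is_abelian_group N.abelian_group_axioms, of Z "mult A" "smult N"])
        (use Suc.prems that in auto)
    then show ?thesis
      by (intro hag_cong[OF hag_refl[of _ _ _ "\<lambda>as x. \<zero>\<^bsub>N\<^esub>"]]) (auto simp: True supp_def)
  next
    case False
    have a': "a \<in> carrier A" using a by (rule A.hcomp_closed)
    have ml: "ml n (\<lambda>bs. F (t + d) (a # bs))" for t using Suc.prems a' by auto
    have "asmb F (a # as) x = asmb (\<lambda>t bs. F (t + d) (a # bs)) as x"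
      if "as \<in> tuples A n" "x \<in> carrier M" for as x
      using False asm_closed[OF ml that]
      by (simp add: supp_homog_A[OF a] A.hp_homog[OF a] N.finsum_insert)
    moreover have "hg n (asmb (\<lambda>t bs. F (t + d) (a # bs))) (\<lambda>bs. F (t - d + d) (a # bs)) (t - d)"
      by (rule Suc.IH) (rule ml)
    ultimately show ?thesis by (auto elim!: hag_cong)
  qed
  then show ?case by simp
qed

text \<open>Elements of \<open>A\<close> have no components in negative degree, so arguments that
  end in \<open>x\<close> have only components of total degree at least \<open>e\<close>, beyond
  \<open>j\<close>. This is what lets the descent in \<open>strand_representative\<close>
  start.\<close>

lemma homog_vanish:
  assumes "ml n F" "hmg n F j" "x \<in> hcomp M e" "e > j" "as \<in> tuples A n"
  shows "F as x = \<zero>\<^bsub>N\<^esub>"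
  using assms(1,2,4,5)
proof (induction n arbitrary: F j as)
  case 0
  then show ?case using assms(3) by (auto simp: homog_def)
next
  case (Suc n)
  obtain b bs where as: "as = b # bs" "b \<in> carrier A" "bs \<in> tuples A n"
    using Suc.prems(4) by (rule tuples_SucE)
  have x: "x \<in> carrier M" using assms(3) by (rule M.M.hcomp_closed)
  have z: "zlin Z A (mult A) N (smult N) (\<lambda>a. F (a # bs) x)" using Suc.prems(1) as x by simp
  have "F (A.hp d b # bs) x = \<zero>\<^bsub>N\<^esub>" for d
  proof (cases "d < 0")
    case True
    then show ?thesis
      using as zlin_zero[OF A.is_abelian_group N.abelian_group_axioms z] by simp
  next
    case False
    show ?thesis
    proof (rule Suc.IH[of "\<lambda>as. F (A.hp d b # as)" "j - d"])
      show "hmg n (\<lambda>as. F (A.hp d b # as)) (j - d)"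
        unfolding homog_def
      proof (intro allI impI)
        fix t assume "t \<noteq> j - d"
        then have "hg (Suc n) F (\<lambda>as x. \<zero>\<^bsub>N\<^esub>) (t + d)" using Suc.prems(2) by (auto simp: homog_def)
        then have "hg n (\<lambda>as. F (A.hp d b # as)) (\<lambda>as x. \<zero>\<^bsub>N\<^esub>) (t + d - d)"
          using A.hp_in[OF as(2), of d] unfolding hag.simps by blast
        then show "hg n (\<lambda>as. F (A.hp d b # as)) (\<lambda>as x. \<zero>\<^bsub>N\<^esub>) t" by simp
      qed
    qed (use Suc.prems as False in auto)
  qed
  then show ?case using zlin_decomp_A[OF z as(2)] as(1) by simp
qed

end

text \<open>This links the recursion to the condition with degree lists \<open>ds\<close> that
  defines \<open>gr_bar_cochains\<close>.\<close>

lemma hag_iff: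
  "hag A M n F G t \<longleftrightarrow> (\<forall>as ds x e. length as = n \<and> list_all2 (\<lambda>a d. a \<in> hcomp A d) as ds \<and>
     x \<in> hcomp M e \<and> sum_list ds + e = t \<longrightarrow> F as x = G as x)"
proof (induction n arbitrary: F G t)
  case 0
  then show ?case by auto
next
  case (Suc n)
  show ?case
  proof
    assume h: "hag A M (Suc n) F G t"
    show "\<forall>as ds x e. length as = Suc n \<and> list_all2 (\<lambda>a d. a \<in> hcomp A d) as ds \<and>
     x \<in> hcomp M e \<and> sum_list ds + e = t \<longrightarrow> F as x = G as x"
    proof (intro allI impI, elim conjE)
      fix as ds x e
      assume as: "length as = Suc n" "list_all2 (\<lambda>a d. a \<in> hcomp A d) as ds" "x \<in> hcomp M e"
        "sum_list ds + e = t"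
      then obtain b bs d ds' where b: "as = b # bs" "ds = d # ds'" "b \<in> hcomp A d"
        "list_all2 (\<lambda>a d. a \<in> hcomp A d) bs ds'"
        by (cases as; cases ds) auto
      then have "hag A M n (\<lambda>as. F (b # as)) (\<lambda>as. G (b # as)) (t - d)" using h by simp
      then show "F as x = G as x" unfolding Suc.IH using as b
        by (auto dest!: spec[of _ bs] spec[of _ ds'] spec[of _ x] spec[of _ e])
    qed
  next
    assume h: "\<forall>as ds x e. length as = Suc n \<and> list_all2 (\<lambda>a d. a \<in> hcomp A d) as ds \<and>
     x \<in> hcomp M e \<and> sum_list ds + e = t \<longrightarrow> F as x = G as x"
    show "hag A M (Suc n) F G t"
      unfolding hag.simps Suc.IH
    proof (intro allI impI ballI, elim conjE)
      fix d b as ds x e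
      assume "b \<in> hcomp A d" "length as = n" "list_all2 (\<lambda>a d. a \<in> hcomp A d) as ds" "x \<in> hcomp M e"
        "sum_list ds + e = t - d"
      then show "F (b # as) x = G (b # as) x"
        using h[rule_format, of "b # as" "d # ds" x e] by auto
    qed
  qed
qed

section \<open>Cocycles and coboundaries\<close>

definition cocyc :: "'a set \<Rightarrow> ('k, 'a, 'x) graded_scheme \<Rightarrow> ('a, 'm, 'y) graded_scheme \<Rightarrow>
    ('a, 'n, 'z) graded_scheme \<Rightarrow> nat \<Rightarrow> ('a list \<Rightarrow> 'm \<Rightarrow> 'n) \<Rightarrow> bool" where
  "cocyc Z A M N n F \<longleftrightarrow> multilin Z A M N n F \<and>
     (\<forall>as\<in>tuples A (Suc n). \<forall>x\<in>carrier M. delta A M N F as x = \<zero>\<^bsub>N\<^esub>)"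

text \<open>Nothing maps into degree 0 of the complex, so there the only coboundary is zero.\<close>

primrec bnd :: "'a set \<Rightarrow> ('k, 'a, 'x) graded_scheme \<Rightarrow> ('a, 'm, 'y) graded_scheme \<Rightarrow>
    ('a, 'n, 'z) graded_scheme \<Rightarrow> nat \<Rightarrow> ('a list \<Rightarrow> 'm \<Rightarrow> 'n) \<Rightarrow> bool" where
  "bnd Z A M N 0 F \<longleftrightarrow> (\<forall>x\<in>carrier M. F [] x = \<zero>\<^bsub>N\<^esub>)"
| "bnd Z A M N (Suc n) F \<longleftrightarrow> (\<exists>H. multilin Z A M N n H \<and>
     (\<forall>as\<in>tuples A (Suc n). \<forall>x\<in>carrier M. F as x = delta A M N H as x))"

section \<open>Closure properties of cocycles and coboundaries\<close>

context bar
begin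

abbreviation "cocycle \<equiv> cocyc Z A M N"
abbreviation "bound \<equiv> bnd Z A M N"

lemma cocycle_ml: "cocycle n F \<Longrightarrow> ml n F"
  by (simp add: cocyc_def)

lemma cocycle_dl: "cocycle n F \<Longrightarrow> as \<in> tuples A (Suc n) \<Longrightarrow> x \<in> carrier M \<Longrightarrow> dl F as x = \<zero>\<^bsub>N\<^esub>"
  by (simp add: cocyc_def)

lemma cocycle_cong:
  assumes "cocycle n F" "\<And>as x. as \<in> tuples A n \<Longrightarrow> x \<in> carrier M \<Longrightarrow> G as x = F as x"
  shows "cocycle n G"
  unfolding cocyc_def
proof (intro conjI ballI)
  show "ml n G" by (rule ml_cong[OF cocycle_ml[OF assms(1)] assms(2)])
  fix as x assume "as \<in> tuples A (Suc n)" "x \<in> carrier M"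
  then show "dl G as x = \<zero>\<^bsub>N\<^esub>"
    using dl_cong[of as n x G F] cocycle_dl[OF assms(1), of as x] assms(2) by simp
qed

lemma cocycle_zero: "cocycle n (\<lambda>as x. \<zero>\<^bsub>N\<^esub>)"
  by (simp add: cocyc_def ml_zero dl_zero)

lemma cocycle_add: "cocycle n F \<Longrightarrow> cocycle n G \<Longrightarrow> cocycle n (\<lambda>as x. F as x \<oplus>\<^bsub>N\<^esub> G as x)"
  unfolding cocyc_def by (auto simp: ml_add dl_add)

lemma cocycle_uminus: "cocycle n F \<Longrightarrow> cocycle n (\<lambda>as x. \<ominus>\<^bsub>N\<^esub> F as x)"
  unfolding cocyc_def using N.add.inv_one by (auto simp: ml_uminus dl_uminus)

lemma cocycle_minus: "cocycle n F \<Longrightarrow> cocycle n G \<Longrightarrow> cocycle n (\<lambda>as x. F as x \<ominus>\<^bsub>N\<^esub> G as x)"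
  unfolding N.minus_eq by (intro cocycle_add cocycle_uminus)

lemma cocycle_finsum:
  assumes "finite I" "\<And>i. i \<in> I \<Longrightarrow> cocycle n (F i)"
  shows "cocycle n (\<lambda>as x. \<Oplus>\<^bsub>N\<^esub>i\<in>I. F i as x)"
  unfolding cocyc_def
proof (intro conjI ballI)
  show "ml n (\<lambda>as x. \<Oplus>\<^bsub>N\<^esub>i\<in>I. F i as x)" by (rule ml_finsum) (use assms in \<open>auto intro: cocycle_ml\<close>)
  fix as x assume as: "as \<in> tuples A (Suc n)" "x \<in> carrier M"
  have "dl (\<lambda>as x. \<Oplus>\<^bsub>N\<^esub>i\<in>I. F i as x) as x = (\<Oplus>\<^bsub>N\<^esub>i\<in>I. dl (F i) as x)"
    by (rule dl_finsum) (use assms as in \<open>auto intro: cocycle_ml\<close>)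
  also have "\<dots> = (\<Oplus>\<^bsub>N\<^esub>i\<in>I. \<zero>\<^bsub>N\<^esub>)"
    by (rule N.finsum_cong') (use assms as in \<open>auto intro: cocycle_dl\<close>)
  finally show "dl (\<lambda>as x. \<Oplus>\<^bsub>N\<^esub>i\<in>I. F i as x) as x = \<zero>\<^bsub>N\<^esub>" by simp
qed

lemma bound_cong:
  assumes "bound n F" "\<And>as x. as \<in> tuples A n \<Longrightarrow> x \<in> carrier M \<Longrightarrow> G as x = F as x"
  shows "bound n G"
  using assms by (cases n) auto

lemma bound_zero: "bound n (\<lambda>as x. \<zero>\<^bsub>N\<^esub>)"
proof (cases n)
  case (Suc m)
  have "ml m (\<lambda>as x. \<zero>\<^bsub>N\<^esub>) \<and> (\<forall>as\<in>tuples A (Suc m). \<forall>x\<in>carrier M. \<zero>\<^bsub>N\<^esub> = dl (\<lambda>as x. \<zero>\<^bsub>N\<^esub>) as x)"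
    by (simp add: ml_zero dl_zero)
  then show ?thesis unfolding Suc bnd.simps by blast
qed simp

lemma bound_add:
  assumes "bound n F" "bound n G"
  shows "bound n (\<lambda>as x. F as x \<oplus>\<^bsub>N\<^esub> G as x)"
proof (cases n)
  case 0
  then show ?thesis using assms by simp
next
  case (Suc m)
  from assms obtain H H' where "ml m H" "ml m H'"
    "\<forall>as\<in>tuples A (Suc m). \<forall>x\<in>carrier M. F as x = dl H as x"
    "\<forall>as\<in>tuples A (Suc m). \<forall>x\<in>carrier M. G as x = dl H' as x"
    unfolding Suc by auto
  then have "ml m (\<lambda>as x. H as x \<oplus>\<^bsub>N\<^esub> H' as x) \<and> (\<forall>as\<in>tuples A (Suc m). \<forall>x\<in>carrier M.
      F as x \<oplus>\<^bsub>N\<^esub> G as x = dl (\<lambda>as x. H as x \<oplus>\<^bsub>N\<^esub> H' as x) as x)"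
    by (simp add: ml_add dl_add)
  then show ?thesis unfolding Suc bnd.simps by blast
qed

lemma bound_uminus:
  assumes "bound n F"
  shows "bound n (\<lambda>as x. \<ominus>\<^bsub>N\<^esub> F as x)"
proof (cases n)
  case 0
  then show ?thesis using assms N.add.inv_one by simp
next
  case (Suc m)
  from assms obtain H where "ml m H" "\<forall>as\<in>tuples A (Suc m). \<forall>x\<in>carrier M. F as x = dl H as x"
    unfolding Suc by auto
  then have "ml m (\<lambda>as x. \<ominus>\<^bsub>N\<^esub> H as x) \<and> (\<forall>as\<in>tuples A (Suc m). \<forall>x\<in>carrier M.
      \<ominus>\<^bsub>N\<^esub> F as x = dl (\<lambda>as x. \<ominus>\<^bsub>N\<^esub> H as x) as x)"
    by (simp add: ml_uminus dl_uminus)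
  then show ?thesis unfolding Suc bnd.simps by blast
qed

lemma bound_minus: "bound n F \<Longrightarrow> bound n G \<Longrightarrow> bound n (\<lambda>as x. F as x \<ominus>\<^bsub>N\<^esub> G as x)"
  unfolding N.minus_eq by (intro bound_add bound_uminus)

lemma bound_finsum:
  assumes "finite I" "\<And>i. i \<in> I \<Longrightarrow> bound n (F i)" "\<And>i. i \<in> I \<Longrightarrow> ml n (F i)"
  shows "bound n (\<lambda>as x. \<Oplus>\<^bsub>N\<^esub>i\<in>I. F i as x)"
  using assms
proof (induction I rule: finite_induct)
  case empty
  then show ?case by (simp add: bound_zero)
next
  case (insert i I)
  show ?case
    by (rule bound_cong[OF bound_add[of n "F i" "\<lambda>as x. \<Oplus>\<^bsub>N\<^esub>i\<in>I. F i as x"]])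
      (use insert in \<open>auto intro!: N.finsum_insert dest!: ml_closed\<close>)
qed

lemma bound_cocycle:
  assumes "bound n F" "ml n F"
  shows "cocycle n F"
proof (cases n)
  case 0
  then show ?thesis
    using assms cocycle_cong[OF cocycle_zero[of 0], of F] by auto
next
  case (Suc m)
  from assms obtain H where H: "ml m H" "\<forall>as\<in>tuples A (Suc m). \<forall>x\<in>carrier M. F as x = dl H as x"
    unfolding Suc by auto
  have "dl F as x = \<zero>\<^bsub>N\<^esub>" if "as \<in> tuples A (Suc n)" "x \<in> carrier M" for as x
    using dl_cong[of as n x F "dl H"] dl_dl[OF H(1), of as x] H(2) that Suc by simp
  then show ?thesis using assms(2) by (simp add: cocyc_def)
qed

lemma ml_at_zero: "ml n F \<Longrightarrow> as \<in> tuples A n \<Longrightarrow> F as \<zero>\<^bsub>M\<^esub> = \<zero>\<^bsub>N\<^esub>"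
proof (induction n arbitrary: F as)
  case 0
  then show ?case
    using zlin_zero[OF M.abelian_group_axioms N.abelian_group_axioms, of Z "smult M" "smult N" "F []"] by auto
next
  case (Suc n)
  from Suc.prems(2) obtain b bs where "as = b # bs" "b \<in> carrier A" "bs \<in> tuples A n"
    by (rule tuples_SucE)
  then show ?case using Suc by auto
qed

lemma ml_add_last: "ml n F \<Longrightarrow> as \<in> tuples A n \<Longrightarrow> x \<in> carrier M \<Longrightarrow> y \<in> carrier M \<Longrightarrow>
    F as (x \<oplus>\<^bsub>M\<^esub> y) = F as x \<oplus>\<^bsub>N\<^esub> F as y"
proof (induction n arbitrary: F as)
  case 0
  then show ?case by (simp add: zlinD(2))
next
  case (Suc n)
  from Suc.prems(2) obtain b bs where "as = b # bs" "b \<in> carrier A" "bs \<in> tuples A n"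
    by (rule tuples_SucE)
  then show ?case using Suc by auto
qed

lemma ml_finsum_last:
  assumes "ml n F" "as \<in> tuples A n" "finite I" "\<And>i. i \<in> I \<Longrightarrow> f i \<in> carrier M"
  shows "F as (\<Oplus>\<^bsub>M\<^esub>i\<in>I. f i) = (\<Oplus>\<^bsub>N\<^esub>i\<in>I. F as (f i))"
  by (rule additive_finsum[OF M.abelian_group_axioms N.abelian_group_axioms])
    (use assms ml_closed ml_add_last in auto)

end

section \<open>Products of cocycles with coboundaries\<close>

context bar_pair
begin

lemma comp_cocycle:
  assumes "G.cocycle m G" "F.cocycle n F"
  shows "H.cocycle (m + n) (ycomp m G F)"
  unfolding cocyc_def
proof (intro conjI ballI)
  show "H.ml (m + n) (ycomp m G F)" by (intro comp_ml G.cocycle_ml F.cocycle_ml assms)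
  fix as x assume as: "as \<in> tuples A (Suc (m + n))" "x \<in> carrier M"
  have "H.dl (ycomp m G F) as x = ycomp (Suc m) (G.dl G) F as x"
    by (rule dl_comp_left[OF G.cocycle_ml[OF assms(1)] F.cocycle_ml[OF assms(2)] as])
      (rule F.cocycle_dl[OF assms(2) _ as(2)])
  moreover obtain us vs where "as = us @ vs" "us \<in> tuples A (Suc m)" "vs \<in> tuples A n"
    using as(1) tuples_append[of as A "Suc m" n] by auto
  ultimately show "H.dl (ycomp m G F) as x = \<zero>\<^bsub>P\<^esub>"
    using G.cocycle_dl[OF assms(1), of us "F vs x"] F.ml_closed[OF F.cocycle_ml[OF assms(2)], of vs x] as(2)
    by (simp add: comp_append)
qed

text \<open>If \<open>G\<close> is the differential of \<open>K\<close>, the Leibniz rule makes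
  \<open>ycomp m G F\<close> the differential of the product of \<open>K\<close> with the cocycle
  \<open>F\<close>.\<close>

lemma comp_bound_left:
  assumes "G.bound m G" "F.cocycle n F"
  shows "H.bound (m + n) (ycomp m G F)"
proof (cases m)
  case 0
  show ?thesis
    by (rule H.bound_cong[OF H.bound_zero])
      (use assms 0 F.ml_closed[OF F.cocycle_ml[OF assms(2)]] in \<open>auto simp: comp_0\<close>)
next
  case (Suc k)
  from assms(1) obtain K where K: "G.ml k K" "\<forall>as\<in>tuples A (Suc k). \<forall>x\<in>carrier N. G as x = G.dl K as x"
    unfolding Suc by auto
  have "ycomp m G F as x = H.dl (ycomp k K F) as x" if as: "as \<in> tuples A (Suc (k + n))" "x \<in> carrier M" for as x
  proof -
    have "H.dl (ycomp k K F) as x = ycomp (Suc k) (G.dl K) F as x"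
      by (rule dl_comp_left[OF K(1) F.cocycle_ml[OF assms(2)] as])
        (rule F.cocycle_dl[OF assms(2) _ as(2)])
    moreover obtain us vs where "as = us @ vs" "us \<in> tuples A (Suc k)" "vs \<in> tuples A n"
      using as(1) tuples_append[of as A "Suc k" n] by auto
    ultimately show ?thesis
      using K(2) F.ml_closed[OF F.cocycle_ml[OF assms(2)], of vs x] as(2) by (simp add: comp_append Suc)
  qed
  moreover have "H.ml (k + n) (ycomp k K F)" by (intro comp_ml K F.cocycle_ml assms)
  ultimately show ?thesis unfolding Suc by auto
qed

text \<open>If \<open>F\<close> is the differential of \<open>K\<close>, the product is the
  differential of \<open>ycomp m G K\<close> up to the sign (-1)^m, because \<open>G\<close> is a
  cocycle.\<close>

lemma comp_bound_right:
  assumes "G.cocycle m G" "F.bound n F"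
  shows "H.bound (m + n) (ycomp m G F)"
proof (cases n)
  case 0
  show ?thesis
  proof (rule H.bound_cong[OF H.bound_zero])
    fix as x assume "as \<in> tuples A (m + n)" "x \<in> carrier M"
    then show "ycomp m G F as x = \<zero>\<^bsub>P\<^esub>"
      using assms(2) 0 G.ml_at_zero[OF G.cocycle_ml[OF assms(1)], of as] by (simp add: ycomp_def length_tuples)
  qed
next
  case (Suc k)
  from assms(2) obtain K where K: "F.ml k K" "\<forall>as\<in>tuples A (Suc k). \<forall>x\<in>carrier M. F as x = F.dl K as x"
    unfolding Suc by auto
  have m: "H.ml (m + k) (ycomp m G K)" by (intro comp_ml K G.cocycle_ml assms)
  have dl: "ycomp m G F as x = (if even m then H.dl (ycomp m G K) as x else \<ominus>\<^bsub>P\<^esub> H.dl (ycomp m G K) as x)"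
    if as: "as \<in> tuples A (m + Suc k)" "x \<in> carrier M" for as x
  proof -
    have "H.dl (ycomp m G K) as x = (if even m then ycomp m G (F.dl K) as x else \<ominus>\<^bsub>P\<^esub> ycomp m G (F.dl K) as x)"
      by (rule dl_comp_right[OF G.cocycle_ml[OF assms(1)] K(1) as])
        (rule G.cocycle_dl[OF assms(1)])
    moreover obtain us vs where "as = us @ vs" "us \<in> tuples A m" "vs \<in> tuples A (Suc k)"
      using as(1) by (rule tuples_append)
    moreover from this have "G us (F.dl K vs x) \<in> carrier P"
      by (intro G.ml_closed[OF G.cocycle_ml[OF assms(1)]] F.dl_closed[OF K(1)] as)
    ultimately show ?thesis
      using K(2) as(2) by (simp add: comp_append)
  qed
  have b: "H.bound (Suc (m + k)) (H.dl (ycomp m G K))" using m by auto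
  show ?thesis
  proof (cases "even m")
    case True
    show ?thesis unfolding Suc add_Suc_right
      by (rule H.bound_cong[OF b]) (use dl True in simp)
  next
    case False
    show ?thesis unfolding Suc add_Suc_right
      by (rule H.bound_cong[OF H.bound_uminus[OF b]]) (use dl False in simp)
  qed
qed

end

section \<open>Homogeneous components of cochains\<close>

definition proj :: "('k, 'a, 'x) graded_scheme \<Rightarrow> ('a, 'm, 'y) graded_scheme \<Rightarrow> ('a, 'n, 'z) graded_scheme \<Rightarrow>
    int \<Rightarrow> ('a list \<Rightarrow> 'm \<Rightarrow> 'n) \<Rightarrow> 'a list \<Rightarrow> 'm \<Rightarrow> 'n" where
  "proj A M N j F = asm A M N (\<lambda>t. if t = j then F else (\<lambda>as x. \<zero>\<^bsub>N\<^esub>))"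

context gbar
begin

lemma proj_ml: "ml n F \<Longrightarrow> ml n (proj A M N j F)"
  unfolding proj_def by (rule asm_ml) (simp add: ml_zero)

lemma proj_hag: "ml n F \<Longrightarrow> hg n (proj A M N j F) (if t = j then F else (\<lambda>as x. \<zero>\<^bsub>N\<^esub>)) t"
  unfolding proj_def
  by (rule asm_hag[of n "\<lambda>t. if t = j then F else (\<lambda>as x. \<zero>\<^bsub>N\<^esub>)"]) (simp add: ml_zero)

lemma proj_hag_eq: "ml n F \<Longrightarrow> hg n (proj A M N j F) F j"
  using proj_hag[of n F j j] by simp

lemma proj_homog: "ml n F \<Longrightarrow> hmg n (proj A M N j F) j"
  unfolding homog_def using proj_hag[of n F j] by metis

lemma homog_ext:
  assumes "ml n F" "ml n G" "hmg n F j" "hmg n G j" "hg n F G j" "as \<in> tuples A n" "x \<in> carrier M"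
  shows "F as x = G as x"
proof (rule hag_ext[OF assms(1,2) _ assms(6,7)])
  fix t show "hg n F G t"
    using assms(3-5) hag_trans[OF _ hag_sym, of A M n F "\<lambda>as x. \<zero>\<^bsub>N\<^esub>" t G]
    by (cases "t = j") (auto simp: homog_def)
qed

text \<open>The differential respects internal degrees: that of the component agrees with that of
  \<open>F\<close> in degree \<open>j\<close>, where it is zero, and it is homogeneous of degree
  \<open>j\<close>.\<close>

lemma proj_cocycle:
  assumes "cocycle n F" shows "cocycle n (proj A M N j F)"
  unfolding cocyc_def
proof (intro conjI ballI)
  note F = cocycle_ml[OF assms]
  show "ml n (proj A M N j F)" by (rule proj_ml[OF F])
  fix as x assume as: "as \<in> tuples A (Suc n)" "x \<in> carrier M"
  show "dl (proj A M N j F) as x = \<zero>\<^bsub>N\<^esub>"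
  proof (rule homog_ext[OF _ ml_zero _ _ _ as, where j = j])
    show "ml (Suc n) (dl (proj A M N j F))" by (intro dl_ml proj_ml F)
    show "hmg (Suc n) (dl (proj A M N j F)) j" by (intro dl_homog proj_ml proj_homog F)
    show "hmg (Suc n) (\<lambda>as x. \<zero>\<^bsub>N\<^esub>) j" by (simp add: homog_def del: hag.simps)
    show "hg (Suc n) (dl (proj A M N j F)) (\<lambda>as x. \<zero>\<^bsub>N\<^esub>) j"
      by (rule hag_cong[OF dl_hag[OF proj_ml[OF F] F proj_hag_eq[OF F]]]) (use cocycle_dl[OF assms] in auto)
  qed
qed

lemma bound_homog_eq:
  assumes "ml (Suc m) F" "hmg (Suc m) F j" "ml m H" "hg (Suc m) F (dl H) j"
    "as \<in> tuples A (Suc m)" "x \<in> carrier M"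
  shows "F as x = dl (proj A M N j H) as x"
proof (rule homog_ext[OF assms(1) _ assms(2) _ _ assms(5,6)])
  show "ml (Suc m) (dl (proj A M N j H))" by (intro dl_ml proj_ml assms)
  show "hmg (Suc m) (dl (proj A M N j H)) j" by (intro dl_homog proj_ml proj_homog assms)
  show "hg (Suc m) F (dl (proj A M N j H)) j"
    by (rule hag_trans[OF assms(4) hag_sym[OF dl_hag[OF proj_ml[OF assms(3)] assms(3) proj_hag_eq[OF assms(3)]]]])
qed

text \<open>The component of degree \<open>j\<close> of a cochain bounding \<open>G\<close> bounds
  \<open>F\<close>. A homogeneous cochain may thus be compared with an inhomogeneous coboundary in a
  single degree; the splitting into strands and the summand criterion both rest on this.\<close>

lemma bound_hag:
  assumes "ml n F" "hmg n F j" "bound n G" "hg n F G j"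
  shows "bound n F"
proof (cases n)
  case 0
  have "F [] x = \<zero>\<^bsub>N\<^esub>" if x: "x \<in> carrier M" for x
  proof (rule homog_ext[of 0 F "\<lambda>as x. \<zero>\<^bsub>N\<^esub>" j "[]" x])
    show "hg 0 F (\<lambda>as x. \<zero>\<^bsub>N\<^esub>) j"
      using assms(3,4) M.M.hcomp_closed by (auto simp: 0)
  qed (use assms x 0 ml_zero[of 0] in \<open>auto simp: homog_def\<close>)
  then show ?thesis by (simp add: 0)
next
  case (Suc m)
  from assms(3) obtain H where H: "ml m H" "\<forall>as\<in>tuples A (Suc m). \<forall>x\<in>carrier M. G as x = dl H as x"
    unfolding Suc by auto
  have "hg (Suc m) F (dl H) j"
    by (rule hag_cong[OF assms(4)[unfolded Suc]]) (use H in auto)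
  then have "\<forall>as\<in>tuples A (Suc m). \<forall>x\<in>carrier M. F as x = dl (proj A M N j H) as x"
    using bound_homog_eq[OF assms(1,2)[unfolded Suc] H(1)] by blast
  then show ?thesis unfolding Suc using proj_ml[OF H(1)] by auto
qed

text \<open>Projecting the bounding cochain costs nothing. Hence a homogeneous cocycle that bounds
  in the ungraded complex already bounds in the graded one.\<close>

lemma bound_homogE:
  assumes "ml (Suc m) F" "hmg (Suc m) F j" "bound (Suc m) F"
  obtains H where "ml m H" "hmg m H j" "\<And>as x. as \<in> tuples A (Suc m) \<Longrightarrow> x \<in> carrier M \<Longrightarrow> F as x = dl H as x"
proof -
  from assms(3) obtain H where H: "ml m H" "\<forall>as\<in>tuples A (Suc m). \<forall>x\<in>carrier M. F as x = dl H as x"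
    by auto
  have "hg (Suc m) F (dl H) j"
    by (rule hag_cong[OF hag_refl[of _ _ _ F]]) (use H in auto)
  with that[of "proj A M N j H"] H show thesis
    using bound_homog_eq[OF assms(1,2) H(1)] proj_ml proj_homog by blast
qed

lemma bound_proj:
  assumes "ml n F" "bound n F"
  shows "bound n (proj A M N j F)"
  by (rule bound_hag[OF proj_ml[OF assms(1)] proj_homog[OF assms(1)] assms(2) proj_hag_eq[OF assms(1)]])

text \<open>
  A cocycle may have infinitely many nonzero homogeneous components, so that bounding them one by
  one is not enough: the bounding cochains have to be assembled with \<open>asm\<close>.
\<close>

lemma koszul_proj:
  assumes kos: "\<And>j G. cocycle n G \<Longrightarrow> hmg n G j \<Longrightarrow> j \<noteq> int n \<Longrightarrow> bound n G" and F: "cocycle n F"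
  shows "bound n (\<lambda>as x. F as x \<ominus>\<^bsub>N\<^esub> proj A M N (int n) F as x)"
proof -
  note ml = cocycle_ml[OF F]
  let ?D = "\<lambda>as x. F as x \<ominus>\<^bsub>N\<^esub> proj A M N (int n) F as x"
  have D: "ml n ?D" by (intro ml_minus ml proj_ml)
  have D0: "hg n ?D (\<lambda>as x. \<zero>\<^bsub>N\<^esub>) (int n)"
    by (rule hag_cong[OF hag_map2[OF hag_refl[of _ _ _ F] proj_hag_eq[OF ml], of "\<lambda>x y. x \<ominus>\<^bsub>N\<^esub> y"]])
      (use ml_closed[OF ml] in \<open>auto simp: N.minus_eq N.r_neg\<close>)
  have Dj: "hg n ?D F j" if "j \<noteq> int n" for j
  proof -
    have "hg n (proj A M N (int n) F) (\<lambda>as x. \<zero>\<^bsub>N\<^esub>) j" using proj_hag[OF ml, of "int n" j] that by simp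
    from hag_map2[OF hag_refl[of _ _ _ F] this, of "\<lambda>x y. x \<ominus>\<^bsub>N\<^esub> y"]
    show ?thesis by (rule hag_cong) (use ml_closed[OF ml] N.add.inv_one in \<open>auto simp: N.minus_eq\<close>)
  qed
  have P: "bound n (proj A M N j F)" if "j \<noteq> int n" for j
    by (rule kos[OF proj_cocycle[OF F] proj_homog[OF ml] that])
  show ?thesis
  proof (cases n)
    case 0
    have "?D [] x = \<zero>\<^bsub>N\<^esub>" if x: "x \<in> carrier M" for x
    proof (rule hag_ext[of 0 ?D "\<lambda>as x. \<zero>\<^bsub>N\<^esub>" "[]" x])
      fix t show "hg 0 ?D (\<lambda>as x. \<zero>\<^bsub>N\<^esub>) t"
      proof (cases "t = int n")
        case False
        have "hg 0 (proj A M N t F) (\<lambda>as x. \<zero>\<^bsub>N\<^esub>) t"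
          using P[OF False] M.M.hcomp_closed by (auto simp: 0)
        then show ?thesis
          using hag_trans[OF Dj[OF False] hag_trans[OF hag_sym[OF proj_hag_eq[OF ml, of t]]]] 0 by blast
      qed (use D0 0 in simp)
    qed (use D x 0 ml_zero[of 0] in auto)
    then show ?thesis by (simp add: 0)
  next
    case (Suc m)
    have "\<exists>H. ml m H \<and> (\<forall>as\<in>tuples A n. \<forall>x\<in>carrier M. proj A M N j F as x = dl H as x)"
      if "j \<noteq> int n" for j
      using P[OF that] unfolding Suc by auto
    then obtain H where H: "\<And>j. j \<noteq> int n \<Longrightarrow> ml m (H j)"
      "\<And>j as x. j \<noteq> int n \<Longrightarrow> as \<in> tuples A n \<Longrightarrow> x \<in> carrier M \<Longrightarrow> proj A M N j F as x = dl (H j) as x"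
      by metis
    let ?H = "\<lambda>j. if j = int n then (\<lambda>as x. \<zero>\<^bsub>N\<^esub>) else H j"
    have mlH: "ml m (?H j)" for j using H(1) ml_zero by simp
    have mlA: "ml m (asmb ?H)" by (intro asm_ml mlH)
    have "?D as x = dl (asmb ?H) as x" if as: "as \<in> tuples A n" "x \<in> carrier M" for as x
    proof (rule hag_ext[OF D _ _ as])
      show "ml n (dl (asmb ?H))" using dl_ml[OF mlA] unfolding Suc[symmetric] .
      fix t
      have a: "hg n (dl (asmb ?H)) (dl (?H t)) t"
        using dl_hag[OF mlA mlH asm_hag[OF mlH]] unfolding Suc[symmetric] .
      show "hg n ?D (dl (asmb ?H)) t"
      proof (cases "t = int n")
        case True
        have "hg n (dl (asmb ?H)) (\<lambda>as x. \<zero>\<^bsub>N\<^esub>) t"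
          by (rule hag_cong[OF a]) (use True dl_zero in \<open>auto simp: Suc\<close>)
        then show ?thesis using D0 True hag_trans[OF _ hag_sym] by blast
      next
        case False
        have "hg n (dl (asmb ?H)) (proj A M N t F) t"
          by (rule hag_cong[OF a]) (use False H(2) in auto)
        then have "hg n (dl (asmb ?H)) F t" using hag_trans[OF _ proj_hag_eq[OF ml]] by blast
        then show ?thesis using hag_trans[OF Dj[OF False] hag_sym] by blast
      qed
    qed
    then have "bound (Suc m) ?D" unfolding bnd.simps using mlA unfolding Suc[symmetric] by blast
    then show ?thesis unfolding Suc[symmetric] .
  qed
qed

end

section \<open>Internal degrees of products\<close>

locale gbar_pair = F: gbar A M N Z + G: gbar A N P Z
  for A :: "('k, 'a, 'x) graded_scheme" and M :: "('a, 'm, 'y) graded_scheme"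
    and N :: "('a, 'n, 'z) graded_scheme" and P :: "('a, 'p, 'w) graded_scheme" and Z :: "'a set" +
  assumes N_0: "hcomp N 0 = carrier N"
begin

sublocale bar_pair A M N P Z ..

sublocale H: gbar A M P Z
  by unfold_locales (use F.Z_0 G.N_trivial in auto)

lemma homog_shift:
  assumes "homog A M' N' (Suc m) G i" "a \<in> hcomp A d"
  shows "homog A M' N' m (\<lambda>as. G (a # as)) (i - d)"
  unfolding homog_def
proof (intro allI impI)
  fix t assume "t \<noteq> i - d"
  then have "hag A M' (Suc m) G (\<lambda>as x. \<zero>\<^bsub>N'\<^esub>) (t + d)" using assms(1) by (auto simp: homog_def)
  then have "hag A M' m (\<lambda>as. G (a # as)) (\<lambda>as x. \<zero>\<^bsub>N'\<^esub>) (t + d - d)"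
    using assms(2) unfolding hag.simps by blast
  then show "hag A M' m (\<lambda>as. G (a # as)) (\<lambda>as x. \<zero>\<^bsub>N'\<^esub>) t" by simp
qed

text \<open>The values of \<open>F\<close> lie in \<open>N\<close>, which is all of degree 0, so for
  \<open>G\<close> only its first \<open>m\<close> arguments contribute to the degree. They must add
  up to \<open>i\<close>, which leaves total degree \<open>t\<close> for the arguments of
  \<open>F\<close>.\<close>

lemma comp_hag:
  assumes "G.ml m G" "G.hmg m G i" "F.ml n F" "F.ml n F'" "F.hg n F F' t"
  shows "F.hg (m + n) (ycomp m G F) (ycomp m G F') (t + i)"
  using assms(1,2)
proof (induction m arbitrary: G i)
  case 0
  show ?case
  proof (cases "i = 0")
    case True
    then show ?thesis using hag_map[OF assms(5), of "G []"] by (simp add: comp_0)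
  next
    case False
    then have "G [] y = \<zero>\<^bsub>P\<^esub>" if "y \<in> carrier N" for y
      using 0(2) that N_0 by (auto simp: homog_def)
    then show ?thesis
      by (intro F.hag_cong[OF hag_refl[of _ _ _ "\<lambda>as x. \<zero>\<^bsub>P\<^esub>"]])
        (use F.ml_closed assms(3,4) in \<open>auto simp: comp_0\<close>)
  qed
next
  case (Suc m)
  have "F.hg (m + n) (ycomp m (\<lambda>as. G (a # as)) F) (ycomp m (\<lambda>as. G (a # as)) F') (t + i - d)"
    if a: "a \<in> hcomp A d" for a d
  proof -
    have "F.hg (m + n) (ycomp m (\<lambda>as. G (a # as)) F) (ycomp m (\<lambda>as. G (a # as)) F') (t + (i - d))"
      by (rule Suc.IH[OF _ homog_shift[OF Suc.prems(2) a]]) (use Suc.prems F.A.hcomp_closed[OF a] in auto)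
    then show ?thesis by (simp add: algebra_simps)
  qed
  then show ?case by (simp add: comp_Suc)
qed

lemma comp_homog:
  assumes "G.ml m G" "G.hmg m G i" "F.ml n F" "F.hmg n F j"
  shows "H.hmg (m + n) (ycomp m G F) (i + j)"
  unfolding homog_def
proof (intro allI impI)
  fix t assume "t \<noteq> i + j"
  then have "F.hg n F (\<lambda>as x. \<zero>\<^bsub>N\<^esub>) (t - i)" using assms(4) by (auto simp: homog_def)
  from comp_hag[OF assms(1-3) F.ml_zero this]
  have "F.hg (m + n) (ycomp m G F) (ycomp m G (\<lambda>as x. \<zero>\<^bsub>N\<^esub>)) t" by simp
  then show "F.hg (m + n) (ycomp m G F) (\<lambda>as x. \<zero>\<^bsub>P\<^esub>) t"
  proof (rule F.hag_cong)
    fix as x assume "as \<in> tuples A (m + n)" "x \<in> carrier M"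
    then obtain us vs where "as = us @ vs" "us \<in> tuples A m" "vs \<in> tuples A n"
      by (auto elim: tuples_append)
    then show "\<zero>\<^bsub>P\<^esub> = ycomp m G (\<lambda>as x. \<zero>\<^bsub>N\<^esub>) as x"
      using G.ml_at_zero[OF assms(1)] by (simp add: comp_append)
  qed simp
qed

end

section \<open>Ext classes of curried cochains\<close>

definition scal :: "('k, 'w) ring_scheme \<Rightarrow> ('k, 'a, 'x) graded_scheme \<Rightarrow> 'a set" where
  "scal k A = (\<lambda>c. c \<odot>\<^bsub>A\<^esub> \<one>\<^bsub>A\<^esub>) ` carrier k"

text \<open>The passage back to cochains as functions of pairs. Restriction to legal arguments turns
  agreement there into equality of functions.\<close>

definition mk :: "('k, 'a, 'x) graded_scheme \<Rightarrow> ('a, 'm, 'y) graded_scheme \<Rightarrow> nat \<Rightarrow>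
    ('a list \<Rightarrow> 'm \<Rightarrow> 'n) \<Rightarrow> 'a list \<times> 'm \<Rightarrow> 'n" where
  "mk A M n F = (\<lambda>(as, x)\<in>bar_args A M n. F as x)"

lemma bar_args_iff: "(as, x) \<in> bar_args A M n \<longleftrightarrow> as \<in> tuples A n \<and> x \<in> carrier M"
  by (auto simp: bar_args_def tuples_def)

lemma mk_apply [simp]: "as \<in> tuples A n \<Longrightarrow> x \<in> carrier M \<Longrightarrow> mk A M n F (as, x) = F as x"
  by (simp add: mk_def bar_args_iff)

lemma mk_cong: "(\<And>as x. as \<in> tuples A n \<Longrightarrow> x \<in> carrier M \<Longrightarrow> F as x = G as x) \<Longrightarrow> mk A M n F = mk A M n G"
  unfolding mk_def by (rule restrict_ext) (auto simp: bar_args_iff)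

lemma mk_ext: "f \<in> extensional (bar_args A M n) \<Longrightarrow>
    (\<And>as x. as \<in> tuples A n \<Longrightarrow> x \<in> carrier M \<Longrightarrow> f (as, x) = F as x) \<Longrightarrow> f = mk A M n F"
  unfolding mk_def by (rule extensionalityI[of _ "bar_args A M n"]) (auto simp: bar_args_iff)

lemma mk_extensional: "mk A M n F \<in> extensional (bar_args A M n)"
  by (simp add: mk_def)

lemma mk_eqD: "mk A M n F = mk A M n G \<Longrightarrow> as \<in> tuples A n \<Longrightarrow> x \<in> carrier M \<Longrightarrow> F as x = G as x"
  by (metis mk_apply)

lemma (in abelian_group) add_pow_sign:
  "x \<in> carrier G \<Longrightarrow> add_pow G ((-1 :: int) ^ n) x = (if even n then x else \<ominus> x)"
proof -
  assume x: "x \<in> carrier G"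
  have 1: "add_pow G (1 :: int) x = x"
    using x by (simp add: add_pow_int_ge)
  have 2: "add_pow G (- 1 :: int) x = \<ominus> x"
    using x by (simp add: add_pow_int_lt)
  show ?thesis using 1 2 by (cases "even n") auto
qed

text \<open>Sorting a sum can leave an element and its negative separated by one or two other
  summands; these rules cancel such pairs.\<close>

lemma (in abelian_group) cancel_simps:
  assumes "x \<in> carrier G" "y \<in> carrier G"
  shows "x \<oplus> (y \<oplus> \<ominus> x) = y" "\<ominus> x \<oplus> (y \<oplus> x) = y"
    "z \<in> carrier G \<Longrightarrow> x \<oplus> (y \<oplus> (\<ominus> x \<oplus> z)) = y \<oplus> z"
    "z \<in> carrier G \<Longrightarrow> \<ominus> x \<oplus> (y \<oplus> (x \<oplus> z)) = y \<oplus> z"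
    "z \<in> carrier G \<Longrightarrow> x \<oplus> (y \<oplus> (z \<oplus> \<ominus> x)) = y \<oplus> z"
    "z \<in> carrier G \<Longrightarrow> \<ominus> x \<oplus> (y \<oplus> (z \<oplus> x)) = y \<oplus> z"
    "z \<in> carrier G \<Longrightarrow> w \<in> carrier G \<Longrightarrow> x \<oplus> (y \<oplus> (z \<oplus> (\<ominus> x \<oplus> w))) = y \<oplus> (z \<oplus> w)"
    "z \<in> carrier G \<Longrightarrow> w \<in> carrier G \<Longrightarrow> \<ominus> x \<oplus> (y \<oplus> (z \<oplus> (x \<oplus> w))) = y \<oplus> (z \<oplus> w)"
proof -
  have 1: "x \<oplus> (y \<oplus> z) = y \<oplus> (x \<oplus> z)" if "x \<in> carrier G" "y \<in> carrier G" "z \<in> carrier G" for x y z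
    using that by (rule a_lcomm)
  note n = r_neg r_neg1 r_neg2 l_neg
  show "x \<oplus> (y \<oplus> \<ominus> x) = y" "\<ominus> x \<oplus> (y \<oplus> x) = y"
    using assms 1[of x y "\<ominus> x"] 1[of "\<ominus> x" y x] by (simp_all add: n)
  assume z: "z \<in> carrier G"
  show 2: "x \<oplus> (y \<oplus> (\<ominus> x \<oplus> z)) = y \<oplus> z" "\<ominus> x \<oplus> (y \<oplus> (x \<oplus> z)) = y \<oplus> z"
    using assms z 1[of x y "\<ominus> x \<oplus> z"] 1[of "\<ominus> x" y "x \<oplus> z"] by (simp_all add: n)
  show "x \<oplus> (y \<oplus> (z \<oplus> \<ominus> x)) = y \<oplus> z" "\<ominus> x \<oplus> (y \<oplus> (z \<oplus> x)) = y \<oplus> z"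
    using assms z 2 a_comm[of z "\<ominus> x"] a_comm[of z x] by simp_all
  assume w: "w \<in> carrier G"
  show "x \<oplus> (y \<oplus> (z \<oplus> (\<ominus> x \<oplus> w))) = y \<oplus> (z \<oplus> w)"
    "\<ominus> x \<oplus> (y \<oplus> (z \<oplus> (x \<oplus> w))) = y \<oplus> (z \<oplus> w)"
    using assms z w 1[of x y "z \<oplus> (\<ominus> x \<oplus> w)"] 1[of x z "\<ominus> x \<oplus> w"]
      1[of "\<ominus> x" y "z \<oplus> (x \<oplus> w)"] 1[of "\<ominus> x" z "x \<oplus> w"] by (simp_all add: n)
qed

section \<open>Ext over a graded algebra in terms of curried cochains\<close>

locale galg =
  fixes k :: "('k, 'w) ring_scheme" and A :: "('k, 'a, 'x) graded_scheme"
  assumes galg: "graded_algebra k A"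
begin

lemma field_k: "field k" and ring_A: "ring A" and module_A: "module k A"
  using galg by (simp_all add: graded_algebra_def)

sublocale k: field k by (rule field_k)
sublocale A: ring A by (rule ring_A)
sublocale kA: module k A by (rule module_A)

lemma graded_ring: "graded_ring A"
  by unfold_locales (use galg in \<open>auto simp: graded_algebra_def\<close>)

sublocale A: graded_ring A by (rule graded_ring)

lemma smult_eq: "c \<in> carrier k \<Longrightarrow> a \<in> carrier A \<Longrightarrow> c \<odot>\<^bsub>A\<^esub> a = (c \<odot>\<^bsub>A\<^esub> \<one>\<^bsub>A\<^esub>) \<otimes>\<^bsub>A\<^esub> a"
  using galg unfolding graded_algebra_def by (metis A.one_closed A.l_one)

lemma scal_sub: "scal k A \<subseteq> carrier A"
  by (auto simp: scal_def)

lemma scal_central: "z \<in> scal k A \<Longrightarrow> a \<in> carrier A \<Longrightarrow> z \<otimes>\<^bsub>A\<^esub> a = a \<otimes>\<^bsub>A\<^esub> z"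
proof -
  assume "z \<in> scal k A" and a: "a \<in> carrier A"
  then obtain c where c: "c \<in> carrier k" "z = c \<odot>\<^bsub>A\<^esub> \<one>\<^bsub>A\<^esub>" by (auto simp: scal_def)
  have "c \<odot>\<^bsub>A\<^esub> (a \<otimes>\<^bsub>A\<^esub> \<one>\<^bsub>A\<^esub>) = a \<otimes>\<^bsub>A\<^esub> (c \<odot>\<^bsub>A\<^esub> \<one>\<^bsub>A\<^esub>)"
    using galg c a A.one_closed unfolding graded_algebra_def by blast
  then show ?thesis using smult_eq[OF c(1) a] c a by simp
qed

lemma scal_0: "scal k A \<subseteq> hcomp A 0"
proof -
  have "submodule (hcomp A 0) k A" using galg by (simp add: graded_algebra_def)
  then show ?thesis using A.one_hcomp by (auto simp: scal_def intro: submodule.smult_closed)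
qed

end

locale extl = galg k A for k :: "('k, 'w) ring_scheme" and A :: "('k, 'a, 'x) graded_scheme" +
  fixes M :: "('a, 'm, 'y) graded_scheme" and N :: "('a, 'n, 'z) graded_scheme"
  assumes mod_M: "left_module A M" and mod_N: "left_module A N"
begin

sublocale bar A M N "scal k A"
  by (rule bar.intro[OF ring_A mod_M mod_N scal_sub scal_central])

abbreviation "C \<equiv> bar_cochains k A M N"
abbreviation "d \<equiv> bar_diff A M N"
abbreviation "mkn \<equiv> mk A M"

definition cls :: "nat \<Rightarrow> ('a list \<Rightarrow> 'm \<Rightarrow> 'n) \<Rightarrow> ('a list \<times> 'm \<Rightarrow> 'n) set" where
  "cls n F = cohomology_class C d n (mkn n F)"

lemma ball_bar_args:
  "(\<forall>(as, x)\<in>bar_args A M n. Q as x) \<longleftrightarrow> (\<forall>as\<in>tuples A n. \<forall>x\<in>carrier M. Q as x)"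
  by (auto simp: bar_args_iff)

lemma multilinear_curried:
  "multilinear k A M N n (\<lambda>(as, x). F as x) \<longleftrightarrow> (\<forall>as\<in>tuples A n. \<forall>x\<in>carrier M.
     (\<forall>i<n. \<forall>a\<in>carrier A. \<forall>b\<in>carrier A.
        F (as[i := a \<oplus>\<^bsub>A\<^esub> b]) x = F (as[i := a]) x \<oplus>\<^bsub>N\<^esub> F (as[i := b]) x) \<and>
     (\<forall>i<n. \<forall>c\<in>carrier k. \<forall>a\<in>carrier A.
        F (as[i := c \<odot>\<^bsub>A\<^esub> a]) x = base_smult A N c (F (as[i := a]) x)) \<and>
     (\<forall>y\<in>carrier M. F as (x \<oplus>\<^bsub>M\<^esub> y) = F as x \<oplus>\<^bsub>N\<^esub> F as y) \<and>
     (\<forall>c\<in>carrier k. F as (base_smult A M c x) = base_smult A N c (F as x)))"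
  unfolding multilinear_def ball_bar_args prod.case ..

text \<open>Updating position 0 is the linearity clause of \<open>multilin\<close> for the head, and
  updating position \<open>Suc i\<close> is the same statement for the tail with the head
  fixed.\<close>

lemma multilinear_iff:
  assumes "\<And>as x. as \<in> tuples A n \<Longrightarrow> x \<in> carrier M \<Longrightarrow> F as x \<in> carrier N"
  shows "multilinear k A M N n (\<lambda>(as, x). F as x) \<longleftrightarrow> ml n F"
  using assms
proof (induction n arbitrary: F)
  case 0
  then show ?case
    by (auto simp: multilinear_curried zlin_def base_smult_def scal_def)
next
  case (Suc n)
  have IH: "multilinear k A M N n (\<lambda>(as, x). F (a # as) x) \<longleftrightarrow> ml n (\<lambda>as. F (a # as))" if "a \<in> carrier A" for a
    by (rule Suc.IH) (use Suc.prems that in auto)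
  show ?case
  proof
    assume m: "multilinear k A M N (Suc n) (\<lambda>(as, x). F as x)"
    have "multilinear k A M N n (\<lambda>(as, x). F (a # as) x)" if a: "a \<in> carrier A" for a
      unfolding multilinear_curried
    proof (intro ballI)
      fix as x assume as: "as \<in> tuples A n" "x \<in> carrier M"
      then have b: "a # as \<in> tuples A (Suc n)" using a by simp
      note m' = m[unfolded multilinear_curried, rule_format, OF b as(2)]
      have 1: "F ((a # as)[Suc i := u \<oplus>\<^bsub>A\<^esub> v]) x = F ((a # as)[Suc i := u]) x \<oplus>\<^bsub>N\<^esub> F ((a # as)[Suc i := v]) x"
        if "i < n" "u \<in> carrier A" "v \<in> carrier A" for i u v
        by (rule m'[THEN conjunct1, rule_format]) (use that in auto)
      have 2: "F ((a # as)[Suc i := c \<odot>\<^bsub>A\<^esub> u]) x = base_smult A N c (F ((a # as)[Suc i := u]) x)"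
        if "i < n" "c \<in> carrier k" "u \<in> carrier A" for i u c
        by (rule m'[THEN conjunct2, THEN conjunct1, rule_format]) (use that in auto)
      show "(\<forall>i<n. \<forall>u\<in>carrier A. \<forall>v\<in>carrier A.
          F (a # as[i := u \<oplus>\<^bsub>A\<^esub> v]) x = F (a # as[i := u]) x \<oplus>\<^bsub>N\<^esub> F (a # as[i := v]) x) \<and>
       (\<forall>i<n. \<forall>c\<in>carrier k. \<forall>u\<in>carrier A.
          F (a # as[i := c \<odot>\<^bsub>A\<^esub> u]) x = base_smult A N c (F (a # as[i := u]) x)) \<and>
       (\<forall>y\<in>carrier M. F (a # as) (x \<oplus>\<^bsub>M\<^esub> y) = F (a # as) x \<oplus>\<^bsub>N\<^esub> F (a # as) y) \<and>
       (\<forall>c\<in>carrier k. F (a # as) (base_smult A M c x) = base_smult A N c (F (a # as) x))"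
        using 1 2 m' by simp
    qed
    moreover have "zlin (scal k A) A (mult A) N (smult N) (\<lambda>a. F (a # as) x)"
      if as: "as \<in> tuples A n" "x \<in> carrier M" for as x
      unfolding zlin_def
    proof (intro conjI ballI)
      fix a assume a: "a \<in> carrier A"
      then show "F (a # as) x \<in> carrier N" using Suc.prems as by simp
      have b: "a # as \<in> tuples A (Suc n)" using as a by simp
      note m' = m[unfolded multilinear_curried, rule_format, OF b as(2)]
      { fix b assume b: "b \<in> carrier A"
        have "F ((a # as)[0 := a \<oplus>\<^bsub>A\<^esub> b]) x = F ((a # as)[0 := a]) x \<oplus>\<^bsub>N\<^esub> F ((a # as)[0 := b]) x"
          by (intro m'[THEN conjunct1, rule_format] zero_less_Suc a b)
        then show "F ((a \<oplus>\<^bsub>A\<^esub> b) # as) x = F (a # as) x \<oplus>\<^bsub>N\<^esub> F (b # as) x" by simp }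
      { fix z assume "z \<in> scal k A"
        then obtain c where c: "c \<in> carrier k" "z = c \<odot>\<^bsub>A\<^esub> \<one>\<^bsub>A\<^esub>" by (auto simp: scal_def)
        have "F ((a # as)[0 := c \<odot>\<^bsub>A\<^esub> a]) x = base_smult A N c (F ((a # as)[0 := a]) x)"
          by (intro m'[THEN conjunct2, THEN conjunct1, rule_format] zero_less_Suc a c)
        then show "F ((z \<otimes>\<^bsub>A\<^esub> a) # as) x = z \<odot>\<^bsub>N\<^esub> F (a # as) x"
          using c a by (simp add: base_smult_def smult_eq[symmetric]) }
    qed
    ultimately show "ml (Suc n) F" using IH by simp
  next
    assume m: "ml (Suc n) F"
    then have s: "multilinear k A M N n (\<lambda>(as, x). F (a # as) x)" if "a \<in> carrier A" for a using IH that by simp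
    have l: "zlin (scal k A) A (mult A) N (smult N) (\<lambda>a. F (a # as) x)"
      if "as \<in> tuples A n" "x \<in> carrier M" for as x using m that by simp
    show "multilinear k A M N (Suc n) (\<lambda>(as, x). F as x)"
      unfolding multilinear_curried
    proof (intro ballI)
      fix as x assume "as \<in> tuples A (Suc n)" and x: "x \<in> carrier M"
      then obtain b bs where as: "as = b # bs" "b \<in> carrier A" "bs \<in> tuples A n"
        by (elim tuples_SucE)
      note s' = s[OF as(2), unfolded multilinear_curried, rule_format, OF as(3) x]
      note l' = l[OF as(3) x]
      have sc: "F ((c \<odot>\<^bsub>A\<^esub> u) # bs) x = base_smult A N c (F (u # bs) x)"
        if "c \<in> carrier k" "u \<in> carrier A" for c u
      proof -
        have "F (((c \<odot>\<^bsub>A\<^esub> \<one>\<^bsub>A\<^esub>) \<otimes>\<^bsub>A\<^esub> u) # bs) x = (c \<odot>\<^bsub>A\<^esub> \<one>\<^bsub>A\<^esub>) \<odot>\<^bsub>N\<^esub> F (u # bs) x"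
          using l' that by (auto simp: zlin_def scal_def)
        then show ?thesis using that by (simp add: base_smult_def smult_eq[symmetric])
      qed
      have 1: "F (as[i := u \<oplus>\<^bsub>A\<^esub> v]) x = F (as[i := u]) x \<oplus>\<^bsub>N\<^esub> F (as[i := v]) x"
        if "i < Suc n" "u \<in> carrier A" "v \<in> carrier A" for i u v
        using s' l' that by (cases i) (auto simp: as(1) zlin_def)
      have 2: "F (as[i := c \<odot>\<^bsub>A\<^esub> u]) x = base_smult A N c (F (as[i := u]) x)"
        if "i < Suc n" "c \<in> carrier k" "u \<in> carrier A" for i u c
        using s' sc that by (cases i) (auto simp: as(1))
      show "(\<forall>i<Suc n. \<forall>u\<in>carrier A. \<forall>v\<in>carrier A.
          F (as[i := u \<oplus>\<^bsub>A\<^esub> v]) x = F (as[i := u]) x \<oplus>\<^bsub>N\<^esub> F (as[i := v]) x) \<and>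
       (\<forall>i<Suc n. \<forall>c\<in>carrier k. \<forall>u\<in>carrier A.
          F (as[i := c \<odot>\<^bsub>A\<^esub> u]) x = base_smult A N c (F (as[i := u]) x)) \<and>
       (\<forall>y\<in>carrier M. F as (x \<oplus>\<^bsub>M\<^esub> y) = F as x \<oplus>\<^bsub>N\<^esub> F as y) \<and>
       (\<forall>c\<in>carrier k. F as (base_smult A M c x) = base_smult A N c (F as x))"
        using 1 2 s' by (simp add: as(1))
    qed
  qed
qed

lemma C_carrier: "f \<in> carrier (C n) \<longleftrightarrow> (\<exists>F. ml n F \<and> f = mkn n F)"
proof
  assume f: "f \<in> carrier (C n)"
  then have cl: "f (as, x) \<in> carrier N" if "as \<in> tuples A n" "x \<in> carrier M" for as x
    using that by (auto simp: bar_cochains_def bar_args_iff)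
  have "(\<lambda>(as, x). f (as, x)) = f" by auto
  then have "ml n (\<lambda>as x. f (as, x))"
    using f multilinear_iff[of n "\<lambda>as x. f (as, x)"] cl by (simp add: bar_cochains_def)
  moreover have "f = mkn n (\<lambda>as x. f (as, x))"
    by (rule mk_ext) (use f in \<open>auto simp: bar_cochains_def PiE_def\<close>)
  ultimately show "\<exists>F. ml n F \<and> f = mkn n F" by blast
next
  assume "\<exists>F. ml n F \<and> f = mkn n F"
  then obtain F where F: "ml n F" "f = mkn n F" by blast
  have m: "ml n (\<lambda>as x. f (as, x))" by (rule ml_cong[OF F(1)]) (simp add: F)
  have cl: "f (as, x) \<in> carrier N" if "as \<in> tuples A n" "x \<in> carrier M" for as x
    using that F by (simp add: ml_closed)
  have "(\<lambda>(as, x). f (as, x)) = f" by auto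
  then have "multilinear k A M N n f"
    using multilinear_iff[of n "\<lambda>as x. f (as, x)"] cl m by simp
  then show "f \<in> carrier (C n)"
    using cl mk_extensional[of A M n F] F(2) by (auto simp: bar_cochains_def PiE_def bar_args_iff)
qed

lemma C_zero: "\<zero>\<^bsub>C n\<^esub> = mkn n (\<lambda>as x. \<zero>\<^bsub>N\<^esub>)"
  by (auto simp: bar_cochains_def mk_def)

lemma C_add: "mkn n F \<oplus>\<^bsub>C n\<^esub> mkn n G = mkn n (\<lambda>as x. F as x \<oplus>\<^bsub>N\<^esub> G as x)"
  by (rule mk_ext) (auto simp: bar_cochains_def bar_args_iff)

lemma C_smult: "c \<odot>\<^bsub>C n\<^esub> mkn n F = mkn n (\<lambda>as x. base_smult A N c (F as x))"
  by (rule mk_ext) (auto simp: bar_cochains_def bar_args_iff)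

text \<open>Taking off the summand at index 0 and shifting the others by one flips every remaining
  sign. This is exactly the subtraction in the recursion of \<open>inner\<close>.\<close>

lemma inn_expand:
  assumes "ml n F" "as \<in> tuples A (Suc n)" "x \<in> carrier M"
  shows "(\<Oplus>\<^bsub>N\<^esub>i\<in>{..<n}. add_pow N ((-1 :: int) ^ Suc i)
             (F (take i as @ (as ! i \<otimes>\<^bsub>A\<^esub> as ! Suc i) # drop (i + 2) as) x))
     \<oplus>\<^bsub>N\<^esub> add_pow N ((-1 :: int) ^ Suc n) (F (butlast as) (last as \<odot>\<^bsub>M\<^esub> x)) = \<ominus>\<^bsub>N\<^esub> inn F as x"
  using assms
proof (induction n arbitrary: F as)
  case 0
  then obtain a where "as = [a]" "a \<in> carrier A" by (auto elim!: tuples_SucE)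
  then show ?case using 0 N.add_pow_sign[of "F [] (a \<odot>\<^bsub>M\<^esub> x)" 1] by (simp add: zlinD(1))
next
  case (Suc n)
  obtain a b cs where as: "as = a # b # cs" "a \<in> carrier A" "b \<in> carrier A" "cs \<in> tuples A n"
    using Suc.prems(2) by (auto elim!: tuples_SucE)
  let ?t = "\<lambda>F i as. F (take i as @ (as ! i \<otimes>\<^bsub>A\<^esub> as ! Suc i) # drop (i + 2) as) x"
  let ?F = "\<lambda>as. F (a # as)"
  have ml: "ml n ?F" using Suc.prems as by simp
  have bcs: "b # cs \<in> tuples A (Suc n)" using as by simp
  have cl: "?t ?F i (b # cs) \<in> carrier N" if "i < n" for i
  proof (rule ml_closed[OF ml _ Suc.prems(3)])
    have "set (take i (b # cs)) \<subseteq> carrier A" "set (drop (i + 2) (b # cs)) \<subseteq> carrier A"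
      "(b # cs) ! i \<in> carrier A" "(b # cs) ! Suc i \<in> carrier A"
      using bcs that set_take_subset[of i "b # cs"] set_drop_subset[of "i + 2" "b # cs"]
        nth_mem[of i "b # cs"] nth_mem[of "Suc i" "b # cs"]
      by (auto simp: tuples_def simp del: nth_Cons_Suc set_simps(2)) 
    then show "take i (b # cs) @ ((b # cs) ! i \<otimes>\<^bsub>A\<^esub> (b # cs) ! Suc i) # drop (i + 2) (b # cs) \<in> tuples A n"
      using that bcs unfolding tuples_def by (auto simp del: nth_Cons_Suc)
  qed
  have l: "last (b # cs) \<odot>\<^bsub>M\<^esub> x \<in> carrier M" "butlast (b # cs) \<in> tuples A n"
    using bcs last_in_set[of "b # cs"] Suc.prems(3)
    by (auto simp: tuples_def simp del: last.simps butlast.simps dest!: in_set_butlastD)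
  have L: "?F (butlast (b # cs)) (last (b # cs) \<odot>\<^bsub>M\<^esub> x) \<in> carrier N"
    by (rule ml_closed[OF ml l(2,1)])
  have sg: "add_pow N ((-1 :: int) ^ Suc j) y = \<ominus>\<^bsub>N\<^esub> add_pow N ((-1 :: int) ^ j) y" if "y \<in> carrier N" for y j
    using that by (simp add: N.add_pow_sign del: power_Suc)
  have cl': "add_pow N ((-1 :: int) ^ j) y \<in> carrier N" if "y \<in> carrier N" for y j
    using that by (simp add: N.add_pow_sign)
  have F0: "F ((a \<otimes>\<^bsub>A\<^esub> b) # cs) x \<in> carrier N"
    by (rule ml_closed[OF Suc.prems(1)]) (use as Suc.prems in auto)
  let ?S = "\<Oplus>\<^bsub>N\<^esub>i\<in>{..<n}. add_pow N ((-1 :: int) ^ Suc i) (?t ?F i (b # cs))"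
  let ?L = "add_pow N ((-1 :: int) ^ Suc n) (?F (butlast (b # cs)) (last (b # cs) \<odot>\<^bsub>M\<^esub> x))"
  have S: "?S \<in> carrier N" by (intro N.finsum_closed funcsetI cl' cl) simp
  have t0: "?t F 0 as = F ((a \<otimes>\<^bsub>A\<^esub> b) # cs) x" by (simp add: as(1))
  have tS: "?t F (Suc i) as = ?t ?F i (b # cs)" for i by (simp add: as(1))
  have "(\<Oplus>\<^bsub>N\<^esub>i\<in>{..<Suc n}. add_pow N ((-1 :: int) ^ Suc i) (?t F i as)) =
      (\<Oplus>\<^bsub>N\<^esub>i\<in>insert 0 (Suc ` {..<n}). add_pow N ((-1 :: int) ^ Suc i) (?t F i as))"
    by (simp only: lessThan_Suc_eq_insert_0)
  also have "\<dots> = add_pow N ((-1 :: int) ^ Suc 0) (?t F 0 as) \<oplus>\<^bsub>N\<^esub>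
      (\<Oplus>\<^bsub>N\<^esub>i\<in>Suc ` {..<n}. add_pow N ((-1 :: int) ^ Suc i) (?t F i as))"
  proof (rule N.finsum_insert)
    show "(\<lambda>i. add_pow N ((-1 :: int) ^ Suc i) (?t F i as)) \<in> Suc ` {..<n} \<rightarrow> carrier N"
      by (rule funcsetI, elim imageE) (simp only: tS, intro cl' cl, simp)
    show "add_pow N ((-1 :: int) ^ Suc 0) (?t F 0 as) \<in> carrier N" by (simp only: t0 cl'[OF F0])
  qed auto
  also have "(\<Oplus>\<^bsub>N\<^esub>i\<in>Suc ` {..<n}. add_pow N ((-1 :: int) ^ Suc i) (?t F i as)) =
      (\<Oplus>\<^bsub>N\<^esub>i\<in>{..<n}. add_pow N ((-1 :: int) ^ Suc (Suc i)) (?t F (Suc i) as))"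
  proof (rule N.finsum_reindex)
    show "(\<lambda>i. add_pow N ((-1 :: int) ^ Suc i) (?t F i as)) \<in> Suc ` {..<n} \<rightarrow> carrier N"
      by (rule funcsetI, elim imageE) (simp only: tS, intro cl' cl, simp)
  qed simp
  also have "\<dots> = (\<Oplus>\<^bsub>N\<^esub>i\<in>{..<n}. \<ominus>\<^bsub>N\<^esub> add_pow N ((-1 :: int) ^ Suc i) (?t ?F i (b # cs)))"
  proof (rule N.finsum_cong'[OF refl])
    show "(\<lambda>i. \<ominus>\<^bsub>N\<^esub> add_pow N ((-1 :: int) ^ Suc i) (?t ?F i (b # cs))) \<in> {..<n} \<rightarrow> carrier N"
      by (intro funcsetI N.a_inv_closed cl' cl) simp
    fix i assume "i \<in> {..<n}"
    then show "add_pow N ((-1 :: int) ^ Suc (Suc i)) (?t F (Suc i) as) =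
      \<ominus>\<^bsub>N\<^esub> add_pow N ((-1 :: int) ^ Suc i) (?t ?F i (b # cs))"
      unfolding tS by (intro sg cl) simp
  qed
  also have "\<dots> = \<ominus>\<^bsub>N\<^esub> ?S"
    by (rule additive_finsum[OF N.abelian_group_axioms N.abelian_group_axioms, symmetric,
          where h = "\<lambda>y. \<ominus>\<^bsub>N\<^esub> y"], simp, intro cl' cl, simp, simp, simp add: N.minus_add)
  finally have sum: "(\<Oplus>\<^bsub>N\<^esub>i\<in>{..<Suc n}. add_pow N ((-1 :: int) ^ Suc i) (?t F i as)) =
    \<ominus>\<^bsub>N\<^esub> F ((a \<otimes>\<^bsub>A\<^esub> b) # cs) x \<oplus>\<^bsub>N\<^esub> (\<ominus>\<^bsub>N\<^esub> ?S)"
    using N.add_pow_sign[OF F0, of 1] by (simp only: t0) simp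
  have last: "add_pow N ((-1 :: int) ^ Suc (Suc n)) (F (butlast as) (last as \<odot>\<^bsub>M\<^esub> x)) = \<ominus>\<^bsub>N\<^esub> ?L"
    using sg[OF L, of "Suc n"] by (simp add: as(1))
  have "inn F as x = F ((a \<otimes>\<^bsub>A\<^esub> b) # cs) x \<ominus>\<^bsub>N\<^esub> inn ?F (b # cs) x" by (simp add: as(1))
  moreover have "?S \<oplus>\<^bsub>N\<^esub> ?L = \<ominus>\<^bsub>N\<^esub> inn ?F (b # cs) x" by (rule Suc.IH[OF ml bcs Suc.prems(3)])
  moreover have "\<ominus>\<^bsub>N\<^esub> F ((a \<otimes>\<^bsub>A\<^esub> b) # cs) x \<oplus>\<^bsub>N\<^esub> (\<ominus>\<^bsub>N\<^esub> ?S) \<oplus>\<^bsub>N\<^esub> (\<ominus>\<^bsub>N\<^esub> ?L) =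
      \<ominus>\<^bsub>N\<^esub> F ((a \<otimes>\<^bsub>A\<^esub> b) # cs) x \<oplus>\<^bsub>N\<^esub> (\<ominus>\<^bsub>N\<^esub> (?S \<oplus>\<^bsub>N\<^esub> ?L))"
    using F0 S cl'[OF L, of "Suc n"] by (simp add: N.minus_add N.a_assoc del: power_Suc)
  ultimately show ?case
    unfolding sum last using F0 inn_closed[OF ml bcs Suc.prems(3)] by (simp add: N.minus_eq N.minus_add)
qed

lemma bar_diff_mk:
  assumes "ml n F"
  shows "d n (mkn n F) = mkn (Suc n) (dl F)"
proof (rule mk_ext)
  show "d n (mkn n F) \<in> extensional (bar_args A M (Suc n))" by (simp add: bar_diff_def)
  fix as x assume as: "as \<in> tuples A (Suc n)" and x: "x \<in> carrier M"
  define f where "f = mkn n F"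
  have m: "ml n (\<lambda>as x. f (as, x))" by (rule ml_cong[OF assms]) (simp add: f_def)
  have cl: "hd as \<odot>\<^bsub>N\<^esub> f (tl as, x) \<in> carrier N"
    using as x assms by (auto elim!: tuples_SucE simp: f_def ml_closed)
  let ?S = "\<Oplus>\<^bsub>N\<^esub>i\<in>{..<n}. add_pow N ((-1 :: int) ^ Suc i)
             (f (take i as @ (as ! i \<otimes>\<^bsub>A\<^esub> as ! Suc i) # drop (i + 2) as, x))"
  let ?L = "add_pow N ((-1 :: int) ^ Suc n) (f (butlast as, last as \<odot>\<^bsub>M\<^esub> x))"
  have "as \<noteq> []" using as by (auto simp: tuples_def)
  then have l: "last as \<odot>\<^bsub>M\<^esub> x \<in> carrier M" "butlast as \<in> tuples A n"
    using as last_in_set[of as] x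
    by (auto simp: tuples_def simp del: last.simps butlast.simps dest!: in_set_butlastD intro!: M.smult_closed)
  have L: "?L \<in> carrier N"
    using ml_closed[OF m l(2,1)] by (simp add: N.add_pow_sign del: power_Suc)
  have S: "?S \<in> carrier N"
  proof (intro N.finsum_closed funcsetI)
    fix i assume i: "i \<in> {..<n}"
    have "set (take i as) \<subseteq> carrier A" "set (drop (i + 2) as) \<subseteq> carrier A"
      "as ! i \<in> carrier A" "as ! Suc i \<in> carrier A"
      using as i set_take_subset[of i as] set_drop_subset[of "i + 2" as] nth_mem[of i as] nth_mem[of "Suc i" as]
      by (auto simp: tuples_def)
    then have "take i as @ (as ! i \<otimes>\<^bsub>A\<^esub> as ! Suc i) # drop (i + 2) as \<in> tuples A n"
      using i as unfolding tuples_def by auto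
    from ml_closed[OF m this x]
    show "add_pow N ((-1 :: int) ^ Suc i) (f (take i as @ (as ! i \<otimes>\<^bsub>A\<^esub> as ! Suc i) # drop (i + 2) as, x)) \<in> carrier N"
      by (simp add: N.add_pow_sign del: power_Suc)
  qed
  have "d n f (as, x) = hd as \<odot>\<^bsub>N\<^esub> f (tl as, x) \<oplus>\<^bsub>N\<^esub> ?S \<oplus>\<^bsub>N\<^esub> ?L"
    using as x by (simp add: bar_diff_def bar_args_iff)
  also have "\<dots> = hd as \<odot>\<^bsub>N\<^esub> f (tl as, x) \<oplus>\<^bsub>N\<^esub> (?S \<oplus>\<^bsub>N\<^esub> ?L)" by (rule N.a_assoc[OF cl S L])
  also have "\<dots> = dl (\<lambda>as x. f (as, x)) as x"
    using inn_expand[OF m as x] by (simp add: delta_def N.minus_eq)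
  also have "\<dots> = dl F as x" by (rule dl_cong[OF as x]) (simp add: f_def)
  finally show "d n (mkn n F) (as, x) = dl F as x" by (simp add: f_def)
qed

lemma coboundaries_iff: "f \<in> coboundaries C d n \<longleftrightarrow> (\<exists>F. ml n F \<and> bound n F \<and> f = mkn n F)"
proof (cases n)
  case 0
  have "f = mkn 0 (\<lambda>as x. \<zero>\<^bsub>N\<^esub>) \<longleftrightarrow> (\<exists>F. ml 0 F \<and> bound 0 F \<and> f = mkn 0 F)"
    using ml_zero[of 0] bound_zero[of 0] by (auto intro!: mk_cong)
  then show ?thesis by (simp add: coboundaries_def 0 C_zero)
next
  case (Suc m)
  show ?thesis
  proof
    assume "f \<in> coboundaries C d n"
    then obtain H where "ml m H" "f = d m (mkn m H)" by (auto simp: coboundaries_def Suc C_carrier)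
    then show "\<exists>F. ml n F \<and> bound n F \<and> f = mkn n F"
      using bar_diff_mk dl_ml unfolding Suc by (intro exI[of _ "dl H"]) auto
  next
    assume "\<exists>F. ml n F \<and> bound n F \<and> f = mkn n F"
    then obtain F H where "f = mkn n F" "ml m H" "\<forall>as\<in>tuples A (Suc m). \<forall>x\<in>carrier M. F as x = dl H as x"
      by (auto simp: Suc)
    then have "f = d m (mkn m H)" by (auto simp: bar_diff_mk Suc intro!: mk_cong)
    moreover have "mkn m H \<in> carrier (C m)" using \<open>ml m H\<close> C_carrier by blast
    ultimately show "f \<in> coboundaries C d n" by (simp add: coboundaries_def Suc)
  qed
qed

lemma cls_mem:
  assumes "ml n F"
  shows "f \<in> cls n F \<longleftrightarrow> (\<exists>G. ml n G \<and> bound n (\<lambda>as x. G as x \<ominus>\<^bsub>N\<^esub> F as x) \<and> f = mkn n G)"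
proof
  assume "f \<in> cls n F"
  then obtain h where "h \<in> coboundaries C d n" "f = h \<oplus>\<^bsub>C n\<^esub> mkn n F"
    by (auto simp: cls_def cohomology_class_def a_r_coset_def')
  then obtain H where H: "ml n H" "bound n H" "f = mkn n (\<lambda>as x. H as x \<oplus>\<^bsub>N\<^esub> F as x)"
    by (auto simp: coboundaries_iff C_add)
  have "bound n (\<lambda>as x. (H as x \<oplus>\<^bsub>N\<^esub> F as x) \<ominus>\<^bsub>N\<^esub> F as x)"
    by (rule bound_cong[OF H(2)]) (use ml_closed[OF H(1)] ml_closed[OF assms] in \<open>simp add: N_simps N.cancel_simps\<close>)
  then show "\<exists>G. ml n G \<and> bound n (\<lambda>as x. G as x \<ominus>\<^bsub>N\<^esub> F as x) \<and> f = mkn n G"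
    using H ml_add[OF H(1) assms] by blast
next
  assume "\<exists>G. ml n G \<and> bound n (\<lambda>as x. G as x \<ominus>\<^bsub>N\<^esub> F as x) \<and> f = mkn n G"
  then obtain G where G: "ml n G" "bound n (\<lambda>as x. G as x \<ominus>\<^bsub>N\<^esub> F as x)" "f = mkn n G" by blast
  have "f = mkn n (\<lambda>as x. G as x \<ominus>\<^bsub>N\<^esub> F as x) \<oplus>\<^bsub>C n\<^esub> mkn n F"
    unfolding C_add G(3) by (rule mk_cong) (use ml_closed[OF G(1)] ml_closed[OF assms] in \<open>simp add: N_simps N.cancel_simps\<close>)
  moreover have "mkn n (\<lambda>as x. G as x \<ominus>\<^bsub>N\<^esub> F as x) \<in> coboundaries C d n"
    using G ml_minus[OF G(1) assms] by (auto simp: coboundaries_iff)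
  ultimately show "f \<in> cls n F"
    by (auto simp: cls_def cohomology_class_def a_r_coset_def')
qed

lemma bound_minus_refl: "ml n F \<Longrightarrow> bound n (\<lambda>as x. F as x \<ominus>\<^bsub>N\<^esub> F as x)"
  by (rule bound_cong[OF bound_zero]) (simp add: ml_closed N.minus_eq N.r_neg)

lemma bound_minus_sym:
  assumes "ml n F" "ml n G" "bound n (\<lambda>as x. F as x \<ominus>\<^bsub>N\<^esub> G as x)"
  shows "bound n (\<lambda>as x. G as x \<ominus>\<^bsub>N\<^esub> F as x)"
  by (rule bound_cong[OF bound_uminus[OF assms(3)]])
    (use ml_closed[OF assms(1)] ml_closed[OF assms(2)] in \<open>simp add: N_simps N.cancel_simps\<close>)

lemma bound_minus_trans:
  assumes "ml n F" "ml n G" "ml n H" "bound n (\<lambda>as x. F as x \<ominus>\<^bsub>N\<^esub> G as x)" "bound n (\<lambda>as x. G as x \<ominus>\<^bsub>N\<^esub> H as x)"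
  shows "bound n (\<lambda>as x. F as x \<ominus>\<^bsub>N\<^esub> H as x)"
  by (rule bound_cong[OF bound_add[OF assms(4,5)]])
    (use ml_closed[OF assms(1)] ml_closed[OF assms(2)] ml_closed[OF assms(3)] in \<open>simp add: N_simps N.cancel_simps\<close>)

lemma mk_in_cls: "ml n F \<Longrightarrow> mkn n F \<in> cls n F"
  using cls_mem bound_minus_refl by blast

lemma cls_eq:
  assumes "ml n F" "ml n G"
  shows "cls n F = cls n G \<longleftrightarrow> bound n (\<lambda>as x. F as x \<ominus>\<^bsub>N\<^esub> G as x)"
proof
  assume "cls n F = cls n G"
  then have "mkn n F \<in> cls n G" using mk_in_cls[OF assms(1)] by simp
  then obtain H where H: "bound n (\<lambda>as x. H as x \<ominus>\<^bsub>N\<^esub> G as x)" "mkn n F = mkn n H"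
    unfolding cls_mem[OF assms(2)] by blast
  show "bound n (\<lambda>as x. F as x \<ominus>\<^bsub>N\<^esub> G as x)"
    by (rule bound_cong[OF H(1)]) (simp add: mk_eqD[OF H(2)])
next
  assume b: "bound n (\<lambda>as x. F as x \<ominus>\<^bsub>N\<^esub> G as x)"
  note b' = bound_minus_sym[OF assms b]
  show "cls n F = cls n G"
    unfolding set_eq_iff cls_mem[OF assms(1)] cls_mem[OF assms(2)]
    using bound_minus_trans[OF _ assms(1,2) _ b] bound_minus_trans[OF _ assms(2,1) _ b'] by blast
qed

lemma cls_cong: "(\<And>as x. as \<in> tuples A n \<Longrightarrow> x \<in> carrier M \<Longrightarrow> F as x = G as x) \<Longrightarrow> cls n F = cls n G"
  unfolding cls_def by (simp cong: mk_cong)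

abbreviation "E \<equiv> Ext k A M N"

lemma cocycles_iff: "f \<in> cocycles C d n \<longleftrightarrow> (\<exists>F. cocycle n F \<and> f = mkn n F)"
proof
  assume "f \<in> cocycles C d n"
  then obtain F where F: "ml n F" "f = mkn n F" "d n f = \<zero>\<^bsub>C (Suc n)\<^esub>" by (auto simp: cocycles_def C_carrier)
  then have "mkn (Suc n) (dl F) = mkn (Suc n) (\<lambda>as x. \<zero>\<^bsub>N\<^esub>)" by (simp add: bar_diff_mk C_zero)
  then have "cocycle n F" using F(1) mk_eqD[of A M "Suc n" "dl F"] by (simp add: cocyc_def)
  then show "\<exists>F. cocycle n F \<and> f = mkn n F" using F by blast
next
  assume "\<exists>F. cocycle n F \<and> f = mkn n F"
  then obtain F where F: "cocycle n F" "f = mkn n F" by blast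
  then have "d n f = \<zero>\<^bsub>C (Suc n)\<^esub>"
    by (auto simp: bar_diff_mk C_zero cocyc_def intro!: mk_cong)
  then show "f \<in> cocycles C d n" using F cocycle_ml by (auto simp: cocycles_def C_carrier)
qed

lemma E_carrier: "X \<in> carrier (E n) \<longleftrightarrow> (\<exists>F. cocycle n F \<and> X = cls n F)"
proof -
  have "X \<in> carrier (E n) \<longleftrightarrow> (\<exists>f. f \<in> cocycles C d n \<and> X = cohomology_class C d n f)"
    by (auto simp: Ext_def cohomology_def)
  also have "\<dots> \<longleftrightarrow> (\<exists>F. cocycle n F \<and> X = cls n F)" unfolding cocycles_iff cls_def by blast
  finally show ?thesis .
qed

lemma cls_in_E [simp, intro]: "cocycle n F \<Longrightarrow> cls n F \<in> carrier (E n)"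
  by (auto simp: E_carrier)

lemma E_zero: "\<zero>\<^bsub>E n\<^esub> = cls n (\<lambda>as x. \<zero>\<^bsub>N\<^esub>)"
proof -
  have z: "\<And>G. ml n G \<Longrightarrow> bound n (\<lambda>as x. G as x \<ominus>\<^bsub>N\<^esub> \<zero>\<^bsub>N\<^esub>) \<longleftrightarrow> bound n G"
    using N.add.inv_one ml_closed by (auto simp: N.minus_eq elim!: bound_cong[of n])
  show ?thesis
    by (auto simp: Ext_def cohomology_def set_eq_iff coboundaries_iff cls_mem[OF ml_zero] z)
qed

lemma cls_zero_iff: "ml n F \<Longrightarrow> cls n F = \<zero>\<^bsub>E n\<^esub> \<longleftrightarrow> bound n F"
  unfolding E_zero using cls_eq[OF _ ml_zero, of n F] N.add.inv_one ml_closed[of n F]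
  by (auto simp: N.minus_eq elim!: bound_cong[of n])

text \<open>Addition of classes is defined as the sum of cosets as sets, so both inclusions have to
  be checked on representatives.\<close>

lemma E_add:
  assumes "ml n F" "ml n G"
  shows "cls n F \<oplus>\<^bsub>E n\<^esub> cls n G = cls n (\<lambda>as x. F as x \<oplus>\<^bsub>N\<^esub> G as x)"
proof -
  have "cls n F \<oplus>\<^bsub>E n\<^esub> cls n G = (\<Union>f\<in>cls n F. \<Union>g\<in>cls n G. {f \<oplus>\<^bsub>C n\<^esub> g})"
    by (simp add: Ext_def cohomology_def set_add_def')
  also have "\<dots> = cls n (\<lambda>as x. F as x \<oplus>\<^bsub>N\<^esub> G as x)"
  proof (intro equalityI subsetI)
    fix f assume "f \<in> (\<Union>f\<in>cls n F. \<Union>g\<in>cls n G. {f \<oplus>\<^bsub>C n\<^esub> g})"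
    then obtain F' G' where F': "ml n F'" "bound n (\<lambda>as x. F' as x \<ominus>\<^bsub>N\<^esub> F as x)"
      and G': "ml n G'" "bound n (\<lambda>as x. G' as x \<ominus>\<^bsub>N\<^esub> G as x)"
      and f: "f = mkn n (\<lambda>as x. F' as x \<oplus>\<^bsub>N\<^esub> G' as x)"
      unfolding cls_mem[OF assms(1)] cls_mem[OF assms(2)] UN_iff by (auto simp: C_add cls_mem assms)
    have "bound n (\<lambda>as x. (F' as x \<oplus>\<^bsub>N\<^esub> G' as x) \<ominus>\<^bsub>N\<^esub> (F as x \<oplus>\<^bsub>N\<^esub> G as x))"
      by (rule bound_cong[OF bound_add[OF F'(2) G'(2)]])
        (use ml_closed[OF F'(1)] ml_closed[OF G'(1)] ml_closed[OF assms(1)] ml_closed[OF assms(2)]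
          in \<open>simp add: N_simps N.cancel_simps\<close>)
    then show "f \<in> cls n (\<lambda>as x. F as x \<oplus>\<^bsub>N\<^esub> G as x)"
      unfolding cls_mem[OF ml_add[OF assms]] using f ml_add[OF F'(1) G'(1)] by blast
  next
    fix f assume "f \<in> cls n (\<lambda>as x. F as x \<oplus>\<^bsub>N\<^esub> G as x)"
    then obtain H where H: "ml n H" "bound n (\<lambda>as x. H as x \<ominus>\<^bsub>N\<^esub> (F as x \<oplus>\<^bsub>N\<^esub> G as x))" "f = mkn n H"
      unfolding cls_mem[OF ml_add[OF assms]] by blast
    \<comment> \<open>A representative \<open>H\<close> of the sum is split as \<open>H\<close>
      minus \<open>G\<close>, which represents the first class, plus \<open>G\<close>
      itself.\<close>
    have "bound n (\<lambda>as x. (H as x \<ominus>\<^bsub>N\<^esub> G as x) \<ominus>\<^bsub>N\<^esub> F as x)"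
      by (rule bound_cong[OF H(2)])
        (use ml_closed[OF H(1)] ml_closed[OF assms(1)] ml_closed[OF assms(2)] in \<open>simp add: N_simps N.cancel_simps\<close>)
    then have 1: "mkn n (\<lambda>as x. H as x \<ominus>\<^bsub>N\<^esub> G as x) \<in> cls n F"
      unfolding cls_mem[OF assms(1)] using ml_minus[OF H(1) assms(2)] by blast
    have "f = mkn n (\<lambda>as x. H as x \<ominus>\<^bsub>N\<^esub> G as x) \<oplus>\<^bsub>C n\<^esub> mkn n G"
      unfolding H(3) C_add
      by (rule mk_cong) (use ml_closed[OF H(1)] ml_closed[OF assms(2)] in \<open>simp add: N_simps N.cancel_simps\<close>)
    then show "f \<in> (\<Union>f\<in>cls n F. \<Union>g\<in>cls n G. {f \<oplus>\<^bsub>C n\<^esub> g})"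
      using 1 mk_in_cls[OF assms(2)] by blast
  qed
  finally show ?thesis .
qed

lemma E_group: "abelian_group (E n)"
proof (rule abelian_groupI)
  show "\<zero>\<^bsub>E n\<^esub> \<in> carrier (E n)" by (simp add: E_zero cocycle_zero)
next
  fix X Y assume "X \<in> carrier (E n)" "Y \<in> carrier (E n)"
  then obtain F G where F: "cocycle n F" "X = cls n F" and G: "cocycle n G" "Y = cls n G"
    by (auto simp: E_carrier)
  show "X \<oplus>\<^bsub>E n\<^esub> Y \<in> carrier (E n)"
    unfolding F G by (simp add: E_add cocycle_ml F G cocycle_add)
  show "X \<oplus>\<^bsub>E n\<^esub> Y = Y \<oplus>\<^bsub>E n\<^esub> X"
    unfolding F G using ml_closed[OF cocycle_ml[OF F(1)]] ml_closed[OF cocycle_ml[OF G(1)]]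
    by (simp add: E_add cocycle_ml F G) (intro cls_cong, simp add: N.a_comm)
  fix W assume "W \<in> carrier (E n)"
  then obtain H where H: "cocycle n H" "W = cls n H" by (auto simp: E_carrier)
  show "X \<oplus>\<^bsub>E n\<^esub> Y \<oplus>\<^bsub>E n\<^esub> W = X \<oplus>\<^bsub>E n\<^esub> (Y \<oplus>\<^bsub>E n\<^esub> W)"
    unfolding F G H
    using ml_closed[OF cocycle_ml[OF F(1)]] ml_closed[OF cocycle_ml[OF G(1)]] ml_closed[OF cocycle_ml[OF H(1)]]
    by (simp add: E_add cocycle_ml F G H ml_add) (intro cls_cong, simp add: N.a_assoc)
next
  fix X assume "X \<in> carrier (E n)"
  then obtain F where F: "cocycle n F" "X = cls n F" by (auto simp: E_carrier)
  note cl = ml_closed[OF cocycle_ml[OF F(1)]]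
  show "\<zero>\<^bsub>E n\<^esub> \<oplus>\<^bsub>E n\<^esub> X = X"
    unfolding F E_zero by (simp add: E_add cocycle_ml F ml_zero) (intro cls_cong, simp add: cl)
  have "cls n (\<lambda>as x. \<ominus>\<^bsub>N\<^esub> F as x) \<oplus>\<^bsub>E n\<^esub> X = \<zero>\<^bsub>E n\<^esub>"
    unfolding F E_zero by (simp add: E_add cocycle_ml F ml_uminus) (intro cls_cong, simp add: cl N.l_neg)
  then show "\<exists>Y\<in>carrier (E n). Y \<oplus>\<^bsub>E n\<^esub> X = \<zero>\<^bsub>E n\<^esub>"
    using cocycle_uminus[OF F(1)] by blast
qed

lemma E_finsum:
  assumes "finite I" "\<And>i. i \<in> I \<Longrightarrow> cocycle n (F i)"
  shows "(\<Oplus>\<^bsub>E n\<^esub>i\<in>I. cls n (F i)) = cls n (\<lambda>as x. \<Oplus>\<^bsub>N\<^esub>i\<in>I. F i as x)"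
proof -
  interpret E: abelian_group "E n" by (rule E_group)
  show ?thesis using assms
  proof (induction I rule: finite_induct)
    case empty
    then show ?case by (simp add: E_zero)
  next
    case (insert i I)
    have "(\<Oplus>\<^bsub>E n\<^esub>i\<in>insert i I. cls n (F i)) = cls n (F i) \<oplus>\<^bsub>E n\<^esub> cls n (\<lambda>as x. \<Oplus>\<^bsub>N\<^esub>i\<in>I. F i as x)"
      using insert by (subst E.finsum_insert) auto
    also have "\<dots> = cls n (\<lambda>as x. F i as x \<oplus>\<^bsub>N\<^esub> (\<Oplus>\<^bsub>N\<^esub>i\<in>I. F i as x))"
      by (rule E_add) (use insert in \<open>auto intro!: ml_finsum intro: cocycle_ml\<close>)
    also have "\<dots> = cls n (\<lambda>as x. \<Oplus>\<^bsub>N\<^esub>i\<in>insert i I. F i as x)"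
      by (rule cls_cong, rule N.finsum_insert[symmetric])
        (use insert in \<open>auto dest!: cocycle_ml dest: ml_closed\<close>)
    finally show ?case .
  qed
qed

text \<open>The action on \<open>cohomology\<close> is a union over all representatives, so it has
  to be shown that each gives the same class. A scalar is central, hence commutes with the outer
  term of the differential and preserves cocycles and coboundaries.\<close>

lemma E_smult:
  assumes "cocycle n F" "c \<in> carrier k"
  shows "c \<odot>\<^bsub>E n\<^esub> cls n F = cls n (\<lambda>as x. (c \<odot>\<^bsub>A\<^esub> \<one>\<^bsub>A\<^esub>) \<odot>\<^bsub>N\<^esub> F as x)"
    and "cocycle n (\<lambda>as x. (c \<odot>\<^bsub>A\<^esub> \<one>\<^bsub>A\<^esub>) \<odot>\<^bsub>N\<^esub> F as x)"
proof -
  let ?c = "c \<odot>\<^bsub>A\<^esub> \<one>\<^bsub>A\<^esub>"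
  have c: "?c \<in> carrier A" "?c \<in> scal k A" using assms by (auto simp: scal_def)
  have dl: "dl (\<lambda>as x. ?c \<odot>\<^bsub>N\<^esub> H as x) as x = ?c \<odot>\<^bsub>N\<^esub> dl H as x"
    if H: "ml n H" "as \<in> tuples A (Suc n)" "x \<in> carrier M" for H n as x
  proof -
    obtain b bs where as: "as = b # bs" "b \<in> carrier A" "bs \<in> tuples A n" using H(2) by (rule tuples_SucE)
    show ?thesis
      using inn_smult[OF H(1) c(1) H(2,3)] inn_closed[OF H] ml_closed[OF H(1) as(3) H(3)]
        Z_smult[OF c(2) as(2), of "H bs x"] as(2) c(1)
      by (simp add: delta_def as(1) N.minus_eq N.smult_r_distr N.smult_r_minus)
  qed
  show 2: "cocycle n (\<lambda>as x. ?c \<odot>\<^bsub>N\<^esub> F as x)"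
    unfolding cocyc_def
  proof (intro conjI ballI)
    show "ml n (\<lambda>as x. ?c \<odot>\<^bsub>N\<^esub> F as x)" by (rule ml_smult[OF cocycle_ml[OF assms(1)] c(1)])
    fix as x assume as: "as \<in> tuples A (Suc n)" "x \<in> carrier M"
    show "dl (\<lambda>as x. ?c \<odot>\<^bsub>N\<^esub> F as x) as x = \<zero>\<^bsub>N\<^esub>"
      unfolding dl[OF cocycle_ml[OF assms(1)] as] cocycle_dl[OF assms(1) as] by (rule N.smult_r_null[OF c(1)])
  qed
  have bs: "bound n (\<lambda>as x. ?c \<odot>\<^bsub>N\<^esub> G as x)" if G: "bound n G" for G
  proof (cases n)
    case 0
    then show ?thesis using G c by (simp add: N.smult_r_null)
  next
    case (Suc m)
    obtain H where H: "ml m H" "\<forall>as\<in>tuples A (Suc m). \<forall>x\<in>carrier M. G as x = dl H as x"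
      using G Suc by auto
    then have "ml m (\<lambda>as x. ?c \<odot>\<^bsub>N\<^esub> H as x) \<and> (\<forall>as\<in>tuples A (Suc m). \<forall>x\<in>carrier M.
        ?c \<odot>\<^bsub>N\<^esub> G as x = dl (\<lambda>as x. ?c \<odot>\<^bsub>N\<^esub> H as x) as x)"
      using c by (simp add: ml_smult dl)
    then show ?thesis unfolding Suc bnd.simps by blast
  qed
  have "c \<odot>\<^bsub>E n\<^esub> cls n F = (\<Union>f\<in>cls n F. cohomology_class C d n (c \<odot>\<^bsub>C n\<^esub> f))"
    by (simp add: Ext_def cohomology_def)
  moreover have "cohomology_class C d n (c \<odot>\<^bsub>C n\<^esub> f) = cls n (\<lambda>as x. ?c \<odot>\<^bsub>N\<^esub> F as x)"
    if "f \<in> cls n F" for f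
  proof -
    obtain G where G: "ml n G" "bound n (\<lambda>as x. G as x \<ominus>\<^bsub>N\<^esub> F as x)" "f = mkn n G"
      using \<open>f \<in> cls n F\<close> cls_mem[OF cocycle_ml[OF assms(1)]] by blast
    have "cohomology_class C d n (c \<odot>\<^bsub>C n\<^esub> f) = cls n (\<lambda>as x. ?c \<odot>\<^bsub>N\<^esub> G as x)"
      by (simp add: cls_def G(3) C_smult base_smult_def)
    also have "\<dots> = cls n (\<lambda>as x. ?c \<odot>\<^bsub>N\<^esub> F as x)"
      unfolding cls_eq[OF ml_smult[OF G(1) c(1)] ml_smult[OF cocycle_ml[OF assms(1)] c(1)]]
      by (rule bound_cong[OF bs[OF G(2)]])
        (use ml_closed[OF G(1)] ml_closed[OF cocycle_ml[OF assms(1)]] c(1)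
          in \<open>simp add: N.minus_eq N.smult_r_distr N.smult_r_minus\<close>)
    finally show ?thesis .
  qed
  ultimately show "c \<odot>\<^bsub>E n\<^esub> cls n F = cls n (\<lambda>as x. ?c \<odot>\<^bsub>N\<^esub> F as x)"
    using mk_in_cls[OF cocycle_ml[OF assms(1)]] by blast
qed

end

locale ext_pair = F: extl k A M N + G: extl k A N P
  for k :: "('k, 'w) ring_scheme" and A :: "('k, 'a, 'x) graded_scheme" and M :: "('a, 'm, 'y) graded_scheme"
    and N :: "('a, 'n, 'z) graded_scheme" and P :: "('a, 'p, 'v) graded_scheme"
begin

sublocale bar_pair A M N P "scal k A" ..

sublocale H: extl k A M P
  by (rule extl.intro[OF F.galg_axioms extl_axioms.intro[OF F.mod_M G.mod_N]])

text \<open>\<open>ext_comp\<close> is a union over all representatives. They all give one class, as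
  g' f' - g f = (g' - g) f + g' (f' - f) and both summands bound; for the second one,
  \<open>G'\<close> has to be a cocycle as well.\<close>

lemma ext_comp_cls:
  assumes "G.cocycle m G" "F.cocycle n F"
  shows "ext_comp k A M P m n (G.cls m G) (F.cls n F) = H.cls (m + n) (ycomp m G F)"
proof -
  have "cohomology_class (bar_cochains k A M P) (bar_diff A M P) (m + n) (cochain_comp A M m n g f)
      = H.cls (m + n) (ycomp m G F)" if g: "g \<in> G.cls m G" and f: "f \<in> F.cls n F" for g f
  proof -
    note mlG = G.cocycle_ml[OF assms(1)] and mlF = F.cocycle_ml[OF assms(2)]
    obtain G' where G': "G.ml m G'" "G.bound m (\<lambda>as x. G' as x \<ominus>\<^bsub>P\<^esub> G as x)" "g = mk A N m G'"
      using g unfolding G.cls_mem[OF mlG] by blast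
    obtain F' where F': "F.ml n F'" "F.bound n (\<lambda>as x. F' as x \<ominus>\<^bsub>N\<^esub> F as x)" "f = mk A M n F'"
      using f unfolding F.cls_mem[OF mlF] by blast
    have "cochain_comp A M m n g f = mk A M (m + n) (ycomp m G' F')"
    proof (rule mk_ext)
      fix as x assume as: "as \<in> tuples A (m + n)" "x \<in> carrier M"
      then obtain us vs where as': "as = us @ vs" "us \<in> tuples A m" "vs \<in> tuples A n"
        by (auto elim: tuples_append)
      have "F' vs x \<in> carrier N" by (rule F.ml_closed[OF F'(1) as'(3) as(2)])
      then show "cochain_comp A M m n g f (as, x) = ycomp m G' F' as x"
        using as as' by (simp add: cochain_comp_def bar_args_iff G'(3) F'(3) comp_append length_tuples)
    qed (simp add: cochain_comp_def)
    then have "cohomology_class (bar_cochains k A M P) (bar_diff A M P) (m + n) (cochain_comp A M m n g f)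
      = H.cls (m + n) (ycomp m G' F')" by (simp add: H.cls_def)
    also have "\<dots> = H.cls (m + n) (ycomp m G F)"
      unfolding H.cls_eq[OF comp_ml[OF G'(1) F'(1)] comp_ml[OF mlG mlF]]
    proof -
      have cG': "G.cocycle m G'"
        by (rule G.cocycle_cong[OF G.cocycle_add[OF G.bound_cocycle[OF G'(2) G.ml_minus[OF G'(1) mlG]] assms(1)]])
          (use G.ml_closed[OF G'(1)] G.ml_closed[OF mlG] in \<open>simp add: G.N_simps G.N.cancel_simps\<close>)
      have 1: "H.bound (m + n) (ycomp m (\<lambda>as x. G' as x \<ominus>\<^bsub>P\<^esub> G as x) F)"
        by (rule comp_bound_left[OF G'(2) assms(2)])
      have 2: "H.bound (m + n) (ycomp m G' (\<lambda>as x. F' as x \<ominus>\<^bsub>N\<^esub> F as x))"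
        by (rule comp_bound_right[OF cG' F'(2)])
      show "H.bound (m + n) (\<lambda>as x. ycomp m G' F' as x \<ominus>\<^bsub>P\<^esub> ycomp m G F as x)"
      proof (rule H.bound_cong[OF H.bound_add[OF 1 2]])
        fix as x assume as: "as \<in> tuples A (m + n)" "x \<in> carrier M"
        then obtain us vs where as': "as = us @ vs" "us \<in> tuples A m" "vs \<in> tuples A n"
          by (auto elim: tuples_append)
        have y: "F' vs x \<in> carrier N" "F vs x \<in> carrier N"
          using F.ml_closed[OF F'(1) as'(3) as(2)] F.ml_closed[OF mlF as'(3) as(2)] by auto
        have "G' us (F' vs x \<ominus>\<^bsub>N\<^esub> F vs x) = G' us (F' vs x) \<ominus>\<^bsub>P\<^esub> G' us (F vs x)"
          using G.ml_add_last[OF G'(1) as'(2) y(1) F.N.a_inv_closed[OF y(2)]]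
            additive_minus[OF F.N.abelian_group_axioms G.N.abelian_group_axioms y(2), of "G' us"]
            G.ml_closed[OF G'(1) as'(2)] G.ml_add_last[OF G'(1) as'(2)]
          by (simp add: F.N.minus_eq G.N.minus_eq)
        then show "ycomp m G' F' as x \<ominus>\<^bsub>P\<^esub> ycomp m G F as x =
            ycomp m (\<lambda>as x. G' as x \<ominus>\<^bsub>P\<^esub> G as x) F as x \<oplus>\<^bsub>P\<^esub>
            ycomp m G' (\<lambda>as x. F' as x \<ominus>\<^bsub>N\<^esub> F as x) as x"
          using as' y G.ml_closed[OF G'(1) as'(2)] G.ml_closed[OF mlG as'(2)]
          by (simp add: comp_append G.N_simps G.N.cancel_simps)
      qed
    qed
    finally show ?thesis .
  qed
  then show ?thesis
    unfolding ext_comp_def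
    using G.mk_in_cls[OF G.cocycle_ml[OF assms(1)]] F.mk_in_cls[OF F.cocycle_ml[OF assms(2)]] by blast
qed

end

section \<open>Total Ext\<close>

context extl
begin

definition single :: "nat \<Rightarrow> ('a list \<Rightarrow> 'm \<Rightarrow> 'n) \<Rightarrow> nat \<Rightarrow> ('a list \<times> 'm \<Rightarrow> 'n) set" where
  "single n F = (\<lambda>m. if m = n then cls n F else \<zero>\<^bsub>E m\<^esub>)"

end

text \<open>\<open>koszul_dual\<close> and \<open>ext_module\<close> have the same underlying graded
  group as \<open>total_ext\<close> but different multiplicative structure. The locale fixes only
  the common part, so that both are instances.\<close>

locale tot = extl k A M N
  for k :: "('k, 'w) ring_scheme" and A :: "('k, 'a, 'x) graded_scheme" and M :: "('a, 'm, 'y) graded_scheme"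
    and N :: "('a, 'n, 'z) graded_scheme" +
  fixes X :: "('r, nat \<Rightarrow> ('a list \<times> 'm \<Rightarrow> 'n) set, 'v) graded_scheme"
  assumes X_carrier: "carrier X = {\<phi>. (\<forall>n. \<phi> n \<in> carrier (E n)) \<and> finite {n. \<phi> n \<noteq> \<zero>\<^bsub>E n\<^esub>}}"
    and X_zero: "\<zero>\<^bsub>X\<^esub> = (\<lambda>n. \<zero>\<^bsub>E n\<^esub>)"
    and X_add: "\<And>\<phi> \<psi>. \<phi> \<oplus>\<^bsub>X\<^esub> \<psi> = (\<lambda>n. \<phi> n \<oplus>\<^bsub>E n\<^esub> \<psi> n)"
    and X_hcomp: "\<And>i. hcomp X i = {\<phi> \<in> carrier X. \<forall>n. int n \<noteq> i \<longrightarrow> \<phi> n = \<zero>\<^bsub>E n\<^esub>}"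
begin

lemma E_uminus_zero: "\<ominus>\<^bsub>E n\<^esub> \<zero>\<^bsub>E n\<^esub> = \<zero>\<^bsub>E n\<^esub>"
proof -
  interpret En: abelian_group "E n" by (rule E_group)
  show ?thesis by (simp add: a_inv_def)
qed

lemma X_group: "abelian_group X"
proof (rule abelian_groupI)
  fix \<phi> \<psi> assume p: "\<phi> \<in> carrier X" "\<psi> \<in> carrier X"
  have "{n. \<phi> n \<oplus>\<^bsub>E n\<^esub> \<psi> n \<noteq> \<zero>\<^bsub>E n\<^esub>} \<subseteq> {n. \<phi> n \<noteq> \<zero>\<^bsub>E n\<^esub>} \<union> {n. \<psi> n \<noteq> \<zero>\<^bsub>E n\<^esub>}"
    using abelian_groupE(2,5)[OF E_group] by auto
  then show "\<phi> \<oplus>\<^bsub>X\<^esub> \<psi> \<in> carrier X"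
    using p abelian_groupE(1)[OF E_group] by (auto simp: X_carrier X_add intro: finite_subset)
  show "\<phi> \<oplus>\<^bsub>X\<^esub> \<psi> = \<psi> \<oplus>\<^bsub>X\<^esub> \<phi>"
    using p abelian_groupE(4)[OF E_group] by (auto simp: X_carrier X_add)
  fix \<theta> assume "\<theta> \<in> carrier X"
  then show "\<phi> \<oplus>\<^bsub>X\<^esub> \<psi> \<oplus>\<^bsub>X\<^esub> \<theta> = \<phi> \<oplus>\<^bsub>X\<^esub> (\<psi> \<oplus>\<^bsub>X\<^esub> \<theta>)"
    using p abelian_groupE(3)[OF E_group] by (auto simp: X_carrier X_add)
next
  show "\<zero>\<^bsub>X\<^esub> \<in> carrier X"
    using abelian_groupE(2)[OF E_group] by (auto simp: X_carrier X_zero)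
next
  fix \<phi> assume p: "\<phi> \<in> carrier X"
  then show "\<zero>\<^bsub>X\<^esub> \<oplus>\<^bsub>X\<^esub> \<phi> = \<phi>"
    using abelian_groupE(5)[OF E_group] by (auto simp: X_carrier X_add X_zero)
  have "(\<lambda>n. \<ominus>\<^bsub>E n\<^esub> \<phi> n) \<in> carrier X"
  proof -
    have "{n. \<ominus>\<^bsub>E n\<^esub> \<phi> n \<noteq> \<zero>\<^bsub>E n\<^esub>} \<subseteq> {n. \<phi> n \<noteq> \<zero>\<^bsub>E n\<^esub>}"
      using E_uminus_zero by auto
    then show ?thesis
      using p abelian_group.a_inv_closed[OF E_group] by (auto simp: X_carrier intro: finite_subset)
  qed
  moreover have "(\<lambda>n. \<ominus>\<^bsub>E n\<^esub> \<phi> n) \<oplus>\<^bsub>X\<^esub> \<phi> = \<zero>\<^bsub>X\<^esub>"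
    using p abelian_group.l_neg[OF E_group] by (auto simp: X_carrier X_add X_zero)
  ultimately show "\<exists>\<psi>\<in>carrier X. \<psi> \<oplus>\<^bsub>X\<^esub> \<phi> = \<zero>\<^bsub>X\<^esub>" by blast
qed

sublocale X: abelian_group X by (rule X_group)

lemma X_apply: "\<phi> \<in> carrier X \<Longrightarrow> \<phi> n \<in> carrier (E n)"
  by (simp add: X_carrier)

lemma X_uminus: "\<phi> \<in> carrier X \<Longrightarrow> (\<ominus>\<^bsub>X\<^esub> \<phi>) n = \<ominus>\<^bsub>E n\<^esub> \<phi> n"
  by (rule additive_minus[OF X_group E_group, where h = "\<lambda>\<phi>. \<phi> n"])
    (assumption, erule X_apply, simp add: X_add)

lemma X_finsum:
  assumes "finite I" "\<And>i. i \<in> I \<Longrightarrow> \<phi> i \<in> carrier X"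
  shows "(\<Oplus>\<^bsub>X\<^esub>i\<in>I. \<phi> i) n = (\<Oplus>\<^bsub>E n\<^esub>i\<in>I. \<phi> i n)"
  by (rule additive_finsum[OF X_group E_group, where h = "\<lambda>\<phi>. \<phi> n"])
    (fact assms(1), erule assms(2), erule X_apply, simp add: X_add)

definition comp_at :: "int \<Rightarrow> (nat \<Rightarrow> ('a list \<times> 'm \<Rightarrow> 'n) set) \<Rightarrow> nat \<Rightarrow> ('a list \<times> 'm \<Rightarrow> 'n) set" where
  "comp_at i \<phi> = (\<lambda>n. if int n = i then \<phi> n else \<zero>\<^bsub>E n\<^esub>)"

lemma comp_at_hcomp: "\<phi> \<in> carrier X \<Longrightarrow> comp_at i \<phi> \<in> hcomp X i"
proof -
  assume p: "\<phi> \<in> carrier X"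
  have "{n. comp_at i \<phi> n \<noteq> \<zero>\<^bsub>E n\<^esub>} \<subseteq> {n. \<phi> n \<noteq> \<zero>\<^bsub>E n\<^esub>}" by (auto simp: comp_at_def)
  then have fin: "finite {n. comp_at i \<phi> n \<noteq> \<zero>\<^bsub>E n\<^esub>}"
    by (rule finite_subset) (use p in \<open>simp add: X_carrier\<close>)
  have "comp_at i \<phi> n \<in> carrier (E n)" for n
    using X_apply[OF p, of n] abelian_groupE(2)[OF E_group, of n] by (simp add: comp_at_def)
  with fin have "comp_at i \<phi> \<in> carrier X" by (simp add: X_carrier)
  then show ?thesis by (simp add: X_hcomp comp_at_def)
qed

text \<open>Evaluation at \<open>n\<close> is additive and kills all components but the one in
  degree \<open>n\<close>, which is therefore forced to be \<open>comp_at\<close>.\<close>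

lemma X_decomp:
  assumes p: "\<phi> \<in> carrier X"
  shows "is_decomposition X (hcomp X) \<phi> c \<longleftrightarrow> c = (\<lambda>i. comp_at i \<phi>)"
proof
  assume c: "is_decomposition X (hcomp X) \<phi> c"
  let ?S = "{i. c i \<noteq> \<zero>\<^bsub>X\<^esub>}"
  have cX: "c i \<in> carrier X" for i using c by (auto simp: is_decomposition_def X_hcomp)
  have "c i n = comp_at i \<phi> n" for i n
  proof (cases "int n = i")
    case False
    then show ?thesis using c by (auto simp: is_decomposition_def X_hcomp comp_at_def)
  next
    case True
    interpret En: abelian_group "E n" by (rule E_group)
    have fin: "finite ?S" and ph: "\<phi> = (\<Oplus>\<^bsub>X\<^esub>i\<in>?S. c i)" using c by (simp_all add: is_decomposition_def)
    have z: "c j n = \<zero>\<^bsub>E n\<^esub>" if "j \<noteq> i" for j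
      using c that True by (auto simp: is_decomposition_def X_hcomp)
    have "\<phi> n = (\<Oplus>\<^bsub>E n\<^esub>j\<in>?S. c j n)"
      using X_finsum[of ?S c n] fin cX ph by simp
    also have "\<dots> = (\<Oplus>\<^bsub>E n\<^esub>j\<in>insert i ?S. c j n)"
    proof (cases "i \<in> ?S")
      case False
      then have "c i n = \<zero>\<^bsub>E n\<^esub>" by (simp add: X_zero)
      then show ?thesis using False fin X_apply[OF cX] by (subst En.finsum_insert) auto
    qed (simp add: insert_absorb)
    also have "\<dots> = (\<Oplus>\<^bsub>E n\<^esub>j\<in>insert i ?S. if i = j then c j n else \<zero>\<^bsub>E n\<^esub>)"
      by (rule En.finsum_cong') (use z X_apply[OF cX] in auto)
    also have "\<dots> = c i n" by (rule En.finsum_singleton) (use fin X_apply[OF cX] in auto)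
    finally show ?thesis using True by (simp add: comp_at_def)
  qed
  then show "c = (\<lambda>i. comp_at i \<phi>)" by (intro ext)
next
  assume c: "c = (\<lambda>i. comp_at i \<phi>)"
  let ?S = "{i. c i \<noteq> \<zero>\<^bsub>X\<^esub>}"
  have sub: "?S \<subseteq> int ` {n. \<phi> n \<noteq> \<zero>\<^bsub>E n\<^esub>}"
  proof
    fix i assume "i \<in> ?S"
    then obtain n where "c i n \<noteq> \<zero>\<^bsub>E n\<^esub>" by (auto simp: X_zero fun_eq_iff)
    then show "i \<in> int ` {n. \<phi> n \<noteq> \<zero>\<^bsub>E n\<^esub>}" by (auto simp: c comp_at_def split: if_splits)
  qed
  then have fin: "finite ?S" using p finite_subset by (auto simp: X_carrier)
  have cX: "c i \<in> carrier X" for i using comp_at_hcomp[OF p, of i] by (simp add: c X_hcomp)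
  have "\<phi> n = (\<Oplus>\<^bsub>X\<^esub>i\<in>?S. c i) n" for n
  proof -
    interpret En: abelian_group "E n" by (rule E_group)
    have "(\<Oplus>\<^bsub>X\<^esub>i\<in>?S. c i) n = (\<Oplus>\<^bsub>E n\<^esub>j\<in>?S. c j n)" by (rule X_finsum) (use fin cX in auto)
    also have "\<dots> = (\<Oplus>\<^bsub>E n\<^esub>j\<in>insert (int n) ?S. c j n)"
    proof (cases "int n \<in> ?S")
      case False
      then have "c (int n) n = \<zero>\<^bsub>E n\<^esub>" by (simp add: X_zero)
      then show ?thesis using False fin X_apply[OF cX] by (subst En.finsum_insert) auto
    qed (simp add: insert_absorb)
    also have "\<dots> = (\<Oplus>\<^bsub>E n\<^esub>j\<in>insert (int n) ?S. if int n = j then \<phi> n else \<zero>\<^bsub>E n\<^esub>)"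
      by (simp add: c comp_at_def)
    also have "\<dots> = \<phi> n" by (rule En.finsum_singleton) (use fin X_apply[OF p] in auto)
    finally show ?thesis by simp
  qed
  then have "\<phi> = (\<Oplus>\<^bsub>X\<^esub>i\<in>?S. c i)" by (rule ext)
  then show "is_decomposition X (hcomp X) \<phi> c"
    using fin comp_at_hcomp[OF p] unfolding is_decomposition_def by (simp add: c)
qed

lemma X_internal: "internal_direct_sum X (hcomp X)"
  unfolding internal_direct_sum_def
proof (intro conjI allI ballI)
  fix i
  have sub: "hcomp X i \<subseteq> carrier X" by (auto simp: X_hcomp)
  have "subgroup (hcomp X i) (add_monoid X)"
  proof (rule group.subgroupI[OF X.a_group])
    show "hcomp X i \<subseteq> carrier (add_monoid X)" using sub by simp
    have "\<zero>\<^bsub>X\<^esub> \<in> hcomp X i" using X.zero_closed by (simp add: X_hcomp X_zero)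
    then show "hcomp X i \<noteq> {}" by blast
    fix \<phi> assume p: "\<phi> \<in> hcomp X i"
    have "\<ominus>\<^bsub>X\<^esub> \<phi> \<in> hcomp X i"
      using p by (auto simp: X_hcomp X_uminus E_uminus_zero)
    then show "inv\<^bsub>add_monoid X\<^esub> \<phi> \<in> hcomp X i" by (simp add: a_inv_def)
    fix \<psi> assume "\<psi> \<in> hcomp X i"
    then show "\<phi> \<otimes>\<^bsub>add_monoid X\<^esub> \<psi> \<in> hcomp X i"
      using p abelian_groupE(2,5)[OF E_group] X.a_closed[of \<phi> \<psi>] by (auto simp: X_hcomp X_add)
  qed
  then show "additive_subgroup (hcomp X i) X" by (rule additive_subgroup.intro)
next
  fix \<phi> assume "\<phi> \<in> carrier X"
  then show "\<exists>!c. is_decomposition X (hcomp X) \<phi> c" using X_decomp by simp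
qed

lemma X_graded: "graded_group X"
  by (rule graded_group.intro[OF X_group]) (simp add: graded_group_axioms_def X_internal)

sublocale X: graded_group X by (rule X_graded)

lemma X_hp: "\<phi> \<in> carrier X \<Longrightarrow> homog_part X i \<phi> = comp_at i \<phi>"
  unfolding homog_part_def by (subst the_equality[of _ "\<lambda>i. comp_at i \<phi>"]) (use X_decomp[of \<phi>] in auto)

lemma X_reps:
  assumes "\<phi> \<in> carrier X"
  obtains f where "\<And>n. cocycle n (f n)" "\<And>n. \<phi> n = cls n (f n)"
proof -
  have "\<forall>n. \<exists>F. cocycle n F \<and> \<phi> n = cls n F" using X_apply[OF assms] by (simp add: E_carrier)
  then show thesis using that by metis
qed

lemma single_hcomp: "cocycle n F \<Longrightarrow> single n F \<in> hcomp X (int n)"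
proof -
  assume F: "cocycle n F"
  have "{m. single n F m \<noteq> \<zero>\<^bsub>E m\<^esub>} \<subseteq> {n}" by (auto simp: single_def)
  then have "finite {m. single n F m \<noteq> \<zero>\<^bsub>E m\<^esub>}" by (rule finite_subset) simp
  then show ?thesis
    using F abelian_groupE(2)[OF E_group] by (auto simp: X_hcomp X_carrier single_def)
qed

lemma single_closed: "cocycle n F \<Longrightarrow> single n F \<in> carrier X"
  using single_hcomp by (simp add: X_hcomp)

lemma hcomp_single:
  assumes "\<phi> \<in> hcomp X (int n)"
  obtains F where "cocycle n F" "\<phi> = single n F"
proof -
  obtain F where F: "cocycle n F" "\<phi> n = cls n F"
    using assms X_apply[of \<phi> n] by (auto simp: X_hcomp E_carrier)
  then have "\<phi> = single n F" using assms by (auto simp: X_hcomp single_def fun_eq_iff)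
  then show thesis using F that by blast
qed

lemma single_eq_iff: "ml n F \<Longrightarrow> ml n G \<Longrightarrow> single n F = single n G \<longleftrightarrow> bound n (\<lambda>as x. F as x \<ominus>\<^bsub>N\<^esub> G as x)"
  using cls_eq[of n F G] by (auto simp: single_def fun_eq_iff)

lemma single_finsum:
  assumes "finite I" "\<And>i. i \<in> I \<Longrightarrow> cocycle n (F i)"
  shows "(\<Oplus>\<^bsub>X\<^esub>i\<in>I. single n (F i)) = single n (\<lambda>as x. \<Oplus>\<^bsub>N\<^esub>i\<in>I. F i as x)"
proof
  fix m
  interpret Em: abelian_group "E m" by (rule E_group)
  have "(\<Oplus>\<^bsub>X\<^esub>i\<in>I. single n (F i)) m = (\<Oplus>\<^bsub>E m\<^esub>i\<in>I. single n (F i) m)"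
    by (rule X_finsum) (use assms single_closed in auto)
  also have "\<dots> = single n (\<lambda>as x. \<Oplus>\<^bsub>N\<^esub>i\<in>I. F i as x) m"
    using E_finsum[OF assms] by (cases "m = n") (auto simp: single_def)
  finally show "(\<Oplus>\<^bsub>X\<^esub>i\<in>I. single n (F i)) m = single n (\<lambda>as x. \<Oplus>\<^bsub>N\<^esub>i\<in>I. F i as x) m" .
qed

lemma X_neg: "i < 0 \<Longrightarrow> hcomp X i = {\<zero>\<^bsub>X\<^esub>}"
  using X.zero_closed by (auto simp: X_hcomp X_zero)

end

section \<open>The Yoneda product on total Ext\<close>

context ext_pair
begin

text \<open>Only one summand of the convolution survives when the right factor sits in a single
  degree. The left factor stays arbitrary: coefficients of a generating set of degree 0 elements are
  of this kind.\<close>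

lemma yoneda_right:
  assumes g: "\<And>i. \<gamma> i \<in> carrier (G.E i)" and f: "\<phi> j0 \<in> carrier (F.E j0)"
    and z: "\<And>j. j \<noteq> j0 \<Longrightarrow> \<phi> j = \<zero>\<^bsub>F.E j\<^esub>"
  shows "yoneda k A M P \<gamma> \<phi> n =
    (if j0 \<le> n then ext_comp k A M P (n - j0) j0 (\<gamma> (n - j0)) (\<phi> j0) else \<zero>\<^bsub>H.E n\<^esub>)"
proof -
  interpret En: abelian_group "H.E n" by (rule H.E_group)
  have cz: "ext_comp k A M P i j (\<gamma> i) \<zero>\<^bsub>F.E j\<^esub> = \<zero>\<^bsub>H.E (i + j)\<^esub>" for i j
  proof -
    obtain g' where g': "G.cocycle i g'" "\<gamma> i = G.cls i g'" using g by (auto simp: G.E_carrier)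
    have "ext_comp k A M P i j (\<gamma> i) \<zero>\<^bsub>F.E j\<^esub> = H.cls (i + j) (ycomp i g' (\<lambda>as x. \<zero>\<^bsub>N\<^esub>))"
      unfolding F.E_zero g'(2) by (rule ext_comp_cls[OF g'(1) F.cocycle_zero])
    also have "\<dots> = \<zero>\<^bsub>H.E (i + j)\<^esub>"
      unfolding H.cls_zero_iff[OF comp_ml[OF G.cocycle_ml[OF g'(1)] F.ml_zero]]
      by (rule comp_bound_right[OF g'(1) F.bound_zero])
    finally show ?thesis .
  qed
  have cl: "ext_comp k A M P i j (\<gamma> i) (\<phi> j) \<in> carrier (H.E (i + j))" for i j
  proof -
    obtain g' where g': "G.cocycle i g'" "\<gamma> i = G.cls i g'" using g by (auto simp: G.E_carrier)
    have "\<phi> j \<in> carrier (F.E j)" using f z[of j] abelian_groupE(2)[OF F.E_group] by (cases "j = j0") auto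
    then obtain f' where f': "F.cocycle j f'" "\<phi> j = F.cls j f'" by (auto simp: F.E_carrier)
    show ?thesis unfolding g'(2) f'(2) ext_comp_cls[OF g'(1) f'(1)]
      by (rule H.cls_in_E[OF comp_cocycle[OF g'(1) f'(1)]])
  qed
  let ?t = "\<lambda>i. ext_comp k A M P i (n - i) (\<gamma> i) (\<phi> (n - i))"
  have t0: "?t i = \<zero>\<^bsub>H.E n\<^esub>" if "i \<le> n" "n - i \<noteq> j0" for i
    using cz[of i "n - i"] that(1) unfolding z[OF that(2)] by simp
  have tc: "?t i \<in> carrier (H.E n)" if "i \<le> n" for i
    using cl[of i "n - i"] that by simp
  show ?thesis
  proof (cases "j0 \<le> n")
    case True
    have "yoneda k A M P \<gamma> \<phi> n = (\<Oplus>\<^bsub>H.E n\<^esub>i\<in>{..n}. if n - j0 = i then ?t i else \<zero>\<^bsub>H.E n\<^esub>)"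
      unfolding yoneda_def
    proof (rule En.finsum_cong'[OF refl])
      show "(\<lambda>i. if n - j0 = i then ?t i else \<zero>\<^bsub>H.E n\<^esub>) \<in> {..n} \<rightarrow> carrier (H.E n)"
        by (rule funcsetI) (simp add: tc)
      fix i assume i: "i \<in> {..n}"
      show "?t i = (if n - j0 = i then ?t i else \<zero>\<^bsub>H.E n\<^esub>)"
      proof (cases "n - j0 = i")
        case False
        then have "n - i \<noteq> j0" using i by auto
        then show ?thesis using t0 i False by simp
      qed simp
    qed
    also have "\<dots> = ?t (n - j0)"
      by (rule En.finsum_singleton) (auto intro: tc)
    finally show ?thesis using True by simp
  next
    case False
    have "yoneda k A M P \<gamma> \<phi> n = (\<Oplus>\<^bsub>H.E n\<^esub>i\<in>{..n}. \<zero>\<^bsub>H.E n\<^esub>)"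
      unfolding yoneda_def
    proof (rule En.finsum_cong'[OF refl])
      fix i assume "i \<in> {..n}"
      then show "?t i = \<zero>\<^bsub>H.E n\<^esub>" using False by (intro t0) auto
    qed auto
    then show ?thesis using False by simp
  qed
qed

lemma yoneda_single:
  assumes "G.cocycle i G'" "F.cocycle j F'"
  shows "yoneda k A M P (G.single i G') (F.single j F') = H.single (i + j) (ycomp i G' F')"
proof
  fix n
  have g: "G.single i G' m \<in> carrier (G.E m)" for m
    using assms(1) abelian_groupE(2)[OF G.E_group] by (simp add: G.single_def)
  have f: "F.single j F' j \<in> carrier (F.E j)" using assms(2) by (simp add: F.single_def)
  have "yoneda k A M P (G.single i G') (F.single j F') n =
    (if j \<le> n then ext_comp k A M P (n - j) j (G.single i G' (n - j)) (F.single j F' j) else \<zero>\<^bsub>H.E n\<^esub>)"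
    by (rule yoneda_right[where \<gamma> = "G.single i G'" and \<phi> = "F.single j F'" and ?j0.0 = j, OF g f])
      (simp add: F.single_def)
  also have "\<dots> = H.single (i + j) (ycomp i G' F') n"
  proof (cases "j \<le> n")
    case False
    then show ?thesis by (simp add: H.single_def)
  next
    case True
    show ?thesis
    proof (cases "n = i + j")
      case True
      then show ?thesis
        using ext_comp_cls[OF assms] by (simp add: G.single_def F.single_def H.single_def)
    next
      case False
      then have ne: "n - j \<noteq> i" using True by auto
      have "ext_comp k A M P (n - j) j (G.single i G' (n - j)) (F.single j F' j) =
          H.cls (n - j + j) (ycomp (n - j) (\<lambda>as x. \<zero>\<^bsub>P\<^esub>) F')"
        using ne ext_comp_cls[OF G.cocycle_zero assms(2), of "n - j"]
        by (simp add: G.single_def F.single_def G.E_zero)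
      also have "\<dots> = \<zero>\<^bsub>H.E (n - j + j)\<^esub>"
        unfolding H.cls_zero_iff[OF comp_ml[OF G.ml_zero F.cocycle_ml[OF assms(2)]]]
        by (rule comp_bound_left[OF G.bound_zero assms(2)])
      finally show ?thesis using True False by (simp add: H.single_def)
    qed
  qed
  finally show "yoneda k A M P (G.single i G') (F.single j F') n = H.single (i + j) (ycomp i G' F') n" .
qed

lemma yoneda_cls:
  assumes "\<And>i. G.cocycle i (g i)" "\<And>j. F.cocycle j (f j)"
  shows "yoneda k A M P (\<lambda>i. G.cls i (g i)) (\<lambda>j. F.cls j (f j)) n =
    H.cls n (\<lambda>as x. \<Oplus>\<^bsub>P\<^esub>i\<in>{..n}. ycomp i (g i) (f (n - i)) as x)"
proof -
  interpret En: abelian_group "H.E n" by (rule H.E_group)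
  have co: "H.cocycle n (ycomp i (g i) (f (n - i)))" if "i \<le> n" for i
    using comp_cocycle[OF assms(1)[of i] assms(2)[of "n - i"]] that by simp
  have "yoneda k A M P (\<lambda>i. G.cls i (g i)) (\<lambda>j. F.cls j (f j)) n =
      (\<Oplus>\<^bsub>H.E n\<^esub>i\<in>{..n}. H.cls n (ycomp i (g i) (f (n - i))))"
    unfolding yoneda_def
  proof (rule En.finsum_cong'[OF refl])
    show "(\<lambda>i. H.cls n (ycomp i (g i) (f (n - i)))) \<in> {..n} \<rightarrow> carrier (H.E n)" using co by auto
    fix i assume "i \<in> {..n}"
    then show "ext_comp k A M P i (n - i) (G.cls i (g i)) (F.cls (n - i) (f (n - i))) =
        H.cls n (ycomp i (g i) (f (n - i)))"
      using ext_comp_cls[OF assms(1)[of i] assms(2)[of "n - i"]] by simp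
  qed
  also have "\<dots> = H.cls n (\<lambda>as x. \<Oplus>\<^bsub>P\<^esub>i\<in>{..n}. ycomp i (g i) (f (n - i)) as x)"
    by (rule H.E_finsum) (use co in auto)
  finally show ?thesis .
qed

end

section \<open>Koszul modules in terms of cochains\<close>

locale gext = galg k A for k :: "('k, 'w) ring_scheme" and A :: "('k, 'a, 'x) graded_scheme" +
  fixes M :: "('a, 'm, 'y) graded_scheme"
  assumes graded_S: "graded_mod A (degree_zero A)" and graded_M: "graded_mod A M"
begin

abbreviation "S \<equiv> degree_zero A"

sublocale S: graded_mod A "degree_zero A" by (rule graded_S)
sublocale M: graded_mod A M by (rule graded_M)

sublocale extl k A M "degree_zero A"
  by (rule extl.intro[OF galg_axioms extl_axioms.intro[OF M.left_module_axioms S.left_module_axioms]])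

lemma S_simps [simp]: "carrier S = hcomp A 0" "\<zero>\<^bsub>S\<^esub> = \<zero>\<^bsub>A\<^esub>" "x \<oplus>\<^bsub>S\<^esub> y = x \<oplus>\<^bsub>A\<^esub> y"
  "a \<odot>\<^bsub>S\<^esub> x = A.hp 0 a \<otimes>\<^bsub>A\<^esub> x" "hcomp S i = (if i = 0 then hcomp A 0 else {\<zero>\<^bsub>A\<^esub>})"
  by (simp_all add: degree_zero_def)

sublocale gbar A M "degree_zero A" "scal k A"
proof (unfold_locales)
  show "scal k A \<subseteq> hcomp A 0" by (rule scal_0)
  fix d a y assume "d \<noteq> 0" "a \<in> hcomp A d" "y \<in> carrier S"
  then show "a \<odot>\<^bsub>S\<^esub> y = \<zero>\<^bsub>S\<^esub>" using A.hp_homog[of a d 0] A.hcomp_closed[of y 0] by simp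
qed

text \<open>A shift changes \<open>hcomp\<close> only, which neither the ungraded cochains nor the
  differential look at.\<close>

lemma gr_bar: "bar_cochains k A M (grade_shift S j) = C" "bar_diff A M (grade_shift S j) = d"
proof -
  have 1: "multilinear k A M (grade_shift S j) n f = multilinear k A M S n f" for n f
    by (simp add: multilinear_def grade_shift_def base_smult_def)
  show "bar_cochains k A M (grade_shift S j) = C"
    by (rule ext) (simp add: bar_cochains_def 1, simp add: grade_shift_def base_smult_def)
  show "bar_diff A M (grade_shift S j) = d"
    by (intro ext) (simp add: bar_diff_def grade_shift_def finsum_def add_pow_def)
qed

abbreviation "GC j \<equiv> gr_bar_cochains k A M (grade_shift S j)"

text \<open>The component of the shifted \<open>S\<close> in degree \<open>sum_list ds + e\<close>
  is everything if this number equals \<open>j\<close> and zero otherwise, so the degree condition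
  is the vanishing condition of \<open>homog\<close>.\<close>

lemma gr_carrier: "f \<in> carrier (GC j n) \<longleftrightarrow> (\<exists>F. ml n F \<and> hmg n F j \<and> f = mkn n F)"
proof -
  have *: "(\<forall>as ds x e. length as = n \<and> list_all2 (\<lambda>a d. a \<in> hcomp A d) as ds \<and> x \<in> hcomp M e
          \<longrightarrow> mkn n F (as, x) \<in> hcomp (grade_shift S j) (sum_list ds + e)) \<longleftrightarrow> hmg n F j" (is "?L \<longleftrightarrow> _")
    if F: "ml n F" for F
  proof -
    have t: "as \<in> tuples A n \<and> x \<in> carrier M"
      if "length as = n \<and> list_all2 (\<lambda>a d. a \<in> hcomp A d) as ds \<and> x \<in> hcomp M e" for as ds x e
    proof -
      have "list_all2 (\<lambda>a d. a \<in> hcomp A d) as ds" using that by blast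
      then have "set as \<subseteq> carrier A"
        by (induction rule: list_all2_induct) (auto intro: A.hcomp_closed)
      then show ?thesis using that M.M.hcomp_closed by (auto simp: tuples_def)
    qed
    have "?L \<longleftrightarrow> (\<forall>as ds x e. length as = n \<and> list_all2 (\<lambda>a d. a \<in> hcomp A d) as ds \<and> x \<in> hcomp M e
          \<longrightarrow> sum_list ds + e \<noteq> j \<longrightarrow> F as x = \<zero>\<^bsub>A\<^esub>)"
    proof (intro iff_allI imp_cong refl)
      fix as ds x e
      assume "length as = n \<and> list_all2 (\<lambda>a d. a \<in> hcomp A d) as ds \<and> x \<in> hcomp M e"
      from t[OF this] show "mkn n F (as, x) \<in> hcomp (grade_shift S j) (sum_list ds + e) \<longleftrightarrow>
          (sum_list ds + e \<noteq> j \<longrightarrow> F as x = \<zero>\<^bsub>A\<^esub>)"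
        using ml_closed[OF F, of as x] by (auto simp: grade_shift_def)
    qed
    also have "\<dots> \<longleftrightarrow> hmg n F j" unfolding homog_def hag_iff S_simps by metis
    finally show ?thesis .
  qed
  have "f \<in> carrier (GC j n) \<longleftrightarrow> f \<in> carrier (C n) \<and> (\<forall>as ds x e. length as = n \<and>
      list_all2 (\<lambda>a d. a \<in> hcomp A d) as ds \<and> x \<in> hcomp M e
          \<longrightarrow> f (as, x) \<in> hcomp (grade_shift S j) (sum_list ds + e))"
    by (simp add: gr_bar_cochains_def gr_bar)
  then show ?thesis unfolding C_carrier using * by blast
qed

lemma gr_simps: "\<zero>\<^bsub>GC j n\<^esub> = \<zero>\<^bsub>C n\<^esub>" "x \<oplus>\<^bsub>GC j n\<^esub> y = x \<oplus>\<^bsub>C n\<^esub> y"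
  by (simp_all add: gr_bar_cochains_def gr_bar)

text \<open>By \<open>bound_homogE\<close>, no homogeneous coboundary is lost when only homogeneous
  bounding cochains are allowed.\<close>

lemma gr_coboundaries:
  "f \<in> coboundaries (GC j) d n \<longleftrightarrow> (\<exists>F. ml n F \<and> hmg n F j \<and> bound n F \<and> f = mkn n F)"
proof (cases n)
  case 0
  have "f = mkn 0 (\<lambda>as x. \<zero>\<^bsub>S\<^esub>) \<longleftrightarrow> (\<exists>F. ml 0 F \<and> hmg 0 F j \<and> bound 0 F \<and> f = mkn 0 F)"
    using ml_zero[of 0] bound_zero[of 0] by (auto intro!: mk_cong exI[of _ "\<lambda>as x. \<zero>\<^bsub>A\<^esub>"] simp: homog_def)
  then show ?thesis by (simp add: coboundaries_def 0 C_zero gr_simps)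
next
  case (Suc m)
  show ?thesis
  proof
    assume "f \<in> coboundaries (GC j) d n"
    then obtain h where "h \<in> carrier (GC j m)" "f = d m h" by (auto simp: coboundaries_def Suc)
    then obtain H where "ml m H" "hmg m H j" "h = mkn m H" using gr_carrier by blast
    with \<open>f = d m h\<close> have H: "ml m H" "hmg m H j" "f = d m (mkn m H)" by simp_all
    have "ml n (dl H)" "hmg n (dl H) j" "bound n (dl H)" "f = mkn n (dl H)"
      using dl_ml[OF H(1)] dl_homog[OF H(1,2)] H(1,3) bar_diff_mk[OF H(1)] unfolding Suc by auto
    then show "\<exists>F. ml n F \<and> hmg n F j \<and> bound n F \<and> f = mkn n F" by blast
  next
    assume "\<exists>F. ml n F \<and> hmg n F j \<and> bound n F \<and> f = mkn n F"
    then obtain F where F: "ml (Suc m) F" "hmg (Suc m) F j" "bound (Suc m) F" "f = mkn n F" unfolding Suc by blast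
    from bound_homogE[OF F(1-3)] obtain H where H: "ml m H" "hmg m H j"
      "\<And>as x. as \<in> tuples A (Suc m) \<Longrightarrow> x \<in> carrier M \<Longrightarrow> F as x = dl H as x" by blast
    have "f = d m (mkn m H)" unfolding F(4) Suc bar_diff_mk[OF H(1)] by (rule mk_cong[OF H(3)])
    moreover have "mkn m H \<in> carrier (GC j m)" using gr_carrier H by blast
    ultimately show "f \<in> coboundaries (GC j) d n" by (simp add: coboundaries_def Suc)
  qed
qed

lemma gr_coboundariesI:
  "ml n F \<Longrightarrow> hmg n F j \<Longrightarrow> bound n F \<Longrightarrow> mkn n F \<in> coboundaries (GC j) d n"
  unfolding gr_coboundaries by (rule exI[of _ F]) simp

lemma homog_zero: "hmg n (\<lambda>as x. \<zero>\<^bsub>S\<^esub>) j"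
  by (simp add: homog_def)

lemma homog_add:
  assumes "hmg n F j" "hmg n G j"
  shows "hmg n (\<lambda>as x. F as x \<oplus>\<^bsub>S\<^esub> G as x) j"
  unfolding homog_def
proof (intro allI impI)
  fix t assume "t \<noteq> j"
  then have "hg n F (\<lambda>as x. \<zero>\<^bsub>S\<^esub>) t" "hg n G (\<lambda>as x. \<zero>\<^bsub>S\<^esub>) t"
    using assms unfolding homog_def by blast+
  from hag_map2[OF this, of "\<lambda>x y. x \<oplus>\<^bsub>S\<^esub> y"] S.M.l_zero[OF S.M.zero_closed]
  show "hg n (\<lambda>as x. F as x \<oplus>\<^bsub>S\<^esub> G as x) (\<lambda>as x. \<zero>\<^bsub>S\<^esub>) t" by simp
qed

text \<open>By \<open>gr_coboundaries\<close>, vanishing of graded Ext can be tested with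
  \<open>bound\<close>, which allows inhomogeneous bounding cochains. In this form the Koszul
  condition can be set beside statements about ungraded Ext.\<close>

lemma Ext_Gr_trivial:
  "carrier (Ext_Gr k A M (grade_shift S j) n) = {\<zero>\<^bsub>Ext_Gr k A M (grade_shift S j) n\<^esub>} \<longleftrightarrow>
    (\<forall>F. cocycle n F \<longrightarrow> hmg n F j \<longrightarrow> bound n F)"
proof -
  let ?B = "coboundaries (GC j) d n"
  have z: "\<zero>\<^bsub>Ext_Gr k A M (grade_shift S j) n\<^esub> = ?B"
    by (simp add: Ext_Gr_def cohomology_def gr_bar)
  have coc: "f \<in> cocycles (GC j) d n \<longleftrightarrow> (\<exists>F. cocycle n F \<and> hmg n F j \<and> f = mkn n F)" for f
  proof -
    have "f \<in> cocycles (GC j) d n \<longleftrightarrow> f \<in> carrier (GC j n) \<and> f \<in> cocycles C d n"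
      by (auto simp: cocycles_def gr_simps gr_bar_cochains_def gr_bar)
    also have "\<dots> \<longleftrightarrow> (\<exists>F. cocycle n F \<and> hmg n F j \<and> f = mkn n F)"
    proof
      assume "f \<in> carrier (GC j n) \<and> f \<in> cocycles C d n"
      then obtain F G where F: "ml n F" "hmg n F j" "f = mkn n F" and G: "cocycle n G" "f = mkn n G"
        unfolding gr_carrier cocycles_iff by blast
      have "cocycle n F" by (rule cocycle_cong[OF G(1)]) (use F(3) G(2) mk_eqD[of A M n F G] in simp)
      then show "\<exists>F. cocycle n F \<and> hmg n F j \<and> f = mkn n F" using F by blast
    next
      assume "\<exists>F. cocycle n F \<and> hmg n F j \<and> f = mkn n F"
      then obtain F where F: "cocycle n F" "hmg n F j" "f = mkn n F" by blast
      then have "f \<in> carrier (GC j n)" unfolding gr_carrier using cocycle_ml by blast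
      moreover have "f \<in> cocycles C d n" unfolding cocycles_iff using F by blast
      ultimately show "f \<in> carrier (GC j n) \<and> f \<in> cocycles C d n" ..
    qed
    finally show ?thesis .
  qed
  have cl: "cohomology_class (GC j) d n f = ?B \<longleftrightarrow> f \<in> ?B"
    if f: "f = mkn n F" "ml n F" "hmg n F j" for f F
  proof
    assume e: "cohomology_class (GC j) d n f = ?B"
    \<comment> \<open>The class of \<open>f\<close> is a coset of the coboundaries. As zero is one
      of them, \<open>f\<close> lies in its own class.\<close>
    have "mkn n (\<lambda>as x. \<zero>\<^bsub>S\<^esub>) \<in> ?B"
      by (rule gr_coboundariesI[OF ml_zero homog_zero bound_zero])
    moreover have "f = mkn n (\<lambda>as x. \<zero>\<^bsub>S\<^esub>) \<oplus>\<^bsub>C n\<^esub> f"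
      unfolding f(1) C_add by (rule mk_cong) (use ml_closed[OF f(2)] S.M.l_zero in auto)
    ultimately have "f \<in> cohomology_class (GC j) d n f"
      by (auto simp: cohomology_class_def a_r_coset_def' gr_simps)
    then show "f \<in> ?B" using e by simp
  next
    assume fB: "f \<in> ?B"
    then obtain F where F: "ml n F" "hmg n F j" "bound n F" "f = mkn n F" unfolding gr_coboundaries by blast
    have "g \<in> cohomology_class (GC j) d n f \<longleftrightarrow> g \<in> ?B" for g
    proof
      assume "g \<in> cohomology_class (GC j) d n f"
      then obtain h where "h \<in> ?B" "g = h \<oplus>\<^bsub>C n\<^esub> f"
        by (auto simp: cohomology_class_def a_r_coset_def' gr_simps)
      then obtain H where H: "ml n H" "hmg n H j" "bound n H" "g = mkn n (\<lambda>as x. H as x \<oplus>\<^bsub>S\<^esub> F as x)"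
        unfolding gr_coboundaries F(4) by (auto simp: C_add simp del: S_simps)
      show "g \<in> ?B" unfolding H(4)
        by (rule gr_coboundariesI[OF ml_add[OF H(1) F(1)] homog_add[OF H(2) F(2)] bound_add[OF H(3) F(3)]])
    next
      assume "g \<in> ?B"
      then obtain H where H: "ml n H" "hmg n H j" "bound n H" "g = mkn n H" unfolding gr_coboundaries by blast
      have "mkn n (\<lambda>as x. H as x \<ominus>\<^bsub>S\<^esub> F as x) \<in> ?B"
        by (rule gr_coboundariesI[OF ml_minus[OF H(1) F(1)] homog_minus[OF H(2) F(2)] bound_minus[OF H(3) F(3)]])
      moreover have "g = mkn n (\<lambda>as x. H as x \<ominus>\<^bsub>S\<^esub> F as x) \<oplus>\<^bsub>C n\<^esub> f"
        unfolding H(4) F(4) C_add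
        by (rule mk_cong) (use ml_closed[OF H(1)] ml_closed[OF F(1)] in \<open>simp add: N_simps S.M.cancel_simps del: S_simps\<close>)
      ultimately show "g \<in> cohomology_class (GC j) d n f"
        by (auto simp: cohomology_class_def a_r_coset_def' gr_simps)
    qed
    then show "cohomology_class (GC j) d n f = ?B" by blast
  qed
  have car: "carrier (Ext_Gr k A M (grade_shift S j) n) = cohomology_class (GC j) d n ` cocycles (GC j) d n"
    by (simp add: Ext_Gr_def cohomology_def gr_bar)
  have ne: "cocycles (GC j) d n \<noteq> {}"
  proof -
    have "mkn n (\<lambda>as x. \<zero>\<^bsub>S\<^esub>) \<in> cocycles (GC j) d n"
      unfolding coc by (rule exI[of _ "\<lambda>as x. \<zero>\<^bsub>S\<^esub>"], intro conjI cocycle_zero refl) (simp add: homog_def)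
    then show ?thesis by blast
  qed
  show ?thesis
  proof
    assume "carrier (Ext_Gr k A M (grade_shift S j) n) = {\<zero>\<^bsub>Ext_Gr k A M (grade_shift S j) n\<^esub>}"
    then have all: "cohomology_class (GC j) d n f = ?B" if "f \<in> cocycles (GC j) d n" for f
      using that unfolding z car by blast
    show "\<forall>F. cocycle n F \<longrightarrow> hmg n F j \<longrightarrow> bound n F"
    proof (intro allI impI)
      fix F assume F: "cocycle n F" "hmg n F j"
      then have "mkn n F \<in> cocycles (GC j) d n" unfolding coc by blast
      from all[OF this] have "mkn n F \<in> ?B" unfolding cl[OF refl cocycle_ml[OF F(1)] F(2)] .
      then obtain G where G: "bound n G" "mkn n F = mkn n G" unfolding gr_coboundaries by blast
      show "bound n F" by (rule bound_cong[OF G(1)]) (rule mk_eqD[OF G(2)])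
    qed
  next
    assume h: "\<forall>F. cocycle n F \<longrightarrow> hmg n F j \<longrightarrow> bound n F"
    have "cohomology_class (GC j) d n f = ?B" if fc: "f \<in> cocycles (GC j) d n" for f
    proof -
      obtain F where F: "cocycle n F" "hmg n F j" "f = mkn n F" using fc unfolding coc by blast
      have "f \<in> ?B" unfolding F(3) using h F by (intro gr_coboundariesI cocycle_ml) auto
      then show ?thesis unfolding cl[OF F(3) cocycle_ml[OF F(1)] F(2)] .
    qed
    then show "carrier (Ext_Gr k A M (grade_shift S j) n) = {\<zero>\<^bsub>Ext_Gr k A M (grade_shift S j) n\<^esub>}"
      unfolding z car using ne by blast
  qed
qed

lemma koszul_module_iff:
  "koszul_module k A M \<longleftrightarrow> fin_gen A M \<and>
     (\<forall>n j F. cocycle n F \<longrightarrow> hmg n F j \<longrightarrow> j \<noteq> int n \<longrightarrow> bound n F)"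
proof -
  have "graded_module A M" using graded_M graded_module_iff[OF A.graded_ring_axioms] by blast
  then show ?thesis
    unfolding koszul_module_def Let_def
    by (metis (no_types, opaque_lifting) Ext_Gr_trivial)
qed

end

section \<open>Dual bases over semisimple rings\<close>

text \<open>Each left ideal R e_i is zero or simple, since any nonzero c e_i generates it, and these
  ideals add up to R. The condition is phrased with idempotents because the exchange argument of
  \<open>dual_basis_exists\<close> uses exactly these data.\<close>

definition semisimple_ring :: "('r, 'x) ring_scheme \<Rightarrow> bool" where
  "semisimple_ring R \<longleftrightarrow> (\<exists>r e. (\<forall>i<r. e i \<in> carrier R \<and> e i \<otimes>\<^bsub>R\<^esub> e i = e i \<and>
      (\<forall>c\<in>carrier R. c \<otimes>\<^bsub>R\<^esub> e i \<noteq> \<zero>\<^bsub>R\<^esub> \<longrightarrow> (\<exists>u\<in>carrier R. u \<otimes>\<^bsub>R\<^esub> (c \<otimes>\<^bsub>R\<^esub> e i) = e i))) \<and>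
    (\<Oplus>\<^bsub>R\<^esub>i\<in>{..<r::nat}. e i) = \<one>\<^bsub>R\<^esub>)"

lemma (in abelian_group) minus_zero_eq:
  assumes "x \<in> carrier G" "y \<in> carrier G" shows "x \<ominus> y = \<zero> \<longleftrightarrow> x = y"
proof
  assume "x \<ominus> y = \<zero>"
  then have "(x \<ominus> y) \<oplus> y = y" using assms by simp
  then show "x = y" using assms by (simp add: minus_eq a_assoc l_neg)
qed (use assms in \<open>simp add: minus_eq r_neg\<close>)

lemma finsum_mem:
  assumes "abelian_group G" "finite I" "\<And>i. i \<in> I \<Longrightarrow> f i \<in> P" "P \<subseteq> carrier G" "\<zero>\<^bsub>G\<^esub> \<in> P"
    "\<And>x y. x \<in> P \<Longrightarrow> y \<in> P \<Longrightarrow> x \<oplus>\<^bsub>G\<^esub> y \<in> P"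
  shows "(\<Oplus>\<^bsub>G\<^esub>i\<in>I. f i) \<in> P"
proof -
  interpret G: abelian_group G by fact
  show ?thesis using assms(2,3)
  proof (induction I rule: finite_induct)
    case empty
    then show ?case using assms(5) by simp
  next
    case (insert i I)
    have "(\<Oplus>\<^bsub>G\<^esub>i\<in>insert i I. f i) = f i \<oplus>\<^bsub>G\<^esub> (\<Oplus>\<^bsub>G\<^esub>i\<in>I. f i)"
      by (rule G.finsum_insert) (use insert assms(4) in auto)
    then show ?case using insert assms(6) by simp
  qed
qed

definition spanned :: "('r, 'x) ring_scheme \<Rightarrow> ('r, 'm, 'y) module_scheme \<Rightarrow> 'm set \<Rightarrow> 'm set" where
  "spanned R W G = {x. \<exists>c\<in>G \<rightarrow> carrier R. x = (\<Oplus>\<^bsub>W\<^esub>g\<in>G. c g \<odot>\<^bsub>W\<^esub> g)}"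

context left_module
begin

lemma spanned_closed: "G \<subseteq> carrier M \<Longrightarrow> spanned R M G \<subseteq> carrier M"
  by (auto simp: spanned_def intro!: M.finsum_closed smult_closed)

lemma spanned_zero: "G \<subseteq> carrier M \<Longrightarrow> \<zero>\<^bsub>M\<^esub> \<in> spanned R M G"
proof -
  assume G: "G \<subseteq> carrier M"
  have "(\<Oplus>\<^bsub>M\<^esub>g\<in>G. \<zero>\<^bsub>R\<^esub> \<odot>\<^bsub>M\<^esub> g) = (\<Oplus>\<^bsub>M\<^esub>g\<in>G. \<zero>\<^bsub>M\<^esub>)"
    by (rule M.finsum_cong') (use G in \<open>auto simp: smult_l_null\<close>)
  then show ?thesis unfolding spanned_def by (auto intro!: bexI[of _ "\<lambda>g. \<zero>\<^bsub>R\<^esub>"])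
qed

lemma spanned_add:
  assumes "G \<subseteq> carrier M" "x \<in> spanned R M G" "y \<in> spanned R M G"
  shows "x \<oplus>\<^bsub>M\<^esub> y \<in> spanned R M G"
proof -
  obtain c d where c: "c \<in> G \<rightarrow> carrier R" "x = (\<Oplus>\<^bsub>M\<^esub>g\<in>G. c g \<odot>\<^bsub>M\<^esub> g)"
    and d: "d \<in> G \<rightarrow> carrier R" "y = (\<Oplus>\<^bsub>M\<^esub>g\<in>G. d g \<odot>\<^bsub>M\<^esub> g)"
    using assms(2,3) by (auto simp: spanned_def)
  have "x \<oplus>\<^bsub>M\<^esub> y = (\<Oplus>\<^bsub>M\<^esub>g\<in>G. c g \<odot>\<^bsub>M\<^esub> g \<oplus>\<^bsub>M\<^esub> d g \<odot>\<^bsub>M\<^esub> g)"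
    unfolding c(2) d(2) by (rule M.finsum_addf[symmetric]) (use assms(1) c d in \<open>auto intro!: smult_closed\<close>)
  also have "\<dots> = (\<Oplus>\<^bsub>M\<^esub>g\<in>G. (c g \<oplus>\<^bsub>R\<^esub> d g) \<odot>\<^bsub>M\<^esub> g)"
    by (rule M.finsum_cong') (use assms(1) c d in \<open>auto intro!: smult_closed smult_l_distr[symmetric]\<close>)
  finally show ?thesis using c d unfolding spanned_def by (auto intro!: bexI[of _ "\<lambda>g. c g \<oplus>\<^bsub>R\<^esub> d g"])
qed

lemma spanned_base:
  assumes "finite G" "G \<subseteq> carrier M" "g \<in> G" "a \<in> carrier R"
  shows "a \<odot>\<^bsub>M\<^esub> g \<in> spanned R M G"
proof -
  have "(\<Oplus>\<^bsub>M\<^esub>h\<in>G. (if g = h then a else \<zero>\<^bsub>R\<^esub>) \<odot>\<^bsub>M\<^esub> h) = (\<Oplus>\<^bsub>M\<^esub>h\<in>G. if g = h then a \<odot>\<^bsub>M\<^esub> h else \<zero>\<^bsub>M\<^esub>)"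
    by (rule M.finsum_cong') (use assms in \<open>auto simp: smult_l_null intro!: smult_closed\<close>)
  also have "\<dots> = a \<odot>\<^bsub>M\<^esub> g"
    by (rule M.finsum_singleton) (use assms in \<open>auto intro!: smult_closed\<close>)
  finally show ?thesis using assms(4)
    unfolding spanned_def by (auto intro!: bexI[of _ "\<lambda>h. if g = h then a else \<zero>\<^bsub>R\<^esub>"])
qed

lemma spanned_finsum:
  assumes "finite I" "\<And>i. i \<in> I \<Longrightarrow> f i \<in> spanned R M G" "G \<subseteq> carrier M"
  shows "(\<Oplus>\<^bsub>M\<^esub>i\<in>I. f i) \<in> spanned R M G"
  by (rule finsum_mem[OF M.abelian_group_axioms assms(1)])
    (use assms spanned_closed spanned_zero spanned_add in auto)

lemma fin_gen_iff: "fin_gen R M \<longleftrightarrow> (\<exists>G. finite G \<and> G \<subseteq> carrier M \<and> carrier M \<subseteq> spanned R M G)"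
  unfolding fin_gen_def spanned_def by blast

end

text \<open>The aim is a dual basis of the quotient of \<open>W\<close> by \<open>Z\<close>,
  expressed by congruences in \<open>W\<close> so that no quotient module has to be formed. This
  \<open>Z\<close> is a submodule, unrelated to the scalars in the locale
  \<open>bar\<close>.\<close>

locale dual_basis = left_module R W for R (structure) and W (structure) +
  fixes Z :: "'c set"
  assumes Z_submodule: "submodule Z R W"
begin

lemma Z_closed: "z \<in> Z \<Longrightarrow> z \<in> carrier W"
  using subgroup.subset[OF submodule.axioms(1)[OF Z_submodule]] by auto

lemma Z_zero: "\<zero>\<^bsub>W\<^esub> \<in> Z"
  using subgroup.one_closed[OF submodule.axioms(1)[OF Z_submodule]] by simp

lemma Z_add: "x \<in> Z \<Longrightarrow> y \<in> Z \<Longrightarrow> x \<oplus>\<^bsub>W\<^esub> y \<in> Z"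
  using subgroup.m_closed[OF submodule.axioms(1)[OF Z_submodule]] by simp

lemma Z_smult: "a \<in> carrier R \<Longrightarrow> x \<in> Z \<Longrightarrow> a \<odot>\<^bsub>W\<^esub> x \<in> Z"
  using submodule.smult_closed[OF Z_submodule] .

lemma Z_uminus: "x \<in> Z \<Longrightarrow> \<ominus>\<^bsub>W\<^esub> x \<in> Z"
  using subgroup.m_inv_closed[OF submodule.axioms(1)[OF Z_submodule]] by (simp add: a_inv_def)

lemma Z_minus: "x \<in> Z \<Longrightarrow> y \<in> Z \<Longrightarrow> x \<ominus>\<^bsub>W\<^esub> y \<in> Z"
  unfolding M.minus_eq by (intro Z_add Z_uminus)

abbreviation "lc v T c \<equiv> (\<Oplus>\<^bsub>W\<^esub>t\<in>T. c t \<odot>\<^bsub>W\<^esub> v t)"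

lemmas W_simps = M.minus_eq M.minus_add M.minus_minus M.a_ac M.r_neg M.r_neg1 M.r_neg2 M.l_neg M.cancel_simps

lemma lc_closed: "c \<in> T \<rightarrow> carrier R \<Longrightarrow> v \<in> T \<rightarrow> carrier W \<Longrightarrow> lc v T c \<in> carrier W"
  by (intro M.finsum_closed) (auto intro!: smult_closed)

lemma lc_add:
  assumes "c \<in> T \<rightarrow> carrier R" "d \<in> T \<rightarrow> carrier R" "v \<in> T \<rightarrow> carrier W"
  shows "lc v T (\<lambda>t. c t \<oplus> d t) = lc v T c \<oplus>\<^bsub>W\<^esub> lc v T d"
proof -
  have "lc v T (\<lambda>t. c t \<oplus> d t) = (\<Oplus>\<^bsub>W\<^esub>t\<in>T. c t \<odot>\<^bsub>W\<^esub> v t \<oplus>\<^bsub>W\<^esub> d t \<odot>\<^bsub>W\<^esub> v t)"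
    by (rule M.finsum_cong') (use assms in \<open>auto intro!: smult_closed smult_l_distr\<close>)
  also have "\<dots> = lc v T c \<oplus>\<^bsub>W\<^esub> lc v T d"
    by (rule M.finsum_addf) (use assms in \<open>auto intro!: smult_closed\<close>)
  finally show ?thesis .
qed

lemma lc_smult:
  assumes "finite T" "c \<in> T \<rightarrow> carrier R" "a \<in> carrier R" "v \<in> T \<rightarrow> carrier W"
  shows "lc v T (\<lambda>t. a \<otimes> c t) = a \<odot>\<^bsub>W\<^esub> lc v T c"
proof -
  have "a \<odot>\<^bsub>W\<^esub> lc v T c = (\<Oplus>\<^bsub>W\<^esub>t\<in>T. a \<odot>\<^bsub>W\<^esub> (c t \<odot>\<^bsub>W\<^esub> v t))"
    by (rule smult_r_finsum) (use assms in \<open>auto intro!: smult_closed\<close>)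
  also have "\<dots> = lc v T (\<lambda>t. a \<otimes> c t)"
    by (rule M.finsum_cong') (use assms in \<open>auto intro!: smult_closed smult_assoc[symmetric]\<close>)
  finally show ?thesis by simp
qed

lemma lc_uminus:
  assumes "finite T" "c \<in> T \<rightarrow> carrier R" "v \<in> T \<rightarrow> carrier W"
  shows "lc v T (\<lambda>t. \<ominus> c t) = \<ominus>\<^bsub>W\<^esub> lc v T c"
proof -
  have cl: "lc v T c \<in> carrier W" by (rule lc_closed[OF assms(2,3)])
  have "lc v T (\<lambda>t. \<ominus> c t) = lc v T (\<lambda>t. (\<ominus> \<one>) \<otimes> c t)"
  proof (rule M.finsum_cong'[OF refl])
    fix t assume "t \<in> T"
    then have "c t \<in> carrier R" using assms(2) by auto
    then show "\<ominus> c t \<odot>\<^bsub>W\<^esub> v t = (\<ominus> \<one>) \<otimes> c t \<odot>\<^bsub>W\<^esub> v t" by (simp add: R.l_minus)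
  qed (use assms in \<open>auto intro!: smult_closed\<close>)
  also have "\<dots> = (\<ominus> \<one>) \<odot>\<^bsub>W\<^esub> lc v T c"
    by (rule lc_smult) (use assms in auto)
  also have "\<dots> = \<ominus>\<^bsub>W\<^esub> lc v T c" using cl by (simp add: smult_l_minus smult_one)
  finally show ?thesis .
qed

lemma lc_minus:
  assumes "finite T" "c \<in> T \<rightarrow> carrier R" "d \<in> T \<rightarrow> carrier R" "v \<in> T \<rightarrow> carrier W"
  shows "lc v T (\<lambda>t. c t \<ominus> d t) = lc v T c \<ominus>\<^bsub>W\<^esub> lc v T d"
  unfolding R.minus_eq M.minus_eq
  using lc_add[of c T "\<lambda>t. \<ominus> d t" v] lc_uminus[of T d v] assms by (auto simp: Pi_def)

definition gen :: "('t \<Rightarrow> 'c) \<Rightarrow> 't set \<Rightarrow> bool" where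
  "gen v T \<longleftrightarrow> (\<forall>x\<in>carrier W. \<exists>c\<in>T \<rightarrow> carrier R. x \<ominus>\<^bsub>W\<^esub> lc v T c \<in> Z)"

text \<open>After multiplication by \<open>u\<close>, the relation expresses \<open>v t\<close>
  modulo \<open>Z\<close> through the other generators, so \<open>v t\<close> can be
  eliminated.\<close>

lemma gen_remove:
  assumes "finite T" "v \<in> T \<rightarrow> carrier W" "gen v T" "t \<in> T" "c \<in> T \<rightarrow> carrier R" "lc v T c \<in> Z"
    "u \<in> carrier R" "(u \<otimes> c t) \<odot>\<^bsub>W\<^esub> v t = v t"
  shows "gen v (T - {t})"
  unfolding gen_def
proof
  fix x assume x: "x \<in> carrier W"
  obtain d where d: "d \<in> T \<rightarrow> carrier R" "x \<ominus>\<^bsub>W\<^esub> lc v T d \<in> Z" using assms(3) x by (auto simp: gen_def)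
  let ?T = "T - {t}"
  have v: "v \<in> ?T \<rightarrow> carrier W" and vt: "v t \<in> carrier W" using assms by auto
  have dT: "d \<in> ?T \<rightarrow> carrier R" and dt: "d t \<in> carrier R" using d assms(4) by auto
  have cT: "(\<lambda>s. u \<otimes> c s) \<in> ?T \<rightarrow> carrier R" using assms by auto
  have T: "T = insert t ?T" "finite ?T" "t \<notin> ?T" using assms by auto
  have split: "lc v T b = b t \<odot>\<^bsub>W\<^esub> v t \<oplus>\<^bsub>W\<^esub> lc v ?T b" if b: "b \<in> T \<rightarrow> carrier R" for b
  proof -
    have "(\<Oplus>\<^bsub>W\<^esub>t\<in>insert t ?T. b t \<odot>\<^bsub>W\<^esub> v t) = b t \<odot>\<^bsub>W\<^esub> v t \<oplus>\<^bsub>W\<^esub> lc v ?T b"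
      by (rule M.finsum_insert) (use b assms in \<open>auto intro!: smult_closed\<close>)
    then show ?thesis using T(1) by simp
  qed
  have "lc v T (\<lambda>s. u \<otimes> c s) \<in> Z"
    using lc_smult[OF assms(1,5,7,2)] Z_smult[OF assms(7,6)] by simp
  moreover have "(\<lambda>s. u \<otimes> c s) \<in> T \<rightarrow> carrier R" using assms by auto
  ultimately have r: "v t \<oplus>\<^bsub>W\<^esub> lc v ?T (\<lambda>s. u \<otimes> c s) \<in> Z" using split[of "\<lambda>s. u \<otimes> c s"] assms(8) by simp
  \<comment> \<open>The coefficients left after substituting for \<open>v t\<close> in the
    combination \<open>d\<close>.\<close>
  let ?b = "\<lambda>s. d s \<ominus> d t \<otimes> (u \<otimes> c s)"
  have m: "(\<lambda>s. d t \<otimes> (u \<otimes> c s)) \<in> ?T \<rightarrow> carrier R" using cT dt by auto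
  have lb: "lc v ?T ?b = lc v ?T d \<ominus>\<^bsub>W\<^esub> d t \<odot>\<^bsub>W\<^esub> lc v ?T (\<lambda>s. u \<otimes> c s)"
    using lc_minus[OF T(2) dT m v] lc_smult[OF T(2) cT dt v] by simp
  have "(x \<ominus>\<^bsub>W\<^esub> lc v T d) \<oplus>\<^bsub>W\<^esub> d t \<odot>\<^bsub>W\<^esub> (v t \<oplus>\<^bsub>W\<^esub> lc v ?T (\<lambda>s. u \<otimes> c s)) \<in> Z"
    by (intro Z_add Z_smult d r dt)
  moreover have "(x \<ominus>\<^bsub>W\<^esub> lc v T d) \<oplus>\<^bsub>W\<^esub> d t \<odot>\<^bsub>W\<^esub> (v t \<oplus>\<^bsub>W\<^esub> lc v ?T (\<lambda>s. u \<otimes> c s)) = x \<ominus>\<^bsub>W\<^esub> lc v ?T ?b"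
    unfolding split[OF d(1)] lb
    using x vt dt lc_closed[OF dT v] lc_closed[OF cT v] by (simp add: W_simps smult_r_distr smult_closed)
  moreover have "?b \<in> ?T \<rightarrow> carrier R" using dT m by auto
  ultimately show "\<exists>c\<in>?T \<rightarrow> carrier R. x \<ominus>\<^bsub>W\<^esub> lc v ?T c \<in> Z" by metis
qed

text \<open>Among the elements e_i g, with g in \<open>G\<close>, a generating family modulo
  \<open>Z\<close> of least cardinality is chosen. Minimality forces c_t e_i = 0 in every relation
  modulo \<open>Z\<close>; hence the products c_t e_i are determined by the element they expand, and
  uniqueness gives linearity.\<close>

theorem dual_basis_exists:
  assumes ss: "semisimple_ring R" and G: "finite G" "G \<subseteq> carrier W"
    and gens: "\<And>x. x \<in> carrier W \<Longrightarrow> \<exists>y\<in>spanned R W G. x \<ominus>\<^bsub>W\<^esub> y \<in> Z"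
  obtains T :: "(nat \<times> 'c) set" and v \<psi> where
    "finite T" "v \<in> T \<rightarrow> carrier W"
    "\<And>t x. t \<in> T \<Longrightarrow> x \<in> carrier W \<Longrightarrow> \<psi> t x \<in> carrier R"
    "\<And>t x y. t \<in> T \<Longrightarrow> x \<in> carrier W \<Longrightarrow> y \<in> carrier W \<Longrightarrow> \<psi> t (x \<oplus>\<^bsub>W\<^esub> y) = \<psi> t x \<oplus> \<psi> t y"
    "\<And>t a x. t \<in> T \<Longrightarrow> a \<in> carrier R \<Longrightarrow> x \<in> carrier W \<Longrightarrow> \<psi> t (a \<odot>\<^bsub>W\<^esub> x) = a \<otimes> \<psi> t x"
    "\<And>t z. t \<in> T \<Longrightarrow> z \<in> Z \<Longrightarrow> \<psi> t z = \<zero>"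
    "\<And>x. x \<in> carrier W \<Longrightarrow> x \<ominus>\<^bsub>W\<^esub> (\<Oplus>\<^bsub>W\<^esub>t\<in>T. \<psi> t x \<odot>\<^bsub>W\<^esub> v t) \<in> Z"
proof -
  obtain r :: nat and e where e: "\<And>i. i < r \<Longrightarrow> e i \<in> carrier R" "\<And>i. i < r \<Longrightarrow> e i \<otimes> e i = e i"
    "\<And>i c. i < r \<Longrightarrow> c \<in> carrier R \<Longrightarrow> c \<otimes> e i \<noteq> \<zero> \<Longrightarrow> \<exists>u\<in>carrier R. u \<otimes> (c \<otimes> e i) = e i"
    and sum1: "(\<Oplus>i\<in>{..<r}. e i) = \<one>"
    using ss unfolding semisimple_ring_def by blast
  define v :: "nat \<times> 'c \<Rightarrow> 'c" where "v t = e (fst t) \<odot>\<^bsub>W\<^esub> snd t" for t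
  define T0 where "T0 = {..<r} \<times> G"
  have T0: "finite T0" using G by (simp add: T0_def)
  have vW: "v t \<in> carrier W" if "t \<in> T0" for t
    using that e G by (auto simp: v_def T0_def intro!: smult_closed)
  have gen0: "gen v T0"
    unfolding gen_def
  proof
    fix x assume "x \<in> carrier W"
    then obtain c where c: "c \<in> G \<rightarrow> carrier R" "x \<ominus>\<^bsub>W\<^esub> (\<Oplus>\<^bsub>W\<^esub>g\<in>G. c g \<odot>\<^bsub>W\<^esub> g) \<in> Z"
      using gens by (auto simp: spanned_def)
    \<comment> \<open>Each g in \<open>H\<close> is split as the sum of the e_i g, since the
      idempotents add up to the unit.\<close>
    have "lc v ({..<r} \<times> H) (\<lambda>t. c (snd t) \<otimes> e (fst t)) = (\<Oplus>\<^bsub>W\<^esub>g\<in>H. c g \<odot>\<^bsub>W\<^esub> g)" if "H \<subseteq> G" for H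
      using finite_subset[OF that G(1)] that
    proof (induction H rule: finite_induct)
      case empty
      then show ?case by simp
    next
      case (insert g H)
      let ?f = "\<lambda>t. (c (snd t) \<otimes> e (fst t)) \<odot>\<^bsub>W\<^esub> v t"
      have f: "?f t \<in> carrier W" if "t \<in> T0" for t
        using that funcset_mem[OF c(1)] e(1) vW[OF that] by (auto simp: T0_def intro!: smult_closed)
      have g: "c g \<in> carrier R" "g \<in> carrier W" "g \<in> G" using insert.prems c G by auto
      have "(\<Oplus>\<^bsub>W\<^esub>t\<in>{..<r} \<times> insert g H. ?f t) = (\<Oplus>\<^bsub>W\<^esub>t\<in>(\<lambda>i. (i, g)) ` {..<r} \<union> {..<r} \<times> H. ?f t)"
        by (rule arg_cong[where f = "finsum W ?f"]) auto
      also have "\<dots> = (\<Oplus>\<^bsub>W\<^esub>t\<in>(\<lambda>i. (i, g)) ` {..<r}. ?f t) \<oplus>\<^bsub>W\<^esub> (\<Oplus>\<^bsub>W\<^esub>t\<in>{..<r} \<times> H. ?f t)"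
        by (rule M.finsum_Un_disjoint) (use insert f in \<open>auto simp: T0_def\<close>)
      also have "(\<Oplus>\<^bsub>W\<^esub>t\<in>(\<lambda>i. (i, g)) ` {..<r}. ?f t) = (\<Oplus>\<^bsub>W\<^esub>i\<in>{..<r}. ?f (i, g))"
        by (rule M.finsum_reindex) (use f g in \<open>auto simp: T0_def inj_on_def\<close>)
      also have "\<dots> = (\<Oplus>\<^bsub>W\<^esub>i\<in>{..<r}. c g \<odot>\<^bsub>W\<^esub> (e i \<odot>\<^bsub>W\<^esub> g))"
      proof (rule M.finsum_cong'[OF refl])
        fix i assume "i \<in> {..<r}"
        then have i: "e i \<in> carrier R" "e i \<otimes> e i = e i" using e by auto
        show "?f (i, g) = c g \<odot>\<^bsub>W\<^esub> (e i \<odot>\<^bsub>W\<^esub> g)"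
          using i g by (simp add: v_def smult_assoc[symmetric] smult_closed R.m_assoc)
      qed (use e g in \<open>auto intro!: smult_closed\<close>)
      also have "\<dots> = c g \<odot>\<^bsub>W\<^esub> ((\<Oplus>i\<in>{..<r}. e i) \<odot>\<^bsub>W\<^esub> g)"
        using smult_r_finsum[of "{..<r}" "\<lambda>i. e i \<odot>\<^bsub>W\<^esub> g" "c g"] smult_l_finsum[of "{..<r}" e g] e(1) g
        by (simp add: smult_closed)
      also have "\<dots> = c g \<odot>\<^bsub>W\<^esub> g" using g by (simp add: sum1 smult_one)
      also have "(\<Oplus>\<^bsub>W\<^esub>t\<in>{..<r} \<times> H. ?f t) = (\<Oplus>\<^bsub>W\<^esub>g\<in>H. c g \<odot>\<^bsub>W\<^esub> g)" using insert by simp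
      also have "c g \<odot>\<^bsub>W\<^esub> g \<oplus>\<^bsub>W\<^esub> \<dots> = (\<Oplus>\<^bsub>W\<^esub>g\<in>insert g H. c g \<odot>\<^bsub>W\<^esub> g)"
        by (rule M.finsum_insert[symmetric]) (use insert c G in \<open>auto intro!: smult_closed\<close>)
      finally show ?case .
    qed
    from this[of G] have "x \<ominus>\<^bsub>W\<^esub> lc v T0 (\<lambda>t. c (snd t) \<otimes> e (fst t)) \<in> Z" using c(2) by (simp add: T0_def)
    moreover have "(\<lambda>t. c (snd t) \<otimes> e (fst t)) \<in> T0 \<rightarrow> carrier R"
      using funcset_mem[OF c(1)] e(1) by (auto simp: T0_def)
    ultimately show "\<exists>c\<in>T0 \<rightarrow> carrier R. x \<ominus>\<^bsub>W\<^esub> lc v T0 c \<in> Z" by (intro bexI)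
  qed
  obtain T where T: "T \<subseteq> T0" "gen v T" and min: "\<And>T'. T' \<subseteq> T0 \<Longrightarrow> gen v T' \<Longrightarrow> card T \<le> card T'"
    using ex_has_least_nat[of "\<lambda>T. T \<subseteq> T0 \<and> gen v T" T0 card] gen0 by blast
  have fin: "finite T" using finite_subset[OF T(1) T0] .
  have v: "v \<in> T \<rightarrow> carrier W" using vW T by auto
  have eT: "e (fst t) \<in> carrier R" "e (fst t) \<otimes> e (fst t) = e (fst t)" "fst t < r" "snd t \<in> carrier W" if "t \<in> T" for t
    using subsetD[OF T(1) that] e(1,2) subsetD[OF G(2)] by (auto simp: T0_def mem_Times_iff)
  \<comment> \<open>A nonzero value could be brought back to \<open>e (fst t)\<close> by some
    \<open>u\<close>, and \<open>gen_remove\<close> would then shrink the family.\<close>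
  have indep: "c t \<otimes> e (fst t) = \<zero>" if c: "c \<in> T \<rightarrow> carrier R" "lc v T c \<in> Z" and t: "t \<in> T" for c t
  proof (rule ccontr)
    assume "c t \<otimes> e (fst t) \<noteq> \<zero>"
    moreover have ct: "c t \<in> carrier R" using c t by auto
    ultimately obtain u where u: "u \<in> carrier R" "u \<otimes> (c t \<otimes> e (fst t)) = e (fst t)"
      using e(3)[OF eT(3)[OF t]] by blast
    have "(u \<otimes> c t) \<odot>\<^bsub>W\<^esub> v t = (u \<otimes> (c t \<otimes> e (fst t))) \<odot>\<^bsub>W\<^esub> snd t"
      using u(1) ct eT[OF t] by (simp add: v_def smult_assoc[symmetric] R.m_assoc)
    then have "(u \<otimes> c t) \<odot>\<^bsub>W\<^esub> v t = v t" by (simp only: u(2) v_def)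
    from gen_remove[OF fin v T(2) t c u(1) this] have "card T \<le> card (T - {t})"
      using min[of "T - {t}"] T(1) by auto
    then show False using fin t card_Diff1_less[of T t] by simp
  qed
  have "\<forall>x\<in>carrier W. \<exists>c. c \<in> T \<rightarrow> carrier R \<and> x \<ominus>\<^bsub>W\<^esub> lc v T c \<in> Z" using T(2) by (auto simp: gen_def)
  then obtain c where c: "\<And>x. x \<in> carrier W \<Longrightarrow> c x \<in> T \<rightarrow> carrier R"
    "\<And>x. x \<in> carrier W \<Longrightarrow> x \<ominus>\<^bsub>W\<^esub> lc v T (c x) \<in> Z" by metis
  have cR: "c x t \<in> carrier R" if "x \<in> carrier W" "t \<in> T" for x t using c(1)[OF that(1)] that(2) by auto
  have lcW: "lc v T (c x) \<in> carrier W" if "x \<in> carrier W" for x by (rule lc_closed[OF c(1)[OF that] v])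
  \<comment> \<open>The coefficient \<open>c x t\<close> itself depends on choices. Its product with
    \<open>e (fst t)\<close> does not, and it gives the same multiple of \<open>v t\<close> because
    e_i is idempotent.\<close>
  define \<psi> where "\<psi> t x = c x t \<otimes> e (fst t)" for t x
  show thesis
  proof (rule that[of T v \<psi>])
    show "\<psi> t x \<in> carrier R" if "t \<in> T" "x \<in> carrier W" for t x using that cR eT by (simp add: \<psi>_def)
    show "\<psi> t (x \<oplus>\<^bsub>W\<^esub> y) = \<psi> t x \<oplus> \<psi> t y" if t: "t \<in> T" and x: "x \<in> carrier W" and y: "y \<in> carrier W" for t x y
    proof -
      have xy: "x \<oplus>\<^bsub>W\<^esub> y \<in> carrier W" using x y by simp
      let ?d = "\<lambda>t. c (x \<oplus>\<^bsub>W\<^esub> y) t \<ominus> (c x t \<oplus> c y t)"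
      have a: "(\<lambda>t. c x t \<oplus> c y t) \<in> T \<rightarrow> carrier R" using cR x y by auto
      have "lc v T ?d = lc v T (c (x \<oplus>\<^bsub>W\<^esub> y)) \<ominus>\<^bsub>W\<^esub> (lc v T (c x) \<oplus>\<^bsub>W\<^esub> lc v T (c y))"
        using lc_minus[OF fin c(1)[OF xy] a v] lc_add[OF c(1)[OF x] c(1)[OF y] v] by simp
      also have "\<dots> = ((x \<ominus>\<^bsub>W\<^esub> lc v T (c x)) \<oplus>\<^bsub>W\<^esub> (y \<ominus>\<^bsub>W\<^esub> lc v T (c y))) \<ominus>\<^bsub>W\<^esub>
          ((x \<oplus>\<^bsub>W\<^esub> y) \<ominus>\<^bsub>W\<^esub> lc v T (c (x \<oplus>\<^bsub>W\<^esub> y)))"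
        using x y lcW[OF x] lcW[OF y] lcW[OF xy] by (simp add: W_simps)
      also have "\<dots> \<in> Z" by (intro Z_minus Z_add c x y xy)
      finally have z: "lc v T ?d \<in> Z" .
      have d: "?d \<in> T \<rightarrow> carrier R" using cR x y xy by auto
      have "?d t \<otimes> e (fst t) = \<zero>" by (rule indep[OF d z t])
      then have "c (x \<oplus>\<^bsub>W\<^esub> y) t \<otimes> e (fst t) \<ominus> (c x t \<oplus> c y t) \<otimes> e (fst t) = \<zero>"
        using cR[OF x t] cR[OF y t] cR[OF xy t] eT[OF t] by (simp add: R.minus_eq R.l_distr R.l_minus)
      then show ?thesis
        using cR[OF x t] cR[OF y t] cR[OF xy t] eT[OF t] by (simp add: \<psi>_def R.l_distr R.minus_zero_eq)
    qed
    show "\<psi> t (a \<odot>\<^bsub>W\<^esub> x) = a \<otimes> \<psi> t x" if t: "t \<in> T" and a: "a \<in> carrier R" and x: "x \<in> carrier W" for t a x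
    proof -
      have ax: "a \<odot>\<^bsub>W\<^esub> x \<in> carrier W" using a x by (rule smult_closed)
      let ?d = "\<lambda>t. c (a \<odot>\<^bsub>W\<^esub> x) t \<ominus> a \<otimes> c x t"
      have m: "(\<lambda>t. a \<otimes> c x t) \<in> T \<rightarrow> carrier R" using cR x a by auto
      have "lc v T ?d = lc v T (c (a \<odot>\<^bsub>W\<^esub> x)) \<ominus>\<^bsub>W\<^esub> a \<odot>\<^bsub>W\<^esub> lc v T (c x)"
        using lc_minus[OF fin c(1)[OF ax] m v] lc_smult[OF fin c(1)[OF x] a v] by simp
      also have "\<dots> = a \<odot>\<^bsub>W\<^esub> (x \<ominus>\<^bsub>W\<^esub> lc v T (c x)) \<ominus>\<^bsub>W\<^esub> (a \<odot>\<^bsub>W\<^esub> x \<ominus>\<^bsub>W\<^esub> lc v T (c (a \<odot>\<^bsub>W\<^esub> x)))"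
        using x a ax lcW[OF x] lcW[OF ax] by (simp add: W_simps smult_r_distr smult_r_minus smult_closed)
      also have "\<dots> \<in> Z" by (intro Z_minus Z_smult c x a ax)
      finally have z: "lc v T ?d \<in> Z" .
      have d: "?d \<in> T \<rightarrow> carrier R" using cR x a ax by auto
      have "?d t \<otimes> e (fst t) = \<zero>" by (rule indep[OF d z t])
      then have "c (a \<odot>\<^bsub>W\<^esub> x) t \<otimes> e (fst t) \<ominus> a \<otimes> (c x t \<otimes> e (fst t)) = \<zero>"
        using cR[OF x t] a cR[OF ax t] eT[OF t] by (simp add: R.minus_eq R.l_distr R.l_minus R.m_assoc)
      then show ?thesis
        using cR[OF x t] a cR[OF ax t] eT[OF t] by (simp add: \<psi>_def R.minus_zero_eq)
    qed
    show "\<psi> t z = \<zero>" if t: "t \<in> T" and z: "z \<in> Z" for t z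
    proof -
      have zW: "z \<in> carrier W" by (rule Z_closed[OF z])
      have "lc v T (c z) = z \<ominus>\<^bsub>W\<^esub> (z \<ominus>\<^bsub>W\<^esub> lc v T (c z))" using zW lcW[OF zW] by (simp add: W_simps)
      also have "\<dots> \<in> Z" by (intro Z_minus z c zW)
      finally show ?thesis unfolding \<psi>_def by (rule indep[OF c(1)[OF zW] _ t])
    qed
    show "x \<ominus>\<^bsub>W\<^esub> (\<Oplus>\<^bsub>W\<^esub>t\<in>T. \<psi> t x \<odot>\<^bsub>W\<^esub> v t) \<in> Z" if x: "x \<in> carrier W" for x
    proof -
      have "(\<Oplus>\<^bsub>W\<^esub>t\<in>T. \<psi> t x \<odot>\<^bsub>W\<^esub> v t) = lc v T (c x)"
      proof (rule M.finsum_cong'[OF refl])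
        show "(\<lambda>t. c x t \<odot>\<^bsub>W\<^esub> v t) \<in> T \<rightarrow> carrier W" using cR[OF x] v by (auto intro!: smult_closed)
        fix t assume t: "t \<in> T"
        show "\<psi> t x \<odot>\<^bsub>W\<^esub> v t = c x t \<odot>\<^bsub>W\<^esub> v t"
          using cR[OF x t] eT[OF t]
          by (simp add: \<psi>_def v_def smult_assoc[symmetric] R.m_assoc smult_closed)
      qed
      then show ?thesis using c(2)[OF x] by simp
    qed
  qed (use fin v in auto)
qed

end

text \<open>The images of the idempotents serve. The lemma carries the property from a power of
  \<open>k\<close> to the degree 0 part of \<open>A\<close>, and from there to the degree 0 part of
  the Koszul dual.\<close>

lemma semisimple_ring_hom:
  assumes "ring R" "ring R'" "g \<in> ring_hom R R'" "g ` carrier R = carrier R'" "semisimple_ring R"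
  shows "semisimple_ring R'"
proof -
  interpret R: ring R by fact
  interpret R': ring R' by fact
  note h = ring_hom_memE[OF assms(3)]
  have g0: "g \<zero>\<^bsub>R\<^esub> = \<zero>\<^bsub>R'\<^esub>"
    by (rule additive_zero[OF R.is_abelian_group R'.is_abelian_group]) (use h in auto)
  obtain r e where e: "\<And>i. i < r \<Longrightarrow> e i \<in> carrier R" "\<And>i. i < r \<Longrightarrow> e i \<otimes>\<^bsub>R\<^esub> e i = e i"
    "\<And>i c. i < r \<Longrightarrow> c \<in> carrier R \<Longrightarrow> c \<otimes>\<^bsub>R\<^esub> e i \<noteq> \<zero>\<^bsub>R\<^esub> \<Longrightarrow> \<exists>u\<in>carrier R. u \<otimes>\<^bsub>R\<^esub> (c \<otimes>\<^bsub>R\<^esub> e i) = e i"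
    and sum1: "(\<Oplus>\<^bsub>R\<^esub>i\<in>{..<r::nat}. e i) = \<one>\<^bsub>R\<^esub>"
    using assms(5) unfolding semisimple_ring_def by blast
  show ?thesis
    unfolding semisimple_ring_def
  proof (intro exI conjI allI impI ballI)
    have "g (\<Oplus>\<^bsub>R\<^esub>i\<in>{..<r}. e i) = (\<Oplus>\<^bsub>R'\<^esub>i\<in>{..<r}. g (e i))"
      by (rule additive_finsum[OF R.is_abelian_group R'.is_abelian_group]) (use e h in auto)
    then show "(\<Oplus>\<^bsub>R'\<^esub>i\<in>{..<r}. g (e i)) = \<one>\<^bsub>R'\<^esub>" using sum1 h by simp
    fix i assume i: "i < r"
    show "g (e i) \<in> carrier R'" using e(1)[OF i] h by simp
    show "g (e i) \<otimes>\<^bsub>R'\<^esub> g (e i) = g (e i)" using h(2)[OF e(1)[OF i] e(1)[OF i]] e(2)[OF i] by simp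
    fix c assume c: "c \<in> carrier R'" "c \<otimes>\<^bsub>R'\<^esub> g (e i) \<noteq> \<zero>\<^bsub>R'\<^esub>"
    then obtain b where b: "b \<in> carrier R" "c = g b" using assms(4) by blast
    have gb: "g (b \<otimes>\<^bsub>R\<^esub> e i) = c \<otimes>\<^bsub>R'\<^esub> g (e i)" using h(2)[OF b(1) e(1)[OF i]] b by simp
    then have "b \<otimes>\<^bsub>R\<^esub> e i \<noteq> \<zero>\<^bsub>R\<^esub>" using c g0 by metis
    then obtain u where u: "u \<in> carrier R" "u \<otimes>\<^bsub>R\<^esub> (b \<otimes>\<^bsub>R\<^esub> e i) = e i" using e(3)[OF i b(1)] by blast
    have "g u \<otimes>\<^bsub>R'\<^esub> (c \<otimes>\<^bsub>R'\<^esub> g (e i)) = g (e i)"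
      using h(2)[OF u(1), of "b \<otimes>\<^bsub>R\<^esub> e i"] u(2) b(1) e(1)[OF i] gb by simp
    then show "\<exists>u\<in>carrier R'. u \<otimes>\<^bsub>R'\<^esub> (c \<otimes>\<^bsub>R'\<^esub> g (e i)) = g (e i)" using u h by blast
  qed
qed

section \<open>Finite powers of a field\<close>

lemma RDirProd_list_Cons:
  assumes "a \<in> carrier R" "b \<in> carrier R" "as \<in> carrier (RDirProd_list Rs)" "bs \<in> carrier (RDirProd_list Rs)"
  shows "(a # as) \<otimes>\<^bsub>RDirProd_list (R # Rs)\<^esub> (b # bs) = (a \<otimes>\<^bsub>R\<^esub> b) # (as \<otimes>\<^bsub>RDirProd_list Rs\<^esub> bs)"
    "(a # as) \<oplus>\<^bsub>RDirProd_list (R # Rs)\<^esub> (b # bs) = (a \<oplus>\<^bsub>R\<^esub> b) # (as \<oplus>\<^bsub>RDirProd_list Rs\<^esub> bs)"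
  using ring_iso_memE(2,3)[OF RDirProd_list_iso1[of R Rs], of "(a, as)" "(b, bs)"] assms
  by (simp_all add: RDirProd_carrier, simp_all add: RDirProd_def DirProd_def monoid.defs)

lemma field_power_nth:
  assumes "ring k" "as \<in> carrier (RDirProd_list (replicate n k))" "bs \<in> carrier (RDirProd_list (replicate n k))" "i < n"
  shows "(as \<otimes>\<^bsub>RDirProd_list (replicate n k)\<^esub> bs) ! i = as ! i \<otimes>\<^bsub>k\<^esub> bs ! i"
    "(as \<oplus>\<^bsub>RDirProd_list (replicate n k)\<^esub> bs) ! i = as ! i \<oplus>\<^bsub>k\<^esub> bs ! i"
proof -
  have "(as \<otimes>\<^bsub>RDirProd_list (replicate n k)\<^esub> bs) ! i = as ! i \<otimes>\<^bsub>k\<^esub> bs ! i \<and>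
    (as \<oplus>\<^bsub>RDirProd_list (replicate n k)\<^esub> bs) ! i = as ! i \<oplus>\<^bsub>k\<^esub> bs ! i"
    using assms(2-4)
  proof (induction n arbitrary: as bs i)
    case 0
    then show ?case by simp
  next
    case (Suc n)
    obtain a as' where a: "as = a # as'" "a \<in> carrier k" "as' \<in> carrier (RDirProd_list (replicate n k))"
      using Suc.prems(1) by (auto simp: RDirProd_list_carrier)
    obtain b bs' where b: "bs = b # bs'" "b \<in> carrier k" "bs' \<in> carrier (RDirProd_list (replicate n k))"
      using Suc.prems(2) by (auto simp: RDirProd_list_carrier)
    show ?case
      using Suc.IH[OF a(3) b(3), of "i - 1"] Suc.prems(3) RDirProd_list_Cons[OF a(2) b(2) a(3) b(3)]
      by (cases i) (simp_all add: a(1) b(1))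
  qed
  then show "(as \<otimes>\<^bsub>RDirProd_list (replicate n k)\<^esub> bs) ! i = as ! i \<otimes>\<^bsub>k\<^esub> bs ! i"
    "(as \<oplus>\<^bsub>RDirProd_list (replicate n k)\<^esub> bs) ! i = as ! i \<oplus>\<^bsub>k\<^esub> bs ! i" by auto
qed

lemma field_power_carrier:
  "as \<in> carrier (RDirProd_list (replicate n k)) \<longleftrightarrow> length as = n \<and> (\<forall>i<n. as ! i \<in> carrier k)"
  using RDirProd_list_carrier_mem[of as "replicate n k"] RDirProd_list_carrier_memI[of as "replicate n k"]
  by auto

lemma field_power_one_zero:
  "\<one>\<^bsub>RDirProd_list (replicate n k)\<^esub> = replicate n \<one>\<^bsub>k\<^esub>" "\<zero>\<^bsub>RDirProd_list (replicate n k)\<^esub> = replicate n \<zero>\<^bsub>k\<^esub>"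
  unfolding RDirProd_list_one RDirProd_list_zero by (induction n) auto

lemma field_power_ring: "ring k \<Longrightarrow> ring (RDirProd_list (replicate n k))"
  by (rule RDirProd_list_is_ring) simp

lemma field_power_comm:
  assumes "cring k" "as \<in> carrier (RDirProd_list (replicate n k))" "bs \<in> carrier (RDirProd_list (replicate n k))"
  shows "as \<otimes>\<^bsub>RDirProd_list (replicate n k)\<^esub> bs = bs \<otimes>\<^bsub>RDirProd_list (replicate n k)\<^esub> as"
proof -
  interpret k: cring k by fact
  interpret P: ring "RDirProd_list (replicate n k)" by (rule field_power_ring[OF k.ring_axioms])
  show ?thesis
  proof (rule nth_equalityI)
    show "length (as \<otimes>\<^bsub>RDirProd_list (replicate n k)\<^esub> bs) = length (bs \<otimes>\<^bsub>RDirProd_list (replicate n k)\<^esub> as)"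
      using P.m_closed[OF assms(2,3)] P.m_closed[OF assms(3,2)] by (simp add: field_power_carrier)
    fix i assume "i < length (as \<otimes>\<^bsub>RDirProd_list (replicate n k)\<^esub> bs)"
    then have "i < n" using P.m_closed[OF assms(2,3)] by (simp add: field_power_carrier)
    then show "(as \<otimes>\<^bsub>RDirProd_list (replicate n k)\<^esub> bs) ! i = (bs \<otimes>\<^bsub>RDirProd_list (replicate n k)\<^esub> as) ! i"
      using field_power_nth(1)[OF k.ring_axioms assms(2,3)] field_power_nth(1)[OF k.ring_axioms assms(3,2)]
        assms(2,3) by (simp add: field_power_carrier k.m_comm)
  qed
qed

text \<open>The idempotents are the unit vectors. A nonzero multiple of the i-th one has a nonzero
  i-th coordinate, and the inverse of that coordinate, placed at position i, is the required
  \<open>u\<close>.\<close>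

lemma field_power_semisimple:
  assumes "field k"
  shows "semisimple_ring (RDirProd_list (replicate n k))"
proof -
  interpret k: field k by fact
  let ?P = "RDirProd_list (replicate n k)"
  interpret P: ring ?P by (rule field_power_ring[OF k.ring_axioms])
  define E where "E i = (\<lambda>a. (replicate n \<zero>\<^bsub>k\<^esub>)[i := a])" for i
  have nth: "E i a ! j = (if i = j then a else \<zero>\<^bsub>k\<^esub>)" if "j < n" for i j a
    using that by (simp add: E_def nth_list_update)
  have E: "E i a \<in> carrier ?P" if "a \<in> carrier k" for i a
    using that nth by (auto simp: field_power_carrier) (auto simp: E_def)
  have ext: "as = bs" if "as \<in> carrier ?P" "bs \<in> carrier ?P" "\<And>j. j < n \<Longrightarrow> as ! j = bs ! j" for as bs
    using that by (intro nth_equalityI) (auto simp: field_power_carrier)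
  show ?thesis
    unfolding semisimple_ring_def
  proof (intro exI conjI allI impI ballI)
    show "(\<Oplus>\<^bsub>?P\<^esub>i\<in>{..<n}. E i \<one>\<^bsub>k\<^esub>) = \<one>\<^bsub>?P\<^esub>"
    proof (rule ext)
      fix j assume j: "j < n"
      have "(\<Oplus>\<^bsub>?P\<^esub>i\<in>{..<n}. E i \<one>\<^bsub>k\<^esub>) ! j = (\<Oplus>\<^bsub>k\<^esub>i\<in>{..<n}. E i \<one>\<^bsub>k\<^esub> ! j)"
        by (rule additive_finsum[OF P.is_abelian_group k.is_abelian_group, where h = "\<lambda>as. as ! j"])
          (use E j field_power_nth(2)[OF k.ring_axioms] in \<open>auto simp: field_power_carrier\<close>)
      also have "\<dots> = (\<Oplus>\<^bsub>k\<^esub>i\<in>{..<n}. if j = i then \<one>\<^bsub>k\<^esub> else \<zero>\<^bsub>k\<^esub>)"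
        by (rule k.finsum_cong') (use nth j in auto)
      also have "\<dots> = \<one>\<^bsub>k\<^esub>" by (rule k.finsum_singleton) (use j in auto)
      finally show "(\<Oplus>\<^bsub>?P\<^esub>i\<in>{..<n}. E i \<one>\<^bsub>k\<^esub>) ! j = \<one>\<^bsub>?P\<^esub> ! j" using j by (simp add: field_power_one_zero)
    qed (auto intro!: P.finsum_closed E)
    fix i assume i: "i < n"
    show "E i \<one>\<^bsub>k\<^esub> \<in> carrier ?P" by (rule E) simp
    show "E i \<one>\<^bsub>k\<^esub> \<otimes>\<^bsub>?P\<^esub> E i \<one>\<^bsub>k\<^esub> = E i \<one>\<^bsub>k\<^esub>"
      by (rule ext) (auto intro!: P.m_closed E simp: field_power_nth(1)[OF k.ring_axioms E E] nth)
    fix c assume c: "c \<in> carrier ?P" "c \<otimes>\<^bsub>?P\<^esub> E i \<one>\<^bsub>k\<^esub> \<noteq> \<zero>\<^bsub>?P\<^esub>"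
    have ck: "c ! j \<in> carrier k" if "j < n" for j using c that by (simp add: field_power_carrier)
    have ce: "(c \<otimes>\<^bsub>?P\<^esub> E i \<one>\<^bsub>k\<^esub>) ! j = (if i = j then c ! j else \<zero>\<^bsub>k\<^esub>)" if "j < n" for j
      using field_power_nth(1)[OF k.ring_axioms c(1) E[of "\<one>\<^bsub>k\<^esub>" i] that] nth[OF that] ck[OF that] by auto
    have "c ! i \<noteq> \<zero>\<^bsub>k\<^esub>"
    proof
      assume "c ! i = \<zero>\<^bsub>k\<^esub>"
      then have "c \<otimes>\<^bsub>?P\<^esub> E i \<one>\<^bsub>k\<^esub> = \<zero>\<^bsub>?P\<^esub>"
        by (intro ext P.m_closed c E P.zero_closed) (auto simp: ce field_power_one_zero)
      then show False using c by simp
    qed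
    then have inv: "inv\<^bsub>k\<^esub> (c ! i) \<in> carrier k" "inv\<^bsub>k\<^esub> (c ! i) \<otimes>\<^bsub>k\<^esub> c ! i = \<one>\<^bsub>k\<^esub>"
      using ck[OF i] k.field_Units k.Units_inv_closed k.Units_l_inv by auto
    have cP: "c \<otimes>\<^bsub>?P\<^esub> E i \<one>\<^bsub>k\<^esub> \<in> carrier ?P" by (intro P.m_closed c E) simp
    have "E i (inv\<^bsub>k\<^esub> (c ! i)) \<otimes>\<^bsub>?P\<^esub> (c \<otimes>\<^bsub>?P\<^esub> E i \<one>\<^bsub>k\<^esub>) = E i \<one>\<^bsub>k\<^esub>"
    proof (rule ext)
      fix j assume j: "j < n"
      show "(E i (inv\<^bsub>k\<^esub> (c ! i)) \<otimes>\<^bsub>?P\<^esub> (c \<otimes>\<^bsub>?P\<^esub> E i \<one>\<^bsub>k\<^esub>)) ! j = E i \<one>\<^bsub>k\<^esub> ! j"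
        using field_power_nth(1)[OF k.ring_axioms E[OF inv(1), of i] cP j] ce[OF j] nth[OF j] inv by auto
    qed (intro P.m_closed E inv cP k.one_closed)+
    then show "\<exists>u\<in>carrier ?P. u \<otimes>\<^bsub>?P\<^esub> (c \<otimes>\<^bsub>?P\<^esub> E i \<one>\<^bsub>k\<^esub>) = E i \<one>\<^bsub>k\<^esub>" using E[OF inv(1)] by blast
  qed
qed

context graded_ring
begin

lemma degree_zero_ring: "ring (degree_zero A)"
proof (rule ringI)
  show "abelian_group (degree_zero A)"
  proof (rule abelian_groupI)
    fix x assume "x \<in> carrier (degree_zero A)"
    then show "\<exists>y\<in>carrier (degree_zero A). y \<oplus>\<^bsub>degree_zero A\<^esub> x = \<zero>\<^bsub>degree_zero A\<^esub>"
      by (intro bexI[of _ "\<ominus> x"]) (auto simp: degree_zero_def hcomp_uminus l_neg hcomp_closed)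
  qed (auto simp: degree_zero_def hcomp_add hcomp_closed a_ac)
  show "monoid (degree_zero A)"
    by (rule monoidI) (use hcomp_mult[of _ 0 _ 0] in \<open>auto simp: degree_zero_def one_hcomp hcomp_closed m_assoc\<close>)
qed (auto simp: degree_zero_def hcomp_closed l_distr r_distr)

end

text \<open>Both properties come from a power of \<open>k\<close> along the given isomorphism.
  Commutativity makes right multiplications compose in the right order in
  \<open>dual_semisimple\<close>.\<close>

lemma standard_degree_zero:
  assumes "standard_graded_algebra k A"
  shows "semisimple_ring (degree_zero A)"
    and "x \<in> hcomp A 0 \<Longrightarrow> y \<in> hcomp A 0 \<Longrightarrow> x \<otimes>\<^bsub>A\<^esub> y = y \<otimes>\<^bsub>A\<^esub> x"
proof -
  interpret galg k A by unfold_locales (use assms in \<open>simp add: standard_graded_algebra_def\<close>)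
  let ?S = "degree_zero A"
  obtain n h where h: "h \<in> ring_iso ?S (RDirProd_list (replicate n k))"
    using assms unfolding standard_graded_algebra_def is_ring_iso_def by blast
  let ?P = "RDirProd_list (replicate n k)"
  interpret S: ring ?S by (rule A.degree_zero_ring)
  have P: "ring ?P" by (rule field_power_ring[OF k.ring_axioms])
  have g: "inv_into (carrier ?S) h \<in> ring_iso ?P ?S" by (rule ring_iso_set_sym[OF S.ring_axioms h])
  then have hom: "inv_into (carrier ?S) h \<in> ring_hom ?P ?S" and "bij_betw (inv_into (carrier ?S) h) (carrier ?P) (carrier ?S)"
    by (auto simp: ring_iso_def)
  then show "semisimple_ring ?S"
    by (intro semisimple_ring_hom[OF P S.ring_axioms hom _ field_power_semisimple[OF field_k]]) (simp add: bij_betw_def)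
  assume x: "x \<in> hcomp A 0" and y: "y \<in> hcomp A 0"
  have car: "carrier ?S = hcomp A 0" and mult: "a \<otimes>\<^bsub>?S\<^esub> b = a \<otimes>\<^bsub>A\<^esub> b" for a b by (simp_all add: degree_zero_def)
  note hm = ring_iso_memE[OF h]
  have "h (x \<otimes>\<^bsub>?S\<^esub> y) = h (y \<otimes>\<^bsub>?S\<^esub> x)"
    using hm(2)[of x y] hm(2)[of y x] field_power_comm[OF k.is_cring hm(1) hm(1)] x y car by simp
  then show "x \<otimes>\<^bsub>A\<^esub> y = y \<otimes>\<^bsub>A\<^esub> x"
    using hm(5) x y S.m_closed[of x y] S.m_closed[of y x] car
    unfolding bij_betw_def inj_on_def mult by simp
qed

section \<open>Graded submodules and direct summands\<close>

lemma (in abelian_group) add_minus_add: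
  assumes "x \<in> carrier G" "y \<in> carrier G" "x' \<in> carrier G" "y' \<in> carrier G"
  shows "(x \<oplus> y) \<ominus> (x' \<oplus> y') = (x \<ominus> x') \<oplus> (y \<ominus> y')"
  using assms by (simp add: minus_eq minus_add a_ac)

text \<open>A finite sum depends on the structure in which it is formed; the inclusion is additive,
  so the sums in a substructure and in the ambient group agree.\<close>

lemma finsum_sub:
  assumes "abelian_group X" "abelian_group Y" "carrier X \<subseteq> carrier Y" "\<And>x y. x \<oplus>\<^bsub>X\<^esub> y = x \<oplus>\<^bsub>Y\<^esub> y"
    "finite I" "\<And>i. i \<in> I \<Longrightarrow> f i \<in> carrier X"
  shows "(\<Oplus>\<^bsub>X\<^esub>i\<in>I. f i) = (\<Oplus>\<^bsub>Y\<^esub>i\<in>I. f i)"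
  by (rule additive_finsum[OF assms(1,2,5,6), where h = "\<lambda>x. x"]) (use assms(3,4) in auto)

lemma (in left_module) restrict_left_module:
  assumes "submodule U R M" "carrier X = U" "\<zero>\<^bsub>X\<^esub> = \<zero>\<^bsub>M\<^esub>" "\<And>x y. x \<oplus>\<^bsub>X\<^esub> y = x \<oplus>\<^bsub>M\<^esub> y"
    "\<And>a x. a \<odot>\<^bsub>X\<^esub> x = a \<odot>\<^bsub>M\<^esub> x"
  shows "left_module R X"
proof -
  have sg: "subgroup U (add_monoid M)" using assms(1) by (rule submodule.axioms)
  have sub: "U \<subseteq> carrier M" using subgroup.subset[OF sg] by simp
  have "abelian_group X"
  proof (rule abelian_groupI)
    fix x assume "x \<in> carrier X"
    then show "\<exists>y\<in>carrier X. y \<oplus>\<^bsub>X\<^esub> x = \<zero>\<^bsub>X\<^esub>"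
      using subgroup.m_inv_closed[OF sg] sub
      by (intro bexI[of _ "\<ominus>\<^bsub>M\<^esub> x"]) (auto simp: assms M.l_neg, auto simp: a_inv_def)
  next
    fix x y z assume "x \<in> carrier X" "y \<in> carrier X" "z \<in> carrier X"
    then have "x \<in> carrier M" "y \<in> carrier M" "z \<in> carrier M" using sub by (auto simp: assms)
    then show "x \<oplus>\<^bsub>X\<^esub> y \<oplus>\<^bsub>X\<^esub> z = x \<oplus>\<^bsub>X\<^esub> (y \<oplus>\<^bsub>X\<^esub> z)" by (simp add: assms M.a_assoc)
  next
    fix x y assume "x \<in> carrier X" "y \<in> carrier X"
    then have "x \<in> carrier M" "y \<in> carrier M" using sub by (auto simp: assms)
    then show "x \<oplus>\<^bsub>X\<^esub> y = y \<oplus>\<^bsub>X\<^esub> x" by (simp add: assms M.a_comm)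
  qed (use subgroup.one_closed[OF sg] subgroup.m_closed[OF sg] sub in \<open>auto simp: assms\<close>)
  then show ?thesis
    using submodule.smult_closed[OF assms(1)] subsetD[OF sub] smult_one
    by (intro left_module.intro R.ring_axioms left_module_axioms.intro)
      (auto simp: assms smult_l_distr smult_r_distr smult_assoc)
qed

context graded_mod
begin

lemma sub_closed: "submodule U A M \<Longrightarrow> U \<subseteq> carrier M"
  using subgroup.subset[OF submodule.axioms(1)] by fastforce

lemma sub_zero: "submodule U A M \<Longrightarrow> \<zero>\<^bsub>M\<^esub> \<in> U"
  using subgroup.one_closed[OF submodule.axioms(1)] by fastforce

lemma sub_add: "submodule U A M \<Longrightarrow> x \<in> U \<Longrightarrow> y \<in> U \<Longrightarrow> x \<oplus>\<^bsub>M\<^esub> y \<in> U"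
  using subgroup.m_closed[OF submodule.axioms(1)] by fastforce

lemma sub_smult: "submodule U A M \<Longrightarrow> a \<in> carrier A \<Longrightarrow> y \<in> U \<Longrightarrow> a \<odot>\<^bsub>M\<^esub> y \<in> U"
  using submodule.smult_closed by fastforce

lemma sub_uminus: "submodule U A M \<Longrightarrow> y \<in> U \<Longrightarrow> \<ominus>\<^bsub>M\<^esub> y \<in> U"
  using subgroup.m_inv_closed[OF submodule.axioms(1)] by (fastforce simp: a_inv_def)

lemma submoduleI:
  assumes "U \<subseteq> carrier M" "\<zero>\<^bsub>M\<^esub> \<in> U" "\<And>x y. x \<in> U \<Longrightarrow> y \<in> U \<Longrightarrow> x \<oplus>\<^bsub>M\<^esub> y \<in> U"
    "\<And>a x. a \<in> carrier A \<Longrightarrow> x \<in> U \<Longrightarrow> a \<odot>\<^bsub>M\<^esub> x \<in> U"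
  shows "submodule U A M"
proof (rule submodule.intro)
  show "subgroup U (add_monoid M)"
  proof (rule group.subgroupI[OF M.a_group])
    fix x assume x: "x \<in> U"
    then have "(\<ominus>\<^bsub>A\<^esub> \<one>\<^bsub>A\<^esub>) \<odot>\<^bsub>M\<^esub> x \<in> U" using assms(4) by simp
    moreover have "(\<ominus>\<^bsub>A\<^esub> \<one>\<^bsub>A\<^esub>) \<odot>\<^bsub>M\<^esub> x = \<ominus>\<^bsub>M\<^esub> x" using x assms(1) by (auto simp: smult_l_minus smult_one)
    ultimately show "inv\<^bsub>add_monoid M\<^esub> x \<in> U" by (simp add: a_inv_def)
  qed (use assms in auto)
  show "submodule_axioms U A M" by (rule submodule_axioms.intro) (rule assms(4))
qed

lemma graded_restrict_simps [simp]:
  "carrier (graded_restrict M U) = U" "\<zero>\<^bsub>graded_restrict M U\<^esub> = \<zero>\<^bsub>M\<^esub>"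
  "x \<oplus>\<^bsub>graded_restrict M U\<^esub> y = x \<oplus>\<^bsub>M\<^esub> y" "a \<odot>\<^bsub>graded_restrict M U\<^esub> x = a \<odot>\<^bsub>M\<^esub> x"
  "hcomp (graded_restrict M U) i = hcomp M i \<inter> U"
  by (simp_all add: graded_restrict_def)

lemma graded_restrict_mod:
  assumes "graded_submodule A M U"
  shows "graded_mod A (graded_restrict M U)"
proof -
  let ?X = "graded_restrict M U"
  have U: "submodule U A M" and hpU: "\<And>x i. x \<in> U \<Longrightarrow> M.hp i x \<in> U"
    using assms by (auto simp: graded_submodule_def)
  interpret X: left_module A ?X by (rule restrict_left_module[OF U]) simp_all
  have sub: "U \<subseteq> carrier M" by (rule sub_closed[OF U])
  have fs: "(\<Oplus>\<^bsub>?X\<^esub>i\<in>I. f i) = (\<Oplus>\<^bsub>M\<^esub>i\<in>I. f i)" if "finite I" "\<And>i. i \<in> I \<Longrightarrow> f i \<in> U" for f :: "int \<Rightarrow> _" and I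
    by (rule finsum_sub[OF X.abelian_group_axioms M.abelian_group_axioms]) (use that sub in auto)
  have "internal_direct_sum ?X (hcomp ?X)"
    unfolding internal_direct_sum_def
  proof (intro conjI allI ballI)
    fix i
    have "subgroup (hcomp M i \<inter> U) (add_monoid ?X)"
    proof (rule group.subgroupI[OF X.a_group])
      show "hcomp M i \<inter> U \<noteq> {}" using sub_zero[OF U] M.hcomp_zero by blast
      fix x assume x: "x \<in> hcomp M i \<inter> U"
      have "\<ominus>\<^bsub>?X\<^esub> x = \<ominus>\<^bsub>M\<^esub> x"
        using additive_minus[OF X.abelian_group_axioms M.abelian_group_axioms, of x "\<lambda>x. x"] x sub by auto
      then show "inv\<^bsub>add_monoid ?X\<^esub> x \<in> hcomp M i \<inter> U"
        using x M.hcomp_uminus sub_uminus[OF U] by (simp add: a_inv_def)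
    qed (use M.hcomp_add sub_add[OF U] in auto)
    then show "additive_subgroup (hcomp ?X i) ?X" by (simp add: additive_subgroup.intro)
  next
    fix x assume "x \<in> carrier ?X"
    then have x: "x \<in> U" "x \<in> carrier M" using sub by auto
    show "\<exists>!c. is_decomposition ?X (hcomp ?X) x c"
    proof (rule ex1I)
      have "x = (\<Oplus>\<^bsub>M\<^esub>i\<in>supp M x. M.hp i x)" by (rule M.decomp) (use x in auto)
      also have "\<dots> = (\<Oplus>\<^bsub>?X\<^esub>i\<in>supp M x. M.hp i x)" by (rule fs[symmetric]) (use x hpU in auto)
      finally show "is_decomposition ?X (hcomp ?X) x (\<lambda>i. M.hp i x)"
        using x hpU M.supp_finite[OF x(2)] by (auto simp: is_decomposition_def supp_def)
      fix c assume c: "is_decomposition ?X (hcomp ?X) x c"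
      let ?I = "{i. c i \<noteq> \<zero>\<^bsub>M\<^esub>}"
      have "x = (\<Oplus>\<^bsub>M\<^esub>i\<in>?I. c i)" using c fs[of ?I c] by (auto simp: is_decomposition_def)
      then have "M.hp i x = c i" for i
        by (rule M.hp_unique[rotated 3]) (use c in \<open>auto simp: is_decomposition_def\<close>)
      then show "c = (\<lambda>i. M.hp i x)" by auto
    qed
  qed
  then show ?thesis
    by unfold_locales (use hcomp_smult sub_smult[OF U] A.hcomp_closed in auto)
qed

text \<open>\<open>p x\<close> is the only element of \<open>U\<close> that differs from
  \<open>x\<close> by an element of the complement. Additivity and linearity follow from this
  uniqueness.\<close>

lemma summand_projection:
  assumes "graded_direct_summand A M U"
  obtains p where "\<And>x. x \<in> carrier M \<Longrightarrow> p x \<in> U" "\<And>x. x \<in> U \<Longrightarrow> p x = x"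
    "\<And>x y. x \<in> carrier M \<Longrightarrow> y \<in> carrier M \<Longrightarrow> p (x \<oplus>\<^bsub>M\<^esub> y) = p x \<oplus>\<^bsub>M\<^esub> p y"
    "\<And>a x. a \<in> carrier A \<Longrightarrow> x \<in> carrier M \<Longrightarrow> p (a \<odot>\<^bsub>M\<^esub> x) = a \<odot>\<^bsub>M\<^esub> p x"
proof -
  obtain V where U: "submodule U A M" and V: "submodule V A M"
    and int: "U \<inter> V = {\<zero>\<^bsub>M\<^esub>}" and sum: "U <+>\<^bsub>M\<^esub> V = carrier M"
    using assms by (auto simp: graded_direct_summand_def graded_submodule_def)
  note c = subsetD[OF sub_closed[OF U]] subsetD[OF sub_closed[OF V]]
  have "\<forall>x\<in>carrier M. \<exists>u. u \<in> U \<and> x \<ominus>\<^bsub>M\<^esub> u \<in> V"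
  proof
    fix x assume "x \<in> carrier M"
    then have "x \<in> U <+>\<^bsub>M\<^esub> V" using sum by simp
    then obtain u v where "u \<in> U" "v \<in> V" "x = u \<oplus>\<^bsub>M\<^esub> v" by (auto simp: set_add_def')
    then have "x \<ominus>\<^bsub>M\<^esub> u = v" using c by (simp add: M.minus_eq M.a_ac M.r_neg1 M.r_neg2 M.cancel_simps)
    then show "\<exists>u. u \<in> U \<and> x \<ominus>\<^bsub>M\<^esub> u \<in> V" using \<open>u \<in> U\<close> \<open>v \<in> V\<close> by auto
  qed
  then obtain p where p: "\<And>x. x \<in> carrier M \<Longrightarrow> p x \<in> U" "\<And>x. x \<in> carrier M \<Longrightarrow> x \<ominus>\<^bsub>M\<^esub> p x \<in> V" by metis
  have uniq: "u = p x" if "x \<in> carrier M" "u \<in> U" "x \<ominus>\<^bsub>M\<^esub> u \<in> V" for x u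
  proof -
    have cl: "u \<in> carrier M" "p x \<in> carrier M" using that p(1) c by auto
    have "u \<ominus>\<^bsub>M\<^esub> p x = (x \<ominus>\<^bsub>M\<^esub> p x) \<oplus>\<^bsub>M\<^esub> \<ominus>\<^bsub>M\<^esub> (x \<ominus>\<^bsub>M\<^esub> u)"
      using cl that(1) by (simp add: M.minus_eq M.minus_add M.minus_minus M.a_ac M.r_neg M.r_neg1 M.r_neg2 M.cancel_simps)
    also have "\<dots> \<in> V" by (intro sub_add[OF V] sub_uminus[OF V] p that)
    finally have "u \<ominus>\<^bsub>M\<^esub> p x \<in> V" .
    moreover have "u \<ominus>\<^bsub>M\<^esub> p x \<in> U"
      unfolding M.minus_eq by (intro sub_add[OF U] sub_uminus[OF U] p that)
    ultimately have "u \<ominus>\<^bsub>M\<^esub> p x = \<zero>\<^bsub>M\<^esub>" using int by blast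
    then show ?thesis using M.minus_zero_eq[OF cl] by simp
  qed
  show thesis
  proof (rule that[of p])
    show "p x \<in> U" if "x \<in> carrier M" for x using p that by simp
    show "p x = x" if "x \<in> U" for x
      using uniq[of x x] that c sub_zero[OF V] by (simp add: M.minus_eq M.r_neg)
    show "p (x \<oplus>\<^bsub>M\<^esub> y) = p x \<oplus>\<^bsub>M\<^esub> p y" if x: "x \<in> carrier M" and y: "y \<in> carrier M" for x y
    proof (rule uniq[symmetric])
      have "(x \<oplus>\<^bsub>M\<^esub> y) \<ominus>\<^bsub>M\<^esub> (p x \<oplus>\<^bsub>M\<^esub> p y) = (x \<ominus>\<^bsub>M\<^esub> p x) \<oplus>\<^bsub>M\<^esub> (y \<ominus>\<^bsub>M\<^esub> p y)"
        using x y c p by (simp add: M.minus_eq M.minus_add M.a_ac)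
      also have "\<dots> \<in> V" by (intro sub_add[OF V] p x y)
      finally show "(x \<oplus>\<^bsub>M\<^esub> y) \<ominus>\<^bsub>M\<^esub> (p x \<oplus>\<^bsub>M\<^esub> p y) \<in> V" .
    qed (use x y p sub_add[OF U] in auto)
    show "p (a \<odot>\<^bsub>M\<^esub> x) = a \<odot>\<^bsub>M\<^esub> p x" if a: "a \<in> carrier A" and x: "x \<in> carrier M" for a x
    proof (rule uniq[symmetric])
      have "a \<odot>\<^bsub>M\<^esub> x \<ominus>\<^bsub>M\<^esub> a \<odot>\<^bsub>M\<^esub> p x = a \<odot>\<^bsub>M\<^esub> (x \<ominus>\<^bsub>M\<^esub> p x)"
        using x a c p by (simp add: M.minus_eq smult_r_distr smult_r_minus)
      also have "\<dots> \<in> V" by (intro sub_smult[OF V] p x a)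
      finally show "a \<odot>\<^bsub>M\<^esub> x \<ominus>\<^bsub>M\<^esub> a \<odot>\<^bsub>M\<^esub> p x \<in> V" .
    qed (use x a p sub_smult[OF U] smult_closed in auto)
  qed
qed

lemma summand_fin_gen:
  assumes "graded_direct_summand A M U" "fin_gen A M"
  shows "fin_gen A (graded_restrict M U)"
proof -
  let ?X = "graded_restrict M U"
  have U: "graded_submodule A M U" "submodule U A M"
    using assms(1) by (auto simp: graded_direct_summand_def graded_submodule_def)
  interpret X: graded_mod A ?X by (rule graded_restrict_mod[OF U(1)])
  obtain p where p: "\<And>x. x \<in> carrier M \<Longrightarrow> p x \<in> U" "\<And>x. x \<in> U \<Longrightarrow> p x = x"
    "\<And>x y. x \<in> carrier M \<Longrightarrow> y \<in> carrier M \<Longrightarrow> p (x \<oplus>\<^bsub>M\<^esub> y) = p x \<oplus>\<^bsub>M\<^esub> p y"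
    "\<And>a x. a \<in> carrier A \<Longrightarrow> x \<in> carrier M \<Longrightarrow> p (a \<odot>\<^bsub>M\<^esub> x) = a \<odot>\<^bsub>M\<^esub> p x"
    by (rule summand_projection[OF assms(1)]) blast
  obtain G where G: "finite G" "G \<subseteq> carrier M" "carrier M \<subseteq> spanned A M G"
    using assms(2) fin_gen_iff by blast
  have pG: "finite (p ` G)" "p ` G \<subseteq> carrier ?X" using G p by auto
  have "x \<in> spanned A ?X (p ` G)" if x: "x \<in> U" for x
  proof -
    have "x \<in> spanned A M G" using x sub_closed[OF U(2)] G(3) by blast
    then obtain c where c: "c \<in> G \<rightarrow> carrier A" "x = (\<Oplus>\<^bsub>M\<^esub>g\<in>G. c g \<odot>\<^bsub>M\<^esub> g)" by (auto simp: spanned_def)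
    have "p x = (\<Oplus>\<^bsub>?X\<^esub>g\<in>G. p (c g \<odot>\<^bsub>M\<^esub> g))"
      unfolding c(2) by (rule additive_finsum[OF M.abelian_group_axioms X.M.abelian_group_axioms G(1)])
        (use c G p in \<open>auto intro!: smult_closed\<close>)
    also have "\<dots> \<in> spanned A ?X (p ` G)"
    proof (rule X.spanned_finsum[OF G(1) _ pG(2)])
      fix g assume g: "g \<in> G"
      then have "p (c g \<odot>\<^bsub>M\<^esub> g) = c g \<odot>\<^bsub>?X\<^esub> p g" using p(4)[of "c g" g] c G by auto
      moreover have "c g \<odot>\<^bsub>?X\<^esub> p g \<in> spanned A ?X (p ` G)"
        by (rule X.spanned_base[OF pG]) (use g c in auto)
      ultimately show "p (c g \<odot>\<^bsub>M\<^esub> g) \<in> spanned A ?X (p ` G)" by simp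
    qed
    finally show ?thesis using p(2)[OF x] by simp
  qed
  then show ?thesis unfolding X.fin_gen_iff using pG by auto
qed

section \<open>Homogeneous components as modules over the degree zero part\<close>

abbreviation "S \<equiv> degree_zero A"
abbreviation "Mc e \<equiv> M\<lparr>carrier := hcomp M e\<rparr>"

lemma comp_left_module: "left_module S (Mc e)"
proof -
  have "abelian_group (Mc e)"
  proof (rule abelian_groupI)
    fix x assume "x \<in> carrier (Mc e)"
    then show "\<exists>y\<in>carrier (Mc e). y \<oplus>\<^bsub>Mc e\<^esub> x = \<zero>\<^bsub>Mc e\<^esub>"
      by (intro bexI[of _ "\<ominus>\<^bsub>M\<^esub> x"]) (auto simp: M.hcomp_uminus M.l_neg M.hcomp_closed)
  qed (auto simp: M.hcomp_add M.hcomp_closed M.a_ac)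
  moreover have "a \<odot>\<^bsub>M\<^esub> x \<in> hcomp M e" if "a \<in> hcomp A 0" "x \<in> hcomp M e" for a x
    using hcomp_smult[OF that] by simp
  ultimately show ?thesis
    by (intro left_module.intro A.degree_zero_ring left_module_axioms.intro)
      (auto simp: degree_zero_def A.hcomp_closed M.hcomp_closed smult_l_distr smult_r_distr smult_assoc smult_one)
qed

lemma comp_finsum:
  assumes "finite I" "\<And>i. i \<in> I \<Longrightarrow> f i \<in> hcomp M e"
  shows "(\<Oplus>\<^bsub>Mc e\<^esub>i\<in>I. f i) = (\<Oplus>\<^bsub>M\<^esub>i\<in>I. f i)"
proof -
  interpret c: left_module S "Mc e" by (rule comp_left_module)
  show ?thesis
    by (rule finsum_sub[OF c.M.abelian_group_axioms M.abelian_group_axioms])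
      (use assms M.hcomp_closed in auto)
qed

lemma hp_smult_expand:
  assumes "a \<in> carrier A" "x \<in> carrier M"
  shows "M.hp i (a \<odot>\<^bsub>M\<^esub> x) = (\<Oplus>\<^bsub>M\<^esub>d\<in>supp M x. A.hp (i - d) a \<odot>\<^bsub>M\<^esub> M.hp d x)"
proof -
  have "a \<odot>\<^bsub>M\<^esub> x = (\<Oplus>\<^bsub>M\<^esub>d\<in>supp M x. a \<odot>\<^bsub>M\<^esub> M.hp d x)"
    using M.decomp[of x "supp M x"] smult_r_finsum[of "supp M x" "\<lambda>d. M.hp d x" a] assms by simp
  then have "M.hp i (a \<odot>\<^bsub>M\<^esub> x) = (\<Oplus>\<^bsub>M\<^esub>d\<in>supp M x. M.hp i (a \<odot>\<^bsub>M\<^esub> M.hp d x))"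
    using M.hp_finsum[of "supp M x" "\<lambda>d. a \<odot>\<^bsub>M\<^esub> M.hp d x" i] assms by (simp add: smult_closed)
  also have "\<dots> = (\<Oplus>\<^bsub>M\<^esub>d\<in>supp M x. A.hp (i - d) a \<odot>\<^bsub>M\<^esub> M.hp d x)"
    by (rule M.finsum_cong') (use assms hp_smult_right[OF M.hp_in] in \<open>auto intro!: smult_closed\<close>)
  finally show ?thesis .
qed

text \<open>An element of degree \<open>e\<close> is a sum of products of a component of
  \<open>A\<close> in degree \<open>e - d\<close> with the degree \<open>d\<close> component of a
  generator. Hence finitely many products b g_d suffice, with b among the generators of that
  component of \<open>A\<close> over the degree 0 part.\<close>

lemma comp_fin_gen:
  assumes fg: "fin_gen A M"
    and Afg: "\<And>i. \<exists>B. finite B \<and> B \<subseteq> hcomp A i \<and>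
      (\<forall>a\<in>hcomp A i. \<exists>c\<in>B \<rightarrow> hcomp A 0. a = (\<Oplus>\<^bsub>A\<^esub>b\<in>B. c b \<otimes>\<^bsub>A\<^esub> b))"
  shows "\<exists>G. finite G \<and> G \<subseteq> hcomp M e \<and> hcomp M e \<subseteq> spanned S (Mc e) G"
proof -
  interpret c: left_module S "Mc e" by (rule comp_left_module)
  obtain G where G: "finite G" "G \<subseteq> carrier M" "carrier M \<subseteq> spanned A M G"
    using fg fin_gen_iff by blast
  have "\<exists>B. \<forall>i. finite (B i) \<and> B i \<subseteq> hcomp A i \<and>
      (\<forall>a\<in>hcomp A i. \<exists>c\<in>B i \<rightarrow> hcomp A 0. a = (\<Oplus>\<^bsub>A\<^esub>b\<in>B i. c b \<otimes>\<^bsub>A\<^esub> b))"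
    by (intro choice allI Afg)
  then obtain B where "\<forall>i. finite (B i) \<and> B i \<subseteq> hcomp A i \<and>
      (\<forall>a\<in>hcomp A i. \<exists>c\<in>B i \<rightarrow> hcomp A 0. a = (\<Oplus>\<^bsub>A\<^esub>b\<in>B i. c b \<otimes>\<^bsub>A\<^esub> b))" ..
  then have B: "finite (B i)" "B i \<subseteq> hcomp A i"
    "a \<in> hcomp A i \<Longrightarrow> \<exists>c\<in>B i \<rightarrow> hcomp A 0. a = (\<Oplus>\<^bsub>A\<^esub>b\<in>B i. c b \<otimes>\<^bsub>A\<^esub> b)" for i a
    by blast+
  define H where "H = (\<Union>g\<in>G. \<Union>d\<in>supp M g. (\<lambda>b. b \<odot>\<^bsub>M\<^esub> M.hp d g) ` B (e - d))"
  have finH: "finite H" unfolding H_def using G B M.supp_finite by (intro finite_UN_I finite_imageI) auto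
  have bh: "b \<odot>\<^bsub>M\<^esub> M.hp d g \<in> hcomp M e" if "g \<in> G" "b \<in> B (e - d)" for g d b
    using hcomp_smult[of b "e - d" "M.hp d g" d] subsetD[OF B(2) that(2)] subsetD[OF G(2) that(1)] by simp
  have subH: "H \<subseteq> hcomp M e" using bh by (auto simp: H_def)
  have subH': "H \<subseteq> carrier (Mc e)" using subH by simp
  have base: "a \<odot>\<^bsub>M\<^esub> M.hp d g \<in> spanned S (Mc e) H"
    if a: "a \<in> hcomp A (e - d)" and g: "g \<in> G" and d: "d \<in> supp M g" for a d g
  proof -
    obtain k where k: "k \<in> B (e - d) \<rightarrow> hcomp A 0" "a = (\<Oplus>\<^bsub>A\<^esub>b\<in>B (e - d). k b \<otimes>\<^bsub>A\<^esub> b)"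
      using B(3)[OF a] by blast
    have kA: "k b \<in> carrier A" "b \<in> carrier A" "k b \<in> hcomp A 0" if "b \<in> B (e - d)" for b
      using k that B(2) A.hcomp_closed by blast+
    have gM: "M.hp d g \<in> carrier M" using g G by auto
    have "a \<odot>\<^bsub>M\<^esub> M.hp d g = (\<Oplus>\<^bsub>M\<^esub>b\<in>B (e - d). (k b \<otimes>\<^bsub>A\<^esub> b) \<odot>\<^bsub>M\<^esub> M.hp d g)"
      unfolding k(2) by (rule smult_l_finsum) (use B kA gM in auto)
    also have "\<dots> = (\<Oplus>\<^bsub>M\<^esub>b\<in>B (e - d). k b \<odot>\<^bsub>M\<^esub> (b \<odot>\<^bsub>M\<^esub> M.hp d g))"
      by (rule M.finsum_cong') (use kA gM in \<open>auto intro!: smult_assoc smult_closed\<close>)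
    also have "\<dots> = (\<Oplus>\<^bsub>Mc e\<^esub>b\<in>B (e - d). k b \<odot>\<^bsub>M\<^esub> (b \<odot>\<^bsub>M\<^esub> M.hp d g))"
      by (rule comp_finsum[symmetric]) (use B kA bh[OF g] hcomp_smult[of _ 0 _ e] in auto)
    also have "\<dots> \<in> spanned S (Mc e) H"
    proof (rule c.spanned_finsum[OF B(1) _ subH'])
      fix b assume b: "b \<in> B (e - d)"
      have "k b \<odot>\<^bsub>Mc e\<^esub> (b \<odot>\<^bsub>M\<^esub> M.hp d g) \<in> spanned S (Mc e) H"
        by (rule c.spanned_base[OF finH subH']) (use b g d kA in \<open>auto simp: H_def degree_zero_def\<close>)
      then show "k b \<odot>\<^bsub>M\<^esub> (b \<odot>\<^bsub>M\<^esub> M.hp d g) \<in> spanned S (Mc e) H" by simp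
    qed
    finally show ?thesis .
  qed
  have "x \<in> spanned S (Mc e) H" if x: "x \<in> hcomp M e" for x
  proof -
    have "x \<in> spanned A M G" using G(3) M.hcomp_closed[OF x] by blast
    then obtain k where k: "k \<in> G \<rightarrow> carrier A" "x = (\<Oplus>\<^bsub>M\<^esub>g\<in>G. k g \<odot>\<^bsub>M\<^esub> g)" by (auto simp: spanned_def)
    have kg: "k g \<in> carrier A" "g \<in> carrier M" if "g \<in> G" for g using k G that by auto
    have t: "A.hp (e - d) (k g) \<odot>\<^bsub>M\<^esub> M.hp d g \<in> hcomp M e" if "g \<in> G" for g d
      using hcomp_smult[OF A.hp_in M.hp_in, of "k g" g "e - d" d] kg[OF that] by simp
    have "x = M.hp e x" using M.hp_homog[OF x] by simp
    also have "\<dots> = (\<Oplus>\<^bsub>M\<^esub>g\<in>G. M.hp e (k g \<odot>\<^bsub>M\<^esub> g))"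
      unfolding k(2) by (rule M.hp_finsum) (use G kg in \<open>auto intro!: smult_closed\<close>)
    also have "\<dots> = (\<Oplus>\<^bsub>Mc e\<^esub>g\<in>G. M.hp e (k g \<odot>\<^bsub>M\<^esub> g))"
      by (rule comp_finsum[symmetric]) (use G kg in \<open>auto intro!: M.hp_in smult_closed\<close>)
    also have "\<dots> \<in> spanned S (Mc e) H"
    proof (rule c.spanned_finsum[OF G(1) _ subH'])
      fix g assume g: "g \<in> G"
      have "M.hp e (k g \<odot>\<^bsub>M\<^esub> g) = (\<Oplus>\<^bsub>Mc e\<^esub>d\<in>supp M g. A.hp (e - d) (k g) \<odot>\<^bsub>M\<^esub> M.hp d g)"
        unfolding hp_smult_expand[OF kg[OF g]] by (rule comp_finsum[symmetric]) (use kg[OF g] t[OF g] in auto)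
      also have "\<dots> \<in> spanned S (Mc e) H"
        by (rule c.spanned_finsum[OF _ _ subH']) (use kg[OF g] base[OF _ g] in auto)
      finally show "M.hp e (k g \<odot>\<^bsub>M\<^esub> g) \<in> spanned S (Mc e) H" .
    qed
    finally show ?thesis .
  qed
  then show ?thesis using finH subH by blast
qed

lemma bounded_below:
  assumes "fin_gen A M"
  obtains l where "\<And>e. e < l \<Longrightarrow> hcomp M e = {\<zero>\<^bsub>M\<^esub>}"
proof -
  obtain G where G: "finite G" "G \<subseteq> carrier M" "carrier M \<subseteq> spanned A M G"
    using assms fin_gen_iff by blast
  \<comment> \<open>Adding 0 keeps the set nonempty, so that its minimum makes sense.\<close>
  let ?D = "insert 0 (\<Union>g\<in>G. supp M g)"
  have D: "finite ?D" using G M.supp_finite by blast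
  have "hcomp M e = {\<zero>\<^bsub>M\<^esub>}" if e: "e < Min ?D" for e
  proof -
    have "x = \<zero>\<^bsub>M\<^esub>" if x: "x \<in> hcomp M e" for x
    proof -
      have "x \<in> spanned A M G" using G(3) M.hcomp_closed[OF x] by blast
      then obtain k where k: "k \<in> G \<rightarrow> carrier A" "x = (\<Oplus>\<^bsub>M\<^esub>g\<in>G. k g \<odot>\<^bsub>M\<^esub> g)" by (auto simp: spanned_def)
      have kg: "k g \<in> carrier A" "g \<in> carrier M" if "g \<in> G" for g using k G that by auto
      have "x = M.hp e x" using M.hp_homog[OF x] by simp
      also have "\<dots> = (\<Oplus>\<^bsub>M\<^esub>g\<in>G. M.hp e (k g \<odot>\<^bsub>M\<^esub> g))"
        unfolding k(2) by (rule M.hp_finsum) (use G kg in \<open>auto intro!: smult_closed\<close>)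
      also have "\<dots> = (\<Oplus>\<^bsub>M\<^esub>g\<in>G. \<zero>\<^bsub>M\<^esub>)"
      proof (rule M.finsum_cong'[OF refl])
        fix g assume g: "g \<in> G"
        have "(\<Oplus>\<^bsub>M\<^esub>d\<in>supp M g. A.hp (e - d) (k g) \<odot>\<^bsub>M\<^esub> M.hp d g) = (\<Oplus>\<^bsub>M\<^esub>d\<in>supp M g. \<zero>\<^bsub>M\<^esub>)"
        proof (rule M.finsum_cong'[OF refl])
          fix d assume "d \<in> supp M g"
          then have "Min ?D \<le> d" using D g by (intro Min_le) auto
          then show "A.hp (e - d) (k g) \<odot>\<^bsub>M\<^esub> M.hp d g = \<zero>\<^bsub>M\<^esub>" using e kg[OF g] by (simp add: smult_l_null)
        qed auto
        then show "M.hp e (k g \<odot>\<^bsub>M\<^esub> g) = \<zero>\<^bsub>M\<^esub>" by (simp add: hp_smult_expand[OF kg[OF g]])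
      qed auto
      finally show ?thesis by simp
    qed
    then show ?thesis by auto
  qed
  then show thesis by (rule that)
qed

text \<open>The submodule generated by the component of degree 0. The coefficients in
  \<open>spanned\<close> form a finite sum over all of \<open>G\<close>, hence the finite subset
  chosen for each element.\<close>

definition gen0 :: "'m set" where
  "gen0 = {x. \<exists>G. finite G \<and> G \<subseteq> hcomp M 0 \<and> x \<in> spanned A M G}"

lemma spanned_mono:
  assumes "finite H" "H \<subseteq> carrier M" "G \<subseteq> H"
  shows "spanned A M G \<subseteq> spanned A M H"
proof
  fix x assume "x \<in> spanned A M G"
  then obtain c where c: "c \<in> G \<rightarrow> carrier A" "x = (\<Oplus>\<^bsub>M\<^esub>g\<in>G. c g \<odot>\<^bsub>M\<^esub> g)" by (auto simp: spanned_def)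
  show "x \<in> spanned A M H" unfolding c(2)
    by (rule spanned_finsum[OF finite_subset[OF assms(3,1)]])
      (use assms c in \<open>auto intro!: spanned_base[OF assms(1,2)]\<close>)
qed

lemma spanned_smult:
  assumes "finite G" "G \<subseteq> carrier M" "x \<in> spanned A M G" "a \<in> carrier A"
  shows "a \<odot>\<^bsub>M\<^esub> x \<in> spanned A M G"
proof -
  obtain c where c: "c \<in> G \<rightarrow> carrier A" "x = (\<Oplus>\<^bsub>M\<^esub>g\<in>G. c g \<odot>\<^bsub>M\<^esub> g)"
    using assms(3) by (auto simp: spanned_def)
  have "a \<odot>\<^bsub>M\<^esub> x = (\<Oplus>\<^bsub>M\<^esub>g\<in>G. a \<odot>\<^bsub>M\<^esub> (c g \<odot>\<^bsub>M\<^esub> g))"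
    unfolding c(2) by (rule smult_r_finsum) (use assms c in \<open>auto intro!: smult_closed\<close>)
  also have "\<dots> \<in> spanned A M G"
  proof (rule spanned_finsum[OF assms(1) _ assms(2)])
    fix g assume g: "g \<in> G"
    then have cg: "c g \<in> carrier A" "g \<in> carrier M" using c assms by auto
    have "(a \<otimes>\<^bsub>A\<^esub> c g) \<odot>\<^bsub>M\<^esub> g \<in> spanned A M G"
      by (rule spanned_base[OF assms(1,2) g]) (use cg assms in simp)
    then show "a \<odot>\<^bsub>M\<^esub> (c g \<odot>\<^bsub>M\<^esub> g) \<in> spanned A M G" using cg assms by (simp add: smult_assoc)
  qed
  finally show ?thesis .
qed

lemma gen0_submodule: "submodule gen0 A M"
proof (rule submoduleI)
  have h0: "G \<subseteq> carrier M" if "G \<subseteq> hcomp M 0" for G using that M.hcomp_closed by blast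
  show "gen0 \<subseteq> carrier M"
  proof
    fix x assume "x \<in> gen0"
    then obtain G where "G \<subseteq> hcomp M 0" "x \<in> spanned A M G" by (auto simp: gen0_def)
    then show "x \<in> carrier M" using spanned_closed[OF h0[of G]] by blast
  qed
  show "\<zero>\<^bsub>M\<^esub> \<in> gen0" using spanned_zero[of "{}"] by (auto simp: gen0_def)
  show "x \<oplus>\<^bsub>M\<^esub> y \<in> gen0" if xy: "x \<in> gen0" "y \<in> gen0" for x y
  proof -
    obtain G H where G: "finite G" "G \<subseteq> hcomp M 0" "x \<in> spanned A M G"
      and H: "finite H" "H \<subseteq> hcomp M 0" "y \<in> spanned A M H"
      using xy by (auto simp: gen0_def)
    have "x \<in> spanned A M (G \<union> H)" "y \<in> spanned A M (G \<union> H)"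
      using spanned_mono[of "G \<union> H" G] spanned_mono[of "G \<union> H" H] G H h0[of "G \<union> H"] by auto
    then have "x \<oplus>\<^bsub>M\<^esub> y \<in> spanned A M (G \<union> H)"
      using h0[of "G \<union> H"] G(2) H(2) by (intro spanned_add) simp_all
    moreover have "finite (G \<union> H)" "G \<union> H \<subseteq> hcomp M 0" using G H by auto
    ultimately show ?thesis unfolding gen0_def by blast
  qed
  show "a \<odot>\<^bsub>M\<^esub> x \<in> gen0" if a: "a \<in> carrier A" and x: "x \<in> gen0" for a x
  proof -
    obtain G where G: "finite G" "G \<subseteq> hcomp M 0" "x \<in> spanned A M G" using x by (auto simp: gen0_def)
    then have "a \<odot>\<^bsub>M\<^esub> x \<in> spanned A M G" using spanned_smult[OF G(1) h0[OF G(2)] G(3) a] by simp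
    then show ?thesis unfolding gen0_def using G by blast
  qed
qed

text \<open>
  In the lowest degree \<open>i\<close> where generation fails, a functional on \<open>M\<^sub>i\<close> which kills the submodule
  generated by \<open>M\<^sub>0\<close> extends by zero to all of \<open>M\<close>.
\<close>

lemma graded_nakayama:
  assumes fg: "fin_gen A M" and ss: "semisimple_ring S" and neg: "\<And>i. i < 0 \<Longrightarrow> hcomp M i = {\<zero>\<^bsub>M\<^esub>}"
    and hom: "\<And>\<phi> i x. i \<noteq> 0 \<Longrightarrow> (\<And>x. x \<in> carrier M \<Longrightarrow> \<phi> x \<in> hcomp A 0) \<Longrightarrow>
      (\<And>x y. x \<in> carrier M \<Longrightarrow> y \<in> carrier M \<Longrightarrow> \<phi> (x \<oplus>\<^bsub>M\<^esub> y) = \<phi> x \<oplus>\<^bsub>A\<^esub> \<phi> y) \<Longrightarrow>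
      (\<And>a x. a \<in> carrier A \<Longrightarrow> x \<in> carrier M \<Longrightarrow> \<phi> (a \<odot>\<^bsub>M\<^esub> x) = A.hp 0 a \<otimes>\<^bsub>A\<^esub> \<phi> x) \<Longrightarrow>
      (\<And>j x. j \<noteq> i \<Longrightarrow> x \<in> hcomp M j \<Longrightarrow> \<phi> x = \<zero>\<^bsub>A\<^esub>) \<Longrightarrow> x \<in> carrier M \<Longrightarrow> \<phi> x = \<zero>\<^bsub>A\<^esub>"
  shows "carrier M \<subseteq> gen0"
proof -
  have U: "submodule gen0 A M" by (rule gen0_submodule)
  have "hcomp M (int n) \<subseteq> gen0" for n
  proof (induction n rule: less_induct)
    case (less n)
    have low: "hcomp M d \<subseteq> gen0" if "d < int n" for d
    proof (cases "d < 0")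
      case True
      then show ?thesis using neg sub_zero[OF U] by simp
    next
      case False
      then show ?thesis using less.IH[of "nat d"] that by simp
    qed
    show ?case
    proof (cases "n = 0")
      case True
      show ?thesis
      proof
        fix x assume x: "x \<in> hcomp M (int n)"
        then have "\<one>\<^bsub>A\<^esub> \<odot>\<^bsub>M\<^esub> x \<in> spanned A M {x}"
          by (intro spanned_base) (auto simp: M.hcomp_closed)
        then show "x \<in> gen0" using x True M.hcomp_closed[OF x]
          by (auto simp: gen0_def smult_one intro!: exI[of _ "{x}"])
      qed
    next
      case False
      let ?i = "int n" and ?W = "Mc (int n)"
      let ?Z = "gen0 \<inter> hcomp M ?i"
      interpret c: left_module S ?W by (rule comp_left_module)
      have "submodule ?Z S ?W"
      proof (rule submodule.intro)
        show "subgroup ?Z (add_monoid ?W)"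
        proof (rule group.subgroupI[OF c.M.a_group])
          fix x assume x: "x \<in> ?Z"
          have "\<ominus>\<^bsub>?W\<^esub> x = \<ominus>\<^bsub>M\<^esub> x"
            using additive_minus[OF c.M.abelian_group_axioms M.abelian_group_axioms, of x "\<lambda>x. x"] x M.hcomp_closed by auto
          then show "inv\<^bsub>add_monoid ?W\<^esub> x \<in> ?Z"
            using x M.hcomp_uminus sub_uminus[OF U] by (simp add: a_inv_def)
        qed (use sub_zero[OF U] sub_add[OF U] M.hcomp_add in auto)
        show "submodule_axioms ?Z S ?W"
          using sub_smult[OF U] hcomp_smult[of _ 0 _ ?i] A.hcomp_closed
          by (intro submodule_axioms.intro) (auto simp: degree_zero_def)
      qed
      then interpret db: dual_basis S ?W ?Z by (intro dual_basis.intro c.left_module_axioms dual_basis_axioms.intro)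
      obtain G where G: "finite G" "G \<subseteq> carrier M" "carrier M \<subseteq> spanned A M G"
        using fg fin_gen_iff by blast
      let ?G = "M.hp ?i ` G"
      have finG: "finite ?G" "?G \<subseteq> carrier ?W" using G by auto
      \<comment> \<open>These are the elements spanned, modulo \<open>?Z\<close>, by the degree
        \<open>?i\<close> components of the generators. Components of a generator in lower degree
        contribute to \<open>gen0\<close> by the induction hypothesis, those in higher degree
        contribute nothing.\<close>
      let ?P = "{x \<in> hcomp M ?i. \<exists>y\<in>spanned S ?W ?G. x \<ominus>\<^bsub>?W\<^esub> y \<in> ?Z}"
      have spW: "spanned S ?W ?G \<subseteq> hcomp M ?i" using c.spanned_closed[OF finG(2)] by simp
      have P0: "x \<in> ?P" if "x \<in> ?Z" for x
      proof -
        have "\<ominus>\<^bsub>?W\<^esub> \<zero>\<^bsub>?W\<^esub> = \<zero>\<^bsub>?W\<^esub>" by (rule c.M.minus_equality) simp_all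
        then have "x \<ominus>\<^bsub>?W\<^esub> \<zero>\<^bsub>?W\<^esub> = x" using that M.hcomp_closed[of x ?i] by (simp add: c.M.minus_eq)
        then show ?thesis using that c.spanned_zero[OF finG(2)] by force
      qed
      have Padd: "x \<oplus>\<^bsub>?W\<^esub> y \<in> ?P" if xP: "x \<in> ?P" "y \<in> ?P" for x y
      proof -
        obtain x' y' where xy: "x' \<in> spanned S ?W ?G" "x \<ominus>\<^bsub>?W\<^esub> x' \<in> ?Z" "y' \<in> spanned S ?W ?G" "y \<ominus>\<^bsub>?W\<^esub> y' \<in> ?Z"
          using xP by blast
        have cl: "x \<in> carrier ?W" "y \<in> carrier ?W" "x' \<in> carrier ?W" "y' \<in> carrier ?W"
          using xP xy subsetD[OF spW] by auto
        have "(x \<oplus>\<^bsub>?W\<^esub> y) \<ominus>\<^bsub>?W\<^esub> (x' \<oplus>\<^bsub>?W\<^esub> y') = (x \<ominus>\<^bsub>?W\<^esub> x') \<oplus>\<^bsub>?W\<^esub> (y \<ominus>\<^bsub>?W\<^esub> y')"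
          by (rule c.M.add_minus_add[OF cl])
        also have "\<dots> \<in> ?Z" by (rule db.Z_add[OF xy(2,4)])
        finally show ?thesis using c.spanned_add[OF finG(2) xy(1,3)] c.M.a_closed[OF cl(1,2)] by auto
      qed
      have gens: "\<exists>y\<in>spanned S ?W ?G. x \<ominus>\<^bsub>?W\<^esub> y \<in> ?Z" if x: "x \<in> carrier ?W" for x
      proof -
        have xh: "x \<in> hcomp M ?i" using x by simp
        have "x \<in> spanned A M G" using G(3) M.hcomp_closed[OF xh] by blast
        then obtain k where k: "k \<in> G \<rightarrow> carrier A" "x = (\<Oplus>\<^bsub>M\<^esub>g\<in>G. k g \<odot>\<^bsub>M\<^esub> g)" by (auto simp: spanned_def)
        have kg: "k g \<in> carrier A" "g \<in> carrier M" if "g \<in> G" for g using k G that by auto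
        have t: "A.hp (?i - d) (k g) \<odot>\<^bsub>M\<^esub> M.hp d g \<in> hcomp M ?i" if "g \<in> G" for g d
          using hcomp_smult[OF A.hp_in M.hp_in, of "k g" g "?i - d" d] kg[OF that] by simp
        have "x = M.hp ?i x" using M.hp_homog[OF xh] by simp
        also have "\<dots> = (\<Oplus>\<^bsub>M\<^esub>g\<in>G. M.hp ?i (k g \<odot>\<^bsub>M\<^esub> g))"
          unfolding k(2) by (rule M.hp_finsum) (use G kg in \<open>auto intro!: smult_closed\<close>)
        also have "\<dots> = (\<Oplus>\<^bsub>?W\<^esub>g\<in>G. M.hp ?i (k g \<odot>\<^bsub>M\<^esub> g))"
          by (rule comp_finsum[symmetric]) (use G kg in \<open>auto intro!: M.hp_in smult_closed\<close>)
        also have "\<dots> \<in> ?P"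
        proof (rule finsum_mem[OF c.M.abelian_group_axioms G(1) _ _ _ Padd])
          fix g assume g: "g \<in> G"
          have "M.hp ?i (k g \<odot>\<^bsub>M\<^esub> g) = (\<Oplus>\<^bsub>?W\<^esub>d\<in>supp M g. A.hp (?i - d) (k g) \<odot>\<^bsub>M\<^esub> M.hp d g)"
            unfolding hp_smult_expand[OF kg[OF g]] by (rule comp_finsum[symmetric]) (use kg[OF g] t[OF g] in auto)
          also have "\<dots> \<in> ?P"
          proof (rule finsum_mem[OF c.M.abelian_group_axioms _ _ _ _ Padd])
            show "finite (supp M g)" using kg[OF g] by simp
            fix d assume "d \<in> supp M g"
            show "A.hp (?i - d) (k g) \<odot>\<^bsub>M\<^esub> M.hp d g \<in> ?P"
            proof (cases "d = ?i")
              case True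
              have "A.hp 0 (k g) \<odot>\<^bsub>?W\<^esub> M.hp ?i g \<in> spanned S ?W ?G"
                by (rule c.spanned_base[OF finG]) (use g kg[OF g] in \<open>auto simp: degree_zero_def\<close>)
              moreover have "y \<ominus>\<^bsub>?W\<^esub> y \<in> ?Z" if "y \<in> carrier ?W" for y
                using c.M.minus_zero_eq[OF that that] db.Z_zero by simp
              ultimately show ?thesis using t[OF g, of d] True by auto
            next
              case False
              show ?thesis
              proof (cases "d < ?i")
                case True
                then have "M.hp d g \<in> gen0" using low M.hp_in kg[OF g] by blast
                then show ?thesis using t[OF g, of d] kg[OF g] sub_smult[OF U] by (intro P0) auto
              next
                case False
                then have "?i - d < 0" using \<open>d \<noteq> ?i\<close> by simp
                then show ?thesis using kg[OF g] db.Z_zero by (intro P0) (simp add: smult_l_null)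
              qed
            qed
          qed (use P0[OF db.Z_zero] in auto)
          finally show "M.hp ?i (k g \<odot>\<^bsub>M\<^esub> g) \<in> ?P" .
        qed (use P0[OF db.Z_zero] in auto)
        finally show ?thesis by blast
      qed
      obtain T :: "(nat \<times> 'm) set" and v \<psi> where T: "finite T" "v \<in> T \<rightarrow> carrier ?W"
        and \<psi>: "\<And>t x. t \<in> T \<Longrightarrow> x \<in> carrier ?W \<Longrightarrow> \<psi> t x \<in> carrier S"
          "\<And>t x y. t \<in> T \<Longrightarrow> x \<in> carrier ?W \<Longrightarrow> y \<in> carrier ?W \<Longrightarrow> \<psi> t (x \<oplus>\<^bsub>?W\<^esub> y) = \<psi> t x \<oplus>\<^bsub>S\<^esub> \<psi> t y"
          "\<And>t a x. t \<in> T \<Longrightarrow> a \<in> carrier S \<Longrightarrow> x \<in> carrier ?W \<Longrightarrow> \<psi> t (a \<odot>\<^bsub>?W\<^esub> x) = a \<otimes>\<^bsub>S\<^esub> \<psi> t x"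
          "\<And>t z. t \<in> T \<Longrightarrow> z \<in> ?Z \<Longrightarrow> \<psi> t z = \<zero>\<^bsub>S\<^esub>"
        and sum: "\<And>x. x \<in> carrier ?W \<Longrightarrow> x \<ominus>\<^bsub>?W\<^esub> (\<Oplus>\<^bsub>?W\<^esub>t\<in>T. \<psi> t x \<odot>\<^bsub>?W\<^esub> v t) \<in> ?Z"
        using db.dual_basis_exists[OF ss finG gens] by blast
      have S: "carrier S = hcomp A 0" "\<zero>\<^bsub>S\<^esub> = \<zero>\<^bsub>A\<^esub>" "\<And>x y. x \<oplus>\<^bsub>S\<^esub> y = x \<oplus>\<^bsub>A\<^esub> y" "\<And>x y. x \<otimes>\<^bsub>S\<^esub> y = x \<otimes>\<^bsub>A\<^esub> y"
        by (simp_all add: degree_zero_def)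
      have \<psi>0: "\<psi> t x = \<zero>\<^bsub>A\<^esub>" if t: "t \<in> T" and x: "x \<in> hcomp M ?i" for t x
      proof -
        have pa: "\<psi> t (x \<oplus>\<^bsub>M\<^esub> y) = \<psi> t x \<oplus>\<^bsub>A\<^esub> \<psi> t y" if "x \<in> hcomp M ?i" "y \<in> hcomp M ?i" for x y
          using \<psi>(2)[OF t, of x y] that by (simp add: S)
        have pc: "\<psi> t x \<in> hcomp A 0" if "x \<in> hcomp M ?i" for x using \<psi>(1)[OF t] that by (simp add: S)
        have z: "\<psi> t \<zero>\<^bsub>M\<^esub> = \<zero>\<^bsub>A\<^esub>" using \<psi>(4)[OF t db.Z_zero] by (simp add: S)
        have "\<psi> t (M.hp ?i x) = \<zero>\<^bsub>A\<^esub>"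
        proof (rule hom[where \<phi> = "\<lambda>x. \<psi> t (M.hp ?i x)" and i = ?i])
          show "?i \<noteq> 0" using False by simp
          show "\<psi> t (M.hp ?i x) \<in> hcomp A 0" if "x \<in> carrier M" for x using that by (intro pc) simp
          show "\<psi> t (M.hp ?i (x \<oplus>\<^bsub>M\<^esub> y)) = \<psi> t (M.hp ?i x) \<oplus>\<^bsub>A\<^esub> \<psi> t (M.hp ?i y)"
            if "x \<in> carrier M" "y \<in> carrier M" for x y using that by (simp add: M.hp_add pa)
          show "\<psi> t (M.hp ?i x) = \<zero>\<^bsub>A\<^esub>" if "j \<noteq> ?i" "x \<in> hcomp M j" for j x
            using that M.hp_homog[of x j ?i] z by simp
          show "x \<in> carrier M" using M.hcomp_closed[OF x] .
          show "\<psi> t (M.hp ?i (a \<odot>\<^bsub>M\<^esub> x)) = A.hp 0 a \<otimes>\<^bsub>A\<^esub> \<psi> t (M.hp ?i x)" if ax: "a \<in> carrier A" "x \<in> carrier M" for a x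
          proof -
            let ?D = "insert ?i (supp M x)"
            have th: "A.hp (?i - d) a \<odot>\<^bsub>M\<^esub> M.hp d x \<in> hcomp M ?i" for d
              using hcomp_smult[OF A.hp_in M.hp_in, of a x "?i - d" d] ax by simp
            have "M.hp ?i (a \<odot>\<^bsub>M\<^esub> x) = (\<Oplus>\<^bsub>M\<^esub>d\<in>supp M x. A.hp (?i - d) a \<odot>\<^bsub>M\<^esub> M.hp d x)"
              by (rule hp_smult_expand[OF ax])
            also have "\<dots> = (\<Oplus>\<^bsub>M\<^esub>d\<in>?D. A.hp (?i - d) a \<odot>\<^bsub>M\<^esub> M.hp d x)"
              by (rule M.finsum_superset[symmetric])
                (use ax M.supp_finite in \<open>auto simp: smult_r_null supp_def intro!: smult_closed\<close>)
            also have "\<dots> = (\<Oplus>\<^bsub>?W\<^esub>d\<in>?D. A.hp (?i - d) a \<odot>\<^bsub>M\<^esub> M.hp d x)"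
              by (rule comp_finsum[symmetric]) (use ax th in auto)
            finally have "\<psi> t (M.hp ?i (a \<odot>\<^bsub>M\<^esub> x)) = (\<Oplus>\<^bsub>A\<^esub>d\<in>?D. \<psi> t (A.hp (?i - d) a \<odot>\<^bsub>M\<^esub> M.hp d x))"
              using additive_finsum[OF c.M.abelian_group_axioms A.is_abelian_group, of ?D
                  "\<lambda>d. A.hp (?i - d) a \<odot>\<^bsub>M\<^esub> M.hp d x" "\<psi> t"] ax th pa A.hcomp_closed[OF pc] by auto
            also have "\<dots> = (\<Oplus>\<^bsub>A\<^esub>d\<in>?D. if ?i = d then \<psi> t (A.hp (?i - d) a \<odot>\<^bsub>M\<^esub> M.hp d x) else \<zero>\<^bsub>A\<^esub>)"
            proof (rule A.finsum_cong'[OF refl])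
              show "(\<lambda>d. if ?i = d then \<psi> t (A.hp (?i - d) a \<odot>\<^bsub>M\<^esub> M.hp d x) else \<zero>\<^bsub>A\<^esub>) \<in> ?D \<rightarrow> carrier A"
                using A.hcomp_closed[OF pc[OF th]] A.hcomp_closed[OF pc[OF th[of ?i]]] by auto
              fix d
              have "\<psi> t (A.hp (?i - d) a \<odot>\<^bsub>M\<^esub> M.hp d x) = \<zero>\<^bsub>A\<^esub>" if "?i \<noteq> d"
              proof (cases "d < ?i")
                case True
                then have "M.hp d x \<in> gen0" using low M.hp_in ax by blast
                then have "A.hp (?i - d) a \<odot>\<^bsub>M\<^esub> M.hp d x \<in> ?Z" using th[of d] ax sub_smult[OF U] by auto
                then show ?thesis using \<psi>(4)[OF t] by (simp add: S)
              next
                case False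
                then have "A.hp (?i - d) a = \<zero>\<^bsub>A\<^esub>" using ax that by simp
                then show ?thesis using z ax by (simp add: smult_l_null)
              qed
              then show "\<psi> t (A.hp (?i - d) a \<odot>\<^bsub>M\<^esub> M.hp d x) =
                (if ?i = d then \<psi> t (A.hp (?i - d) a \<odot>\<^bsub>M\<^esub> M.hp d x) else \<zero>\<^bsub>A\<^esub>)" by simp
            qed
            also have "\<dots> = \<psi> t (A.hp (?i - ?i) a \<odot>\<^bsub>M\<^esub> M.hp ?i x)"
              by (rule A.finsum_singleton) (use A.hcomp_closed[OF pc[OF th]] A.hcomp_closed[OF pc[OF th[of ?i]]] ax in auto)
            also have "\<dots> = A.hp 0 a \<otimes>\<^bsub>A\<^esub> \<psi> t (M.hp ?i x)"
              using \<psi>(3)[OF t, of "A.hp 0 a" "M.hp ?i x"] ax by (simp add: S)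
            finally show ?thesis .
          qed
        qed
        then show ?thesis using M.hp_homog[OF x, of ?i] by simp
      qed
      show ?thesis
      proof
        fix x assume x: "x \<in> hcomp M ?i"
        have "(\<Oplus>\<^bsub>?W\<^esub>t\<in>T. \<psi> t x \<odot>\<^bsub>?W\<^esub> v t) = (\<Oplus>\<^bsub>?W\<^esub>t\<in>T. \<zero>\<^bsub>?W\<^esub>)"
        proof (rule c.M.finsum_cong'[OF refl])
          fix t assume t: "t \<in> T"
          have "v t \<in> carrier M" using T(2) t M.hcomp_closed by auto
          then show "\<psi> t x \<odot>\<^bsub>?W\<^esub> v t = \<zero>\<^bsub>?W\<^esub>" using \<psi>0[OF t x] by (simp add: smult_l_null)
        qed auto
        also have "\<dots> = \<zero>\<^bsub>?W\<^esub>" by (rule c.M.finsum_zero)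
        finally have "x \<ominus>\<^bsub>?W\<^esub> \<zero>\<^bsub>?W\<^esub> \<in> ?Z" using sum[of x] x by simp
        moreover have "\<ominus>\<^bsub>?W\<^esub> \<zero>\<^bsub>?W\<^esub> = \<zero>\<^bsub>?W\<^esub>" by (rule c.M.minus_equality) (simp_all add: M.hcomp_closed)
        ultimately show "x \<in> gen0" using M.hcomp_closed[OF x] by (simp add: c.M.minus_eq)
      qed
    qed
  qed
  note nonneg = this
  have all: "hcomp M i \<subseteq> gen0" for i
  proof (cases "i < 0")
    case True
    then show ?thesis using neg[OF True] sub_zero[OF U] by simp
  next
    case False
    then show ?thesis using nonneg[of "nat i"] by simp
  qed
  show ?thesis
  proof
    fix x assume x: "x \<in> carrier M"
    have "(\<Oplus>\<^bsub>M\<^esub>i\<in>supp M x. M.hp i x) \<in> gen0"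
    proof (rule finsum_mem[OF M.abelian_group_axioms M.supp_finite[OF x] _ sub_closed[OF U] sub_zero[OF U] sub_add[OF U]])
      show "M.hp i x \<in> gen0" for i using subsetD[OF all M.hp_in[OF x]] .
    qed
    then show "x \<in> gen0" using M.decomp[of x "supp M x"] x by simp
  qed
qed

end

section \<open>The Koszul dual algebra\<close>

locale kos = galg k A for k :: "('k, 'w) ring_scheme" and A :: "('k, 'a, 'x) graded_scheme" +
  assumes koszul_A: "koszul_algebra k A"
begin

lemma standard_A: "standard_graded_algebra k A"
  using koszul_A by (simp add: koszul_algebra_def)

lemma graded_S: "graded_mod A (degree_zero A)"
  using koszul_A graded_module_iff[OF A.graded_ring_axioms]
  by (auto simp: koszul_algebra_def koszul_module_def)

lemmas semisimple_S = standard_degree_zero(1)[OF standard_A]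
lemmas S_comm = standard_degree_zero(2)[OF standard_A]

sublocale SS: gext k A "degree_zero A"
  by (rule gext.intro[OF galg_axioms gext_axioms.intro[OF graded_S graded_S]])

lemma koszul_S:
  assumes "SS.cocycle n F" "SS.hmg n F j" "j \<noteq> int n"
  shows "SS.bound n F"
  using koszul_A assms SS.koszul_module_iff unfolding koszul_algebra_def by blast

sublocale Ga: tot k A "degree_zero A" "degree_zero A" "koszul_dual k A"
  by unfold_locales (auto simp: koszul_dual_def total_ext_def Let_def)

sublocale SP: ext_pair k A "degree_zero A" "degree_zero A" "degree_zero A" ..

lemma dual_mult: "\<gamma> \<otimes>\<^bsub>koszul_dual k A\<^esub> \<phi> = yoneda k A (degree_zero A) (degree_zero A) \<gamma> \<phi>"
  by (simp add: koszul_dual_def Let_def)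

lemma dual_one: "\<one>\<^bsub>koszul_dual k A\<^esub> = SS.single 0 (\<lambda>as x. x)"
  by (rule ext) (simp add: koszul_dual_def Let_def SS.single_def SS.cls_def mk_def)

lemma dual_smult: "c \<odot>\<^bsub>koszul_dual k A\<^esub> \<phi> = (\<lambda>n. c \<odot>\<^bsub>SS.E n\<^esub> \<phi> n)"
  by (simp add: koszul_dual_def total_ext_def Let_def)

text \<open>Cocycles in degree 0 are the \<open>A\<close>-linear maps, and right multiplication is
  one by associativity. \<open>dual_semisimple\<close> shows that every endomorphism of the degree 0
  part is of this form.\<close>

lemma right_mult_cocycle:
  assumes x: "x \<in> hcomp A 0"
  shows "SS.cocycle 0 (\<lambda>as y. y \<otimes>\<^bsub>A\<^esub> x)"
proof -
  have cl: "y \<otimes>\<^bsub>A\<^esub> x \<in> hcomp A 0" if "y \<in> hcomp A 0" for y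
    using A.hcomp_mult[OF that x] by simp
  have ml: "SS.ml 0 (\<lambda>as y. y \<otimes>\<^bsub>A\<^esub> x)"
    using x cl A.hcomp_closed[of _ 0] scal_sub by (auto simp: zlin_def A.l_distr A.m_assoc)
  moreover have "SS.dl (\<lambda>as y. y \<otimes>\<^bsub>A\<^esub> x) as y = \<zero>\<^bsub>A\<^esub>"
    if as: "as \<in> tuples A (Suc 0)" and y: "y \<in> hcomp A 0" for as y
  proof -
    obtain a where a: "as = [a]" "a \<in> carrier A" using as by (auto elim!: tuples_SucE)
    have "SS.dl (\<lambda>as y. y \<otimes>\<^bsub>A\<^esub> x) [a] y = (A.hp 0 a \<otimes>\<^bsub>A\<^esub> y) \<otimes>\<^bsub>A\<^esub> x \<ominus>\<^bsub>degree_zero A\<^esub> (A.hp 0 a \<otimes>\<^bsub>A\<^esub> y) \<otimes>\<^bsub>A\<^esub> x"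
      using a y x A.hcomp_closed[of _ 0] by (simp add: delta_def A.m_assoc)
    also have "\<dots> = \<zero>\<^bsub>degree_zero A\<^esub>"
      using SS.S.M.minus_zero_eq[of "(A.hp 0 a \<otimes>\<^bsub>A\<^esub> y) \<otimes>\<^bsub>A\<^esub> x" "(A.hp 0 a \<otimes>\<^bsub>A\<^esub> y) \<otimes>\<^bsub>A\<^esub> x"]
        cl[of "A.hp 0 a \<otimes>\<^bsub>A\<^esub> y"] A.hcomp_mult[of "A.hp 0 a" 0 y 0] a y by simp
    finally show ?thesis by (simp add: a)
  qed
  ultimately show ?thesis by (simp add: cocyc_def)
qed

text \<open>Only the compatibility of the product with degrees is shown; the ring axioms are
  supplied later by the module structure over the dual. Factors of negative degree are zero, the
  others are classes of single cocycles.\<close>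

lemma dual_graded_ring:
  assumes "ring (koszul_dual k A)"
  shows "graded_ring (koszul_dual k A)"
proof -
  let ?D = "koszul_dual k A"
  interpret D: ring ?D by fact
  have m: "\<gamma> \<otimes>\<^bsub>?D\<^esub> \<phi> \<in> hcomp ?D (i + j)" if g: "\<gamma> \<in> hcomp ?D i" and f: "\<phi> \<in> hcomp ?D j" for \<gamma> \<phi> i j
  proof (cases "i < 0 \<or> j < 0")
    case True
    then have "\<gamma> = \<zero>\<^bsub>?D\<^esub> \<or> \<phi> = \<zero>\<^bsub>?D\<^esub>" using g f Ga.X_neg by auto
    then have "\<gamma> \<otimes>\<^bsub>?D\<^esub> \<phi> = \<zero>\<^bsub>?D\<^esub>" using g f Ga.X.hcomp_closed by auto
    then show ?thesis using Ga.X.hcomp_zero by simp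
  next
    case False
    then obtain m n where mn: "i = int m" "j = int n" by (metis int_nat_eq not_less)
    obtain G where G: "SS.cocycle m G" "\<gamma> = SS.single m G" using g unfolding mn by (rule Ga.hcomp_single)
    obtain F where F: "SS.cocycle n F" "\<phi> = SS.single n F" using f unfolding mn by (rule Ga.hcomp_single)
    have "\<gamma> \<otimes>\<^bsub>?D\<^esub> \<phi> = SS.single (m + n) (ycomp m G F)"
      unfolding dual_mult G F by (rule SP.yoneda_single[OF G(1) F(1)])
    also have "\<dots> \<in> hcomp ?D (int (m + n))"
      by (rule Ga.single_hcomp[OF SP.comp_cocycle[OF G(1) F(1)]])
    finally show ?thesis by (simp add: mn)
  qed
  show ?thesis
    by (intro graded_ring.intro D.ring_axioms Ga.X_graded graded_ring_axioms.intro m Ga.X_neg)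
qed

text \<open>The degree 0 part of the dual is the endomorphism ring of \<open>A_0\<close>, that is,
  \<open>A_0\<close> acting by right multiplication. Composition reverses the order of factors,
  which does no harm as \<open>A_0\<close> is commutative.\<close>

lemma dual_semisimple:
  assumes "ring (koszul_dual k A)"
  shows "semisimple_ring (degree_zero (koszul_dual k A))"
proof -
  let ?D = "koszul_dual k A"
  interpret D: graded_ring ?D by (rule dual_graded_ring[OF assms])
  let ?g = "\<lambda>x. SS.single 0 (\<lambda>as y. y \<otimes>\<^bsub>A\<^esub> x)"
  have D0: "carrier (degree_zero ?D) = hcomp ?D (int 0)" "\<one>\<^bsub>degree_zero ?D\<^esub> = \<one>\<^bsub>?D\<^esub>"
    "a \<otimes>\<^bsub>degree_zero ?D\<^esub> b = a \<otimes>\<^bsub>?D\<^esub> b" "a \<oplus>\<^bsub>degree_zero ?D\<^esub> b = a \<oplus>\<^bsub>?D\<^esub> b" for a b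
    by (simp_all add: degree_zero_def)
  have S0: "carrier (degree_zero A) = hcomp A 0" "\<one>\<^bsub>degree_zero A\<^esub> = \<one>\<^bsub>A\<^esub>"
    "a \<otimes>\<^bsub>degree_zero A\<^esub> b = a \<otimes>\<^bsub>A\<^esub> b" "a \<oplus>\<^bsub>degree_zero A\<^esub> b = a \<oplus>\<^bsub>A\<^esub> b" for a b
    by (simp_all add: degree_zero_def)
  have eq: "SS.single 0 F = SS.single 0 G" if "\<And>y. y \<in> hcomp A 0 \<Longrightarrow> F [] y = G [] y" for F G
  proof -
    have "SS.cls 0 F = SS.cls 0 G" by (rule SS.cls_cong) (use that in auto)
    then show ?thesis by (simp add: SS.single_def fun_eq_iff)
  qed
  have hom: "?g \<in> ring_hom (degree_zero A) (degree_zero ?D)"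
  proof (rule ring_hom_memI)
    fix x assume "x \<in> carrier (degree_zero A)"
    then have x: "x \<in> hcomp A 0" by (simp add: S0)
    show "?g x \<in> carrier (degree_zero ?D)"
      unfolding D0 by (rule Ga.single_hcomp[OF right_mult_cocycle[OF x]])
    fix y assume "y \<in> carrier (degree_zero A)"
    then have y: "y \<in> hcomp A 0" by (simp add: S0)
    have xy: "x \<otimes>\<^bsub>A\<^esub> y \<in> hcomp A 0" using A.hcomp_mult[OF x y] by simp
    have "?g x \<otimes>\<^bsub>?D\<^esub> ?g y = SS.single (0 + 0) (ycomp 0 (\<lambda>as y. y \<otimes>\<^bsub>A\<^esub> x) (\<lambda>as z. z \<otimes>\<^bsub>A\<^esub> y))"
      unfolding dual_mult by (rule SP.yoneda_single[OF right_mult_cocycle[OF x] right_mult_cocycle[OF y]])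
    also have "\<dots> = ?g (x \<otimes>\<^bsub>A\<^esub> y)"
      using x y by (auto intro!: eq simp: comp_0 A.m_assoc A.hcomp_closed S_comm[OF x y])
    finally show "?g (x \<otimes>\<^bsub>degree_zero A\<^esub> y) = ?g x \<otimes>\<^bsub>degree_zero ?D\<^esub> ?g y" by (simp add: S0 D0)
    have c: "SS.cocycle 0 (\<lambda>as z. z \<otimes>\<^bsub>A\<^esub> x)" "SS.cocycle 0 (\<lambda>as z. z \<otimes>\<^bsub>A\<^esub> y)"
      using right_mult_cocycle x y by auto
    have "?g (x \<oplus>\<^bsub>A\<^esub> y) = SS.single 0 (\<lambda>as z. (z \<otimes>\<^bsub>A\<^esub> x) \<oplus>\<^bsub>degree_zero A\<^esub> (z \<otimes>\<^bsub>A\<^esub> y))"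
      using x y by (intro eq) (simp add: A.r_distr A.hcomp_closed)
    also have "\<dots> = ?g x \<oplus>\<^bsub>?D\<^esub> ?g y"
    proof
      fix n
      interpret En: abelian_group "SS.E n" by (rule SS.E_group)
      show "SS.single 0 (\<lambda>as z. (z \<otimes>\<^bsub>A\<^esub> x) \<oplus>\<^bsub>degree_zero A\<^esub> (z \<otimes>\<^bsub>A\<^esub> y)) n = (?g x \<oplus>\<^bsub>?D\<^esub> ?g y) n"
        unfolding Ga.X_add
        using SS.E_add[OF SS.cocycle_ml[OF c(1)] SS.cocycle_ml[OF c(2)]]
        by (auto simp: SS.single_def simp del: SS.S_simps)
    qed
    finally show "?g (x \<oplus>\<^bsub>degree_zero A\<^esub> y) = ?g x \<oplus>\<^bsub>degree_zero ?D\<^esub> ?g y" by (simp add: S0 D0)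
  next
    show "?g \<one>\<^bsub>degree_zero A\<^esub> = \<one>\<^bsub>degree_zero ?D\<^esub>"
      unfolding D0 S0 dual_one by (rule eq) (simp add: A.hcomp_closed)
  qed
  have surj: "?g ` carrier (degree_zero A) = carrier (degree_zero ?D)"
  proof
    show "?g ` carrier (degree_zero A) \<subseteq> carrier (degree_zero ?D)" using ring_hom_closed[OF hom] by blast
    show "carrier (degree_zero ?D) \<subseteq> ?g ` carrier (degree_zero A)"
    proof
      fix \<phi> assume "\<phi> \<in> carrier (degree_zero ?D)"
      then obtain F where F: "SS.cocycle 0 F" "\<phi> = SS.single 0 F" unfolding D0 by (rule Ga.hcomp_single)
      \<comment> \<open>A linear map on \<open>A_0\<close> is right multiplication by its value at
        the unit.\<close>
      let ?x = "F [] \<one>\<^bsub>A\<^esub>"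
      have cl: "F [] y \<in> hcomp A 0" if "y \<in> hcomp A 0" for y
        using SS.ml_closed[OF SS.cocycle_ml[OF F(1)], of "[]" y] that by simp
      have "F [] y = y \<otimes>\<^bsub>A\<^esub> ?x" if y: "y \<in> hcomp A 0" for y
      proof -
        have yA: "y \<in> carrier A" using y by (rule A.hcomp_closed)
        have "SS.dl F [y] \<one>\<^bsub>A\<^esub> = \<zero>\<^bsub>degree_zero A\<^esub>"
          using SS.cocycle_dl[OF F(1), of "[y]" "\<one>\<^bsub>A\<^esub>"] yA A.one_hcomp by simp
        moreover have "SS.dl F [y] \<one>\<^bsub>A\<^esub> = y \<otimes>\<^bsub>A\<^esub> ?x \<ominus>\<^bsub>degree_zero A\<^esub> F [] y"
          using y yA A.hp_homog[OF y, of 0] by (simp add: delta_def)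
        ultimately show ?thesis
          using SS.S.M.minus_zero_eq[of "y \<otimes>\<^bsub>A\<^esub> ?x" "F [] y"] cl[OF y] cl[OF A.one_hcomp] A.hcomp_mult[OF y, of ?x 0]
          by simp
      qed
      then have "\<phi> = ?g ?x" unfolding F(2) by (rule eq)
      then show "\<phi> \<in> ?g ` carrier (degree_zero A)" using cl[OF A.one_hcomp] by (auto simp: S0)
    qed
  qed
  show ?thesis
    by (rule semisimple_ring_hom[OF A.degree_zero_ring D.degree_zero_ring hom surj semisimple_S])
qed

text \<open>The scalars act through the unit class, rescaled in degree 0. This supplies the
  condition on scalars in \<open>Ext_Gr_0_trivial\<close> for the dual, which is not presented as a
  \<open>graded_algebra\<close> at this point.\<close>

lemma dual_scalar:
  assumes "c \<in> carrier k"
  shows "c \<odot>\<^bsub>koszul_dual k A\<^esub> \<one>\<^bsub>koszul_dual k A\<^esub> \<in> carrier (koszul_dual k A)"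
proof -
  let ?c = "c \<odot>\<^bsub>A\<^esub> \<one>\<^bsub>A\<^esub>"
  have one: "SS.cocycle 0 (\<lambda>as x. x)"
    by (rule SS.cocycle_cong[OF right_mult_cocycle[OF A.one_hcomp]]) (simp add: A.hcomp_closed)
  have cc: "SS.cocycle 0 (\<lambda>as x. ?c \<odot>\<^bsub>degree_zero A\<^esub> x)" by (rule SS.E_smult(2)[OF one assms])
  have cA: "?c \<in> carrier A" using assms by simp
  have "c \<odot>\<^bsub>koszul_dual k A\<^esub> \<one>\<^bsub>koszul_dual k A\<^esub> = SS.single 0 (\<lambda>as x. ?c \<odot>\<^bsub>degree_zero A\<^esub> x)"
  proof
    fix n
    show "(c \<odot>\<^bsub>koszul_dual k A\<^esub> \<one>\<^bsub>koszul_dual k A\<^esub>) n = SS.single 0 (\<lambda>as x. ?c \<odot>\<^bsub>degree_zero A\<^esub> x) n"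
    proof (cases "n = 0")
      case True
      then show ?thesis unfolding dual_smult dual_one SS.single_def using SS.E_smult(1)[OF one assms]
        by (simp del: SS.S_simps)
    next
      case False
      have "c \<odot>\<^bsub>SS.E n\<^esub> \<zero>\<^bsub>SS.E n\<^esub> = SS.cls n (\<lambda>as x. ?c \<odot>\<^bsub>degree_zero A\<^esub> \<zero>\<^bsub>degree_zero A\<^esub>)"
        unfolding SS.E_zero by (rule SS.E_smult(1)[OF SS.cocycle_zero assms])
      also have "\<dots> = \<zero>\<^bsub>SS.E n\<^esub>"
        unfolding SS.E_zero by (rule SS.cls_cong) (simp only: SS.S.smult_r_null[OF cA])
      finally show ?thesis using False unfolding dual_smult dual_one SS.single_def by simp
    qed
  qed
  then show ?thesis using Ga.single_closed[OF cc] by simp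
qed

text \<open>A scalar acts as multiplication by its multiple of the unit, an element of degree 0, so
  generators over \<open>k\<close> also generate over \<open>A_0\<close>.\<close>

lemma component_fin_gen:
  "\<exists>B. finite B \<and> B \<subseteq> hcomp A i \<and> (\<forall>a\<in>hcomp A i. \<exists>c\<in>B \<rightarrow> hcomp A 0. a = (\<Oplus>\<^bsub>A\<^esub>b\<in>B. c b \<otimes>\<^bsub>A\<^esub> b))"
proof -
  let ?X = "A\<lparr>carrier := hcomp A i\<rparr>"
  have "fin_gen k ?X" using standard_A by (simp add: standard_graded_algebra_def)
  then obtain B where B: "finite B" "B \<subseteq> hcomp A i"
    "\<And>x. x \<in> hcomp A i \<Longrightarrow> \<exists>c\<in>B \<rightarrow> carrier k. x = (\<Oplus>\<^bsub>?X\<^esub>b\<in>B. c b \<odot>\<^bsub>A\<^esub> b)"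
    by (auto simp: fin_gen_def)
  have X: "abelian_group ?X"
  proof (rule abelian_groupI)
    fix x assume "x \<in> carrier ?X"
    then show "\<exists>y\<in>carrier ?X. y \<oplus>\<^bsub>?X\<^esub> x = \<zero>\<^bsub>?X\<^esub>"
      by (intro bexI[of _ "\<ominus>\<^bsub>A\<^esub> x"]) (auto simp: A.hcomp_uminus A.l_neg A.hcomp_closed)
  qed (auto simp: A.hcomp_add A.hcomp_closed A.a_ac)
  have sm: "submodule (hcomp A i) k A" using galg by (simp add: graded_algebra_def)
  have "\<exists>c\<in>B \<rightarrow> hcomp A 0. a = (\<Oplus>\<^bsub>A\<^esub>b\<in>B. c b \<otimes>\<^bsub>A\<^esub> b)" if a: "a \<in> hcomp A i" for a
  proof -
    obtain c where c: "c \<in> B \<rightarrow> carrier k" "a = (\<Oplus>\<^bsub>?X\<^esub>b\<in>B. c b \<odot>\<^bsub>A\<^esub> b)" using B(3)[OF a] by blast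
    have cb: "c b \<in> carrier k" "b \<in> carrier A" "c b \<odot>\<^bsub>A\<^esub> b \<in> hcomp A i" if "b \<in> B" for b
      using c B(2) that A.hcomp_closed submodule.smult_closed[OF sm] by blast+
    have "a = (\<Oplus>\<^bsub>A\<^esub>b\<in>B. c b \<odot>\<^bsub>A\<^esub> b)"
      unfolding c(2) by (rule finsum_sub[OF X A.is_abelian_group]) (use B cb A.hcomp_closed in auto)
    also have "\<dots> = (\<Oplus>\<^bsub>A\<^esub>b\<in>B. (c b \<odot>\<^bsub>A\<^esub> \<one>\<^bsub>A\<^esub>) \<otimes>\<^bsub>A\<^esub> b)"
    proof (rule A.finsum_cong'[OF refl])
      show "(\<lambda>b. (c b \<odot>\<^bsub>A\<^esub> \<one>\<^bsub>A\<^esub>) \<otimes>\<^bsub>A\<^esub> b) \<in> B \<rightarrow> carrier A" using cb by auto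
      fix b assume "b \<in> B"
      then show "c b \<odot>\<^bsub>A\<^esub> b = (c b \<odot>\<^bsub>A\<^esub> \<one>\<^bsub>A\<^esub>) \<otimes>\<^bsub>A\<^esub> b" using cb by (intro smult_eq)
    qed
    finally have "a = (\<Oplus>\<^bsub>A\<^esub>b\<in>B. (c b \<odot>\<^bsub>A\<^esub> \<one>\<^bsub>A\<^esub>) \<otimes>\<^bsub>A\<^esub> b)" .
    moreover have "(\<lambda>b. c b \<odot>\<^bsub>A\<^esub> \<one>\<^bsub>A\<^esub>) \<in> B \<rightarrow> hcomp A 0" using cb scal_0 by (auto simp: scal_def)
    ultimately show ?thesis by (intro bexI)
  qed
  then show ?thesis using B(1,2) by blast
qed

end

section \<open>Homomorphisms to the degree zero part\<close>

text \<open>In degree 0 the only coboundary is zero, so a linear map whose class vanishes is zero.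
  The argument returns to the original complexes because it is applied over a Koszul dual, where
  only a graded ring and its scalars are at hand and the locale \<open>gext\<close> is out of
  reach.\<close>

lemma Ext_Gr_0_trivial:
  fixes k :: "('k, 'w) ring_scheme" and A :: "('k, 'a, 'x) graded_scheme" and M :: "('a, 'm, 'y) graded_scheme"
  assumes A: "graded_ring A" and M: "graded_mod A M" and sc: "\<And>c. c \<in> carrier k \<Longrightarrow> c \<odot>\<^bsub>A\<^esub> \<one>\<^bsub>A\<^esub> \<in> carrier A"
    and triv: "carrier (Ext_Gr k A M (grade_shift (degree_zero A) i) 0) =
      {\<zero>\<^bsub>Ext_Gr k A M (grade_shift (degree_zero A) i) 0\<^esub>}"
    and \<phi>: "\<And>x. x \<in> carrier M \<Longrightarrow> \<phi> x \<in> hcomp A 0"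
      "\<And>x y. x \<in> carrier M \<Longrightarrow> y \<in> carrier M \<Longrightarrow> \<phi> (x \<oplus>\<^bsub>M\<^esub> y) = \<phi> x \<oplus>\<^bsub>A\<^esub> \<phi> y"
      "\<And>a x. a \<in> carrier A \<Longrightarrow> x \<in> carrier M \<Longrightarrow> \<phi> (a \<odot>\<^bsub>M\<^esub> x) = homog_part A 0 a \<otimes>\<^bsub>A\<^esub> \<phi> x"
      "\<And>j x. j \<noteq> i \<Longrightarrow> x \<in> hcomp M j \<Longrightarrow> \<phi> x = \<zero>\<^bsub>A\<^esub>"
    and x: "x \<in> carrier M"
  shows "\<phi> x = \<zero>\<^bsub>A\<^esub>"
proof -
  interpret A: graded_ring A by fact
  interpret M: graded_mod A M by fact
  interpret S: ring "degree_zero A" by (rule A.degree_zero_ring)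
  let ?N = "grade_shift (degree_zero A) i"
  let ?C = "gr_bar_cochains k A M ?N" and ?d = "bar_diff A M ?N"
  define f :: "'a list \<times> 'm \<Rightarrow> 'a" where "f = (\<lambda>(as, x)\<in>bar_args A M 0. \<phi> x)"
  have N: "carrier ?N = hcomp A 0" "\<zero>\<^bsub>?N\<^esub> = \<zero>\<^bsub>A\<^esub>" "u \<oplus>\<^bsub>?N\<^esub> v = u \<oplus>\<^bsub>A\<^esub> v"
    "a \<odot>\<^bsub>?N\<^esub> u = A.hp 0 a \<otimes>\<^bsub>A\<^esub> u" "hcomp ?N j = (if j = i then hcomp A 0 else {\<zero>\<^bsub>A\<^esub>})" for u v a j
    by (simp_all add: degree_zero_def grade_shift_def)
  have Ng: "abelian_group ?N"
  proof (rule abelian_groupI)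
    fix x assume "x \<in> carrier ?N"
    then show "\<exists>y\<in>carrier ?N. y \<oplus>\<^bsub>?N\<^esub> x = \<zero>\<^bsub>?N\<^esub>"
      by (intro bexI[of _ "\<ominus>\<^bsub>A\<^esub> x"]) (auto simp: N A.hcomp_uminus A.l_neg A.hcomp_closed)
  qed (auto simp: N A.hcomp_add A.hcomp_closed A.a_ac)
  interpret N: abelian_group ?N by (rule Ng)
  have fx: "f ([], y) = \<phi> y" if "y \<in> carrier M" for y using that by (simp add: f_def bar_args_def)
  have "f \<in> bar_args A M 0 \<rightarrow>\<^sub>E carrier ?N" using \<phi>(1) by (auto simp: f_def bar_args_def N)
  moreover have "multilinear k A M ?N 0 f"
    using \<phi>(2,3) sc M.smult_closed by (auto simp: multilinear_def bar_args_def fx base_smult_def N)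
  moreover have "f (as, x) \<in> hcomp ?N (sum_list ds + e)"
    if "length as = 0 \<and> list_all2 (\<lambda>a d. a \<in> hcomp A d) as ds \<and> x \<in> hcomp M e" for as ds x e
    using that M.M.hcomp_closed[of x e] \<phi>(1)[of x] \<phi>(4)[of e x] by (auto simp: fx N)
  ultimately have fC: "f \<in> carrier (?C 0)" by (auto simp: gr_bar_cochains_def bar_cochains_def)
  have "?d 0 f = \<zero>\<^bsub>?C (Suc 0)\<^esub>"
  proof
    fix p
    show "?d 0 f p = \<zero>\<^bsub>?C (Suc 0)\<^esub> p"
    proof (cases "p \<in> bar_args A M (Suc 0)")
      case True
      then obtain a y where p: "p = ([a], y)" "a \<in> carrier A" "y \<in> carrier M"
        by (auto simp: bar_args_def length_Suc_conv)
      have cl: "A.hp 0 a \<otimes>\<^bsub>A\<^esub> \<phi> y \<in> hcomp A 0" using A.hcomp_mult[of "A.hp 0 a" 0 "\<phi> y" 0] p \<phi>(1) by simp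
      have "add_pow ?N (- 1 :: int) z = \<ominus>\<^bsub>?N\<^esub> z" if "z \<in> carrier ?N" for z
        using N.add_pow_sign[OF that, of 1] by simp
      then show ?thesis
        using p cl \<phi>(3)[OF p(2,3)] M.smult_closed[OF p(2,3)] N.r_neg[of "A.hp 0 a \<otimes>\<^bsub>A\<^esub> \<phi> y"]
          A.hcomp_closed[OF cl]
        by (simp add: bar_diff_def gr_bar_cochains_def bar_cochains_def bar_args_def fx N)
    qed (simp add: bar_diff_def gr_bar_cochains_def bar_cochains_def)
  qed
  then have fZ: "f \<in> cocycles ?C ?d 0" using fC by (simp add: cocycles_def)
  then have "cohomology_class ?C ?d 0 f \<in> carrier (Ext_Gr k A M ?N 0)"
    by (simp add: Ext_Gr_def cohomology_def)
  then have "cohomology_class ?C ?d 0 f = coboundaries ?C ?d 0"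
    unfolding triv by (simp add: Ext_Gr_def cohomology_def)
  then have "\<zero>\<^bsub>?C 0\<^esub> \<oplus>\<^bsub>?C 0\<^esub> f = \<zero>\<^bsub>?C 0\<^esub>"
    by (auto simp: cohomology_class_def coboundaries_def a_r_coset_def')
  then have "(\<zero>\<^bsub>?C 0\<^esub> \<oplus>\<^bsub>?C 0\<^esub> f) ([], x) = \<zero>\<^bsub>?C 0\<^esub> ([], x)" by simp
  then show ?thesis
    using x \<phi>(1)[OF x] A.hcomp_closed by (simp add: gr_bar_cochains_def bar_cochains_def bar_args_def fx N)
qed

section \<open>The linear strands of Ext\<close>

text \<open>The locale is entered at two levels, for \<Lambda> with \<open>M\<close> and for
  \<Gamma> with its module of Ext classes. In both cases the module structure over the dual,
  \<open>graded_L\<close>, is part of what is given.\<close>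

locale kos_mod = kos k A for k :: "('k, 'w) ring_scheme" and A :: "('k, 'a, 'x) graded_scheme" +
  fixes M :: "('a, 'm, 'y) graded_scheme"
  assumes graded_M: "graded_mod A M"
    and graded_L: "graded_mod (koszul_dual k A) (ext_module k A M)"
begin

abbreviation "D \<equiv> koszul_dual k A"
abbreviation "S \<equiv> degree_zero A"
abbreviation "L \<equiv> ext_module k A M"

sublocale Q: gext k A M
  by (rule gext.intro[OF galg_axioms gext_axioms.intro[OF graded_S graded_M]])

sublocale QP: ext_pair k A M "degree_zero A" "degree_zero A" ..

sublocale QG: gbar_pair A M "degree_zero A" "degree_zero A" "scal k A"
  by unfold_locales simp

sublocale L: tot k A M "degree_zero A" "ext_module k A M"
  by unfold_locales (auto simp: ext_module_def total_ext_def Let_def)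

sublocale DL: graded_mod "koszul_dual k A" "ext_module k A M" by (rule graded_L)

lemma L_smult: "\<gamma> \<odot>\<^bsub>L\<^esub> \<phi> = yoneda k A M S \<gamma> \<phi>"
  by (simp add: ext_module_def Let_def)

text \<open>By Koszulity the components of \<open>G\<close> in internal degrees other than
  \<open>n\<close> can be bounded simultaneously, so the diagonal component represents the same
  class.\<close>

lemma homog_rep:
  assumes G: "SS.cocycle n G"
  obtains G' where "SS.cocycle n G'" "SS.hmg n G' (int n)" "SS.cls n G = SS.cls n G'"
proof
  let ?P = "proj A S S (int n) G"
  show "SS.cocycle n ?P" by (rule SS.proj_cocycle[OF G])
  show "SS.hmg n ?P (int n)" by (rule SS.proj_homog[OF SS.cocycle_ml[OF G]])
  show "SS.cls n G = SS.cls n ?P"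
    unfolding SS.cls_eq[OF SS.cocycle_ml[OF G] SS.proj_ml[OF SS.cocycle_ml[OF G]]]
    by (rule SS.koszul_proj[OF koszul_S G])
qed

lemma dual_homog_reps:
  assumes "\<gamma> \<in> carrier D"
  obtains g where "\<And>n. SS.cocycle n (g n)" "\<And>n. SS.hmg n (g n) (int n)" "\<And>n. \<gamma> n = SS.cls n (g n)"
proof -
  obtain f where f: "\<And>n. SS.cocycle n (f n)" "\<And>n. \<gamma> n = SS.cls n (f n)"
    by (rule Ga.X_reps[OF assms]) blast
  have "\<forall>n. \<exists>G. SS.cocycle n G \<and> SS.hmg n G (int n) \<and> \<gamma> n = SS.cls n G"
    unfolding f(2) using homog_rep[OF f(1)] by metis
  then show thesis using that by metis
qed

text \<open>The condition \<open>P\<close> is on some representative in each degree; the strand and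
  its complement are both of this form and share one closure proof.\<close>

definition rep_sub :: "(nat \<Rightarrow> ('a list \<Rightarrow> 'm \<Rightarrow> 'a) \<Rightarrow> bool) \<Rightarrow> (nat \<Rightarrow> ('a list \<times> 'm \<Rightarrow> 'a) set) set" where
  "rep_sub P = {\<phi> \<in> carrier L. \<forall>n. \<exists>F. Q.cocycle n F \<and> P n F \<and> \<phi> n = Q.cls n F}"

lemma rep_subE:
  assumes "\<phi> \<in> rep_sub P"
  obtains f where "\<And>n. Q.cocycle n (f n)" "\<And>n. P n (f n)" "\<phi> = (\<lambda>n. Q.cls n (f n))"
proof -
  have "\<forall>n. \<exists>F. Q.cocycle n F \<and> P n F \<and> \<phi> n = Q.cls n F" using assms by (simp add: rep_sub_def)
  then obtain f where "\<And>n. Q.cocycle n (f n) \<and> P n (f n) \<and> \<phi> n = Q.cls n (f n)" by metis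
  then show thesis by (intro that[of f]) (auto simp: fun_eq_iff)
qed

text \<open>Elements of the dual have representatives of internal degree equal to their
  cohomological degree. Closure of \<open>P\<close> under products therefore has to be asked for
  such left factors only.\<close>

lemma rep_sub_graded_submodule:
  assumes zero: "\<And>n. P n (\<lambda>as x. \<zero>\<^bsub>S\<^esub>)"
    and add: "\<And>n F G. P n F \<Longrightarrow> P n G \<Longrightarrow> P n (\<lambda>as x. F as x \<oplus>\<^bsub>S\<^esub> G as x)"
    and sum: "\<And>n (I :: nat set) F. finite I \<Longrightarrow> (\<And>i. i \<in> I \<Longrightarrow> Q.ml n (F i)) \<Longrightarrow> (\<And>i. i \<in> I \<Longrightarrow> P n (F i)) \<Longrightarrow>
      P n (\<lambda>as x. \<Oplus>\<^bsub>S\<^esub>i\<in>I. F i as x)"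
    and comp: "\<And>m n G F. SS.ml m G \<Longrightarrow> SS.hmg m G (int m) \<Longrightarrow> Q.ml n F \<Longrightarrow> P n F \<Longrightarrow> P (m + n) (ycomp m G F)"
  shows "graded_submodule D L (rep_sub P)"
  unfolding graded_submodule_def
proof (intro conjI ballI allI)
  have z: "\<exists>F. Q.cocycle n F \<and> P n F \<and> \<zero>\<^bsub>Q.E n\<^esub> = Q.cls n F" for n
    using Q.cocycle_zero zero Q.E_zero by blast
  show "submodule (rep_sub P) D L"
  proof (rule DL.submoduleI)
    show "rep_sub P \<subseteq> carrier L" by (auto simp: rep_sub_def)
    show "\<zero>\<^bsub>L\<^esub> \<in> rep_sub P" unfolding rep_sub_def using z L.X.zero_closed by (simp add: L.X_zero)
    fix \<phi> assume p: "\<phi> \<in> rep_sub P"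
    obtain f where f: "\<And>n. Q.cocycle n (f n)" "\<And>n. P n (f n)" "\<phi> = (\<lambda>n. Q.cls n (f n))"
      by (rule rep_subE[OF p]) blast
    have pL: "\<phi> \<in> carrier L" using p by (simp add: rep_sub_def)
    show "\<phi> \<oplus>\<^bsub>L\<^esub> \<psi> \<in> rep_sub P" if q: "\<psi> \<in> rep_sub P" for \<psi>
    proof -
      obtain g where g: "\<And>n. Q.cocycle n (g n)" "\<And>n. P n (g n)" "\<psi> = (\<lambda>n. Q.cls n (g n))"
        by (rule rep_subE[OF q]) blast
      have "(\<phi> \<oplus>\<^bsub>L\<^esub> \<psi>) n = Q.cls n (\<lambda>as x. f n as x \<oplus>\<^bsub>S\<^esub> g n as x)" for n
        unfolding L.X_add f(3) g(3) by (rule Q.E_add[OF Q.cocycle_ml[OF f(1)] Q.cocycle_ml[OF g(1)]])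
      then show ?thesis
        using Q.cocycle_add[OF f(1) g(1)] add[OF f(2) g(2)] L.X.a_closed[OF pL] q
        unfolding rep_sub_def by blast
    qed
    show "\<gamma> \<odot>\<^bsub>L\<^esub> \<phi> \<in> rep_sub P" if c: "\<gamma> \<in> carrier D" for \<gamma>
    proof -
      obtain g where g: "\<And>n. SS.cocycle n (g n)" "\<And>n. SS.hmg n (g n) (int n)" "\<And>n. \<gamma> n = SS.cls n (g n)"
        by (rule dual_homog_reps[OF c]) blast
      have ge: "\<gamma> = (\<lambda>n. SS.cls n (g n))" using g(3) by (rule ext)
      let ?c = "\<lambda>n i. ycomp i (g i) (f (n - i))"
      have cc: "Q.cocycle n (?c n i)" "P n (?c n i)" if "i \<in> {..n}" for i n
        using QP.comp_cocycle[OF g(1) f(1), of i "n - i"] comp[OF SS.cocycle_ml[OF g(1)] g(2) Q.cocycle_ml[OF f(1)] f(2), of i "n - i"] that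
        by simp_all
      have "(\<gamma> \<odot>\<^bsub>L\<^esub> \<phi>) n = Q.cls n (\<lambda>as x. \<Oplus>\<^bsub>S\<^esub>i\<in>{..n}. ?c n i as x)" for n
        unfolding L_smult f(3) ge by (rule QP.yoneda_cls[OF g(1) f(1)])
      moreover have "Q.cocycle n (\<lambda>as x. \<Oplus>\<^bsub>S\<^esub>i\<in>{..n}. ?c n i as x)" for n
        by (rule Q.cocycle_finsum) (use cc in auto)
      moreover have "P n (\<lambda>as x. \<Oplus>\<^bsub>S\<^esub>i\<in>{..n}. ?c n i as x)" for n
        by (rule sum) (use cc Q.cocycle_ml in auto)
      ultimately show ?thesis using DL.smult_closed[OF c pL] unfolding rep_sub_def by blast
    qed
  qed
  fix \<phi> i assume p: "\<phi> \<in> rep_sub P"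
  then have pL: "\<phi> \<in> carrier L" by (simp add: rep_sub_def)
  have "L.comp_at i \<phi> \<in> carrier L" using L.X.hp_closed[OF pL, of i] by (simp add: L.X_hp[OF pL])
  then show "homog_part L i \<phi> \<in> rep_sub P"
    using p z unfolding L.X_hp[OF pL] by (auto simp: rep_sub_def L.comp_at_def)
qed

definition strand :: "int \<Rightarrow> (nat \<Rightarrow> ('a list \<times> 'm \<Rightarrow> 'a) set) set" where
  "strand s = rep_sub (\<lambda>n F. Q.hmg n F (int n + s))"

text \<open>Some representative has no component in internal degree \<open>int n + s\<close>. This
  copes with cocycles that have infinitely many homogeneous components, for which a sum of the other
  strands could be too small.\<close>

definition costrand :: "int \<Rightarrow> (nat \<Rightarrow> ('a list \<times> 'm \<Rightarrow> 'a) set) set" where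
  "costrand s = rep_sub (\<lambda>n F. Q.hg n F (\<lambda>as x. \<zero>\<^bsub>S\<^esub>) (int n + s))"

lemma strand_graded_submodule: "graded_submodule D L (strand s)"
  unfolding strand_def
proof (rule rep_sub_graded_submodule)
  fix m n G F assume "SS.ml m G" "SS.hmg m G (int m)" "Q.ml n F" "Q.hmg n F (int n + s)"
  from QG.comp_homog[OF this] show "Q.hmg (m + n) (ycomp m G F) (int (m + n) + s)" by (simp add: algebra_simps)
qed (fact Q.homog_zero Q.homog_add Q.homog_finsum)+

lemma costrand_graded_submodule: "graded_submodule D L (costrand s)"
  unfolding costrand_def
proof (rule rep_sub_graded_submodule)
  fix n F G assume "Q.hg n F (\<lambda>as x. \<zero>\<^bsub>S\<^esub>) (int n + s)" "Q.hg n G (\<lambda>as x. \<zero>\<^bsub>S\<^esub>) (int n + s)"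
  from hag_map2[OF this, of "\<lambda>x y. x \<oplus>\<^bsub>S\<^esub> y"]
  show "Q.hg n (\<lambda>as x. F as x \<oplus>\<^bsub>S\<^esub> G as x) (\<lambda>as x. \<zero>\<^bsub>S\<^esub>) (int n + s)"
    unfolding SS.S.M.l_zero[OF SS.S.M.zero_closed] .
next
  fix n I F assume I: "finite I" "\<And>i. i \<in> I \<Longrightarrow> Q.ml n (F i)"
    "\<And>i. i \<in> I \<Longrightarrow> Q.hg n (F i) (\<lambda>as x. \<zero>\<^bsub>S\<^esub>) (int n + s)"
  have "Q.hg n (\<lambda>as x. \<Oplus>\<^bsub>S\<^esub>i\<in>I. F i as x) (\<lambda>as x. \<Oplus>\<^bsub>S\<^esub>i\<in>I. \<zero>\<^bsub>S\<^esub>) (int n + s)"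
    by (rule Q.hag_finsum) (use I Q.ml_zero in auto)
  then show "Q.hg n (\<lambda>as x. \<Oplus>\<^bsub>S\<^esub>i\<in>I. F i as x) (\<lambda>as x. \<zero>\<^bsub>S\<^esub>) (int n + s)"
    using SS.S.M.finsum_zero[of I] by simp
next
  fix m n G F assume a: "SS.ml m G" "SS.hmg m G (int m)" "Q.ml n F" "Q.hg n F (\<lambda>as x. \<zero>\<^bsub>S\<^esub>) (int n + s)"
  have "Q.hg (m + n) (ycomp m G F) (ycomp m G (\<lambda>as x. \<zero>\<^bsub>S\<^esub>)) (int n + s + int m)"
    by (rule QG.comp_hag[OF a(1-3) Q.ml_zero a(4)])
  then have "Q.hg (m + n) (ycomp m G F) (\<lambda>as x. \<zero>\<^bsub>S\<^esub>) (int n + s + int m)"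
    by (rule Q.hag_cong) (use SS.ml_at_zero[OF a(1)] in \<open>auto simp: ycomp_def elim!: tuples_append simp: length_tuples\<close>)
  then show "Q.hg (m + n) (ycomp m G F) (\<lambda>as x. \<zero>\<^bsub>S\<^esub>) (int (m + n) + s)" by (simp add: algebra_simps)
qed simp

text \<open>If \<open>f n\<close> is homogeneous and \<open>g n\<close> has no component in the same
  degree, then the coboundary \<open>f n\<close> minus \<open>g n\<close> agrees with
  \<open>f n\<close> in that degree, and \<open>bound_hag\<close> applies.\<close>

lemma strand_inter: "strand s \<inter> costrand s = {\<zero>\<^bsub>L\<^esub>}"
proof
  show "{\<zero>\<^bsub>L\<^esub>} \<subseteq> strand s \<inter> costrand s"
    using strand_graded_submodule costrand_graded_submodule DL.sub_zero
    by (auto simp: graded_submodule_def)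
  show "strand s \<inter> costrand s \<subseteq> {\<zero>\<^bsub>L\<^esub>}"
  proof
    fix \<phi> assume p: "\<phi> \<in> strand s \<inter> costrand s"
    obtain f where f: "\<And>n. Q.cocycle n (f n)" "\<And>n. Q.hmg n (f n) (int n + s)" "\<phi> = (\<lambda>n. Q.cls n (f n))"
      using p unfolding strand_def by (elim IntE rep_subE) blast
    obtain g where g: "\<And>n. Q.cocycle n (g n)" "\<And>n. Q.hg n (g n) (\<lambda>as x. \<zero>\<^bsub>S\<^esub>) (int n + s)"
      "\<phi> = (\<lambda>n. Q.cls n (g n))"
      using p unfolding costrand_def by (elim IntE rep_subE) blast
    have "\<phi> n = \<zero>\<^bsub>Q.E n\<^esub>" for n
    proof -
      note ml = Q.cocycle_ml[OF f(1)[of n]] Q.cocycle_ml[OF g(1)[of n]]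
      have "Q.cls n (f n) = Q.cls n (g n)" using f(3) g(3) by metis
      then have b: "Q.bound n (\<lambda>as x. f n as x \<ominus>\<^bsub>S\<^esub> g n as x)" using Q.cls_eq[OF ml] by simp
      have "Q.hg n (\<lambda>as x. f n as x \<ominus>\<^bsub>S\<^esub> \<zero>\<^bsub>S\<^esub>) (\<lambda>as x. f n as x \<ominus>\<^bsub>S\<^esub> g n as x) (int n + s)"
        by (rule hag_map2[where f = "\<lambda>x y. x \<ominus>\<^bsub>S\<^esub> y", OF hag_refl hag_sym[OF g(2)]])
      then have "Q.hg n (f n) (\<lambda>as x. f n as x \<ominus>\<^bsub>S\<^esub> g n as x) (int n + s)"
        by (rule Q.hag_cong) (use Q.ml_closed[OF ml(1)] in \<open>simp_all add: SS.S.M.minus_eq SS.S.M.r_zero del: SS.S_simps\<close>)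
      then have "Q.bound n (f n)" by (rule Q.bound_hag[OF ml(1) f(2) b])
      then show ?thesis using Q.cls_zero_iff[OF ml(1)] by (simp add: f(3))
    qed
    then show "\<phi> \<in> {\<zero>\<^bsub>L\<^esub>}" by (auto simp: L.X_zero)
  qed
qed

lemma strand_sum: "strand s <+>\<^bsub>L\<^esub> costrand s = carrier L"
proof
  have "strand s \<subseteq> carrier L" "costrand s \<subseteq> carrier L" by (auto simp: strand_def costrand_def rep_sub_def)
  then show "strand s <+>\<^bsub>L\<^esub> costrand s \<subseteq> carrier L"
    unfolding set_add_def' by (auto intro!: L.X.a_closed)
  show "carrier L \<subseteq> strand s <+>\<^bsub>L\<^esub> costrand s"
  proof
    fix \<phi> assume p: "\<phi> \<in> carrier L"
    obtain f where f: "\<And>n. Q.cocycle n (f n)" "\<And>n. \<phi> n = Q.cls n (f n)"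
      by (rule L.X_reps[OF p]) blast
    note ml = Q.cocycle_ml[OF f(1)]
    let ?u = "\<lambda>n. proj A M S (int n + s) (f n)"
    let ?v = "\<lambda>n as x. f n as x \<ominus>\<^bsub>S\<^esub> ?u n as x"
    have u: "Q.cocycle n (?u n)" "Q.hmg n (?u n) (int n + s)" for n
      by (rule Q.proj_cocycle[OF f(1)]) (rule Q.proj_homog[OF ml])
    have v: "Q.cocycle n (?v n)" for n by (rule Q.cocycle_minus[OF f(1) u(1)])
    have v0: "Q.hg n (?v n) (\<lambda>as x. \<zero>\<^bsub>S\<^esub>) (int n + s)" for n
    proof -
      have "Q.hg n (?v n) (\<lambda>as x. f n as x \<ominus>\<^bsub>S\<^esub> f n as x) (int n + s)"
        by (rule hag_map2[where f = "\<lambda>x y. x \<ominus>\<^bsub>S\<^esub> y", OF hag_refl Q.proj_hag_eq[OF ml]])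
      then show ?thesis
        by (rule Q.hag_cong) (use Q.ml_closed[OF ml] in \<open>simp_all add: SS.S.M.minus_eq SS.S.M.r_neg del: SS.S_simps\<close>)
    qed
    have fin: "finite {n. \<phi> n \<noteq> \<zero>\<^bsub>Q.E n\<^esub>}" using p by (simp add: L.X_carrier)
    \<comment> \<open>Finite support of the two parts: the projection of a coboundary is a
      coboundary, so both vanish wherever the class does.\<close>
    have z: "Q.cls n (?u n) = \<zero>\<^bsub>Q.E n\<^esub>" "Q.cls n (?v n) = \<zero>\<^bsub>Q.E n\<^esub>" if "\<phi> n = \<zero>\<^bsub>Q.E n\<^esub>" for n
    proof -
      have b: "Q.bound n (f n)" using that Q.cls_zero_iff[OF ml] by (simp add: f(2))
      show "Q.cls n (?u n) = \<zero>\<^bsub>Q.E n\<^esub>"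
        unfolding Q.cls_zero_iff[OF Q.cocycle_ml[OF u(1)]] by (rule Q.bound_proj[OF ml b])
      show "Q.cls n (?v n) = \<zero>\<^bsub>Q.E n\<^esub>"
        unfolding Q.cls_zero_iff[OF Q.cocycle_ml[OF v]] by (rule Q.bound_minus[OF b Q.bound_proj[OF ml b]])
    qed
    have "finite {n. Q.cls n (?u n) \<noteq> \<zero>\<^bsub>Q.E n\<^esub>}" "finite {n. Q.cls n (?v n) \<noteq> \<zero>\<^bsub>Q.E n\<^esub>}"
      by (rule finite_subset[OF _ fin], use z in blast)+
    then have L: "(\<lambda>n. Q.cls n (?u n)) \<in> carrier L" "(\<lambda>n. Q.cls n (?v n)) \<in> carrier L"
      unfolding L.X_carrier using Q.cls_in_E[OF u(1)] Q.cls_in_E[OF v] by auto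
    have "(\<lambda>n. Q.cls n (?u n)) \<in> strand s" unfolding strand_def rep_sub_def using L u by blast
    moreover have "(\<lambda>n. Q.cls n (?v n)) \<in> costrand s" unfolding costrand_def rep_sub_def using L v v0 by blast
    moreover have "\<phi> = (\<lambda>n. Q.cls n (?u n)) \<oplus>\<^bsub>L\<^esub> (\<lambda>n. Q.cls n (?v n))"
    proof
      fix n
      have "Q.cls n (?u n) \<oplus>\<^bsub>Q.E n\<^esub> Q.cls n (?v n) = Q.cls n (\<lambda>as x. ?u n as x \<oplus>\<^bsub>S\<^esub> ?v n as x)"
        by (rule Q.E_add[OF Q.cocycle_ml[OF u(1)] Q.cocycle_ml[OF v]])
      also have "\<dots> = Q.cls n (f n)"
        by (rule Q.cls_cong)
          (use Q.ml_closed[OF ml] Q.ml_closed[OF Q.cocycle_ml[OF u(1)]] in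
            \<open>simp add: SS.S.M.minus_eq SS.S.M.cancel_simps del: SS.S_simps\<close>)
      finally show "\<phi> n = ((\<lambda>n. Q.cls n (?u n)) \<oplus>\<^bsub>L\<^esub> (\<lambda>n. Q.cls n (?v n))) n" by (simp add: L.X_add f(2))
    qed
    ultimately show "\<phi> \<in> strand s <+>\<^bsub>L\<^esub> costrand s" unfolding set_add_def' by blast
  qed
qed

lemma strand_summand: "graded_direct_summand D L (strand s)"
  unfolding graded_direct_summand_def
  using strand_graded_submodule costrand_graded_submodule strand_inter strand_sum by blast

end

section \<open>Lowest components and their dual bases\<close>

context graded_mod
begin

text \<open>Elements of \<open>A\<close> have no components of negative degree, so below and at
  \<open>e\<close> only the degree 0 part of \<open>a\<close> can meet a nonzero component of
  \<open>x\<close>.\<close>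

lemma lowest_smult:
  assumes "a \<in> carrier A" "x \<in> carrier M" "\<And>i. i < e \<Longrightarrow> M.hp i x = \<zero>\<^bsub>M\<^esub>"
  shows "M.hp e (a \<odot>\<^bsub>M\<^esub> x) = A.hp 0 a \<odot>\<^bsub>M\<^esub> M.hp e x"
    and "i < e \<Longrightarrow> M.hp i (a \<odot>\<^bsub>M\<^esub> x) = \<zero>\<^bsub>M\<^esub>"
proof -
  let ?I = "insert e (supp M x)"
  have ge: "d \<ge> e" if "d \<in> supp M x" for d
    using that assms(3)[of d] by (auto simp: supp_def not_less[symmetric])
  have z: "A.hp (i - d) a \<odot>\<^bsub>M\<^esub> M.hp d x = \<zero>\<^bsub>M\<^esub>" if "i < d" for i d
    using that assms(1,2) by (simp add: smult_l_null)
  have "M.hp e (a \<odot>\<^bsub>M\<^esub> x) = (\<Oplus>\<^bsub>M\<^esub>d\<in>supp M x. A.hp (e - d) a \<odot>\<^bsub>M\<^esub> M.hp d x)"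
    by (rule hp_smult_expand[OF assms(1,2)])
  also have "\<dots> = (\<Oplus>\<^bsub>M\<^esub>d\<in>?I. A.hp (e - d) a \<odot>\<^bsub>M\<^esub> M.hp d x)"
    by (rule M.finsum_superset[symmetric])
      (use assms(1,2) M.supp_finite[OF assms(2), unfolded supp_def] in
        \<open>auto simp: supp_def smult_r_null intro!: smult_closed\<close>)
  also have "\<dots> = (\<Oplus>\<^bsub>M\<^esub>d\<in>?I. if e = d then A.hp (e - d) a \<odot>\<^bsub>M\<^esub> M.hp d x else \<zero>\<^bsub>M\<^esub>)"
  proof (rule M.finsum_cong'[OF refl])
    fix d assume "d \<in> ?I"
    then have "e < d" if "e \<noteq> d" using ge that by fastforce
    then show "A.hp (e - d) a \<odot>\<^bsub>M\<^esub> M.hp d x = (if e = d then A.hp (e - d) a \<odot>\<^bsub>M\<^esub> M.hp d x else \<zero>\<^bsub>M\<^esub>)"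
      using z by auto
  qed (use assms(1,2) in \<open>auto intro!: smult_closed\<close>)
  also have "\<dots> = A.hp 0 a \<odot>\<^bsub>M\<^esub> M.hp e x"
    by (subst M.finsum_singleton[where f = "\<lambda>d. A.hp (e - d) a \<odot>\<^bsub>M\<^esub> M.hp d x"])
      (use assms(1,2) in \<open>auto intro!: smult_closed\<close>)
  finally show "M.hp e (a \<odot>\<^bsub>M\<^esub> x) = A.hp 0 a \<odot>\<^bsub>M\<^esub> M.hp e x" .
  show "M.hp i (a \<odot>\<^bsub>M\<^esub> x) = \<zero>\<^bsub>M\<^esub>" if "i < e"
  proof -
    have "M.hp i (a \<odot>\<^bsub>M\<^esub> x) = (\<Oplus>\<^bsub>M\<^esub>d\<in>supp M x. A.hp (i - d) a \<odot>\<^bsub>M\<^esub> M.hp d x)"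
      by (rule hp_smult_expand[OF assms(1,2)])
    also have "\<dots> = (\<Oplus>\<^bsub>M\<^esub>d\<in>supp M x. \<zero>\<^bsub>M\<^esub>)"
      by (rule M.finsum_cong'[OF refl]) (use ge that z in force)+
    finally show ?thesis by simp
  qed
qed

text \<open>This is \<open>dual_basis_exists\<close> for the zero submodule, where the congruences
  become equations.\<close>

lemma comp_dual_basis:
  assumes fg: "fin_gen A M" and ss: "semisimple_ring S"
    and Afg: "\<And>i. \<exists>B. finite B \<and> B \<subseteq> hcomp A i \<and>
      (\<forall>a\<in>hcomp A i. \<exists>c\<in>B \<rightarrow> hcomp A 0. a = (\<Oplus>\<^bsub>A\<^esub>b\<in>B. c b \<otimes>\<^bsub>A\<^esub> b))"
  obtains T :: "(nat \<times> 'm) set" and v \<psi> where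
    "finite T" "\<And>t. t \<in> T \<Longrightarrow> v t \<in> hcomp M e"
    "\<And>t x. t \<in> T \<Longrightarrow> x \<in> hcomp M e \<Longrightarrow> \<psi> t x \<in> hcomp A 0"
    "\<And>t x y. t \<in> T \<Longrightarrow> x \<in> hcomp M e \<Longrightarrow> y \<in> hcomp M e \<Longrightarrow> \<psi> t (x \<oplus>\<^bsub>M\<^esub> y) = \<psi> t x \<oplus>\<^bsub>A\<^esub> \<psi> t y"
    "\<And>t a x. t \<in> T \<Longrightarrow> a \<in> hcomp A 0 \<Longrightarrow> x \<in> hcomp M e \<Longrightarrow> \<psi> t (a \<odot>\<^bsub>M\<^esub> x) = a \<otimes>\<^bsub>A\<^esub> \<psi> t x"
    "\<And>x. x \<in> hcomp M e \<Longrightarrow> x = (\<Oplus>\<^bsub>M\<^esub>t\<in>T. \<psi> t x \<odot>\<^bsub>M\<^esub> v t)"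
proof -
  interpret c: left_module S "Mc e" by (rule comp_left_module)
  have Ss: "carrier S = hcomp A 0" "x \<oplus>\<^bsub>S\<^esub> y = x \<oplus>\<^bsub>A\<^esub> y" "x \<otimes>\<^bsub>S\<^esub> y = x \<otimes>\<^bsub>A\<^esub> y" for x y
    by (simp_all add: degree_zero_def)
  have sub: "submodule {\<zero>\<^bsub>M\<^esub>} S (Mc e)"
    using group.triv_subgroup[OF c.M.a_group] c.smult_r_null by (auto intro!: submodule.intro submodule_axioms.intro)
  interpret b: dual_basis S "Mc e" "{\<zero>\<^bsub>M\<^esub>}"
    by (intro dual_basis.intro c.left_module_axioms dual_basis_axioms.intro sub)
  obtain G where G: "finite G" "G \<subseteq> hcomp M e" "hcomp M e \<subseteq> spanned S (Mc e) G"
    using comp_fin_gen[OF fg Afg] by blast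
  have gens: "\<exists>y\<in>spanned S (Mc e) G. x \<ominus>\<^bsub>Mc e\<^esub> y \<in> {\<zero>\<^bsub>M\<^esub>}" if "x \<in> carrier (Mc e)" for x
    using that G(3) c.M.minus_zero_eq[OF that that] by (intro bexI[of _ x]) auto
  have Gc: "G \<subseteq> carrier (Mc e)" using G(2) by simp
  show thesis
  proof (rule b.dual_basis_exists[OF ss G(1) Gc gens])
    fix T :: "(nat \<times> 'm) set" and v \<psi>
    assume b: "finite T" "v \<in> T \<rightarrow> carrier (Mc e)"
    "\<And>t x. t \<in> T \<Longrightarrow> x \<in> carrier (Mc e) \<Longrightarrow> \<psi> t x \<in> carrier S"
    "\<And>t x y. t \<in> T \<Longrightarrow> x \<in> carrier (Mc e) \<Longrightarrow> y \<in> carrier (Mc e) \<Longrightarrow> \<psi> t (x \<oplus>\<^bsub>Mc e\<^esub> y) = \<psi> t x \<oplus>\<^bsub>S\<^esub> \<psi> t y"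
    "\<And>t a x. t \<in> T \<Longrightarrow> a \<in> carrier S \<Longrightarrow> x \<in> carrier (Mc e) \<Longrightarrow> \<psi> t (a \<odot>\<^bsub>Mc e\<^esub> x) = a \<otimes>\<^bsub>S\<^esub> \<psi> t x"
    "\<And>x. x \<in> carrier (Mc e) \<Longrightarrow> x \<ominus>\<^bsub>Mc e\<^esub> (\<Oplus>\<^bsub>Mc e\<^esub>t\<in>T. \<psi> t x \<odot>\<^bsub>Mc e\<^esub> v t) \<in> {\<zero>\<^bsub>M\<^esub>}"
  show thesis
  proof (rule that[of T v \<psi>])
    fix x assume x: "x \<in> hcomp M e"
    have cl: "\<psi> t x \<odot>\<^bsub>M\<^esub> v t \<in> hcomp M e" if "t \<in> T" for t
      using c.smult_closed[of "\<psi> t x" "v t"] b(2,3) that x by auto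
    have "(\<Oplus>\<^bsub>Mc e\<^esub>t\<in>T. \<psi> t x \<odot>\<^bsub>M\<^esub> v t) \<in> carrier (Mc e)"
      by (rule c.M.finsum_closed) (use cl in auto)
    then have "x = (\<Oplus>\<^bsub>Mc e\<^esub>t\<in>T. \<psi> t x \<odot>\<^bsub>M\<^esub> v t)"
      using c.M.minus_zero_eq[of x "\<Oplus>\<^bsub>Mc e\<^esub>t\<in>T. \<psi> t x \<odot>\<^bsub>M\<^esub> v t"] b(6)[of x] x by simp
    also have "\<dots> = (\<Oplus>\<^bsub>M\<^esub>t\<in>T. \<psi> t x \<odot>\<^bsub>M\<^esub> v t)" by (rule comp_finsum[OF b(1) cl])
    finally show "x = (\<Oplus>\<^bsub>M\<^esub>t\<in>T. \<psi> t x \<odot>\<^bsub>M\<^esub> v t)" .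
  qed (use b in \<open>auto simp: Ss\<close>)
  qed
qed

end

context gbar
begin

lemma ml_hp:
  assumes F: "ml n F" and as: "as \<in> tuples A n" and x: "x \<in> carrier M"
    and z: "\<And>i. i \<noteq> e \<Longrightarrow> F as (M.M.hp i x) = \<zero>\<^bsub>N\<^esub>"
  shows "F as x = F as (M.M.hp e x)"
proof -
  let ?I = "insert e (supp M x)"
  have c: "F as (M.M.hp i x) \<in> carrier N" for i by (rule ml_closed[OF F as]) (simp add: x)
  have "F as x = F as (\<Oplus>\<^bsub>M\<^esub>i\<in>?I. M.M.hp i x)" using M.M.decomp[OF x, of ?I] x by (auto intro: arg_cong[where f = "F as"])
  also have "\<dots> = (\<Oplus>\<^bsub>N\<^esub>i\<in>?I. F as (M.M.hp i x))"
    by (rule ml_finsum_last[OF F as]) (use x in auto)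
  also have "\<dots> = (\<Oplus>\<^bsub>N\<^esub>i\<in>?I. if e = i then F as (M.M.hp i x) else \<zero>\<^bsub>N\<^esub>)"
    by (rule N.M.finsum_cong'[OF refl]) (use c z in auto)
  also have "\<dots> = F as (M.M.hp e x)"
    using N.M.finsum_singleton[of e ?I "\<lambda>i. F as (M.M.hp i x)"] c x by auto
  finally show ?thesis .
qed

end

section \<open>Cocycles supported on the lowest degree\<close>

context kos_mod
begin

definition vanish_above :: "nat \<Rightarrow> ('a list \<Rightarrow> 'm \<Rightarrow> 'a) \<Rightarrow> int \<Rightarrow> bool" where
  "vanish_above n F e \<longleftrightarrow> (\<forall>d>e. \<forall>as\<in>tuples A n. \<forall>x\<in>hcomp M d. F as x = \<zero>\<^bsub>S\<^esub>)"

text \<open>The restriction of \<open>\<psi>\<close> to M_e is an element of Hom(M_e,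
  \<open>S\<close>) over the degree 0 part of \<open>A\<close>; its values elsewhere are left
  free.\<close>

definition functional :: "int \<Rightarrow> ('m \<Rightarrow> 'a) \<Rightarrow> bool" where
  "functional e \<psi> \<longleftrightarrow> (\<forall>x\<in>hcomp M e. \<psi> x \<in> hcomp A 0) \<and>
     (\<forall>x\<in>hcomp M e. \<forall>y\<in>hcomp M e. \<psi> (x \<oplus>\<^bsub>M\<^esub> y) = \<psi> x \<oplus>\<^bsub>A\<^esub> \<psi> y) \<and>
     (\<forall>a\<in>hcomp A 0. \<forall>x\<in>hcomp M e. \<psi> (a \<odot>\<^bsub>M\<^esub> x) = a \<otimes>\<^bsub>A\<^esub> \<psi> x)"

abbreviation "hpM \<equiv> homog_part M"

text \<open>Of the components of \<open>x\<close>, those below \<open>e\<close> are zero and those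
  above are killed by \<open>F\<close>.\<close>

lemma vanish_lowest:
  assumes F: "Q.ml n F" "vanish_above n F e" and x: "x \<in> carrier M" "\<And>i. i < e \<Longrightarrow> hpM i x = \<zero>\<^bsub>M\<^esub>"
    and as: "as \<in> tuples A n"
  shows "F as x = F as (hpM e x)"
proof (rule Q.ml_hp[OF F(1) as x(1)])
  fix i assume "i \<noteq> e"
  then consider "i < e" | "e < i" by linarith
  then show "F as (hpM i x) = \<zero>\<^bsub>S\<^esub>"
  proof cases
    case 1
    then show ?thesis using x(2) Q.ml_at_zero[OF F(1) as] by simp
  next
    case 2
    then show ?thesis using F(2) as Q.M.M.hp_in[OF x(1)] unfolding vanish_above_def by blast
  qed
qed

lemma scal_hp: "z \<in> scal k A \<Longrightarrow> A.hp 0 z = z"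
  using A.hp_homog[of z 0 0] scal_0 by auto

lemma zlin_point:
  assumes v: "v \<in> hcomp M e"
  shows "zlin (scal k A) S (smult S) M (smult M) (\<lambda>y. y \<odot>\<^bsub>M\<^esub> v)"
  unfolding zlin_def
  using Q.M.M.hcomp_closed[OF v] A.hcomp_closed[of _ 0] subsetD[OF scal_sub] scal_hp
  by (auto intro: Q.M.smult_closed simp: Q.M.smult_l_distr Q.M.smult_assoc)

lemma point_hcomp:
  assumes v: "v \<in> hcomp M e" and y: "y \<in> hcomp S d"
  shows "y \<odot>\<^bsub>M\<^esub> v \<in> hcomp M (d + e)"
  using y Q.M.hcomp_smult[of y d v e] v Q.M.smult_l_null[OF Q.M.M.hcomp_closed[OF v]] Q.M.M.hcomp_zero
  by (auto split: if_splits)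

text \<open>The map from \<open>A_0\<close> to \<open>M\<close> sending \<open>y\<close> to its
  multiple of \<open>v\<close> is not \<open>A\<close>-linear, as positive degrees of
  \<open>A\<close> act as zero on the source only. The defect lies in degrees above
  \<open>e\<close>, where \<open>F\<close> vanishes, so restriction along it still gives
  cocycles.\<close>

lemma point_cocycle:
  assumes F: "Q.cocycle n F" "vanish_above n F e" and v: "v \<in> hcomp M e"
  shows "SS.cocycle n (\<lambda>as y. F as (y \<odot>\<^bsub>M\<^esub> v))"
  unfolding cocyc_def
proof (intro conjI ballI)
  note ml = Q.cocycle_ml[OF F(1)]
  note vM = Q.M.M.hcomp_closed[OF v]
  show "SS.ml n (\<lambda>as y. F as (y \<odot>\<^bsub>M\<^esub> v))" by (rule multilin_pre[OF ml zlin_point[OF v]])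
  fix as y assume as: "as \<in> tuples A (Suc n)" and "y \<in> carrier S"
  then have y: "y \<in> hcomp A 0" by simp
  then have yA: "y \<in> carrier A" by (rule A.hcomp_closed)
  have w: "y \<odot>\<^bsub>M\<^esub> v \<in> hcomp M e" using Q.M.hcomp_smult[OF y v] by simp
  note wM = Q.M.M.hcomp_closed[OF w]
  have "SS.dl (\<lambda>as y. F as (y \<odot>\<^bsub>M\<^esub> v)) as y = Q.dl F as (y \<odot>\<^bsub>M\<^esub> v)"
  proof (rule delta_pre[OF as])
    fix bs a assume bs: "bs \<in> tuples A n" and a: "a \<in> carrier A"
    have low: "hpM i (y \<odot>\<^bsub>M\<^esub> v) = \<zero>\<^bsub>M\<^esub>" if "i < e" for i
      using Q.M.M.hp_homog[OF w, of i] that by simp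
    note ls = Q.M.lowest_smult[OF a wM low]
    have "F bs (a \<odot>\<^bsub>M\<^esub> (y \<odot>\<^bsub>M\<^esub> v)) = F bs (hpM e (a \<odot>\<^bsub>M\<^esub> (y \<odot>\<^bsub>M\<^esub> v)))"
      by (rule vanish_lowest[OF ml F(2) Q.M.smult_closed[OF a wM] ls(2) bs])
    also have "hpM e (a \<odot>\<^bsub>M\<^esub> (y \<odot>\<^bsub>M\<^esub> v)) = (a \<odot>\<^bsub>S\<^esub> y) \<odot>\<^bsub>M\<^esub> v"
      using ls(1) Q.M.M.hp_homog[OF w, of e] a yA vM by (simp add: Q.M.smult_assoc)
    finally show "F bs ((a \<odot>\<^bsub>S\<^esub> y) \<odot>\<^bsub>M\<^esub> v) = F bs (a \<odot>\<^bsub>M\<^esub> (y \<odot>\<^bsub>M\<^esub> v))" by (rule sym)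
  qed
  also have "\<dots> = \<zero>\<^bsub>S\<^esub>" by (rule Q.cocycle_dl[OF F(1) as wM])
  finally show "SS.dl (\<lambda>as y. F as (y \<odot>\<^bsub>M\<^esub> v)) as y = \<zero>\<^bsub>S\<^esub>" .
qed

lemma point_homog:
  assumes "Q.hmg n F j" and v: "v \<in> hcomp M e"
  shows "SS.hmg n (\<lambda>as y. F as (y \<odot>\<^bsub>M\<^esub> v)) (j - e)"
  by (rule homog_pre[OF assms(1)]) (rule point_hcomp[OF v])

lemma functional_zlin:
  assumes "functional e \<psi>"
  shows "zlin (scal k A) M (smult M) S (smult S) (\<lambda>x. \<psi> (hpM e x))"
  using assms subsetD[OF scal_sub] subsetD[OF scal_0] scal_hp
    Q.M.hp_smult_left[of _ 0 _ e] Q.M.M.hp_in[of _ e] Q.M.M.hp_add[of _ _ e]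
  unfolding zlin_def functional_def by simp

lemma functional_hcomp:
  assumes f: "functional e \<psi>" and x: "x \<in> hcomp M d"
  shows "\<psi> (hpM e x) \<in> hcomp S (d + - e)"
proof (cases "d = e")
  case True
  then show ?thesis using f x Q.M.M.hp_homog[OF x, of e] by (simp add: functional_def)
next
  case False
  then have "hpM e x = hpM e \<zero>\<^bsub>M\<^esub>" using Q.M.M.hp_homog[OF x, of e] by simp
  moreover have "\<psi> (hpM e \<zero>\<^bsub>M\<^esub>) = \<zero>\<^bsub>S\<^esub>"
    by (rule zlin_zero[OF Q.M.M.abelian_group_axioms SS.S.M.abelian_group_axioms functional_zlin[OF f]])
  ultimately show ?thesis using False by simp
qed

text \<open>Composed with the projection to M_e, a functional is linear at elements without
  components below \<open>e\<close>: there the degree \<open>e\<close> component of a product sees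
  only the degree 0 part of \<open>a\<close>.\<close>

lemma functional_smult:
  assumes f: "functional e \<psi>" and x: "x \<in> carrier M" "\<And>i. i < e \<Longrightarrow> hpM i x = \<zero>\<^bsub>M\<^esub>"
    and a: "a \<in> carrier A"
  shows "\<psi> (hpM e (a \<odot>\<^bsub>M\<^esub> x)) = a \<odot>\<^bsub>S\<^esub> \<psi> (hpM e x)"
  using Q.M.lowest_smult(1)[OF a x] f Q.M.M.hp_in[OF x(1), of e] a unfolding functional_def by simp

lemma expand_lowest:
  assumes F: "Q.ml n F" "vanish_above n F e" and x: "x \<in> carrier M" "\<And>i. i < e \<Longrightarrow> hpM i x = \<zero>\<^bsub>M\<^esub>"
    and as: "as \<in> tuples A n"
    and T: "finite T" "\<And>t. t \<in> T \<Longrightarrow> v t \<in> hcomp M e" "\<And>t. t \<in> T \<Longrightarrow> functional e (\<psi> t)"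
      "\<And>x. x \<in> hcomp M e \<Longrightarrow> x = (\<Oplus>\<^bsub>M\<^esub>t\<in>T. \<psi> t x \<odot>\<^bsub>M\<^esub> v t)"
  shows "F as x = (\<Oplus>\<^bsub>S\<^esub>t\<in>T. F as (\<psi> t (hpM e x) \<odot>\<^bsub>M\<^esub> v t))"
proof -
  have "F as x = F as (hpM e x)" by (rule vanish_lowest[OF F x as])
  also have "\<dots> = F as (\<Oplus>\<^bsub>M\<^esub>t\<in>T. \<psi> t (hpM e x) \<odot>\<^bsub>M\<^esub> v t)"
    using T(4)[OF Q.M.M.hp_in[OF x(1), of e]] by simp
  also have "\<dots> = (\<Oplus>\<^bsub>S\<^esub>t\<in>T. F as (\<psi> t (hpM e x) \<odot>\<^bsub>M\<^esub> v t))"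
  proof (rule Q.ml_finsum_last[OF F(1) as T(1)])
    fix t assume t: "t \<in> T"
    have "\<psi> t (hpM e x) \<in> hcomp A 0" using T(3)[OF t] Q.M.M.hp_in[OF x(1)] by (simp add: functional_def)
    then show "\<psi> t (hpM e x) \<odot>\<^bsub>M\<^esub> v t \<in> carrier M"
      by (intro Q.M.smult_closed A.hcomp_closed Q.M.M.hcomp_closed[OF T(2)[OF t]])
  qed
  finally show ?thesis .
qed

lemma kos_dual_basis:
  assumes "fin_gen A M"
  obtains T :: "(nat \<times> 'm) set" and v \<psi> where
    "finite T" "\<And>t. t \<in> T \<Longrightarrow> v t \<in> hcomp M e" "\<And>t. t \<in> T \<Longrightarrow> functional e (\<psi> t)"
    "\<And>x. x \<in> hcomp M e \<Longrightarrow> x = (\<Oplus>\<^bsub>M\<^esub>t\<in>T. \<psi> t x \<odot>\<^bsub>M\<^esub> v t)"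
proof (rule Q.M.comp_dual_basis[OF assms semisimple_S component_fin_gen, of e])
  fix T :: "(nat \<times> 'm) set" and v \<psi>
  assume b: "finite T" "\<And>t. t \<in> T \<Longrightarrow> v t \<in> hcomp M e"
    "\<And>t x. t \<in> T \<Longrightarrow> x \<in> hcomp M e \<Longrightarrow> \<psi> t x \<in> hcomp A 0"
    "\<And>t x y. t \<in> T \<Longrightarrow> x \<in> hcomp M e \<Longrightarrow> y \<in> hcomp M e \<Longrightarrow> \<psi> t (x \<oplus>\<^bsub>M\<^esub> y) = \<psi> t x \<oplus>\<^bsub>A\<^esub> \<psi> t y"
    "\<And>t a x. t \<in> T \<Longrightarrow> a \<in> hcomp A 0 \<Longrightarrow> x \<in> hcomp M e \<Longrightarrow> \<psi> t (a \<odot>\<^bsub>M\<^esub> x) = a \<otimes>\<^bsub>A\<^esub> \<psi> t x"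
    "\<And>x. x \<in> hcomp M e \<Longrightarrow> x = (\<Oplus>\<^bsub>M\<^esub>t\<in>T. \<psi> t x \<odot>\<^bsub>M\<^esub> v t)"
  show thesis
    by (rule that[OF b(1,2) _ b(6)]) (use b(3-5) in \<open>auto simp: functional_def\<close>)
qed

text \<open>
  A cocycle of internal degree \<open>n + s\<close> which vanishes above degree \<open>e\<close> restricts on \<open>M\<^sub>e\<close> to classes
  of the Koszul dual of bidegree \<open>(n, n + s - e)\<close>. For \<open>e \<noteq> s\<close> these are zero, and bounding cochains
  for them, contracted with a dual basis of \<open>M\<^sub>e\<close>, make the cocycle vanish on \<open>M\<^sub>e\<close> as well.
\<close>

lemma strand_representative:
  assumes fg: "fin_gen A M" and F: "Q.cocycle n F" "Q.hmg n F (int n + s)" and "m \<le> n"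
  shows "\<exists>G. Q.cocycle n G \<and> Q.hmg n G (int n + s) \<and> Q.bound n (\<lambda>as x. F as x \<ominus>\<^bsub>S\<^esub> G as x) \<and>
    vanish_above n G (int n + s - int m)"
  using \<open>m \<le> n\<close>
proof (induction m)
  case 0
  note ml = Q.cocycle_ml[OF F(1)]
  have "vanish_above n F (int n + s)"
    using Q.homog_vanish[OF ml F(2)] unfolding vanish_above_def by blast
  then show ?case using F Q.bound_minus_refl[OF ml] by auto
next
  case (Suc m)
  \<comment> \<open>The highest degree still to be cleared. It exceeds \<open>s\<close> because
    \<open>Suc m\<close> is at most \<open>n\<close>.\<close>
  define e where "e = int n + s - int m"
  obtain G where G: "Q.cocycle n G" "Q.hmg n G (int n + s)" "Q.bound n (\<lambda>as x. F as x \<ominus>\<^bsub>S\<^esub> G as x)"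
    "vanish_above n G e"
    using Suc unfolding e_def by auto
  obtain n' where n: "n = Suc n'" using Suc.prems by (cases n) auto
  obtain T :: "(nat \<times> 'm) set" and v \<psi> where T: "finite T" "\<And>t. t \<in> T \<Longrightarrow> v t \<in> hcomp M e"
    "\<And>t. t \<in> T \<Longrightarrow> functional e (\<psi> t)" "\<And>x. x \<in> hcomp M e \<Longrightarrow> x = (\<Oplus>\<^bsub>M\<^esub>t\<in>T. \<psi> t x \<odot>\<^bsub>M\<^esub> v t)"
    by (rule kos_dual_basis[OF fg]) blast
  let ?g = "\<lambda>t as y. G as (y \<odot>\<^bsub>M\<^esub> v t)"
  have "\<exists>h. SS.ml n' h \<and> SS.hmg n' h (int m) \<and>
      (\<forall>as\<in>tuples A n. \<forall>y\<in>carrier S. ?g t as y = SS.dl h as y)" if t: "t \<in> T" for t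
  proof -
    have c: "SS.cocycle n (?g t)" by (rule point_cocycle[OF G(1,4) T(2)[OF t]])
    have hm: "SS.hmg n (?g t) (int m)" using point_homog[OF G(2) T(2)[OF t]] by (simp add: e_def)
    \<comment> \<open>The internal degree \<open>int m\<close> of this cocycle is less than its
      cohomological degree \<open>n\<close>, so the class vanishes by Koszulity.\<close>
    have "SS.bound n (?g t)" by (rule koszul_S[OF c hm]) (use Suc.prems in simp)
    then show ?thesis
      using SS.bound_homogE[of n' "?g t" "int m"] SS.cocycle_ml[OF c] hm unfolding n by metis
  qed
  then obtain h where h: "\<And>t. t \<in> T \<Longrightarrow> SS.ml n' (h t)" "\<And>t. t \<in> T \<Longrightarrow> SS.hmg n' (h t) (int m)"
    "\<And>t as y. t \<in> T \<Longrightarrow> as \<in> tuples A n \<Longrightarrow> y \<in> carrier S \<Longrightarrow> ?g t as y = SS.dl (h t) as y" by metis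
  let ?h = "\<lambda>t as x. h t as (\<psi> t (hpM e x))"
  let ?H = "\<lambda>as x. \<Oplus>\<^bsub>S\<^esub>t\<in>T. ?h t as x"
  have hml: "Q.ml n' (?h t)" if "t \<in> T" for t
    by (rule multilin_pre[OF h(1)[OF that] functional_zlin[OF T(3)[OF that]]])
  have hhm: "Q.hmg n' (?h t) (int n + s)" if t: "t \<in> T" for t
  proof -
    have "Q.hmg n' (?h t) (int m - - e)"
      by (rule homog_pre[OF h(2)[OF t]]) (rule functional_hcomp[OF T(3)[OF t]])
    then show ?thesis by (simp add: e_def)
  qed
  have Hml: "Q.ml n' ?H" by (rule Q.ml_finsum[OF T(1) hml])
  have Hhm: "Q.hmg n' ?H (int n + s)" by (rule Q.homog_finsum[OF T(1) hml hhm])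
  \<comment> \<open>Equality holds only at elements without components below \<open>e\<close>, where
    the functionals are linear. That covers all of M_d for \<open>d\<close> at least
    \<open>e\<close>, so subtracting \<open>Q.dl ?H\<close> clears M_e and leaves the degrees above
    it clear.\<close>
  have dlH: "Q.dl ?H as x = G as x" if as: "as \<in> tuples A n" and x: "x \<in> carrier M" "\<And>i. i < e \<Longrightarrow> hpM i x = \<zero>\<^bsub>M\<^esub>" for as x
  proof -
    have as': "as \<in> tuples A (Suc n')" using as by (simp add: n)
    have "Q.dl ?H as x = (\<Oplus>\<^bsub>S\<^esub>t\<in>T. Q.dl (?h t) as x)" by (rule Q.dl_finsum[OF T(1) hml as' x(1)])
    also have "\<dots> = (\<Oplus>\<^bsub>S\<^esub>t\<in>T. G as (\<psi> t (hpM e x) \<odot>\<^bsub>M\<^esub> v t))"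
    proof (rule SS.S.M.finsum_cong'[OF refl])
      have pc: "\<psi> t (hpM e x) \<in> hcomp A 0" if "t \<in> T" for t
        using T(3)[OF that] Q.M.M.hp_in[OF x(1)] by (simp add: functional_def)
      show "(\<lambda>t. G as (\<psi> t (hpM e x) \<odot>\<^bsub>M\<^esub> v t)) \<in> T \<rightarrow> carrier S"
        using pc T(2) by (intro Pi_I Q.ml_closed[OF Q.cocycle_ml[OF G(1)] as] Q.M.smult_closed A.hcomp_closed Q.M.M.hcomp_closed)
      fix t assume t: "t \<in> T"
      have "Q.dl (?h t) as x = SS.dl (h t) as (\<psi> t (hpM e x))"
        by (rule delta_pre[OF as']) (simp only: functional_smult[OF T(3)[OF t] x])
      also have "\<dots> = G as (\<psi> t (hpM e x) \<odot>\<^bsub>M\<^esub> v t)" using h(3)[OF t as] pc[OF t] by simp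
      finally show "Q.dl (?h t) as x = G as (\<psi> t (hpM e x) \<odot>\<^bsub>M\<^esub> v t)" .
    qed
    also have "\<dots> = G as x"
      by (rule expand_lowest[OF Q.cocycle_ml[OF G(1)] G(4) x as T, symmetric])
    finally show ?thesis .
  qed
  have bH: "Q.bound n (Q.dl ?H)" unfolding n using Hml by auto
  have mlH: "Q.ml n (Q.dl ?H)" unfolding n by (rule Q.dl_ml[OF Hml])
  let ?G = "\<lambda>as x. G as x \<ominus>\<^bsub>S\<^esub> Q.dl ?H as x"
  note mlG = Q.cocycle_ml[OF G(1)]
  have c: "Q.cocycle n ?G" by (rule Q.cocycle_minus[OF G(1) Q.bound_cocycle[OF bH mlH]])
  moreover have "Q.hmg n ?G (int n + s)"
    using Q.homog_minus[OF G(2)] Q.dl_homog[OF Hml Hhm] unfolding n by blast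
  moreover have "Q.bound n (\<lambda>as x. F as x \<ominus>\<^bsub>S\<^esub> ?G as x)"
  proof (rule Q.bound_minus_trans[OF Q.cocycle_ml[OF F(1)] mlG Q.cocycle_ml[OF c] G(3)])
    show "Q.bound n (\<lambda>as x. G as x \<ominus>\<^bsub>S\<^esub> ?G as x)"
      by (rule Q.bound_cong[OF bH])
        (use Q.ml_closed[OF mlG] Q.ml_closed[OF mlH] in
          \<open>simp add: SS.S.M.minus_eq SS.S.M.minus_add SS.S.M.minus_minus SS.S.M.r_neg1 SS.S.M.r_neg2 del: SS.S_simps\<close>)
  qed
  moreover have "vanish_above n ?G (int n + s - int (Suc m))"
    unfolding vanish_above_def
  proof (intro allI impI ballI)
    fix d as x assume d: "int n + s - int (Suc m) < d" and as: "as \<in> tuples A n" and x: "x \<in> hcomp M d"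
    have "hpM i x = \<zero>\<^bsub>M\<^esub>" if "i < e" for i using Q.M.M.hp_homog[OF x, of i] d that by (simp add: e_def)
    then have "Q.dl ?H as x = G as x" by (rule dlH[OF as Q.M.M.hcomp_closed[OF x]])
    then show "?G as x = \<zero>\<^bsub>S\<^esub>"
      using Q.ml_closed[OF mlG as Q.M.M.hcomp_closed[OF x]] by (simp add: SS.S.M.minus_eq SS.S.M.r_neg del: SS.S_simps)
  qed
  ultimately show ?case by blast
qed

text \<open>Since nothing lies below \<open>s\<close>, the condition in
  \<open>functional_smult\<close> holds for every element of \<open>M\<close>, and the functional
  extended by zero is \<open>A\<close>-linear.\<close>

lemma functional_cocycle:
  assumes f: "functional s \<psi>" and low: "\<And>e. e < s \<Longrightarrow> hcomp M e = {\<zero>\<^bsub>M\<^esub>}"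
  shows "Q.cocycle 0 (\<lambda>as x. \<psi> (hpM s x))" "Q.hmg 0 (\<lambda>as x. \<psi> (hpM s x)) s"
proof -
  have lo: "hpM i x = \<zero>\<^bsub>M\<^esub>" if "x \<in> carrier M" "i < s" for i x
    using Q.M.M.hp_in[OF that(1), of i] low[OF that(2)] by simp
  have ml: "Q.ml 0 (\<lambda>as x. \<psi> (hpM s x))" using functional_zlin[OF f] by simp
  moreover have "Q.dl (\<lambda>as x. \<psi> (hpM s x)) as x = \<zero>\<^bsub>S\<^esub>" if as: "as \<in> tuples A (Suc 0)" and x: "x \<in> carrier M" for as x
  proof -
    obtain a where a: "as = [a]" "a \<in> carrier A" using as by (auto elim!: tuples_SucE)
    have "\<psi> (hpM s x) \<in> carrier S" using Q.ml_closed[OF ml, of "[]" x] x by simp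
    then have c: "a \<odot>\<^bsub>S\<^esub> \<psi> (hpM s x) \<in> carrier S" by (rule SS.S.smult_closed[OF a(2)])
    have "Q.dl (\<lambda>as x. \<psi> (hpM s x)) as x = a \<odot>\<^bsub>S\<^esub> \<psi> (hpM s x) \<ominus>\<^bsub>S\<^esub> a \<odot>\<^bsub>S\<^esub> \<psi> (hpM s x)"
      using functional_smult[OF f x lo[OF x] a(2)] by (simp add: delta_def a(1) del: SS.S_simps)
    also have "\<dots> = \<zero>\<^bsub>S\<^esub>" using SS.S.M.minus_zero_eq[OF c c] by simp
    finally show ?thesis .
  qed
  ultimately show "Q.cocycle 0 (\<lambda>as x. \<psi> (hpM s x))" by (simp add: cocyc_def)
  show "Q.hmg 0 (\<lambda>as x. \<psi> (hpM s x)) s"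
    unfolding homog_def
  proof (intro allI impI)
    fix t assume "t \<noteq> s"
    then show "Q.hg 0 (\<lambda>as x. \<psi> (hpM s x)) (\<lambda>as x. \<zero>\<^bsub>S\<^esub>) t"
      using functional_hcomp[OF f, of _ t] by simp
  qed
qed

lemma single_strand:
  assumes F: "Q.cocycle 0 F" "Q.hmg 0 F s"
  shows "Q.single 0 F \<in> strand s"
proof -
  have "\<exists>G. Q.cocycle n G \<and> Q.hmg n G (int n + s) \<and> Q.single 0 F n = Q.cls n G" for n
  proof (cases "n = 0")
    case True
    then show ?thesis using F by (intro exI[of _ F]) (simp add: Q.single_def)
  next
    case False
    then show ?thesis using Q.cocycle_zero Q.homog_zero Q.E_zero
      by (intro exI[of _ "\<lambda>as x. \<zero>\<^bsub>S\<^esub>"]) (simp add: Q.single_def del: SS.S_simps)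
  qed
  then show ?thesis using L.single_closed[OF F(1)] by (simp add: strand_def rep_sub_def)
qed

text \<open>A representative \<open>G\<close> that vanishes above \<open>s\<close> factors through
  M_s. Expanding M_s in a dual basis writes \<open>G\<close> as a sum of products: restriction to
  the point \<open>v t\<close>, a class of the dual, after the functional \<open>\<psi> t\<close>,
  an element of the strand in degree 0.\<close>

lemma strand_generated:
  assumes fg: "fin_gen A M" and low: "\<And>e. e < s \<Longrightarrow> hcomp M e = {\<zero>\<^bsub>M\<^esub>}" and p: "\<phi> \<in> strand s" "\<phi> \<in> hcomp L (int n)"
  obtains T :: "(nat \<times> 'm) set" and g f where "finite T" "\<And>t. t \<in> T \<Longrightarrow> g t \<in> hcomp D (int n)"
    "\<And>t. t \<in> T \<Longrightarrow> f t \<in> strand s" "\<phi> = (\<Oplus>\<^bsub>L\<^esub>t\<in>T. g t \<odot>\<^bsub>L\<^esub> f t)"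
proof -
  obtain F where F: "Q.cocycle n F" "Q.hmg n F (int n + s)" "\<phi> n = Q.cls n F"
    using p(1) unfolding strand_def rep_sub_def by auto
  have pF: "\<phi> = Q.single n F" using p(2) F(3) by (auto simp: L.X_hcomp Q.single_def fun_eq_iff)
  \<comment> \<open>The descent is carried through all \<open>n\<close> steps, so that the bound
    \<open>int n + s - int n\<close> is \<open>s\<close>.\<close>
  obtain G where G: "Q.cocycle n G" "Q.bound n (\<lambda>as x. F as x \<ominus>\<^bsub>S\<^esub> G as x)" "vanish_above n G s"
    "Q.hmg n G (int n + s)"
    using strand_representative[OF fg F(1,2) order_refl] by auto
  obtain T :: "(nat \<times> 'm) set" and v \<psi> where T: "finite T" "\<And>t. t \<in> T \<Longrightarrow> v t \<in> hcomp M s"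
    "\<And>t. t \<in> T \<Longrightarrow> functional s (\<psi> t)" "\<And>x. x \<in> hcomp M s \<Longrightarrow> x = (\<Oplus>\<^bsub>M\<^esub>t\<in>T. \<psi> t x \<odot>\<^bsub>M\<^esub> v t)"
    by (rule kos_dual_basis[OF fg]) blast
  let ?g = "\<lambda>t as y. G as (y \<odot>\<^bsub>M\<^esub> v t)" and ?f = "\<lambda>t as x. \<psi> t (hpM s x)"
  have g: "SS.cocycle n (?g t)" if "t \<in> T" for t by (rule point_cocycle[OF G(1,3) T(2)[OF that]])
  have f: "Q.cocycle 0 (?f t)" "Q.hmg 0 (?f t) s" if "t \<in> T" for t
    using functional_cocycle[OF T(3)[OF that] low] by auto
  have c: "Q.cocycle n (ycomp n (?g t) (?f t))" if "t \<in> T" for t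
    using QP.comp_cocycle[OF g[OF that] f(1)[OF that]] by simp
  have lo: "hpM i x = \<zero>\<^bsub>M\<^esub>" if "x \<in> carrier M" "i < s" for i x
    using Q.M.M.hp_in[OF that(1), of i] low[OF that(2)] by simp
  have "\<phi> = Q.single n G"
    unfolding pF using L.single_eq_iff[OF Q.cocycle_ml[OF F(1)] Q.cocycle_ml[OF G(1)]] G(2) by simp
  also have "\<dots> = Q.single n (\<lambda>as x. \<Oplus>\<^bsub>S\<^esub>t\<in>T. ycomp n (?g t) (?f t) as x)"
  proof -
    have "Q.cls n G = Q.cls n (\<lambda>as x. \<Oplus>\<^bsub>S\<^esub>t\<in>T. ycomp n (?g t) (?f t) as x)"
    proof (rule Q.cls_cong)
      fix as x assume as: "as \<in> tuples A n" and x: "x \<in> carrier M"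
      show "G as x = (\<Oplus>\<^bsub>S\<^esub>t\<in>T. ycomp n (?g t) (?f t) as x)"
        using expand_lowest[OF Q.cocycle_ml[OF G(1)] G(3) x lo[OF x] as T] length_tuples[OF as]
        by (simp add: ycomp_def del: SS.S_simps)
    qed
    then show ?thesis by (simp add: Q.single_def fun_eq_iff del: SS.S_simps)
  qed
  also have "\<dots> = (\<Oplus>\<^bsub>L\<^esub>t\<in>T. Q.single n (ycomp n (?g t) (?f t)))"
    by (rule L.single_finsum[OF T(1) c, symmetric])
  also have "\<dots> = (\<Oplus>\<^bsub>L\<^esub>t\<in>T. SS.single n (?g t) \<odot>\<^bsub>L\<^esub> Q.single 0 (?f t))"
  proof (rule L.X.finsum_cong'[OF refl])
    show "(\<lambda>t. SS.single n (?g t) \<odot>\<^bsub>L\<^esub> Q.single 0 (?f t)) \<in> T \<rightarrow> carrier L"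
      using g f(1) by (intro Pi_I DL.smult_closed Ga.single_closed L.single_closed)
    fix t assume t: "t \<in> T"
    show "Q.single n (ycomp n (?g t) (?f t)) = SS.single n (?g t) \<odot>\<^bsub>L\<^esub> Q.single 0 (?f t)"
      unfolding L_smult QP.yoneda_single[OF g[OF t] f(1)[OF t]] by simp
  qed
  finally have eq: "\<phi> = (\<Oplus>\<^bsub>L\<^esub>t\<in>T. SS.single n (?g t) \<odot>\<^bsub>L\<^esub> Q.single 0 (?f t))" .
  have st: "Q.single 0 (?f t) \<in> strand s" if t: "t \<in> T" for t
    by (rule single_strand[OF f[OF t]])
  show thesis
    by (rule that[OF T(1) _ st eq]) (rule Ga.single_hcomp[OF g])
qed

text \<open>A class in degree 0 is zero only if the map is. So if the strand were zero, all
  functionals of a dual basis would vanish on M_s, and the expansion would make M_s zero.\<close>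

lemma strand_nonzero:
  assumes fg: "fin_gen A M" and low: "\<And>e. e < s \<Longrightarrow> hcomp M e = {\<zero>\<^bsub>M\<^esub>}" and ne: "hcomp M s \<noteq> {\<zero>\<^bsub>M\<^esub>}"
  shows "strand s \<noteq> {\<zero>\<^bsub>L\<^esub>}"
proof
  assume z: "strand s = {\<zero>\<^bsub>L\<^esub>}"
  obtain T :: "(nat \<times> 'm) set" and v \<psi> where T: "finite T" "\<And>t. t \<in> T \<Longrightarrow> v t \<in> hcomp M s"
    "\<And>t. t \<in> T \<Longrightarrow> functional s (\<psi> t)" "\<And>x. x \<in> hcomp M s \<Longrightarrow> x = (\<Oplus>\<^bsub>M\<^esub>t\<in>T. \<psi> t x \<odot>\<^bsub>M\<^esub> v t)"
    by (rule kos_dual_basis[OF fg]) blast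
  have "x = \<zero>\<^bsub>M\<^esub>" if x: "x \<in> hcomp M s" for x
  proof -
    have "\<psi> t x = \<zero>\<^bsub>A\<^esub>" if t: "t \<in> T" for t
    proof -
      note c = functional_cocycle[OF T(3)[OF t] low]
      have "Q.single 0 (\<lambda>as x. \<psi> t (hpM s x)) = \<zero>\<^bsub>L\<^esub>" using single_strand[OF c] z by auto
      then have "Q.cls 0 (\<lambda>as x. \<psi> t (hpM s x)) = \<zero>\<^bsub>Q.E 0\<^esub>"
        by (auto simp: L.X_zero Q.single_def fun_eq_iff dest: spec[of _ 0])
      then show ?thesis
        using Q.cls_zero_iff[OF Q.cocycle_ml[OF c(1)]] Q.M.M.hcomp_closed[OF x] Q.M.M.hp_homog[OF x, of s]
        by (auto dest!: bspec[where x = x])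
    qed
    then have "(\<Oplus>\<^bsub>M\<^esub>t\<in>T. \<psi> t x \<odot>\<^bsub>M\<^esub> v t) = (\<Oplus>\<^bsub>M\<^esub>t\<in>T. \<zero>\<^bsub>M\<^esub>)"
      by (intro Q.M.M.finsum_cong'[OF refl]) (simp_all add: Q.M.smult_l_null[OF Q.M.M.hcomp_closed[OF T(2)]])
    then show ?thesis using T(4)[OF x] Q.M.M.finsum_zero[of T] by simp
  qed
  then show False using ne Q.M.M.hcomp_zero[of s] by blast
qed

end

section \<open>Koszul summands of weakly Koszul modules\<close>

lemma cocyc_pre:
  assumes "cocyc Z A M' N n F" "zlin Z M (smult M) M' (smult M') p"
    "\<And>a x. a \<in> carrier A \<Longrightarrow> x \<in> carrier M \<Longrightarrow> p (a \<odot>\<^bsub>M\<^esub> x) = a \<odot>\<^bsub>M'\<^esub> p x"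
  shows "cocyc Z A M N n (\<lambda>as x. F as (p x))"
  unfolding cocyc_def
proof (intro conjI ballI)
  show "multilin Z A M N n (\<lambda>as x. F as (p x))"
    using assms(1) by (intro multilin_pre[OF _ assms(2)]) (simp add: cocyc_def)
  fix as x assume as: "as \<in> tuples A (Suc n)" and x: "x \<in> carrier M"
  have "delta A M N (\<lambda>as x. F as (p x)) as x = delta A M' N F as (p x)"
    by (rule delta_pre[OF as]) (simp add: assms(3) x)
  then show "delta A M N (\<lambda>as x. F as (p x)) as x = \<zero>\<^bsub>N\<^esub>"
    using assms(1) as zlinD(1)[OF assms(2) x] by (simp add: cocyc_def)
qed

lemma bnd_pre:
  assumes "bnd Z A M' N n F" "zlin Z M (smult M) M' (smult M') p"
    "\<And>a x. a \<in> carrier A \<Longrightarrow> x \<in> carrier M \<Longrightarrow> p (a \<odot>\<^bsub>M\<^esub> x) = a \<odot>\<^bsub>M'\<^esub> p x"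
  shows "bnd Z A M N n (\<lambda>as x. F as (p x))"
proof (cases n)
  case 0
  then show ?thesis using assms(1) zlinD(1)[OF assms(2)] by simp
next
  case (Suc m)
  then obtain H where H: "multilin Z A M' N m H"
    "\<And>as x. as \<in> tuples A n \<Longrightarrow> x \<in> carrier M' \<Longrightarrow> F as x = delta A M' N H as x"
    using assms(1) by auto
  have "F as (p x) = delta A M N (\<lambda>as x. H as (p x)) as x" if as: "as \<in> tuples A n" and x: "x \<in> carrier M" for as x
  proof -
    have "delta A M N (\<lambda>as x. H as (p x)) as x = delta A M' N H as (p x)"
      by (rule delta_pre[OF as[unfolded Suc]]) (simp add: assms(3) x)
    then show ?thesis using H(2)[OF as zlinD(1)[OF assms(2) x]] by simp
  qed
  then show ?thesis using multilin_pre[OF H(1) assms(2)] unfolding Suc by auto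
qed

section \<open>Generation in degree 0 and the criterion for summands\<close>

context kos_mod
begin

lemma cocycle_0_linear:
  assumes F: "Q.cocycle 0 F" and a: "a \<in> carrier A" and x: "x \<in> carrier M"
  shows "F [] (a \<odot>\<^bsub>M\<^esub> x) = a \<odot>\<^bsub>S\<^esub> F [] x"
proof -
  note ml = Q.ml_closed[OF Q.cocycle_ml[OF F], of "[]"]
  have c: "a \<odot>\<^bsub>S\<^esub> F [] x \<in> carrier S" "F [] (a \<odot>\<^bsub>M\<^esub> x) \<in> carrier S"
    by (rule SS.S.smult_closed[OF a ml[OF _ x]], simp) (rule ml[OF _ Q.M.smult_closed[OF a x]], simp)
  have "a \<odot>\<^bsub>S\<^esub> F [] x \<ominus>\<^bsub>S\<^esub> F [] (a \<odot>\<^bsub>M\<^esub> x) = \<zero>\<^bsub>S\<^esub>"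
    using Q.cocycle_dl[OF F, of "[a]" x] a x by (simp add: delta_def del: SS.S_simps)
  then show ?thesis using SS.S.M.minus_zero_eq[OF c] by simp
qed

text \<open>The Koszul condition in cohomological degree 0 excludes nonzero linear maps from
  \<open>L\<close> to the degree 0 part of \<open>D\<close> that live in a single degree other than
  0. This is the input of the graded Nakayama argument.\<close>

lemma ext_generated:
  assumes kos: "koszul_module k D L"
  shows "carrier L \<subseteq> DL.gen0"
proof (rule DL.graded_nakayama)
  show "fin_gen D L" using kos by (simp add: koszul_module_def)
  show "semisimple_ring (degree_zero D)" by (rule dual_semisimple[OF DL.A.ring_axioms])
  show "hcomp L i = {\<zero>\<^bsub>L\<^esub>}" if "i < 0" for i by (rule L.X_neg[OF that])
  fix \<phi> i x
  assume i: "i \<noteq> (0 :: int)" and \<phi>: "\<And>x. x \<in> carrier L \<Longrightarrow> \<phi> x \<in> hcomp D 0"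
    "\<And>x y. x \<in> carrier L \<Longrightarrow> y \<in> carrier L \<Longrightarrow> \<phi> (x \<oplus>\<^bsub>L\<^esub> y) = \<phi> x \<oplus>\<^bsub>D\<^esub> \<phi> y"
    "\<And>a x. a \<in> carrier D \<Longrightarrow> x \<in> carrier L \<Longrightarrow> \<phi> (a \<odot>\<^bsub>L\<^esub> x) = homog_part D 0 a \<otimes>\<^bsub>D\<^esub> \<phi> x"
    "\<And>j x. j \<noteq> i \<Longrightarrow> x \<in> hcomp L j \<Longrightarrow> \<phi> x = \<zero>\<^bsub>D\<^esub>" and x: "x \<in> carrier L"
  have triv: "carrier (Ext_Gr k D L (grade_shift (degree_zero D) i) 0) =
      {\<zero>\<^bsub>Ext_Gr k D L (grade_shift (degree_zero D) i) 0\<^esub>}"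
    using kos i unfolding koszul_module_def Let_def by (metis of_nat_0)
  show "\<phi> x = \<zero>\<^bsub>D\<^esub>"
    by (rule Ext_Gr_0_trivial[OF DL.A.graded_ring_axioms graded_L _ triv _ _ _ _ x])
      (fact dual_scalar \<phi>)+
qed

text \<open>Generation in degree 0 enters through \<open>gen\<close>: the coefficients have exactly
  the degree of \<open>x\<close>, so in positive degree they act as zero on the degree 0 part of
  \<open>A\<close>. The index type stays free, as the family comes with the indices of a dual
  basis.\<close>

theorem koszul_summand:
  fixes U :: "'m set"
  assumes fg: "fin_gen A M" and kos: "koszul_module k D L"
    and U: "graded_direct_summand A M U" and neg: "\<And>e. e < 0 \<Longrightarrow> hcomp M e = {\<zero>\<^bsub>M\<^esub>}"
    and gen: "\<And>n x. x \<in> U \<Longrightarrow> x \<in> hcomp M (int n) \<Longrightarrow> \<exists>(T :: 't set) g f. finite T \<and>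
      (\<forall>t\<in>T. g t \<in> hcomp A (int n)) \<and> (\<forall>t\<in>T. f t \<in> U) \<and> x = (\<Oplus>\<^bsub>M\<^esub>t\<in>T. g t \<odot>\<^bsub>M\<^esub> f t)"
  shows "koszul_module k A (graded_restrict M U)"
proof -
  let ?X = "graded_restrict M U"
  have gU: "graded_submodule A M U" using U by (simp add: graded_direct_summand_def)
  then have sU: "submodule U A M" by (simp add: graded_submodule_def)
  note UM = subsetD[OF Q.M.sub_closed[OF sU]]
  interpret X: gext k A ?X
    by (rule gext.intro[OF galg_axioms gext_axioms.intro[OF graded_S Q.M.graded_restrict_mod[OF gU]]])
  interpret XP: ext_pair k A ?X "degree_zero A" "degree_zero A" ..
  interpret XG: gbar_pair A ?X "degree_zero A" "degree_zero A" "scal k A"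
    by unfold_locales simp
  obtain p where p: "\<And>x. x \<in> carrier M \<Longrightarrow> p x \<in> U" "\<And>x. x \<in> U \<Longrightarrow> p x = x"
    "\<And>x y. x \<in> carrier M \<Longrightarrow> y \<in> carrier M \<Longrightarrow> p (x \<oplus>\<^bsub>M\<^esub> y) = p x \<oplus>\<^bsub>M\<^esub> p y"
    "\<And>a x. a \<in> carrier A \<Longrightarrow> x \<in> carrier M \<Longrightarrow> p (a \<odot>\<^bsub>M\<^esub> x) = a \<odot>\<^bsub>M\<^esub> p x"
    by (rule Q.M.summand_projection[OF U]) blast
  have zp: "zlin (scal k A) M (smult M) ?X (smult ?X) p"
    using p subsetD[OF scal_sub] by (simp add: zlin_def)
  have zi: "zlin (scal k A) ?X (smult ?X) M (smult M) (\<lambda>x. x)"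
    using UM by (simp add: zlin_def)
  show ?thesis
    unfolding X.koszul_module_iff
  proof (intro conjI allI impI)
    show "fin_gen A ?X" by (rule Q.M.summand_fin_gen[OF U fg])
    fix n j F assume F: "X.cocycle n F" "X.hmg n F j" "j \<noteq> int n"
    note mlF = X.cocycle_ml[OF F(1)]
    \<comment> \<open>Only the ungraded class of the pullback is used; the internal degree
      \<open>j\<close> returns after restriction to \<open>U\<close>.\<close>
    let ?F = "\<lambda>as x. F as (p x)"
    have cF: "Q.cocycle n ?F" by (rule cocyc_pre[OF F(1) zp]) (simp add: p(4))
    have "Q.single n ?F \<in> DL.gen0" using ext_generated[OF kos] L.single_closed[OF cF] by blast
    then obtain G c where G: "finite G" "G \<subseteq> hcomp L 0" "c \<in> G \<rightarrow> carrier D"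
      "Q.single n ?F = (\<Oplus>\<^bsub>L\<^esub>g\<in>G. c g \<odot>\<^bsub>L\<^esub> g)"
      unfolding DL.gen0_def spanned_def by blast
    have "\<exists>\<phi>. Q.cocycle 0 \<phi> \<and> g = Q.single 0 \<phi>" if "g \<in> G" for g
    proof -
      have "g \<in> hcomp L (int 0)" using G(2) that by auto
      then show ?thesis by (rule L.hcomp_single) blast
    qed
    then obtain \<phi> where \<phi>: "\<And>g. g \<in> G \<Longrightarrow> Q.cocycle 0 (\<phi> g)" "\<And>g. g \<in> G \<Longrightarrow> g = Q.single 0 (\<phi> g)" by metis
    have cD: "c g \<in> carrier D" if "g \<in> G" for g using G(3) that by auto
    \<comment> \<open>As \<open>g\<close> lies in degree 0, only the degree \<open>n\<close>
      component of its coefficient contributes in degree \<open>n\<close>.\<close>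
    have "\<exists>\<gamma>. SS.cocycle n \<gamma> \<and> c g n = SS.cls n \<gamma>" if "g \<in> G" for g
      using Ga.X_apply[OF cD[OF that], of n] by (simp add: SS.E_carrier)
    then obtain \<gamma> where \<gamma>: "\<And>g. g \<in> G \<Longrightarrow> SS.cocycle n (\<gamma> g)" "\<And>g. g \<in> G \<Longrightarrow> c g n = SS.cls n (\<gamma> g)" by metis
    let ?Y = "\<lambda>g. ycomp n (\<gamma> g) (\<phi> g)"
    have cY: "Q.cocycle n (?Y g)" if "g \<in> G" for g
      using QP.comp_cocycle[OF \<gamma>(1)[OF that] \<phi>(1)[OF that]] by simp
    have ev: "(c g \<odot>\<^bsub>L\<^esub> g) n = Q.cls n (?Y g)" if g: "g \<in> G" for g
    proof -
      have g0: "g 0 = Q.cls 0 (\<phi> g)" "\<And>j. j \<noteq> 0 \<Longrightarrow> g j = \<zero>\<^bsub>Q.E j\<^esub>"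
        by (subst \<phi>(2)[OF g], simp add: Q.single_def)+
      have "(c g \<odot>\<^bsub>L\<^esub> g) n = ext_comp k A M S n 0 (c g n) (g 0)"
        unfolding L_smult
        using QP.yoneda_right[of "c g" g 0 n, OF Ga.X_apply[OF cD[OF g]] _ g0(2)] Q.cls_in_E[OF \<phi>(1)[OF g]]
        by (simp add: g0(1))
      also have "\<dots> = Q.cls n (?Y g)"
        using QP.ext_comp_cls[OF \<gamma>(1)[OF g] \<phi>(1)[OF g]] by (simp add: g0(1) \<gamma>(2)[OF g])
      finally show ?thesis .
    qed
    have gL: "c g \<odot>\<^bsub>L\<^esub> g \<in> carrier L" if "g \<in> G" for g
      using DL.smult_closed[OF cD[OF that]] G(2) L.X.hcomp_closed that by blast
    interpret En: abelian_group "Q.E n" by (rule Q.E_group)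
    have "Q.cls n ?F = (\<Oplus>\<^bsub>L\<^esub>g\<in>G. c g \<odot>\<^bsub>L\<^esub> g) n"
      unfolding G(4)[symmetric] by (simp add: Q.single_def)
    also have "\<dots> = (\<Oplus>\<^bsub>Q.E n\<^esub>g\<in>G. (c g \<odot>\<^bsub>L\<^esub> g) n)" by (rule L.X_finsum[OF G(1) gL])
    also have "\<dots> = (\<Oplus>\<^bsub>Q.E n\<^esub>g\<in>G. Q.cls n (?Y g))"
      by (rule En.finsum_cong'[OF refl]) (use ev cY in auto)
    also have "\<dots> = Q.cls n (\<lambda>as x. \<Oplus>\<^bsub>S\<^esub>g\<in>G. ?Y g as x)" by (rule Q.E_finsum[OF G(1) cY])
    finally have b: "Q.bound n (\<lambda>as x. ?F as x \<ominus>\<^bsub>S\<^esub> (\<Oplus>\<^bsub>S\<^esub>g\<in>G. ?Y g as x))"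
      using Q.cls_eq[OF Q.cocycle_ml[OF cF] Q.ml_finsum[OF G(1) Q.cocycle_ml[OF cY]]] by simp
    \<comment> \<open>On \<open>U\<close> the projection is the identity, so restricting the bounded
      difference brings back \<open>F\<close> itself.\<close>
    let ?D = "\<lambda>as x. F as x \<ominus>\<^bsub>S\<^esub> (\<Oplus>\<^bsub>S\<^esub>g\<in>G. ?Y g as x)"
    have bD: "X.bound n ?D"
      by (rule X.bound_cong[OF bnd_pre[OF b zi]]) (simp_all add: p(2))
    have c\<phi>: "X.cocycle 0 (\<phi> g)" if "g \<in> G" for g
      using cocyc_pre[OF \<phi>(1)[OF that] zi] by simp
    \<comment> \<open>In positive degree \<open>x\<close> is a sum of multiples by elements of that
      same degree, which act as zero on \<open>S\<close>; in negative degree there is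
      nothing.\<close>
    have deg: "\<phi> g [] x = \<zero>\<^bsub>S\<^esub>" if g: "g \<in> G" and e: "e \<noteq> 0" and x: "x \<in> U" "x \<in> hcomp M e" for g e x
    proof (cases "e < 0")
      case True
      then have "x = \<zero>\<^bsub>M\<^esub>" using neg x by blast
      then show ?thesis using Q.ml_at_zero[OF Q.cocycle_ml[OF \<phi>(1)[OF g]], of "[]"] by simp
    next
      case False
      then obtain m where m: "e = int m" "m \<noteq> 0" using e by (metis int_nat_eq not_less of_nat_0)
      obtain T :: "'t set" and a f where T: "finite T" "\<forall>t\<in>T. a t \<in> hcomp A (int m)" "\<forall>t\<in>T. f t \<in> U"
        "x = (\<Oplus>\<^bsub>M\<^esub>t\<in>T. a t \<odot>\<^bsub>M\<^esub> f t)"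
        using gen[OF x(1) x(2)[unfolded m]] by blast
      have aA: "a t \<in> carrier A" "f t \<in> carrier M" if "t \<in> T" for t
        using T(2,3) that UM A.hcomp_closed by blast+
      have "\<phi> g [] x = (\<Oplus>\<^bsub>S\<^esub>t\<in>T. \<phi> g [] (a t \<odot>\<^bsub>M\<^esub> f t))"
        unfolding T(4) by (rule Q.ml_finsum_last[OF Q.cocycle_ml[OF \<phi>(1)[OF g]] _ T(1)])
          (simp_all add: Q.M.smult_closed aA)
      also have "\<dots> = (\<Oplus>\<^bsub>S\<^esub>t\<in>T. \<zero>\<^bsub>S\<^esub>)"
      proof (rule SS.S.M.finsum_cong'[OF refl])
        fix t assume t: "t \<in> T"
        have "\<phi> g [] (a t \<odot>\<^bsub>M\<^esub> f t) = a t \<odot>\<^bsub>S\<^esub> \<phi> g [] (f t)"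
          by (rule cocycle_0_linear[OF \<phi>(1)[OF g] aA[OF t]])
        also have "\<dots> = \<zero>\<^bsub>S\<^esub>"
          using A.hp_homog[of "a t" "int m" 0] T(2) t m(2)
            A.hcomp_closed[of "\<phi> g [] (f t)" 0] Q.ml_closed[OF Q.cocycle_ml[OF \<phi>(1)[OF g]], of "[]" "f t"] aA(2)[OF t]
          by simp
        finally show "\<phi> g [] (a t \<odot>\<^bsub>M\<^esub> f t) = \<zero>\<^bsub>S\<^esub>" .
      qed simp
      finally show ?thesis using SS.S.M.finsum_zero[of T] by simp
    qed
    have h\<phi>: "X.hmg 0 (\<phi> g) 0" if "g \<in> G" for g
      using deg[OF that] by (auto simp: homog_def)
    have \<phi>0: "\<phi> g [] x \<in> hcomp S (e + 0)" if g: "g \<in> G" and x: "x \<in> hcomp ?X e" for g e x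
    proof (cases "e = 0")
      case True
      then show ?thesis using X.ml_closed[OF X.cocycle_ml[OF c\<phi>[OF g]], of "[]" x] x by simp
    next
      case False
      then show ?thesis using deg[OF g False, of x] x SS.S.M.hcomp_zero[of e] by simp
    qed
    \<comment> \<open>On \<open>U\<close> the map \<open>\<phi> g\<close> is nonzero only in degree
      0. The part of \<open>?Y g\<close> in internal degree \<open>j\<close> is therefore governed
      by the component of \<open>\<gamma> g\<close> in degree \<open>j\<close>, and this bounds
      because \<open>j\<close> is not \<open>n\<close>.\<close>
    let ?P = "\<lambda>g. ycomp n (proj A S S j (\<gamma> g)) (\<phi> g)"
    let ?PS = "\<lambda>as x. \<Oplus>\<^bsub>S\<^esub>g\<in>G. ?P g as x" and ?YS = "\<lambda>as x. \<Oplus>\<^bsub>S\<^esub>g\<in>G. ?Y g as x"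
    have mlY: "X.ml n (?Y g)" if "g \<in> G" for g
      using XP.comp_ml[OF SS.cocycle_ml[OF \<gamma>(1)[OF that]] X.cocycle_ml[OF c\<phi>[OF that]]] by simp
    have mlP: "X.ml n (?P g)" if "g \<in> G" for g
      using XP.comp_ml[OF SS.proj_ml[OF SS.cocycle_ml[OF \<gamma>(1)[OF that]]] X.cocycle_ml[OF c\<phi>[OF that]]] by simp
    have bP: "X.bound n (?P g)" if g: "g \<in> G" for g
    proof -
      have "SS.bound n (proj A S S j (\<gamma> g))"
        by (rule koszul_S[OF SS.proj_cocycle[OF \<gamma>(1)[OF g]] SS.proj_homog[OF SS.cocycle_ml[OF \<gamma>(1)[OF g]]] F(3)])
      then show ?thesis using XP.comp_bound_left[OF _ c\<phi>[OF g]] by fastforce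
    qed
    have hP: "X.hg n (?Y g) (?P g) j" if g: "g \<in> G" for g
    proof -
      have "hag A S n (\<gamma> g) (proj A S S j (\<gamma> g)) (j + 0)"
        using hag_sym[OF SS.proj_hag_eq[OF SS.cocycle_ml[OF \<gamma>(1)[OF g]]]] by simp
      then have "X.hg n (\<lambda>as x. \<gamma> g as (\<phi> g [] x)) (\<lambda>as x. proj A S S j (\<gamma> g) as (\<phi> g [] x)) j"
        by (rule hag_pre) (rule \<phi>0[OF g])
      then show ?thesis by (rule X.hag_cong) (simp_all add: ycomp_def length_tuples)
    qed
    have hPS: "X.hg n ?YS ?PS j" by (rule X.hag_finsum[OF G(1) mlY mlP hP])
    have bPS: "X.bound n ?PS" by (rule X.bound_finsum[OF G(1) bP mlP])
    \<comment> \<open>The left cochain is \<open>F\<close>, the right one a coboundary. As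
      \<open>F\<close> is homogeneous of degree \<open>j\<close>, agreement in that degree
      suffices.\<close>
    have "X.hg n (\<lambda>as x. ?D as x \<oplus>\<^bsub>S\<^esub> ?YS as x) (\<lambda>as x. ?D as x \<oplus>\<^bsub>S\<^esub> ?PS as x) j"
      by (rule hag_map2[where f = "\<lambda>x y. x \<oplus>\<^bsub>S\<^esub> y", OF hag_refl hPS])
    then have "X.hg n F (\<lambda>as x. ?D as x \<oplus>\<^bsub>S\<^esub> ?PS as x) j"
      by (rule X.hag_cong)
        (use X.ml_closed[OF mlF] X.ml_closed[OF X.ml_finsum[OF G(1) mlY]] in
          \<open>simp_all add: SS.S.M.minus_eq SS.S.M.a_assoc SS.S.M.l_neg SS.S.M.r_zero del: SS.S_simps\<close>)
    then show "X.bound n F" by (rule X.bound_hag[OF mlF F(2) X.bound_add[OF bD bPS]])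
  qed
qed

end

theorem theorem3p9:
  fixes k :: "('k, 'w) ring_scheme"
    and \<Lambda> :: "('k, 'a, 'x) graded_scheme"
    and M :: "('a, 'm, 'y) graded_scheme"
  assumes "koszul_algebra k \<Lambda>"
    and "graded_module \<Lambda> M" and "fin_gen \<Lambda> M" and "carrier M \<noteq> {\<zero>\<^bsub>M\<^esub>}"
    and "weakly_koszul_module k (koszul_dual k \<Lambda>) (ext_module k \<Lambda> M)"
  shows "\<exists>K. graded_direct_summand (koszul_dual k \<Lambda>) (ext_module k \<Lambda> M) K \<and>
             K \<noteq> {\<zero>\<^bsub>ext_module k \<Lambda> M\<^esub>} \<and>
             koszul_module k (koszul_dual k \<Lambda>) (graded_restrict (ext_module k \<Lambda> M) K)"
proof -
  let ?D = "koszul_dual k \<Lambda>" and ?L = "ext_module k \<Lambda> M"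
  let ?R = "koszul_dual k ?D" and ?N = "ext_module k ?D ?L"
  have w: "koszul_algebra k ?D" "graded_module ?D ?L" "fin_gen ?D ?L" "koszul_module k ?R ?N"
    using assms(5) by (simp_all add: weakly_koszul_module_def)
  have kosI: "kos k B" if "koszul_algebra k B" for B :: "('k, 'b, 'z) graded_scheme"
    using that by (intro kos.intro galg.intro kos_axioms.intro)
      (simp_all add: koszul_algebra_def standard_graded_algebra_def)
  have lm: "ring B" if "graded_module B X" for B :: "('k, 'b, 'z) graded_scheme" and X :: "('b, 'c, 'u) graded_scheme"
    using that by (simp add: graded_module_def left_module_def)
  interpret A: kos k \<Lambda> by (rule kosI[OF assms(1)])
  interpret D: kos k ?D by (rule kosI[OF w(1)])
  \<comment> \<open>That the dual is a ring is contained in the statement that \<open>?L\<close> is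
    a module over it; the same is done below for the dual of \<open>?D\<close> and
    \<open>?N\<close>.\<close>
  have rD: "graded_ring ?D" by (rule A.dual_graded_ring[OF lm[OF w(2)]])
  have gN: "graded_module ?R ?N" using w(4) by (simp add: koszul_module_def)
  have rR: "graded_ring ?R" by (rule D.dual_graded_ring[OF lm[OF gN]])
  have gM: "graded_mod \<Lambda> M" by (rule iffD1[OF graded_module_iff[OF A.A.graded_ring_axioms] assms(2)])
  have gL: "graded_mod ?D ?L" by (rule iffD1[OF graded_module_iff[OF rD] w(2)])
  have gN': "graded_mod ?R ?N" by (rule iffD1[OF graded_module_iff[OF rR] gN])
  \<comment> \<open>The first instance produces the strand inside \<open>?L\<close>, the second
    tests summands of \<open>?L\<close> by Ext over \<open>?D\<close>.\<close>
  interpret P: kos_mod k \<Lambda> M by (intro kos_mod.intro A.kos_axioms kos_mod_axioms.intro gM gL)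
  interpret Y: kos_mod k ?D ?L by (intro kos_mod.intro D.kos_axioms kos_mod_axioms.intro gL gN')
  obtain l where l: "\<And>e. e < l \<Longrightarrow> hcomp M e = {\<zero>\<^bsub>M\<^esub>}" by (rule P.Q.M.bounded_below[OF assms(3)]) blast
  have "\<exists>e. hcomp M e \<noteq> {\<zero>\<^bsub>M\<^esub>}"
  proof (rule ccontr)
    assume "\<not> ?thesis"
    then have z: "hcomp M e = {\<zero>\<^bsub>M\<^esub>}" for e by blast
    have "x = \<zero>\<^bsub>M\<^esub>" if "x \<in> carrier M" for x
      by (rule P.Q.M.M.hp_ext[OF that]) (use P.Q.M.M.hp_in[OF that] z in auto)
    then show False using assms(4) P.Q.M.M.zero_closed by blast
  qed
  then obtain e where e: "hcomp M e \<noteq> {\<zero>\<^bsub>M\<^esub>}" by blast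
  then have "l \<le> e" using l[of e] by (cases "e < l") auto
  then have "\<exists>n. hcomp M (l + int n) \<noteq> {\<zero>\<^bsub>M\<^esub>}" using e by (intro exI[of _ "nat (e - l)"]) simp
  \<comment> \<open>The integers are not well-ordered, so the lowest nonzero degree is found by
    counting upwards from the lower bound \<open>l\<close>.\<close>
  define m where "m = (LEAST n. hcomp M (l + int n) \<noteq> {\<zero>\<^bsub>M\<^esub>})"
  define s where "s = l + int m"
  have s: "hcomp M s \<noteq> {\<zero>\<^bsub>M\<^esub>}"
    unfolding s_def m_def by (rule LeastI_ex) fact
  have low: "hcomp M e = {\<zero>\<^bsub>M\<^esub>}" if "e < s" for e
  proof (cases "e < l")
    case False
    then have "nat (e - l) < m" using that by (simp add: s_def)
    from not_less_Least[OF this[unfolded m_def]] show ?thesis using False by simp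
  qed (rule l)
  have "koszul_module k ?D (graded_restrict ?L (P.strand s))"
  proof (rule Y.koszul_summand[OF w(3,4) P.strand_summand P.L.X_neg])
    fix n x assume x: "x \<in> P.strand s" "x \<in> hcomp ?L (int n)"
    show "\<exists>(T :: (nat \<times> 'm) set) g f. finite T \<and> (\<forall>t\<in>T. g t \<in> hcomp ?D (int n)) \<and>
        (\<forall>t\<in>T. f t \<in> P.strand s) \<and> x = (\<Oplus>\<^bsub>?L\<^esub>t\<in>T. g t \<odot>\<^bsub>?L\<^esub> f t)"
      by (rule P.strand_generated[OF assms(3) low x]) blast+
  qed
  then show ?thesis
    using P.strand_summand[of s] P.strand_nonzero[OF assms(3) low s] by blast
qed

end
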